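(* Let $d\ge3$ be an integer and let $\ell>d$ be an even integer. Let $\beta\in\{1,2\}$ and let $X$ be a Wigner matrix (of size $n\times n$, for each $n$) such that $\mathbb{E}X_{1,1}^2\le2/\beta$. Assume that $X$ is real symmetric if $\beta=1$, and if $\beta=2$ that $X$ is complex Hermitian with $\Re X_{1,2},\Im X_{1,2}$ independent, each of variance $1/2$. Assume that $X$ satisfies the convex concentration property, that $\Lambda_{1,1}$ and $\Lambda_{1,2}$ have their derivatives of order $2$ to $\ell$ uniformly bounded, and that the entries of $X$ have sharp sub-Gaussian tails. Then the sequence $\big(\frac1n\mathrm{tr}(X/\sqrt n)^d\big)_{n\in\mathbb{N}}$ satisfies a large deviations principle with speed $n^{1+\frac2d}$ and good rate function $J_d$, where if $d$ is even, $$J_d(x)=\begin{cases}\frac\beta4\,(x-C_{d/2})^{\frac2d}&\text{if }x\ge C_{d/2},\\+\infty&\text{otherwise,}\end{cases}$$ with $C_{d/2}=\frac{1}{d/2+1}\binom{d}{d/2}$ the $(d/2)$-th Catalan number, and if $d$ is odd, $J_d(x)=\frac\beta4|x|^{\frac2d}$ for all $x\in\mathbb{R}$.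
   Context: $\mathcal{H}_n=\mathcal{H}_n^{(\beta)}$ is the set of $n\times n$ real symmetric matrices if $\beta=1$ and of complex Hermitian matrices if $\beta=2$. A Wigner matrix is a random matrix $X\in\mathcal{H}_n$ whose coefficients are independent up to the symmetry, such that the $(X_{i,i})_{i}$ are identically distributed and the $(X_{i,j})_{i<j}$ are identically distributed (with laws not depending on $n$), $\mathbb{E}X=0$, $\Re X_{1,2}$ and $\Im X_{1,2}$ are independent, and $\mathbb{E}|X_{1,2}|^2=1$. The convex concentration property: there exists $c>0$ (independent of $n$) such that for any convex $g:\mathcal{H}_n\to\mathbb{R}$ that is $1$-Lipschitz for the Hilbert–Schmidt norm, $\mathbb{E}g(X)$ exists and $\mathbb{P}(|g(X)-\mathbb{E}g(X)|>t)\le c^{-1}\exp(-ct^2)$ for every $t>0$. $\Lambda_{i,j}$ is the logarithmic Laplace transform of the law of $X_{i,j}$ (on $\mathbb{R}$, or on $\mathbb{C}\simeq\mathbb{R}^2$ if the entry is complex). A real or complex random variable $\xi$ has sharp sub-Gaussian tails if $\log\mathbb{E}e^{\Re(z\xi)}\le\frac12\langle z,\Sigma z\rangle$ for all $z\in\mathbb{C}$, where $\Sigma$ is the covariance matrix of $(\Re\xi,\Im\xi)$ and $\langle\cdot,\cdot\rangle$ is the standard inner product of $\mathbb{C}\simeq\mathbb{R}^2$. A sequence $(Z_n)$ of real random variables satisfies a large deviations principle with speed $\upsilon_n\uparrow+\infty$ and rate function $I:\mathbb{R}\to[0,+\infty]$ if $I$ is lower semicontinuous and for all Borel $B$, $-\inf_{\mathrm{int}(B)}I\le\liminf\frac1{\upsilon_n}\log\mathbb{P}(Z_n\in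 B)\le\limsup\frac1{\upsilon_n}\log\mathbb{P}(Z_n\in B)\le-\inf_{\mathrm{cl}(B)}I$; $I$ is good if its level sets $\{I\le t\}$, $t\in[0,\infty)$, are compact. *)

theory Defs
  imports "HOL-Probability.Probability" "Jordan_Normal_Form.Schur_Decomposition"
begin

text \<open>Real symmetric matrices (\<open>\<beta> = 1\<close>) are represented as the complex Hermitian
  matrices with real entries.\<close>

definition herm_mats :: "nat \<Rightarrow> nat \<Rightarrow> complex mat set" where
  "herm_mats \<beta> n =
     {A \<in> carrier_mat n n. mat_adjoint A = A \<and> (\<beta> = 1 \<longrightarrow> elements_mat A \<subseteq> \<real>)}"

definition mat_trace :: "complex mat \<Rightarrow> complex" where
  "mat_trace A = (\<Sum>i<dim_row A. A $$ (i,i))"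

definition hs_norm :: "complex mat \<Rightarrow> real" where
  "hs_norm A = sqrt (\<Sum>i<dim_row A. \<Sum>j<dim_col A. (cmod (A $$ (i,j)))\<^sup>2)"

text \<open>Matrices of all sizes share one type, which is therefore not a real vector space;
  hence the library's \<open>convex_on\<close> and \<open>lipschitz_on\<close> do not apply.\<close>

definition mat_convex_on :: "complex mat set \<Rightarrow> (complex mat \<Rightarrow> real) \<Rightarrow> bool" where
  "mat_convex_on S g \<longleftrightarrow> (\<forall>A\<in>S. \<forall>B\<in>S. \<forall>t\<in>{0..1}.
     g (complex_of_real (1 - t) \<cdot>\<^sub>m A + complex_of_real t \<cdot>\<^sub>m B) \<le> (1 - t) * g A + t * g B)"

definition mat_lipschitz1_on :: "complex mat set \<Rightarrow> (complex mat \<Rightarrow> real) \<Rightarrow> bool" where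
  "mat_lipschitz1_on S g \<longleftrightarrow> (\<forall>A\<in>S. \<forall>B\<in>S. \<bar>g A - g B\<bar> \<le> hs_norm (A - B))"

text \<open>The random matrix \<open>X n\<close> of size \<open>n\<close> lives on its own probability space \<open>M n\<close>.
  Indices start at \<open>0\<close>, so \<open>\<mu>\<close> is the law of \<open>X\<^sub>1\<^sub>,\<^sub>1\<close> and \<open>\<nu>\<close> the law of \<open>X\<^sub>1\<^sub>,\<^sub>2\<close>, both
  as laws on the complex numbers.\<close>

definition wigner_matrix ::
  "nat \<Rightarrow> (nat \<Rightarrow> 'a measure) \<Rightarrow> (nat \<Rightarrow> 'a \<Rightarrow> complex mat) \<Rightarrow>
   complex measure \<Rightarrow> complex measure \<Rightarrow> bool" where
  "wigner_matrix \<beta> M X \<mu> \<nu> \<longleftrightarrow>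
     (\<forall>n. prob_space (M n) \<and>
        (\<forall>\<omega>\<in>space (M n). X n \<omega> \<in> herm_mats \<beta> n) \<and>
        prob_space.indep_vars (M n) (\<lambda>_. borel) (\<lambda>(i,j) \<omega>. X n \<omega> $$ (i,j))
          {(i,j). i \<le> j \<and> j < n} \<and>
        (\<forall>i<n. distr (M n) borel (\<lambda>\<omega>. X n \<omega> $$ (i,i)) = \<mu>) \<and>
        (\<forall>i j. i < j \<and> j < n \<longrightarrow> distr (M n) borel (\<lambda>\<omega>. X n \<omega> $$ (i,j)) = \<nu>)) \<and>
     integrable \<mu> (\<lambda>z. z) \<and> (LINT z|\<mu>. z) = 0 \<and>
     integrable \<nu> (\<lambda>z. z) \<and> (LINT z|\<nu>. z) = 0 \<and>
     prob_space.indep_var \<nu> borel Re borel Im \<and>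
     integrable \<nu> (\<lambda>z. (cmod z)\<^sup>2) \<and> (LINT z|\<nu>. (cmod z)\<^sup>2) = 1"

definition convex_concentration ::
  "nat \<Rightarrow> (nat \<Rightarrow> 'a measure) \<Rightarrow> (nat \<Rightarrow> 'a \<Rightarrow> complex mat) \<Rightarrow> bool" where
  "convex_concentration \<beta> M X \<longleftrightarrow>
     (\<exists>c>0. \<forall>n g. mat_convex_on (herm_mats \<beta> n) g \<and> mat_lipschitz1_on (herm_mats \<beta> n) g \<longrightarrow>
        integrable (M n) (\<lambda>\<omega>. g (X n \<omega>)) \<and>
        (\<forall>t>0. measure (M n) {\<omega>\<in>space (M n). \<bar>g (X n \<omega>) - (LINT \<omega>'|M n. g (X n \<omega>'))\<bar> > t}
                 \<le> inverse c * exp (- c * t\<^sup>2)))"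

definition log_laplace :: "'a::euclidean_space measure \<Rightarrow> 'a \<Rightarrow> real" where
  "log_laplace \<mu> x = ln (LINT y|\<mu>. exp (inner x y))"

text \<open>\<open>iter_deriv [v\<^sub>1, \<dots>, v\<^sub>k] f x\<close> is the value of the \<open>k\<close>-th derivative \<open>D\<^sup>k f(x)\<close>,
  a \<open>k\<close>-linear form, at \<open>(v\<^sub>1, \<dots>, v\<^sub>k)\<close>.\<close>

primrec iter_deriv ::
  "'a::real_normed_vector list \<Rightarrow> ('a \<Rightarrow> real) \<Rightarrow> 'a \<Rightarrow> real" where
  "iter_deriv [] f = f"
| "iter_deriv (v # vs) f = (\<lambda>x. frechet_derivative (iter_deriv vs f) (at x) v)"

text \<open>The bound \<open>C\<close> is on the operator norm of \<open>D\<^sup>k f(x)\<close>, uniformly in \<open>x\<close>.\<close>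

definition bounded_derivatives ::
  "nat \<Rightarrow> nat \<Rightarrow> ('a::real_normed_vector \<Rightarrow> real) \<Rightarrow> bool" where
  "bounded_derivatives k l f \<longleftrightarrow>
     (\<forall>vs x. length vs < l \<longrightarrow> iter_deriv vs f differentiable (at x)) \<and>
     (\<exists>C. \<forall>vs x. length vs \<in> {k..l} \<and> (\<forall>v\<in>set vs. norm v \<le> 1) \<longrightarrow>
        \<bar>iter_deriv vs f x\<bar> \<le> C)"

text \<open>The integrability condition says that the logarithmic Laplace transform is finite
  everywhere: the Bochner integral would silently turn an infinite value into \<open>0\<close>.\<close>

definition log_laplace_bounded_derivatives ::
  "nat \<Rightarrow> nat \<Rightarrow> 'a::euclidean_space measure \<Rightarrow> bool" where
  "log_laplace_bounded_derivatives k l \<mu> \<longleftrightarrow>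
     (\<forall>x. integrable \<mu> (\<lambda>y. exp (inner x y))) \<and> bounded_derivatives k l (log_laplace \<mu>)"

definition covariance :: "'a measure \<Rightarrow> ('a \<Rightarrow> real) \<Rightarrow> ('a \<Rightarrow> real) \<Rightarrow> real" where
  "covariance M U V = (LINT \<omega>|M. (U \<omega> - (LINT \<omega>'|M. U \<omega>')) * (V \<omega> - (LINT \<omega>'|M. V \<omega>')))"

text \<open>The covariance matrix of the real and imaginary parts, acting on the complex numbers
  identified with the plane.\<close>

definition covariance_op :: "complex measure \<Rightarrow> complex \<Rightarrow> complex" where
  "covariance_op \<mu> z = Complex
     (covariance \<mu> Re Re * Re z + covariance \<mu> Re Im * Im z)
     (covariance \<mu> Im Re * Re z + covariance \<mu> Im Im * Im z)"

definition sharp_sub_gaussian :: "complex measure \<Rightarrow> bool" where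
  "sharp_sub_gaussian \<mu> \<longleftrightarrow> (\<forall>z. integrable \<mu> (\<lambda>\<xi>. exp (Re (z * \<xi>))) \<and>
     ln (LINT \<xi>|\<mu>. exp (Re (z * \<xi>))) \<le> 1 / 2 * inner z (covariance_op \<mu> z))"

definition ext_ln :: "real \<Rightarrow> ereal" where
  "ext_ln p = (if p = 0 then - \<infinity> else ereal (ln p))"

text \<open>Lower semicontinuity is expressed by closedness of the level sets.\<close>

definition large_deviations_principle ::
  "(nat \<Rightarrow> 'a measure) \<Rightarrow> (nat \<Rightarrow> 'a \<Rightarrow> real) \<Rightarrow> (nat \<Rightarrow> real) \<Rightarrow> (real \<Rightarrow> ereal) \<Rightarrow> bool" where
  "large_deviations_principle M Z \<upsilon> I \<longleftrightarrow>
     (\<forall>n. prob_space (M n) \<and> Z n \<in> borel_measurable (M n)) \<and>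
     mono \<upsilon> \<and> filterlim \<upsilon> at_top sequentially \<and>
     (\<forall>x. 0 \<le> I x) \<and> (\<forall>t::real. closed {x. I x \<le> ereal t}) \<and>
     (\<forall>B\<in>sets borel.
        - (INF x\<in>interior B. I x)
          \<le> liminf (\<lambda>n. ereal (1 / \<upsilon> n) * ext_ln (measure (M n) {\<omega>\<in>space (M n). Z n \<omega> \<in> B})) \<and>
        limsup (\<lambda>n. ereal (1 / \<upsilon> n) * ext_ln (measure (M n) {\<omega>\<in>space (M n). Z n \<omega> \<in> B}))
          \<le> - (INF x\<in>closure B. I x))"

definition good_rate_function :: "(real \<Rightarrow> ereal) \<Rightarrow> bool" where
  "good_rate_function I \<longleftrightarrow> (\<forall>t\<ge>0. compact {x. I x \<le> ereal t})"

definition catalan :: "nat \<Rightarrow> real" where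
  "catalan k = real ((2 * k) choose k) / real (k + 1)"

text \<open>The trace of a power of a Hermitian matrix is real, so \<open>Re\<close> only adjusts the type.\<close>

definition normalized_trace_power ::
  "nat \<Rightarrow> (nat \<Rightarrow> 'a \<Rightarrow> complex mat) \<Rightarrow> nat \<Rightarrow> 'a \<Rightarrow> real" where
  "normalized_trace_power d X n \<omega> =
     1 / real n * Re (mat_trace ((complex_of_real (1 / sqrt (real n)) \<cdot>\<^sub>m X n \<omega>) ^\<^sub>m d))"

definition trace_rate :: "nat \<Rightarrow> nat \<Rightarrow> real \<Rightarrow> ereal" where
  "trace_rate \<beta> d x =
     (if even d then
        (if x \<ge> catalan (d div 2)
         then ereal (real \<beta> / 4 * (x - catalan (d div 2)) powr (2 / real d))
         else \<infinity>)
      else ereal (real \<beta> / 4 * \<bar>x\<bar> powr (2 / real d)))"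

end

(*
  The trace splits into a bulk part and a part carried by the few largest eigenvalues.  The bulk
  part is a difference of convex Lipschitz spectral statistics, obtained by continuing x^d beyond
  a level along its tangent; by convex concentration it stays near the semicircle moment up to a
  probability that is negligible at speed n^(1+2/d), the moments being computed by counting
  closed walks.  The sum of the d-th powers of the remaining eigenvalues is at most the d-th
  power of their l2-norm, which is the supremum of tr(X H) over matrices H of low rank and
  Hilbert-Schmidt norm one; sharp sub-Gaussian tails give a Chernoff bound for each H, and a net
  of subexponential size one for the supremum.  For even d the large eigenvalues can only
  increase the trace, so deviations below the Catalan number have infinite rate.

  For the lower bound, the off-diagonal laws are tilted exponentially with a parameter of order
  n^(1/d-1/2).  Under the tilted law X is a constant matrix of norm of order n^(1/2+1/d) plus a
  Wigner matrix of smaller operator norm, so that the trace of X^d is the sum of the two traces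
  up to a negligible error, and the density of the tilt gives the rate.
*)
theory Submission
  imports Defs "HOL-Real_Asymp.Real_Asymp"
begin

section \<open>Closed walks and moments of Wigner matrices\<close>

text \<open>An eigenvalue \<open>t * n^(1/2 + 1/d)\<close> of \<open>X\<close> moves the normalized
  trace by \<open>t^d\<close>, and its square is of order \<open>n^(1 + 2/d)\<close>: this fixes the
  speed. The factor \<open>\<beta> / 4\<close> comes from optimizing the bound
  \<open>exp (s^2 / \<beta>)\<close> on the Laplace transform of \<open>tr (X H)\<close> for
  \<open>H\<close> of Hilbert-Schmidt norm one; the second moment \<open>2 / \<beta>\<close> on the
  diagonal is what makes diagonal and off-diagonal entries contribute alike. The obstacle is that
  \<open>x^d\<close> is not Lipschitz. The cut at level \<open>n^\<kappa>\<close> must be low enough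
  that a slope of order \<open>n^(\<kappa> (d - 1))\<close> leaves concentration stronger than the
  speed, and high enough that fewer than about \<open>n^(2/d - \<kappa>)\<close> eigenvalues exceed
  it, because a net for rank \<open>r\<close> costs \<open>r n log n\<close> in the exponent. The
  choice \<open>\<kappa> = 1 / (2 d^2)\<close> meets both demands. In the lower bound the shift is
  spread over all off-diagonal entries. The tilt parameter then tends to 0 for
  \<open>d \<ge> 3\<close>, so that a second-order expansion of the Laplace transform suffices and
  the rate depends on the entries only through their variance.\<close>

primrec steps :: "'v \<Rightarrow> 'v list \<Rightarrow> ('v \<times> 'v) list" where
  "steps i [] = []"
| "steps i (x # w) = (i, x) # steps x w"

lemma length_steps [simp]: "length (steps i w) = length w"
  by (induction w arbitrary: i) auto

lemma steps_append: "steps i (w @ w') = steps i w @ steps (last (i # w)) w'"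
  by (induction w arbitrary: i) auto

text \<open>The starting vertex is not stored, so the length of the list is the number of steps, and
  \<open>last (i # w)\<close> is the endpoint even of the empty walk.\<close>

definition walks :: "nat \<Rightarrow> nat \<Rightarrow> nat \<Rightarrow> nat \<Rightarrow> nat list set" where
  "walks n k i j = {w. length w = k \<and> set w \<subseteq> {..<n} \<and> last (i # w) = j}"

lemma finite_walks [simp]: "finite (walks n k i j)"
proof (rule finite_subset)
  show "walks n k i j \<subseteq> {w. set w \<subseteq> {..<n} \<and> length w = k}" by (auto simp: walks_def)
qed (rule finite_lists_length_eq, simp)

lemma steps_bounded:
  assumes "i < n" "set w \<subseteq> {..<n}" "s \<in> set (steps i w)"
  shows "fst s < n" "snd s < n"
  using assms by (induction w arbitrary: i) auto

lemma sum_walks_Suc: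
  fixes f :: "nat list \<Rightarrow> 'b::comm_monoid_add"
  assumes "i < n" "j < n"
  shows "(\<Sum>w\<in>walks n (Suc k) i j. f w) = (\<Sum>l<n. \<Sum>w\<in>walks n k i l. f (w @ [j]))"
proof -
  have "(\<Sum>l<n. \<Sum>w\<in>walks n k i l. f (w @ [j]))
      = (\<Sum>(l, w)\<in>(SIGMA l:{..<n}. walks n k i l). f (w @ [j]))"
    by (subst sum.Sigma) auto
  also have "\<dots> = (\<Sum>w\<in>walks n (Suc k) i j. f w)"
  proof (rule sum.reindex_bij_witness[where j = "\<lambda>(l, w). w @ [j]" and i = "\<lambda>w. (last (i # butlast w), butlast w)"])
    fix w assume w: "w \<in> walks n (Suc k) i j"
    then have ne: "w \<noteq> []" by (auto simp: walks_def)
    \<comment> \<open>The vertex before the last step; it is the start itself when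
      \<open>k = 0\<close>.\<close>
    have "last (i # butlast w) < n"
    proof (cases "butlast w = []")
      case False
      then have "last (butlast w) \<in> set w" by (meson in_set_butlastD last_in_set)
      with False w show ?thesis by (auto simp: walks_def)
    qed (use assms in simp)
    with w ne show "(last (i # butlast w), butlast w) \<in> (SIGMA l:{..<n}. walks n k i l)"
      by (auto simp: walks_def dest: in_set_butlastD)
    show "(case (last (i # butlast w), butlast w) of (l, w) \<Rightarrow> w @ [j]) = w"
      using w ne by (auto simp: walks_def)
  qed (use assms in \<open>auto simp: walks_def\<close>)
  finally show ?thesis ..
qed

definition walk_prod :: "(nat \<Rightarrow> nat \<Rightarrow> 'b::comm_monoid_mult) \<Rightarrow> (nat \<times> nat) list \<Rightarrow> 'b" where
  "walk_prod A es = (\<Prod>(i, j)\<leftarrow>es. A i j)"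

lemma walk_prod_simps [simp]:
  "walk_prod A [] = 1" "walk_prod A (e # es) = A (fst e) (snd e) * walk_prod A es"
  "walk_prod A (es @ fs) = walk_prod A es * walk_prod A fs"
  by (auto simp: walk_prod_def case_prod_beta)

text \<open>\<open>pow_mat\<close> multiplies on the right, hence walks are extended at their
  end.\<close>

lemma pow_mat_walks:
  fixes A :: "'b::comm_semiring_1 mat"
  assumes A: "A \<in> carrier_mat n n" and "i < n" "j < n"
  shows "(A ^\<^sub>m k) $$ (i, j) = (\<Sum>w\<in>walks n k i j. walk_prod (\<lambda>a b. A $$ (a, b)) (steps i w))"
  using assms(3)
proof (induction k arbitrary: j)
  case 0
  have "walks n 0 i j = (if i = j then {[]} else {})" by (auto simp: walks_def)
  with assms 0 show ?case by auto
next
  case (Suc k)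
  have "(A ^\<^sub>m Suc k) $$ (i, j) = (\<Sum>l<n. (A ^\<^sub>m k) $$ (i, l) * A $$ (l, j))"
    using A Suc.prems assms(2) by (simp add: scalar_prod_def atLeast0LessThan)
  also have "\<dots> = (\<Sum>l<n. \<Sum>w\<in>walks n k i l. walk_prod (\<lambda>a b. A $$ (a, b)) (steps i (w @ [j])))"
  proof (intro sum.cong refl)
    fix l assume "l \<in> {..<n}"
    then show "(A ^\<^sub>m k) $$ (i, l) * A $$ (l, j)
        = (\<Sum>w\<in>walks n k i l. walk_prod (\<lambda>a b. A $$ (a, b)) (steps i (w @ [j])))"
      by (subst Suc.IH) (auto simp: sum_distrib_right steps_append walks_def intro!: sum.cong)
  qed
  also have "\<dots> = (\<Sum>w\<in>walks n (Suc k) i j. walk_prod (\<lambda>a b. A $$ (a, b)) (steps i w))"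
    by (rule sum_walks_Suc[OF assms(2) Suc.prems, symmetric])
  finally show ?case .
qed

text \<open>Both orientations of a step read the same independent entry; the normal form is its
  index in the upper triangle.\<close>

definition uedge :: "nat \<times> nat \<Rightarrow> nat \<times> nat" where
  "uedge e = (min (fst e) (snd e), max (fst e) (snd e))"

lemma uedge_swap: "uedge (a, b) = uedge (b, a)"
  by (auto simp: uedge_def)

lemma uedge_eq_iff: "uedge (a, b) = uedge (c, d) \<longleftrightarrow> (a = c \<and> b = d) \<or> (a = d \<and> b = c)"
  by (auto simp: uedge_def min_def max_def split: if_splits)

definition nonloops :: "(nat \<times> nat) list \<Rightarrow> (nat \<times> nat) set" where
  "nonloops es = uedge ` {e \<in> set es. fst e \<noteq> snd e}"

lemma finite_nonloops [simp]: "finite (nonloops es)"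
  by (simp add: nonloops_def)

lemma nonloops_append [simp]: "nonloops (es @ fs) = nonloops es \<union> nonloops fs"
  by (auto simp: nonloops_def)

definition edge_rel :: "(nat \<times> nat) set \<Rightarrow> (nat \<times> nat) set" where
  "edge_rel E = {(x, y). uedge (x, y) \<in> E}"

lemma edge_rel_mono: "E \<subseteq> F \<Longrightarrow> edge_rel E \<subseteq> edge_rel F"
  by (auto simp: edge_rel_def)

lemma reach_mono: "E \<subseteq> F \<Longrightarrow> (x, y) \<in> (edge_rel E)\<^sup>* \<Longrightarrow> (x, y) \<in> (edge_rel F)\<^sup>*"
  using rtrancl_mono[OF edge_rel_mono] by blast

lemma reach_sym: "(x, y) \<in> (edge_rel E)\<^sup>* \<Longrightarrow> (y, x) \<in> (edge_rel E)\<^sup>*"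
proof -
  have "sym (edge_rel E)" by (auto simp: sym_def edge_rel_def uedge_swap)
  then show "(x, y) \<in> (edge_rel E)\<^sup>* \<Longrightarrow> (y, x) \<in> (edge_rel E)\<^sup>*"
    by (meson sym_rtrancl symD)
qed

lemma walk_reach:
  assumes "x \<in> set (i # w)"
  shows "(i, x) \<in> (edge_rel (nonloops (steps i w)))\<^sup>*"
  using assms
proof (induction w arbitrary: i)
  case (Cons y w)
  let ?R = "edge_rel (nonloops (steps i (y # w)))"
  show ?case
  proof (cases "x = i")
    case False
    with Cons have "(y, x) \<in> (edge_rel (nonloops (steps y w)))\<^sup>*" by auto
    then have 1: "(y, x) \<in> ?R\<^sup>*" by (rule reach_mono[rotated]) (auto simp: nonloops_def)
    have "(i, y) \<in> ?R\<^sup>*"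
    proof (cases "i = y")
      case False
      then have "(i, y) \<in> ?R" by (auto simp: edge_rel_def nonloops_def)
      then show ?thesis by simp
    qed simp
    with 1 show ?thesis by simp
  qed simp
qed auto

text \<open>Mapping a vertex to the last edge of a shortest path from the root is injective.\<close>

lemma card_reach_le:
  assumes "finite E" and reach: "\<And>x. x \<in> V \<Longrightarrow> (r, x) \<in> (edge_rel E)\<^sup>*"
  shows "card V \<le> 1 + card E"
proof -
  define D where "D x = (LEAST k. (r, x) \<in> edge_rel E ^^ k)" for x
  have D: "(r, x) \<in> edge_rel E ^^ D x" if "x \<in> V" for x
    using reach[OF that] unfolding D_def by (metis LeastI rtrancl_imp_relpow)
  have "\<exists>y. (y, x) \<in> edge_rel E \<and> D y < D x" if x: "x \<in> V" "x \<noteq> r" for x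
  proof -
    obtain k where k: "D x = Suc k" using D[OF x(1)] x(2) by (cases "D x") auto
    with D[OF x(1)] obtain y where y: "(r, y) \<in> edge_rel E ^^ k" "(y, x) \<in> edge_rel E" by auto
    have "D y \<le> k" unfolding D_def by (rule Least_le) (rule y)
    with y k show ?thesis by auto
  qed
  then obtain p where p: "\<And>x. x \<in> V \<Longrightarrow> x \<noteq> r \<Longrightarrow> (p x, x) \<in> edge_rel E \<and> D (p x) < D x" by metis
  have inj: "inj_on (\<lambda>x. uedge (p x, x)) (V - {r})"
  proof (rule inj_onI)
    fix x y assume xy: "x \<in> V - {r}" "y \<in> V - {r}" "uedge (p x, x) = uedge (p y, y)"
    \<comment> \<open>If the common edge were used in opposite directions, \<open>x\<close> and
      \<open>y\<close> would each be the parent of the other and so strictly closer to the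
      root.\<close>
    then have "D (p x) < D x" "D (p y) < D y" using p by auto
    with xy(3) show "x = y" unfolding uedge_eq_iff by auto
  qed
  have sub: "(\<lambda>x. uedge (p x, x)) ` (V - {r}) \<subseteq> E"
  proof (rule image_subsetI)
    fix x assume "x \<in> V - {r}"
    then have "(p x, x) \<in> edge_rel E" using p by blast
    then show "uedge (p x, x) \<in> E" unfolding edge_rel_def by simp
  qed
  have fin: "finite (V - {r})" using finite_imageD[OF finite_subset[OF sub assms(1)] inj] .
  have "card V \<le> 1 + card (V - {r})"
    using fin by (cases "r \<in> V") (auto simp: card_Diff_singleton_if card_gt_0_iff)
  also have "card (V - {r}) \<le> card E" by (rule card_inj_on_le[OF inj sub assms(1)])
  finally show ?thesis by simp
qed

text \<open>The condition under which the expectation of a monomial can differ from 0. Loops are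
  exempt because diagonal entries need not be centred.\<close>

definition edges_twice :: "(nat \<times> nat) list \<Rightarrow> bool" where
  "edges_twice es \<longleftrightarrow> (\<forall>e\<in>nonloops es. 2 \<le> count_list (map uedge es) e)"

lemma uedge_loop_iff: "fst (uedge e) = snd (uedge e) \<longleftrightarrow> fst e = snd e"
  by (auto simp: uedge_def min_def max_def)

lemma sum_count_nonloops:
  "(\<Sum>e\<in>nonloops es. count_list (map uedge es) e) = length (filter (\<lambda>e. fst e \<noteq> snd e) es)"
proof -
  let ?fs = "filter (\<lambda>e. fst e \<noteq> snd e) es"
  have "count_list (map uedge es) e = count_list (map uedge ?fs) e" if "e \<in> nonloops es" for e
  proof -
    have ne: "fst e \<noteq> snd e" using that by (auto simp: nonloops_def uedge_loop_iff)
    then show ?thesis by (induction es) (auto simp: uedge_loop_iff)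
  qed
  then have "(\<Sum>e\<in>nonloops es. count_list (map uedge es) e)
      = (\<Sum>e\<in>nonloops es. count_list (map uedge ?fs) e)" by simp
  also have "\<dots> = length (map uedge ?fs)"
    by (rule sum_count_set) (auto simp: nonloops_def)
  finally show ?thesis by simp
qed

lemma card_nonloops_le:
  assumes "edges_twice es"
  shows "2 * card (nonloops es) \<le> length (filter (\<lambda>e. fst e \<noteq> snd e) es)"
proof -
  have "(\<Sum>e\<in>nonloops es. 2) \<le> (\<Sum>e\<in>nonloops es. count_list (map uedge es) e)"
    using assms by (intro sum_mono) (auto simp: edges_twice_def)
  then show ?thesis by (simp add: sum_count_nonloops)
qed

text \<open>A loop is a step that joins no two vertices, and a third passage is one more than the
  two allotted to an edge. Either way the number of edges, and with it that of vertices, drops by at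
  least one half.\<close>

lemma card_nonloops_le_loop:
  assumes "edges_twice es" "e \<in> set es" "fst e = snd e"
  shows "2 * card (nonloops es) + 1 \<le> length es"
proof -
  have "length (filter (\<lambda>e. fst e \<noteq> snd e) es) < length es"
    using assms(2,3) by (intro length_filter_less) auto
  with card_nonloops_le[OF assms(1)] show ?thesis by simp
qed

lemma card_nonloops_le_thrice:
  assumes "edges_twice es" "e \<in> nonloops es" "3 \<le> count_list (map uedge es) e"
  shows "2 * card (nonloops es) + 1 \<le> length es"
proof -
  have "(\<Sum>e\<in>nonloops es. 2) < (\<Sum>e\<in>nonloops es. count_list (map uedge es) e)"
  proof (rule sum_strict_mono_ex1)
    show "\<exists>a\<in>nonloops es. 2 < count_list (map uedge es) a" using assms by force
  qed (use assms in \<open>auto simp: edges_twice_def\<close>)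
  also have "\<dots> \<le> length es" by (simp add: sum_count_nonloops)
  finally show ?thesis by simp
qed

lemma card_nonloops_le_length:
  assumes "edges_twice es"
  shows "2 * card (nonloops es) \<le> length es"
  using card_nonloops_le[OF assms] length_filter_le[of "\<lambda>e. fst e \<noteq> snd e" es] by linarith

text \<open>Such a list is determined by a table \<open>g\<close> of \<open>s\<close> values and a
  list \<open>f\<close> of positions in it. Spare places of the table hold 0, a legal value since
  \<open>0 < n\<close>.\<close>

lemma card_few_distinct_le:
  assumes "0 < n"
  shows "card {l. length l = m \<and> set l \<subseteq> {..<n} \<and> card (set l) \<le> s} \<le> s ^ m * n ^ s"
proof -
  let ?L = "{l. length l = m \<and> set l \<subseteq> {..<n} \<and> card (set l) \<le> s}"
  let ?F = "{f. set f \<subseteq> {..<s} \<and> length f = m}" and ?G = "{g. set g \<subseteq> {..<n} \<and> length g = s}"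
  have sub: "?L \<subseteq> (\<lambda>(f, g). map (\<lambda>i. g ! i) f) ` (?F \<times> ?G)"
  proof
    fix l assume "l \<in> ?L"
    then have l: "length l = m" "set l \<subseteq> {..<n}" "card (set l) \<le> s" by (simp_all only: mem_Collect_eq)
    obtain h where h: "set h = set l" "distinct h" using finite_distinct_list[of "set l"] by auto
    have lenh: "length h \<le> s" using distinct_card[OF h(2)] l(3) unfolding h(1) by linarith
    define g where "g = h @ replicate (s - length h) (0::nat)"
    have "\<exists>i. i < length h \<and> h ! i = x" if "x \<in> set l" for x
      using that h(1) in_set_conv_nth[of x h] by simp
    then obtain ix where ix: "\<And>x. x \<in> set l \<Longrightarrow> ix x < length h \<and> h ! ix x = x" by metis
    define f where "f = map ix l"
    have "f \<in> ?F" using ix lenh l(1) by (force simp: f_def)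
    moreover have "g \<in> ?G" using l h lenh assms by (auto simp: g_def)
    moreover have "l = map (\<lambda>i. g ! i) f"
      using ix by (auto simp: f_def g_def nth_append intro!: nth_equalityI)
    ultimately show "l \<in> (\<lambda>(f, g). map (\<lambda>i. g ! i) f) ` (?F \<times> ?G)" by force
  qed
  have "card ?L \<le> card ((\<lambda>(f, g). map (\<lambda>i. g ! i) f) ` (?F \<times> ?G))"
    by (rule card_mono[OF _ sub]) (intro finite_imageI finite_cartesian_product finite_lists_length_eq finite_lessThan)
  also have "\<dots> \<le> card (?F \<times> ?G)"
    by (rule card_image_le) (intro finite_cartesian_product finite_lists_length_eq finite_lessThan)
  also have "\<dots> = s ^ m * n ^ s"
    by (simp add: card_cartesian_product card_lists_length_eq)
  finally show ?thesis .
qed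

section \<open>Mixed moments of independent entries\<close>

lemma measurable_cnj [measurable]: "cnj \<in> borel_measurable borel"
  by (intro borel_measurable_continuous_onI continuous_intros)


text \<open>Each factor is at most the maximum, whose power is one of the summands; the 1 takes care
  of the empty product. Mixed moments are thereby reduced to absolute moments of single
  entries.\<close>

lemma prod_list_norm_le:
  fixes xs :: "real list"
  assumes "\<And>x. x \<in> set xs \<Longrightarrow> 0 \<le> x"
  shows "prod_list xs \<le> 1 + (\<Sum>x\<leftarrow>xs. x ^ length xs)"
proof (cases "xs = []")
  case False
  define m where "m = Max (set xs)"
  have m: "m \<in> set xs" "\<And>x. x \<in> set xs \<Longrightarrow> x \<le> m" using False by (auto simp: m_def)
  have nn: "0 \<le> x ^ length xs" if "x \<in> set xs" for x using assms that by simp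
  have "prod_list ys \<le> m ^ length ys \<and> 0 \<le> prod_list ys" if "set ys \<subseteq> set xs" for ys
    using that
  proof (induction ys)
    case (Cons y ys)
    then show ?case using m assms by (auto intro!: mult_mono)
  qed simp
  then have "prod_list xs \<le> m ^ length xs" by blast
  also have "\<dots> \<le> (\<Sum>x\<leftarrow>xs. x ^ length xs)"
    using member_le_sum_list[of "m ^ length xs" "map (\<lambda>x. x ^ length xs) xs"] m(1) nn by auto
  finally show ?thesis by simp
qed simp

text \<open>Covers the original matrix, with \<open>v = 1\<close>, and also the shifted matrix under
  a tilted law, where the variance only tends to 1 and the diagonal has a nonzero mean. Hence
  diagonal means are unrestricted, and so is the mean of the squared complex entry.\<close>

locale wigner_array = prob_space M for M :: "'a measure" +
  fixes n :: nat and Y :: "nat \<Rightarrow> nat \<Rightarrow> 'a \<Rightarrow> complex" and v :: real and B :: "nat \<Rightarrow> real"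
  assumes herm: "\<And>i j \<omega>. i < n \<Longrightarrow> j < n \<Longrightarrow> \<omega> \<in> space M \<Longrightarrow> Y j i \<omega> = cnj (Y i j \<omega>)"
    and indep: "indep_vars (\<lambda>_. borel) (\<lambda>(i, j). Y i j) {(i, j). i \<le> j \<and> j < n}"
    and mean: "\<And>i j. i < j \<Longrightarrow> j < n \<Longrightarrow> expectation (Y i j) = 0"
    and var: "\<And>i j. i < j \<Longrightarrow> j < n \<Longrightarrow> expectation (\<lambda>\<omega>. (cmod (Y i j \<omega>))\<^sup>2) = v"
    and moment_integrable: "\<And>i j k. i \<le> j \<Longrightarrow> j < n \<Longrightarrow> integrable M (\<lambda>\<omega>. cmod (Y i j \<omega>) ^ k)"
    and moment_le: "\<And>i j k. i \<le> j \<Longrightarrow> j < n \<Longrightarrow> expectation (\<lambda>\<omega>. cmod (Y i j \<omega>) ^ k) \<le> B k"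
begin

definition mon :: "(nat \<times> nat) list \<Rightarrow> 'a \<Rightarrow> complex" where
  "mon es \<omega> = walk_prod (\<lambda>a b. Y a b \<omega>) es"

definition in_range :: "(nat \<times> nat) list \<Rightarrow> bool" where
  "in_range es \<longleftrightarrow> (\<forall>e\<in>set es. fst e < n \<and> snd e < n)"

lemma in_range_simps [simp]:
  "in_range []" "in_range (e # es) \<longleftrightarrow> fst e < n \<and> snd e < n \<and> in_range es"
  "in_range (es @ fs) \<longleftrightarrow> in_range es \<and> in_range fs"
  by (auto simp: in_range_def)

lemma mon_simps [simp]:
  "mon [] \<omega> = 1" "mon (e # es) \<omega> = Y (fst e) (snd e) \<omega> * mon es \<omega>"
  "mon (es @ fs) \<omega> = mon es \<omega> * mon fs \<omega>"
  by (auto simp: mon_def)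

lemma in_range_steps:
  "i < n \<Longrightarrow> set w \<subseteq> {..<n} \<Longrightarrow> in_range (steps i w)"
  using steps_bounded[of i n w] unfolding in_range_def by blast

lemma meas_upper: "i \<le> j \<Longrightarrow> j < n \<Longrightarrow> Y i j \<in> borel_measurable M"
  using indep unfolding indep_vars_def by auto

lemma meas [measurable]: "i < n \<Longrightarrow> j < n \<Longrightarrow> Y i j \<in> borel_measurable M"
proof (cases "i \<le> j")
  case False
  assume ij: "i < n" "j < n"
  with False have "(\<lambda>\<omega>. cnj (Y j i \<omega>)) \<in> borel_measurable M"
    using meas_upper[of j i] by (intro measurable_compose[OF _ measurable_cnj]) auto
  then show ?thesis using herm[OF ij(2) ij(1)] by (subst measurable_cong) auto
qed (use meas_upper in auto)

lemma norm_Y_swap: "i < n \<Longrightarrow> j < n \<Longrightarrow> \<omega> \<in> space M \<Longrightarrow> cmod (Y j i \<omega>) = cmod (Y i j \<omega>)"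
  by (subst herm) auto

lemma moment:
  assumes "i < n" "j < n"
  shows "integrable M (\<lambda>\<omega>. cmod (Y i j \<omega>) ^ k)" "expectation (\<lambda>\<omega>. cmod (Y i j \<omega>) ^ k) \<le> B k"
proof -
  have *: "integrable M (\<lambda>\<omega>. cmod (Y i j \<omega>) ^ k) = integrable M (\<lambda>\<omega>. cmod (Y j i \<omega>) ^ k)"
    "expectation (\<lambda>\<omega>. cmod (Y i j \<omega>) ^ k) = expectation (\<lambda>\<omega>. cmod (Y j i \<omega>) ^ k)"
    using assms norm_Y_swap by (auto intro!: Bochner_Integration.integrable_cong Bochner_Integration.integral_cong)
  show "integrable M (\<lambda>\<omega>. cmod (Y i j \<omega>) ^ k)" "expectation (\<lambda>\<omega>. cmod (Y i j \<omega>) ^ k) \<le> B k"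
    using assms moment_integrable[of i j k] moment_integrable[of j i k] moment_le[of i j k] moment_le[of j i k] *
    by (cases "i \<le> j"; simp)+
qed

lemma B_nonneg: "0 < n \<Longrightarrow> 0 \<le> B k"
  using moment(2)[of 0 0 k] by (intro order_trans[OF integral_nonneg_AE moment(2)[of 0 0 k]]) auto

lemma meas_mon [measurable]: "in_range es \<Longrightarrow> mon es \<in> borel_measurable M"
proof (induction es)
  case (Cons e es)
  have "mon (e # es) = (\<lambda>\<omega>. Y (fst e) (snd e) \<omega> * mon es \<omega>)" by (rule ext) simp
  with Cons show ?case by simp
next
  case Nil
  have "mon [] = (\<lambda>\<omega>. 1)" by (rule ext) simp
  then show ?case by simp
qed

definition cst :: "nat \<Rightarrow> real" where "cst k = 1 + real k * B k"

lemma
  assumes "in_range es"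
  shows integrable_mon: "integrable M (mon es)"
    and norm_mon_le: "cmod (expectation (mon es)) \<le> cst (length es)"
proof -
  let ?f = "\<lambda>\<omega>. 1 + (\<Sum>e\<leftarrow>es. cmod (Y (fst e) (snd e) \<omega>) ^ length es)"
  have le: "cmod (mon es \<omega>) \<le> ?f \<omega>" for \<omega>
  proof -
    have "cmod (mon es \<omega>) = prod_list (map (\<lambda>e. cmod (Y (fst e) (snd e) \<omega>)) es)"
      by (induction es) (auto simp: norm_mult)
    also have "\<dots> \<le> ?f \<omega>"
      using prod_list_norm_le[of "map (\<lambda>e. cmod (Y (fst e) (snd e) \<omega>)) es"] by (force simp: o_def)
    finally show ?thesis .
  qed
  have 1: "integrable M (\<lambda>\<omega>. \<Sum>e\<leftarrow>fs. cmod (Y (fst e) (snd e) \<omega>) ^ k)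
      \<and> expectation (\<lambda>\<omega>. \<Sum>e\<leftarrow>fs. cmod (Y (fst e) (snd e) \<omega>) ^ k) \<le> real (length fs) * B k"
    if "in_range fs" for fs k
    using that
  proof (induction fs)
    case (Cons e fs)
    have "integrable M (\<lambda>\<omega>. cmod (Y (fst e) (snd e) \<omega>) ^ k)"
      "expectation (\<lambda>\<omega>. cmod (Y (fst e) (snd e) \<omega>) ^ k) \<le> B k"
      using Cons.prems by (auto intro!: moment)
    with Cons show ?case by (auto simp: algebra_simps)
  qed simp
  have int: "integrable M ?f" using 1[OF assms] by auto
  show I: "integrable M (mon es)"
    by (rule Bochner_Integration.integrable_bound[OF int]) (use assms le in \<open>auto intro!: AE_I2 order_trans[OF le]\<close>)
  have "cmod (expectation (mon es)) \<le> expectation (\<lambda>\<omega>. cmod (mon es \<omega>))"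
    by (rule integral_norm_bound)
  also have "\<dots> \<le> expectation ?f"
    using I int le by (intro integral_mono) auto
  also have "\<dots> \<le> cst (length es)"
    using 1[OF assms] by (simp add: cst_def prob_space)
  finally show "cmod (expectation (mon es)) \<le> cst (length es)" .
qed

text \<open>The two lists read disjoint sets of independent entries, so the monomials are functions
  of independent families.\<close>

lemma expectation_mon_append:
  assumes es: "in_range es" and fs: "in_range fs"
    and disj: "uedge ` set es \<inter> uedge ` set fs = {}"
  shows "expectation (mon (es @ fs)) = expectation (mon es) * expectation (mon fs)"
proof -
  define I where "I = {(i, j). i \<le> j \<and> j < n}"
  define U where "U = (\<lambda>(i, j). Y i j)"
  \<comment> \<open>The monomial as a function of the upper triangle alone: a step below the
    diagonal reads the conjugate of the mirrored entry.\<close>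
  define F where "F es r = walk_prod (\<lambda>a b. if a \<le> b then r (a, b) else cnj (r (b, a))) es"
    for es and r :: "nat \<times> nat \<Rightarrow> complex"
  \<comment> \<open>\<open>es'\<close> stays fixed during the induction, so that the index set of
    the restricted family does not shrink with the list.\<close>
  have eq: "mon es \<omega> = F es (restrict (\<lambda>i. U i \<omega>) (uedge ` set es'))"
    if "\<omega> \<in> space M" "in_range es" "set es \<subseteq> set es'" for es es' \<omega>
    using that(2,3)
  proof (induction es)
    case (Cons e es)
    obtain a b where e: "e = (a, b)" by force
    have "Y a b \<omega> = (if a \<le> b then restrict (\<lambda>i. U i \<omega>) (uedge ` set es') (a, b)
        else cnj (restrict (\<lambda>i. U i \<omega>) (uedge ` set es') (b, a)))"
    proof -
      have "uedge (a, b) \<in> uedge ` set es'" using Cons.prems e by auto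
      then show ?thesis using herm[of b a \<omega>] that(1) Cons.prems e
        by (auto simp: U_def uedge_def min_def max_def split: if_splits)
    qed
    with Cons e show ?case by (simp add: F_def)
  qed (simp add: F_def)
  have Fm: "F es \<in> borel_measurable (PiM J (\<lambda>_. borel))" if "uedge ` set es \<subseteq> J" for es J
    using that
  proof (induction es)
    case (Cons e es)
    obtain a b where e: "e = (a, b)" by force
    have m: "(\<lambda>r. r (min a b, max a b)) \<in> borel_measurable (PiM J (\<lambda>_. borel))"
      using Cons.prems e by (intro measurable_component_singleton) (auto simp: uedge_def)
    have m2: "(\<lambda>r. if a \<le> b then r (a, b) else cnj (r (b, a))) \<in> borel_measurable (PiM J (\<lambda>_. borel :: complex measure))"
    proof (cases "a \<le> b")
      case True then show ?thesis using m by (simp add: min_def max_def)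
    next
      case False
      then have "(\<lambda>r. cnj (r (b, a))) \<in> borel_measurable (PiM J (\<lambda>_. borel :: complex measure))"
        using measurable_compose[OF m measurable_cnj] by (simp add: min_def max_def)
      with False show ?thesis by simp
    qed
    have "F (e # es) = (\<lambda>r. (if a \<le> b then r (a, b) else cnj (r (b, a))) * F es r)"
      by (simp add: F_def e fun_eq_iff)
    with m2 Cons show ?case by auto
  next
    case Nil
    have "F [] = (\<lambda>r. 1)" by (simp add: F_def fun_eq_iff)
    then show ?case by simp
  qed
  have sub: "uedge ` set es \<subseteq> I" if "in_range es" for es
  proof (rule image_subsetI)
    fix e assume "e \<in> set es"
    then have "fst e < n \<and> snd e < n" using that unfolding in_range_def by blast
    then show "uedge e \<in> I" by (simp add: I_def uedge_def)
  qed
  have "indep_var (PiM (uedge ` set es) (\<lambda>_. borel)) (\<lambda>\<omega>. restrict (\<lambda>i. U i \<omega>) (uedge ` set es))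
      (PiM (uedge ` set fs) (\<lambda>_. borel)) (\<lambda>\<omega>. restrict (\<lambda>i. U i \<omega>) (uedge ` set fs))"
    by (rule indep_var_restrict[OF indep[folded I_def U_def] disj sub[OF es] sub[OF fs]])
  then have "indep_var borel (F es \<circ> (\<lambda>\<omega>. restrict (\<lambda>i. U i \<omega>) (uedge ` set es)))
      borel (F fs \<circ> (\<lambda>\<omega>. restrict (\<lambda>i. U i \<omega>) (uedge ` set fs)))"
    by (rule indep_var_compose) (auto intro: Fm)
  then have "indep_var borel (\<lambda>\<omega>. F es (restrict (\<lambda>i. U i \<omega>) (uedge ` set es)))
      borel (\<lambda>\<omega>. F fs (restrict (\<lambda>i. U i \<omega>) (uedge ` set fs)))" by (simp add: o_def)
  moreover have i: "integrable M (\<lambda>\<omega>. F es (restrict (\<lambda>i. U i \<omega>) (uedge ` set es)))" if "in_range es" for es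
    using integrable_mon[OF that] eq[OF _ that order_refl] by (subst Bochner_Integration.integrable_cong[OF refl, of _ _ "mon es"]) auto
  ultimately have "expectation (\<lambda>\<omega>. F es (restrict (\<lambda>i. U i \<omega>) (uedge ` set es)) * F fs (restrict (\<lambda>i. U i \<omega>) (uedge ` set fs)))
     = expectation (\<lambda>\<omega>. F es (restrict (\<lambda>i. U i \<omega>) (uedge ` set es))) * expectation (\<lambda>\<omega>. F fs (restrict (\<lambda>i. U i \<omega>) (uedge ` set fs)))"
    using es fs by (intro indep_var_lebesgue_integral) auto
  moreover have "expectation (mon es) = expectation (\<lambda>\<omega>. F es (restrict (\<lambda>i. U i \<omega>) (uedge ` set es)))" if "in_range es" for es
    using eq[OF _ that order_refl] by (intro Bochner_Integration.integral_cong) auto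
  moreover have "expectation (mon (es @ fs)) = expectation (\<lambda>\<omega>. F es (restrict (\<lambda>i. U i \<omega>) (uedge ` set es)) * F fs (restrict (\<lambda>i. U i \<omega>) (uedge ` set fs)))"
    using eq[OF _ es order_refl] eq[OF _ fs order_refl] by (intro Bochner_Integration.integral_cong) auto
  ultimately show ?thesis using es fs by simp
qed

lemma mon_perm: "mset es = mset fs \<Longrightarrow> mon es = mon fs"
proof (rule ext)
  fix \<omega> assume *: "mset es = mset fs"
  have m: "mon es \<omega> = prod_mset (image_mset (\<lambda>(i, j). Y i j \<omega>) (mset es))" for es
    unfolding mon_def walk_prod_def by (simp add: prod_mset_prod_list flip: mset_map)
  show "mon es \<omega> = mon fs \<omega>" unfolding m * ..
qed

text \<open>An off-diagonal edge visited only once is a centred factor independent of the rest of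
  the product.\<close>

lemma expectation_mon_eq_0:
  assumes "in_range es" "\<not> edges_twice es"
  shows "expectation (mon es) = 0"
proof -
  obtain e where e: "e \<in> set es" "fst e \<noteq> snd e" "count_list (map uedge es) (uedge e) < 2"
    using assms(2) by (auto simp: edges_twice_def nonloops_def)
  obtain as bs where es: "es = as @ e # bs" using split_list[OF e(1)] by blast
  have "count_list (map uedge as) (uedge e) = 0" "count_list (map uedge bs) (uedge e) = 0"
    using e(3) by (auto simp: es)
  then have dj: "uedge ` set [e] \<inter> uedge ` set (as @ bs) = {}"
    by (auto simp: count_list_0_iff)
  have "mset es = mset ([e] @ (as @ bs))" by (simp add: es)
  from mon_perm[OF this] have "expectation (mon es) = expectation (mon ([e] @ (as @ bs)))" by (rule arg_cong)
  also have "\<dots> = expectation (mon [e]) * expectation (mon (as @ bs))"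
    using assms(1) by (intro expectation_mon_append dj) (auto simp: es)
  also have "expectation (mon [e]) = 0"
  proof -
    have r: "fst e < n" "snd e < n" using assms(1) unfolding es by simp_all
    have m1: "mon [e] = Y (fst e) (snd e)" by (rule ext) simp
    show ?thesis
    proof (cases "fst e < snd e")
      case True
      then show ?thesis unfolding m1 by (rule mean) (rule r)
    next
      case False
      then have lt: "snd e < fst e" using e(2) by linarith
      have "expectation (Y (fst e) (snd e)) = expectation (\<lambda>\<omega>. cnj (Y (snd e) (fst e) \<omega>))"
        by (rule Bochner_Integration.integral_cong[OF refl]) (rule herm[OF r(2) r(1)])
      then show ?thesis unfolding m1 using mean[OF lt r(1)] by simp
    qed
  qed
  finally show ?thesis by simp
qed

end

section \<open>First-return decomposition of closed walks\<close>

lemma steps_split: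
  assumes "e \<in> uedge ` set (steps j w)"
  shows "\<exists>w1 y w2. w = w1 @ y # w2 \<and> uedge (last (j # w1), y) = e \<and> e \<notin> uedge ` set (steps j w1)"
  using assms
proof (induction w arbitrary: j)
  case (Cons x w)
  show ?case
  proof (cases "uedge (j, x) = e")
    case True
    then show ?thesis by (intro exI[of _ "[]"] exI[of _ x] exI[of _ w]) simp
  next
    case False
    with Cons.prems have "e \<in> uedge ` set (steps x w)" by auto
    from Cons.IH[OF this] obtain w1 y w2 where *: "w = w1 @ y # w2" "uedge (last (x # w1), y) = e"
      "e \<notin> uedge ` set (steps x w1)" by blast
    with False show ?thesis by (intro exI[of _ "x # w1"] exI[of _ y] exI[of _ w2]) simp
  qed
qed simp

lemma vertex_of_step: "s \<in> set (steps i w) \<Longrightarrow> fst s \<in> set (i # w) \<and> snd s \<in> set (i # w)"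
  by (induction w arbitrary: i) auto

definition cwalks :: "nat \<Rightarrow> nat \<Rightarrow> (nat \<times> nat list) set" where
  "cwalks n k = (SIGMA i:{..<n}. walks n k i i)"

lemma finite_cwalks [simp]: "finite (cwalks n k)"
  by (simp add: cwalks_def)

lemma cwalks_iff:
  "(i, w) \<in> cwalks n k \<longleftrightarrow> i < n \<and> length w = k \<and> set w \<subseteq> {..<n} \<and> last (i # w) = i"
  by (simp add: cwalks_def walks_def)

definition csteps :: "nat \<times> nat list \<Rightarrow> (nat \<times> nat) list" where
  "csteps c = steps (fst c) (snd c)"

definition cverts :: "nat \<times> nat list \<Rightarrow> nat list" where
  "cverts c = fst c # snd c"

lemma length_csteps: "c \<in> cwalks n k \<Longrightarrow> length (csteps c) = k"
  by (cases c) (auto simp: cwalks_iff csteps_def)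

lemma cverts_cwalks: "c \<in> cwalks n k \<Longrightarrow> length (cverts c) = Suc k \<and> set (cverts c) \<subseteq> {..<n}"
  by (cases c) (auto simp: cwalks_iff cverts_def)

lemma card_cverts_le:
  assumes "c \<in> cwalks n k" "edges_twice (csteps c)"
  shows "2 * card (set (cverts c)) \<le> k + 2"
proof -
  have "card (set (cverts c)) \<le> 1 + card (nonloops (csteps c))"
    unfolding cverts_def csteps_def by (rule card_reach_le[OF finite_nonloops walk_reach])
  with card_nonloops_le_length[OF assms(2)] length_csteps[OF assms(1)] show ?thesis by simp
qed

text \<open>A common vertex makes the union of the two walks connected, so that one root is enough.
  Disjoint walks could have one vertex more; this is the gain that makes covariances
  negligible.\<close>

lemma card_cverts_pair_le:
  assumes "c \<in> cwalks n a" "d \<in> cwalks n b" "edges_twice (csteps c @ csteps d)"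
    and x: "x \<in> set (cverts c)" "x \<in> set (cverts d)"
  shows "2 * card (set (cverts c @ cverts d)) \<le> a + b + 2"
proof -
  let ?E = "nonloops (csteps c @ csteps d)"
  have 1: "(fst c, z) \<in> (edge_rel ?E)\<^sup>*" if "z \<in> set (cverts c)" for z
    using walk_reach[of z "fst c" "snd c"] that reach_mono[of "nonloops (csteps c)" ?E]
    by (auto simp: cverts_def csteps_def)
  have 2: "(fst d, z) \<in> (edge_rel ?E)\<^sup>*" if "z \<in> set (cverts d)" for z
    using walk_reach[of z "fst d" "snd d"] that reach_mono[of "nonloops (csteps d)" ?E]
    by (auto simp: cverts_def csteps_def)
  have "(fst c, z) \<in> (edge_rel ?E)\<^sup>*" if "z \<in> set (cverts c @ cverts d)" for z
    using that 1 2 x reach_sym by (metis Un_iff rtrancl_trans set_append)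
  then have "card (set (cverts c @ cverts d)) \<le> 1 + card ?E"
    by (rule card_reach_le[OF finite_nonloops])
  with card_nonloops_le_length[OF assms(3)] length_csteps[OF assms(1)] length_csteps[OF assms(2)]
  show ?thesis by simp
qed

text \<open>The closed walk based at \<open>fst d\<close> that steps to \<open>fst c\<close>,
  follows \<open>c\<close>, steps back and follows \<open>d\<close>: the inverse of the first-return
  decomposition.\<close>

definition glue :: "(nat \<times> nat list) \<times> (nat \<times> nat list) \<Rightarrow> nat \<times> nat list" where
  "glue = (\<lambda>(c, d). (fst d, cverts c @ cverts d))"

text \<open>The joining edge is new to both walks. Its two passages then contribute an independent
  factor, the variance, and the glued walk can be cut apart again.\<close>

definition good_pair :: "(nat \<times> nat list) \<times> (nat \<times> nat list) \<Rightarrow> bool" where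
  "good_pair = (\<lambda>(c, d). fst c \<noteq> fst d \<and> uedge (fst d, fst c) \<notin> uedge ` set (csteps c @ csteps d))"

text \<open>A closed walk with few repeated edges returns along its first edge exactly once and backwards,
  which splits it into two closed walks; every other case costs at least half a vertex.\<close>

lemma cwalk_first_return:
  assumes c: "c \<in> cwalks n (k + 2)" and tw: "edges_twice (csteps c)"
  shows "2 * card (set (cverts c)) \<le> k + 3 \<or>
    (\<exists>a\<le>k. \<exists>p\<in>cwalks n a \<times> cwalks n (k - a). good_pair p \<and> glue p = c)"
proof -
  obtain i j w where cij: "c = (i, j # w)"
    using c by (cases c; cases "snd c") (auto simp: cwalks_iff)
  have es: "csteps c = (i, j) # steps j w" by (simp add: csteps_def cij)
  have len: "length (csteps c) = k + 2" by (rule length_csteps[OF c])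
  have V: "card (set (cverts c)) \<le> 1 + card (nonloops (csteps c))"
    unfolding cverts_def csteps_def by (rule card_reach_le[OF finite_nonloops walk_reach])
  let ?e = "uedge (i, j)"
  show ?thesis
  proof (cases "i = j")
    case True
    with card_nonloops_le_loop[OF tw, of "(i, j)"] V len show ?thesis by (simp add: es)
  next
    case False
    have e: "?e \<in> nonloops (csteps c)" using False by (force simp: nonloops_def es)
    show ?thesis
    proof (cases "3 \<le> count_list (map uedge (csteps c)) ?e")
      case True
      with card_nonloops_le_thrice[OF tw e] V len show ?thesis by simp
    next
      case False
      with tw e have "count_list (map uedge (csteps c)) ?e = 2"
        unfolding edges_twice_def by force
      then have one: "count_list (map uedge (steps j w)) ?e = 1" by (simp add: es)
      have "?e \<in> set (map uedge (steps j w))"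
      proof (rule ccontr)
        assume "?e \<notin> set (map uedge (steps j w))"
        then have "count_list (map uedge (steps j w)) ?e = 0" by (rule count_notin)
        with one show False by simp
      qed
      then have "?e \<in> uedge ` set (steps j w)" by simp
      from steps_split[OF this] obtain w1 y w2 where w: "w = w1 @ y # w2"
        "uedge (last (j # w1), y) = ?e" "?e \<notin> uedge ` set (steps j w1)" by blast
      have st: "steps j w = steps j w1 @ (last (j # w1), y) # steps y w2"
        by (simp add: w(1) steps_append)
      have "count_list (map uedge (steps y w2)) ?e = 0" using one w(2) by (simp add: st)
      then have w2: "?e \<notin> uedge ` set (steps y w2)" by (simp add: count_list_0_iff)
      consider "last (j # w1) = i" "y = j" | "last (j # w1) = j" "y = i"
        using w(2) unfolding uedge_eq_iff by blast
      then show ?thesis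
      proof cases
        case 1
        \<comment> \<open>A second passage in the same direction closes a cycle through the edge:
          \<open>w1\<close> leads from \<open>j\<close> back to \<open>i\<close> without it. The
          graph stays connected when the edge is removed, which costs a whole vertex.\<close>
        let ?E = "nonloops (csteps c) - {?e}"
        have sub: "nonloops (steps j w1) \<subseteq> ?E" "nonloops (steps j w2) \<subseteq> ?E"
          using w(3) w2 1 by (auto simp: nonloops_def es st)
        have r1: "(j, z) \<in> (edge_rel ?E)\<^sup>*" if "z \<in> set (j # w1)" for z
          by (rule reach_mono[OF sub(1) walk_reach[OF that]])
        have r2: "(j, z) \<in> (edge_rel ?E)\<^sup>*" if "z \<in> set (j # w2)" for z
          by (rule reach_mono[OF sub(2) walk_reach[OF that]])
        have "i \<in> set (j # w1)" using last_in_set[of "j # w1"] unfolding 1(1) by blast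
        then have "(j, z) \<in> (edge_rel ?E)\<^sup>*" if "z \<in> set (cverts c)" for z
          using that r1[of z] r2[of z] r1[of i] unfolding cij cverts_def w(1) 1(2) by auto
        then have "card (set (cverts c)) \<le> 1 + card ?E"
          by (intro card_reach_le[of ?E _ j] finite_Diff finite_nonloops)
        moreover have "card (nonloops (csteps c)) = Suc (card ?E)"
          by (rule card.remove[OF finite_nonloops e])
        ultimately show ?thesis using card_nonloops_le_length[OF tw] len by simp
      next
        case 2
        let ?p = "((j, w1), (i, w2))"
        have "last (i # w2) = i" using c by (simp add: cij cwalks_iff w(1) 2)
        then have "length w1 \<le> k" "?p \<in> cwalks n (length w1) \<times> cwalks n (k - length w1)"
          using c 2(1) unfolding cij w(1) 2(2) by (auto simp add: cwalks_iff mem_Times_iff)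
        moreover have "good_pair ?p"
          using w(3) w2 \<open>i \<noteq> j\<close> unfolding 2(2) by (simp add: good_pair_def csteps_def image_Un)
        moreover have "glue ?p = c" by (simp add: glue_def cverts_def cij w(1) 2)
        ultimately show ?thesis by blast
      qed
    qed
  qed
qed

lemma glue_cwalks:
  assumes "p \<in> cwalks n a \<times> cwalks n b"
  shows "glue p \<in> cwalks n (a + b + 2)"
proof -
  obtain j w1 i w2 where p: "p = ((j, w1), (i, w2))" by (metis prod.exhaust)
  have "last (i # j # w1 @ i # w2) = i" using assms by (simp add: p cwalks_iff)
  then show ?thesis using assms by (simp add: p cwalks_iff glue_def cverts_def)
qed

lemma csteps_glue:
  assumes "p \<in> cwalks n a \<times> cwalks n b"
  shows "csteps (glue p) = (fst (snd p), fst (fst p)) # csteps (fst p) @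
     (fst (fst p), fst (snd p)) # csteps (snd p)"
proof -
  obtain j w1 i w2 where p: "p = ((j, w1), (i, w2))" by (metis prod.exhaust)
  have "last (j # w1) = j" using assms by (simp add: p cwalks_iff)
  then show ?thesis by (simp only: p glue_def csteps_def cverts_def prod.case fst_conv snd_conv
      append_Cons steps.simps steps_append)
qed

text \<open>The cut is the first passage of the joining edge after the initial step. If two cuts
  differed, the longer first part would contain a closed walk at \<open>j\<close> followed by
  \<open>i\<close>, that is, a passage of the excluded edge.\<close>

lemma inj_glue:
  assumes p: "p \<in> cwalks n a \<times> cwalks n b" "good_pair p"
    and q: "q \<in> cwalks n c \<times> cwalks n d" "good_pair q" and eq: "glue p = glue q"
  shows "p = q"
proof -
  have key: False if "(j, w1) \<in> cwalks n a'" "good_pair ((j, w1'), (i, w2'))"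
      "w1' = w1 @ i # z" for i j w1 w1' w2' z a'
  proof -
    have "last (j # w1) = j" using that(1) by (simp add: cwalks_iff)
    then have "(j, i) \<in> set (steps j w1')" unfolding that(3) steps_append by simp
    then have "uedge (j, i) \<in> uedge ` set (steps j w1')" by blast
    then show False using that(2) by (auto simp: good_pair_def csteps_def uedge_swap)
  qed
  obtain j w1 i w2 where P: "p = ((j, w1), (i, w2))" by (metis prod.exhaust)
  obtain j' w1' i' w2' where Q: "q = ((j', w1'), (i', w2'))" by (metis prod.exhaust)
  have [simp]: "j' = j" "i' = i" and w: "w1 @ i # w2 = w1' @ i # w2'"
    using eq by (auto simp: P Q glue_def cverts_def)
  have "w1 = w1'"
  proof (rule ccontr)
    assume ne: "w1 \<noteq> w1'"
    from w obtain us where "w1 = w1' @ us \<and> us @ i # w2 = i # w2' \<or> w1 @ us = w1' \<and> i # w2 = us @ i # w2'"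
      unfolding append_eq_append_conv2 by blast
    then show False
    proof
      assume *: "w1 = w1' @ us \<and> us @ i # w2 = i # w2'"
      with ne obtain z where "us = i # z" by (cases us) auto
      then have "w1 = w1' @ i # z" using * by simp
      then show False using key[of j w1' c w1 i w2 z] p(2) q(1) unfolding P Q by simp
    next
      assume *: "w1 @ us = w1' \<and> i # w2 = us @ i # w2'"
      with ne obtain z where "us = i # z" by (cases us) auto
      then have "w1' = w1 @ i # z" using * by simp
      then show False using key[of j w1 a w1' i w2' z] p(1) q(2) unfolding P Q by simp
    qed
  qed
  with w show ?thesis by (simp add: P Q)
qed

definition lists_few :: "nat \<Rightarrow> nat \<Rightarrow> nat \<Rightarrow> nat list set" where
  "lists_few n m s = {l. length l = m \<and> set l \<subseteq> {..<n} \<and> card (set l) \<le> s}"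

lemma finite_lists_few [simp]: "finite (lists_few n m s)"
  by (rule finite_subset[OF _ finite_lists_length_eq[of "{..<n}" m]]) (auto simp: lists_few_def)

lemma card_lists_few_le: "0 < n \<Longrightarrow> card (lists_few n m s) \<le> s ^ m * n ^ s"
  unfolding lists_few_def by (rule card_few_distinct_le)

lemma card_cwalks_few_le:
  assumes "0 < n"
  shows "card {c \<in> cwalks n k. card (set (cverts c)) \<le> s} \<le> s ^ Suc k * n ^ s"
proof -
  have "card {c \<in> cwalks n k. card (set (cverts c)) \<le> s} \<le> card (lists_few n (Suc k) s)"
  proof (rule card_inj_on_le)
    show "inj_on cverts {c \<in> cwalks n k. card (set (cverts c)) \<le> s}"
      by (auto simp: inj_on_def cverts_def)
    show "cverts ` {c \<in> cwalks n k. card (set (cverts c)) \<le> s} \<subseteq> lists_few n (Suc k) s"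
      by (auto simp: lists_few_def dest: cverts_cwalks)
  qed (rule finite_lists_few)
  from order_trans[OF this card_lists_few_le[OF assms]] show ?thesis .
qed

lemma card_cwalk_pairs_few_le:
  assumes "0 < n"
  shows "card {p \<in> cwalks n a \<times> cwalks n b. card (set (cverts (fst p) @ cverts (snd p))) \<le> s}
    \<le> s ^ (a + b + 2) * n ^ s" (is "card ?P \<le> _")
proof -
  have "card ?P \<le> card (lists_few n (a + b + 2) s)"
  proof (rule card_inj_on_le)
    show "inj_on (\<lambda>p. cverts (fst p) @ cverts (snd p)) ?P"
    proof (rule inj_onI)
      fix p q assume *: "p \<in> ?P" "q \<in> ?P" "cverts (fst p) @ cverts (snd p) = cverts (fst q) @ cverts (snd q)"
      \<comment> \<open>The lengths \<open>a\<close> and \<open>b\<close> are fixed, so the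
        concatenation splits in one way only.\<close>
      then have "length (cverts (fst p)) = length (cverts (fst q))"
        using cverts_cwalks[of "fst p" n a] cverts_cwalks[of "fst q" n a] by auto
      with *(3) show "p = q" by (auto simp: cverts_def prod_eq_iff)
    qed
    show "(\<lambda>p. cverts (fst p) @ cverts (snd p)) ` ?P \<subseteq> lists_few n (a + b + 2) s"
    proof (rule image_subsetI)
      fix p assume "p \<in> ?P"
      then show "cverts (fst p) @ cverts (snd p) \<in> lists_few n (a + b + 2) s"
        using cverts_cwalks[of "fst p" n a] cverts_cwalks[of "snd p" n b] by (auto simp: lists_few_def)
    qed
  qed (rule finite_lists_few)
  from order_trans[OF this card_lists_few_le[OF assms]] show ?thesis .
qed

text \<open>Let \<open>S\<close> be the convolution and \<open>T\<close> the convolution weighted by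
  the index. Symmetry gives \<open>2 * T m = m * S m\<close>, and the ratio recursion expresses
  \<open>T + S\<close> at \<open>Suc n\<close> through both at \<open>n\<close>. Eliminating
  \<open>T\<close> leaves a first-order recursion for \<open>S\<close>.\<close>

lemma catalan_Suc:
  fixes c :: "nat \<Rightarrow> real"
  assumes c0: "c 0 = 1" and step: "\<And>i. (real i + 2) * c (Suc i) = (4 * real i + 2) * c i"
  shows "(\<Sum>i\<le>n. c i * c (n - i)) = c (Suc n)"
proof (induction n)
  case 0
  show ?case using step[of 0] c0 by simp
next
  case (Suc n)
  define S where "S m = (\<Sum>i\<le>m. c i * c (m - i))" for m
  define T where "T m = (\<Sum>i\<le>m. real i * c i * c (m - i))" for m
  have T: "2 * T m = real m * S m" for m
  proof -
    have "T m = (\<Sum>i\<le>m. real (m - i) * c (m - i) * c i)"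
      unfolding T_def by (rule sum.reindex_bij_witness[where i = "\<lambda>i. m - i" and j = "\<lambda>i. m - i"]) auto
    then have "2 * T m = (\<Sum>i\<le>m. real i * c i * c (m - i) + real (m - i) * c (m - i) * c i)"
      unfolding T_def sum.distrib by simp
    also have "\<dots> = (\<Sum>i\<le>m. real m * (c i * c (m - i)))"
      by (intro sum.cong refl) (auto simp: of_nat_diff algebra_simps)
    finally show ?thesis by (simp add: S_def sum_distrib_left)
  qed
  have "T (Suc n) + S (Suc n) = (\<Sum>i\<le>Suc n. (real i + 1) * c i * c (Suc n - i))"
    unfolding S_def T_def sum.distrib[symmetric] by (intro sum.cong) (auto simp: algebra_simps)
  also have "\<dots> = c (Suc n) + (\<Sum>i\<le>n. (real i + 2) * c (Suc i) * c (n - i))"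
    by (subst sum.atMost_Suc_shift) (simp add: c0 add.commute)
  also have "(\<Sum>i\<le>n. (real i + 2) * c (Suc i) * c (n - i)) = (\<Sum>i\<le>n. 4 * (real i * c i * c (n - i)) + 2 * (c i * c (n - i)))"
    by (intro sum.cong refl) (simp only: step, simp add: algebra_simps)
  also have "\<dots> = 4 * T n + 2 * S n"
    unfolding S_def T_def sum.distrib sum_distrib_left ..
  finally have "T (Suc n) + S (Suc n) = c (Suc n) + (2 * real n + 2) * S n"
    using T[of n] by (simp add: algebra_simps)
  moreover have "S n = c (Suc n)" using Suc.IH by (simp add: S_def)
  ultimately have "(real n + 3) * S (Suc n) = (4 * real n + 6) * c (Suc n)"
    using T[of "Suc n"] by (simp add: algebra_simps)
  also have "\<dots> = (real n + 3) * c (Suc (Suc n))" using step[of "Suc n"] by (simp add: algebra_simps)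
  finally show ?case by (simp add: S_def)
qed

section \<open>Expected traces of powers: bounds and recursion\<close>

context wigner_array
begin

definition tr_pow :: "nat \<Rightarrow> 'a \<Rightarrow> complex" where
  "tr_pow k \<omega> = (\<Sum>c\<in>cwalks n k. mon (csteps c) \<omega>)"

lemma in_range_csteps: "c \<in> cwalks n k \<Longrightarrow> in_range (csteps c)"
  unfolding csteps_def by (rule in_range_steps) (cases c; simp add: cwalks_iff)+

lemma integrable_tr_pow: "integrable M (tr_pow k)"
  unfolding tr_pow_def[abs_def] by (intro Bochner_Integration.integrable_sum integrable_mon in_range_csteps)

lemma expectation_tr_pow: "expectation (tr_pow k) = (\<Sum>c\<in>cwalks n k. expectation (mon (csteps c)))"
  unfolding tr_pow_def[abs_def]
  by (intro Bochner_Integration.integral_sum integrable_mon in_range_csteps)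

abbreviation psteps :: "(nat \<times> nat list) \<times> (nat \<times> nat list) \<Rightarrow> (nat \<times> nat) list" where
  "psteps p \<equiv> csteps (fst p) @ csteps (snd p)"

lemma in_range_psteps: "p \<in> cwalks n a \<times> cwalks n b \<Longrightarrow> in_range (psteps p)"
  by (auto intro: in_range_csteps)

lemma length_psteps: "p \<in> cwalks n a \<times> cwalks n b \<Longrightarrow> length (psteps p) = a + b"
  using length_csteps[of "fst p" n a] length_csteps[of "snd p" n b] by (simp add: mem_Times_iff)

lemma tr_pow_mult: "tr_pow a \<omega> * tr_pow b \<omega> = (\<Sum>p\<in>cwalks n a \<times> cwalks n b. mon (psteps p) \<omega>)"
  unfolding tr_pow_def by (simp add: sum_product sum.cartesian_product case_prod_beta)

lemma integrable_tr_pow_mult: "integrable M (\<lambda>\<omega>. tr_pow a \<omega> * tr_pow b \<omega>)"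
  unfolding tr_pow_mult by (rule Bochner_Integration.integrable_sum, rule integrable_mon, rule in_range_psteps)

lemma expectation_tr_pow_mult:
  "expectation (\<lambda>\<omega>. tr_pow a \<omega> * tr_pow b \<omega>) = (\<Sum>p\<in>cwalks n a \<times> cwalks n b. expectation (mon (psteps p)))"
  unfolding tr_pow_mult by (rule Bochner_Integration.integral_sum, rule integrable_mon, rule in_range_psteps)

lemma cst_nonneg: "0 < n \<Longrightarrow> 0 \<le> cst k"
  using B_nonneg[of k] by (simp add: cst_def)

lemma norm_sum_le_card:
  fixes f :: "'b \<Rightarrow> complex"
  assumes "finite A" "\<And>x. x \<in> A \<Longrightarrow> f x \<noteq> 0 \<Longrightarrow> x \<in> P" "\<And>x. x \<in> A \<Longrightarrow> cmod (f x) \<le> K" "0 \<le> K"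
    and "card {x \<in> A. x \<in> P} \<le> N"
  shows "cmod (\<Sum>x\<in>A. f x) \<le> K * real N"
proof -
  have "(\<Sum>x\<in>A. f x) = (\<Sum>x\<in>{x \<in> A. x \<in> P}. f x)"
    using assms(1,2) by (intro sum.mono_neutral_right) auto
  also have "cmod \<dots> \<le> (\<Sum>x\<in>{x \<in> A. x \<in> P}. K)"
    using assms(3) by (intro sum_norm_le) auto
  also have "\<dots> = real (card {x \<in> A. x \<in> P}) * K" by simp
  also have "\<dots> \<le> real N * K" using assms(4,5) by (intro mult_right_mono) auto
  finally show ?thesis by (simp add: mult.commute)
qed

lemma tr_pow_moment_le:
  assumes "0 < n"
  defines "s \<equiv> \<lambda>k. (k + 2) div 2"
  shows "cmod (expectation (tr_pow k)) \<le> cst k * real (s k ^ Suc k * n ^ s k)"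
  unfolding expectation_tr_pow
proof (rule norm_sum_le_card)
  show "card {c \<in> cwalks n k. c \<in> {c. card (set (cverts c)) \<le> s k}} \<le> s k ^ Suc k * n ^ s k"
    using card_cwalks_few_le[OF assms(1), of k "s k"] by simp
  fix c assume c: "c \<in> cwalks n k"
  show "cmod (expectation (mon (csteps c))) \<le> cst k"
    using norm_mon_le[OF in_range_csteps[OF c]] length_csteps[OF c] by simp
  assume "expectation (mon (csteps c)) \<noteq> 0"
  then have "edges_twice (csteps c)" using expectation_mon_eq_0[OF in_range_csteps[OF c]] by blast
  from card_cverts_le[OF c this] show "c \<in> {c. card (set (cverts c)) \<le> s k}"
    unfolding s_def mem_Collect_eq by linarith
qed (use cst_nonneg[OF assms(1)] in auto)

text \<open>Pairs of walks without a common edge cancel. The others share a vertex and visit at most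
  \<open>(a + b + 2) / 2\<close> vertices, one power of \<open>n\<close> below the scale of the
  product of the two means.\<close>

lemma covariance_tr_pow_le:
  assumes "0 < n"
  defines "s \<equiv> \<lambda>k. (k + 2) div 2"
  shows "cmod (expectation (\<lambda>\<omega>. tr_pow a \<omega> * tr_pow b \<omega>) - expectation (tr_pow a) * expectation (tr_pow b))
     \<le> (cst (a + b) + cst a * cst b) * real (s (a + b) ^ (a + b + 2) * n ^ s (a + b))"
proof -
  have eq: "expectation (tr_pow a) * expectation (tr_pow b) =
      (\<Sum>p\<in>cwalks n a \<times> cwalks n b. expectation (mon (csteps (fst p))) * expectation (mon (csteps (snd p))))"
    unfolding expectation_tr_pow by (simp add: sum_product sum.cartesian_product case_prod_beta)
  show ?thesis
    unfolding expectation_tr_pow_mult eq sum_subtractf[symmetric]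
  proof (rule norm_sum_le_card)
    let ?P = "{p. card (set (cverts (fst p) @ cverts (snd p))) \<le> s (a + b)}"
    show "card {p \<in> cwalks n a \<times> cwalks n b. p \<in> ?P} \<le> s (a + b) ^ (a + b + 2) * n ^ s (a + b)"
      using card_cwalk_pairs_few_le[OF assms(1), of a b "s (a + b)"] by simp
    fix p assume p: "p \<in> cwalks n a \<times> cwalks n b"
    then have p1: "fst p \<in> cwalks n a" and p2: "snd p \<in> cwalks n b" by auto
    note r1 = in_range_csteps[OF p1] and r2 = in_range_csteps[OF p2]
    have "cmod (expectation (mon (csteps (fst p))) * expectation (mon (csteps (snd p)))) \<le> cst a * cst b"
      unfolding norm_mult using norm_mon_le[OF r1] norm_mon_le[OF r2] length_csteps[OF p1] length_csteps[OF p2]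
        cst_nonneg[OF assms(1)] by (intro mult_mono) auto
    moreover have "cmod (expectation (mon (psteps p))) \<le> cst (a + b)"
      using norm_mon_le[OF in_range_psteps[OF p]] length_psteps[OF p] by simp
    ultimately show "cmod (expectation (mon (psteps p)) - expectation (mon (csteps (fst p))) * expectation (mon (csteps (snd p))))
       \<le> cst (a + b) + cst a * cst b"
      by (intro order_trans[OF norm_triangle_ineq4]) linarith
    assume ne: "expectation (mon (psteps p)) - expectation (mon (csteps (fst p))) * expectation (mon (csteps (snd p))) \<noteq> 0"
    then have "uedge ` set (csteps (fst p)) \<inter> uedge ` set (csteps (snd p)) \<noteq> {}"
      using expectation_mon_append[OF r1 r2] by auto
    then obtain e f where ef: "e \<in> set (csteps (fst p))" "f \<in> set (csteps (snd p))" "uedge e = uedge f" by blast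
    then have "fst e = fst f \<or> fst e = snd f"
      using uedge_eq_iff[of "fst e" "snd e" "fst f" "snd f"] by auto
    then have x: "fst e \<in> set (cverts (fst p))" "fst e \<in> set (cverts (snd p))"
      using vertex_of_step[of e "fst (fst p)" "snd (fst p)"] vertex_of_step[of f "fst (snd p)" "snd (snd p)"] ef
      unfolding csteps_def cverts_def by auto
    \<comment> \<open>An edge visited once by the pair is visited once by the walk containing it, so
      that the joint moment and the product of moments both vanish.\<close>
    have "edges_twice (psteps p)"
    proof (rule ccontr)
      assume nt: "\<not> edges_twice (psteps p)"
      then have "\<not> edges_twice (csteps (fst p)) \<or> \<not> edges_twice (csteps (snd p))"
        unfolding edges_twice_def nonloops_append by (auto intro: trans_le_add1 trans_le_add2)
      then have "expectation (mon (csteps (fst p))) * expectation (mon (csteps (snd p))) = 0"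
        using expectation_mon_eq_0[OF r1] expectation_mon_eq_0[OF r2] by auto
      with expectation_mon_eq_0[OF in_range_psteps[OF p] nt] ne show False by simp
    qed
    from card_cverts_pair_le[OF p1 p2 this x] show "p \<in> ?P"
      unfolding s_def mem_Collect_eq by linarith
  qed (use cst_nonneg[OF assms(1)] in auto)
qed

lemma mon_back_forth:
  assumes "i < n" "j < n" "i \<noteq> j"
  shows "expectation (mon [(i, j), (j, i)]) = v"
proof -
  have "expectation (mon [(i, j), (j, i)]) = expectation (\<lambda>\<omega>. complex_of_real ((cmod (Y i j \<omega>))\<^sup>2))"
  proof (rule Bochner_Integration.integral_cong[OF refl])
    fix \<omega> assume "\<omega> \<in> space M"
    from herm[OF assms(1,2) this] show "mon [(i, j), (j, i)] \<omega> = complex_of_real ((cmod (Y i j \<omega>))\<^sup>2)"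
      by (simp add: complex_mult_cnj cmod_def)
  qed
  also have "\<dots> = complex_of_real (expectation (\<lambda>\<omega>. (cmod (Y i j \<omega>))\<^sup>2))"
    by (rule integral_complex_of_real)
  also have "expectation (\<lambda>\<omega>. (cmod (Y i j \<omega>))\<^sup>2) = v"
  proof (cases "i < j")
    case False
    then have "j < i" using assms by simp
    moreover have "expectation (\<lambda>\<omega>. (cmod (Y i j \<omega>))\<^sup>2) = expectation (\<lambda>\<omega>. (cmod (Y j i \<omega>))\<^sup>2)"
      by (rule Bochner_Integration.integral_cong[OF refl]) (simp add: norm_Y_swap[OF assms(1,2)])
    ultimately show ?thesis using var assms by simp
  qed (use var assms in simp)
  finally show ?thesis .
qed

lemma expectation_mon_glue:
  assumes p: "p \<in> cwalks n a \<times> cwalks n b" and good: "good_pair p"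
  shows "expectation (mon (csteps (glue p))) = v * expectation (mon (psteps p))"
proof -
  let ?i = "fst (snd p)" and ?j = "fst (fst p)"
  have lt: "?i < n" "?j < n" using p by (auto simp: cwalks_def)
  have ne: "?i \<noteq> ?j" and av: "uedge (?i, ?j) \<notin> uedge ` set (psteps p)"
    using good by (auto simp: good_pair_def case_prod_beta)
  have "mset (csteps (glue p)) = mset ([(?i, ?j), (?j, ?i)] @ psteps p)"
    unfolding csteps_glue[OF p] by simp
  from mon_perm[OF this] have "expectation (mon (csteps (glue p))) = expectation (mon ([(?i, ?j), (?j, ?i)] @ psteps p))"
    by (rule arg_cong)
  also have "\<dots> = expectation (mon [(?i, ?j), (?j, ?i)]) * expectation (mon (psteps p))"
  proof (rule expectation_mon_append)
    show "uedge ` set [(?i, ?j), (?j, ?i)] \<inter> uedge ` set (psteps p) = {}"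
      using av uedge_swap[of ?i ?j] by simp
  qed (use lt in_range_psteps[OF p] in auto)
  also have "expectation (mon [(?i, ?j), (?j, ?i)]) = v" by (rule mon_back_forth[OF lt ne])
  finally show ?thesis .
qed

text \<open>Gluing turns good pairs into closed walks of length \<open>k + 2\<close> and multiplies
  the expectation by \<open>v\<close>. The rest consists of closed walks that are not glued and of
  pairs that are not good. Where their expectation is nonzero they have at most
  \<open>(k + 3) / 2\<close> vertices, half a vertex below the leading order.\<close>

lemma tr_pow_recursion:
  assumes n: "0 < n"
  defines "s \<equiv> \<lambda>k. (k + 3) div 2"
  shows "cmod (expectation (tr_pow (k + 2)) - v * (\<Sum>a\<le>k. expectation (\<lambda>\<omega>. tr_pow a \<omega> * tr_pow (k - a) \<omega>)))
     \<le> cst (k + 2) * real (s k ^ (k + 3) * n ^ s k) + real (k + 1) * (\<bar>v\<bar> * (cst k * real (s k ^ (k + 2) * n ^ s k)))"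
proof -
  define W where "W a = cwalks n a \<times> cwalks n (k - a)" for a
  define G where "G a = {p \<in> W a. good_pair p}" for a
  define H where "H a = {p \<in> W a. \<not> good_pair p}" for a
  have fin [simp]: "finite (W a)" "finite (G a)" "finite (H a)" for a
    by (auto simp: W_def G_def H_def)
  let ?E = "\<lambda>es. expectation (mon es)"
  have sub: "glue ` G a \<subseteq> cwalks n (k + 2)" if "a \<le> k" for a
  proof (rule image_subsetI)
    fix p assume "p \<in> G a"
    then have "p \<in> cwalks n a \<times> cwalks n (k - a)" by (simp add: G_def W_def)
    from glue_cwalks[OF this] that show "glue p \<in> cwalks n (k + 2)" by simp
  qed
  have inj: "p = q" if "p \<in> G a" "q \<in> G b" "glue p = glue q" for p q a b
    by (rule inj_glue[OF _ _ _ _ that(3)]) (use that(1,2) in \<open>auto simp: G_def W_def\<close>)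
  \<comment> \<open>By injectivity a common image comes from one pair, and the length of its first
    walk is both \<open>a\<close> and \<open>b\<close>.\<close>
  have disj: "glue ` G a \<inter> glue ` G b = {}" if "a \<noteq> b" for a b
  proof (rule ccontr)
    assume "glue ` G a \<inter> glue ` G b \<noteq> {}"
    then obtain p q where pq: "p \<in> G a" "q \<in> G b" "glue p = glue q" by blast
    from inj[OF pq] pq have "fst p \<in> cwalks n a" "fst p \<in> cwalks n b" by (auto simp: G_def W_def)
    with that show False by (cases "fst p") (auto simp: cwalks_iff)
  qed
  let ?U = "\<Union>a\<le>k. glue ` G a"
  have U: "?U \<subseteq> cwalks n (k + 2)" using sub by blast
  have sumU: "(\<Sum>c\<in>?U. ?E (csteps c)) = (\<Sum>a\<le>k. \<Sum>p\<in>G a. v * ?E (psteps p))"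
  proof -
    have "(\<Sum>c\<in>?U. ?E (csteps c)) = (\<Sum>a\<le>k. \<Sum>c\<in>glue ` G a. ?E (csteps c))"
      by (rule sum.UNION_disjoint) (use disj in auto)
    also have "\<dots> = (\<Sum>a\<le>k. \<Sum>p\<in>G a. ?E (csteps (glue p)))"
      by (intro sum.cong refl sum.reindex_cong[of glue]) (use inj in \<open>auto simp: inj_on_def\<close>)
    also have "\<dots> = (\<Sum>a\<le>k. \<Sum>p\<in>G a. v * ?E (psteps p))"
      by (intro sum.cong refl expectation_mon_glue) (auto simp: G_def W_def)
    finally show ?thesis .
  qed
  have split: "(\<Sum>p\<in>W a. ?E (psteps p)) = (\<Sum>p\<in>G a. ?E (psteps p)) + (\<Sum>p\<in>H a. ?E (psteps p))" for a
  proof -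
    have W: "W a = G a \<union> H a" and d: "G a \<inter> H a = {}" by (auto simp: G_def H_def)
    show ?thesis unfolding W by (rule sum.union_disjoint[OF fin(2,3) d])
  qed
  have E: "expectation (tr_pow (k + 2)) = (\<Sum>c\<in>cwalks n (k + 2) - ?U. ?E (csteps c)) + (\<Sum>c\<in>?U. ?E (csteps c))"
    using sum.subset_diff[OF U finite_cwalks, of "\<lambda>c. ?E (csteps c)"] unfolding expectation_tr_pow .
  have "expectation (tr_pow (k + 2)) - v * (\<Sum>a\<le>k. expectation (\<lambda>\<omega>. tr_pow a \<omega> * tr_pow (k - a) \<omega>))
     = (\<Sum>c\<in>cwalks n (k + 2) - ?U. ?E (csteps c)) - (\<Sum>a\<le>k. v * (\<Sum>p\<in>H a. ?E (psteps p)))"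
    unfolding E sumU expectation_tr_pow_mult W_def[symmetric] split
    by (simp add: sum_distrib_left sum.distrib algebra_simps)
  also have "cmod \<dots> \<le> cmod (\<Sum>c\<in>cwalks n (k + 2) - ?U. ?E (csteps c)) + cmod (\<Sum>a\<le>k. v * (\<Sum>p\<in>H a. ?E (psteps p)))"
    by (rule norm_triangle_ineq4)
  also have "cmod (\<Sum>c\<in>cwalks n (k + 2) - ?U. ?E (csteps c)) \<le> cst (k + 2) * real (s k ^ (k + 3) * n ^ s k)"
  proof (rule norm_sum_le_card)
    let ?P = "{c. card (set (cverts c)) \<le> s k}"
    have "card {c \<in> cwalks n (k + 2) - ?U. c \<in> ?P} \<le> card {c \<in> cwalks n (k + 2). card (set (cverts c)) \<le> s k}"
      by (rule card_mono) auto
    also have "\<dots> \<le> s k ^ (k + 3) * n ^ s k"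
      using card_cwalks_few_le[OF n, of "k + 2" "s k"] by (simp add: numeral_3_eq_3)
    finally show "card {c \<in> cwalks n (k + 2) - ?U. c \<in> ?P} \<le> s k ^ (k + 3) * n ^ s k" .
    fix c assume c': "c \<in> cwalks n (k + 2) - ?U"
    then have c: "c \<in> cwalks n (k + 2)" by blast
    show "cmod (?E (csteps c)) \<le> cst (k + 2)"
      using norm_mon_le[OF in_range_csteps[OF c]] length_csteps[OF c] by simp
    assume "?E (csteps c) \<noteq> 0"
    then have tw: "edges_twice (csteps c)" using expectation_mon_eq_0[OF in_range_csteps[OF c]] by blast
    have "\<not> (\<exists>a\<le>k. \<exists>p\<in>cwalks n a \<times> cwalks n (k - a). good_pair p \<and> glue p = c)"
    proof
      assume "\<exists>a\<le>k. \<exists>p\<in>cwalks n a \<times> cwalks n (k - a). good_pair p \<and> glue p = c"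
      then obtain a p where "a \<le> k" "p \<in> G a" "c = glue p" unfolding G_def W_def by blast
      with c' show False by blast
    qed
    with cwalk_first_return[OF c tw] have "2 * card (set (cverts c)) \<le> k + 3" by blast
    then show "c \<in> ?P" unfolding s_def mem_Collect_eq by linarith
  qed (use cst_nonneg[OF n] in auto)
  also have "cmod (\<Sum>a\<le>k. v * (\<Sum>p\<in>H a. ?E (psteps p))) \<le> (\<Sum>a\<le>k. \<bar>v\<bar> * (cst k * real (s k ^ (k + 2) * n ^ s k)))"
  proof (rule sum_norm_le)
    fix a assume "a \<in> {..k}"
    then have a: "a + (k - a) = k" by simp
    have "cmod (\<Sum>p\<in>H a. ?E (psteps p)) \<le> cst k * real (s k ^ (k + 2) * n ^ s k)"
    proof (rule norm_sum_le_card)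
      let ?P = "{p. card (set (cverts (fst p) @ cverts (snd p))) \<le> s k}"
      have "card {p \<in> H a. p \<in> ?P} \<le> card {p \<in> W a. card (set (cverts (fst p) @ cverts (snd p))) \<le> s k}"
        by (rule card_mono) (auto simp: H_def)
      also have "\<dots> \<le> s k ^ (k + 2) * n ^ s k"
        using card_cwalk_pairs_few_le[OF n, of a "k - a" "s k"] unfolding a W_def .
      finally show "card {p \<in> H a. p \<in> ?P} \<le> s k ^ (k + 2) * n ^ s k" .
      fix p assume "p \<in> H a"
      then have p: "p \<in> cwalks n a \<times> cwalks n (k - a)" and bad: "\<not> good_pair p" by (auto simp: H_def W_def)
      then have p1: "fst p \<in> cwalks n a" and p2: "snd p \<in> cwalks n (k - a)" by auto
      show "cmod (?E (psteps p)) \<le> cst k"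
        using norm_mon_le[OF in_range_psteps[OF p]] length_psteps[OF p] a by simp
      assume "?E (psteps p) \<noteq> 0"
      then have tw: "edges_twice (psteps p)" using expectation_mon_eq_0[OF in_range_psteps[OF p]] by blast
      let ?i = "fst (snd p)" and ?j = "fst (fst p)"
      have ends: "?j \<in> set (cverts (fst p))" "?i \<in> set (cverts (snd p))" by (auto simp: cverts_def)
      \<comment> \<open>A pair that is not good shares a vertex: the base points coincide, or one
        walk uses the joining edge and so meets the base point of the other.\<close>
      have "?i = ?j \<or> uedge (?i, ?j) \<in> uedge ` set (psteps p)"
        using bad by (auto simp: good_pair_def case_prod_beta)
      then have "\<exists>x. x \<in> set (cverts (fst p)) \<and> x \<in> set (cverts (snd p))"
      proof
        assume "?i = ?j"
        with ends show ?thesis by metis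
      next
        assume "uedge (?i, ?j) \<in> uedge ` set (psteps p)"
        then obtain e where e': "uedge (?i, ?j) = uedge e" "e \<in> set (psteps p)" by (rule imageE)
        then have e: "e \<in> set (csteps (fst p)) \<or> e \<in> set (csteps (snd p))" "uedge e = uedge (?i, ?j)" by simp_all
        then have fe: "fst e = ?i \<and> snd e = ?j \<or> fst e = ?j \<and> snd e = ?i"
          using uedge_eq_iff[of "fst e" "snd e" ?i ?j] by auto
        from e(1) show ?thesis
        proof
          assume "e \<in> set (csteps (fst p))"
          then have "?i \<in> set (cverts (fst p))"
            using vertex_of_step[of e ?j "snd (fst p)"] fe unfolding csteps_def cverts_def by auto
          with ends show ?thesis by blast
        next
          assume "e \<in> set (csteps (snd p))"
          then have "?j \<in> set (cverts (snd p))"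
            using vertex_of_step[of e ?i "snd (snd p)"] fe unfolding csteps_def cverts_def by auto
          with ends show ?thesis by blast
        qed
      qed
      then obtain x where "x \<in> set (cverts (fst p))" "x \<in> set (cverts (snd p))" by blast
      from card_cverts_pair_le[OF p1 p2 tw this] a show "p \<in> ?P"
        unfolding s_def mem_Collect_eq by linarith
    qed (use cst_nonneg[OF n] in auto)
    then show "cmod (v * (\<Sum>p\<in>H a. ?E (psteps p))) \<le> \<bar>v\<bar> * (cst k * real (s k ^ (k + 2) * n ^ s k))"
      unfolding norm_mult norm_of_real by (rule mult_left_mono) simp
  qed
  finally show ?thesis by simp
qed

end

section \<open>Convergence to the semicircle moments\<close>

definition trace_pow :: "nat \<Rightarrow> (nat \<Rightarrow> nat \<Rightarrow> 'b) \<Rightarrow> nat \<Rightarrow> 'b::comm_semiring_1" where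
  "trace_pow n A k = (\<Sum>c\<in>cwalks n k. walk_prod A (csteps c))"

lemma mat_trace_pow:
  assumes A: "A \<in> carrier_mat n n"
  shows "mat_trace (A ^\<^sub>m k) = trace_pow n (\<lambda>i j. A $$ (i, j)) k"
proof -
  have "mat_trace (A ^\<^sub>m k) = (\<Sum>i<n. \<Sum>w\<in>walks n k i i. walk_prod (\<lambda>a b. A $$ (a, b)) (steps i w))"
    unfolding mat_trace_def using A by (auto intro!: sum.cong pow_mat_walks)
  also have "\<dots> = trace_pow n (\<lambda>i j. A $$ (i, j)) k"
    unfolding trace_pow_def cwalks_def by (subst sum.Sigma) (auto simp: csteps_def intro!: sum.cong)
  finally show ?thesis .
qed

text \<open>The moments of the semicircle law on \<open>[-2, 2]\<close>.\<close>

definition semicircle_moment :: "nat \<Rightarrow> real" where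
  "semicircle_moment k = (if even k then catalan (k div 2) else 0)"

lemma catalan_step: "(real i + 2) * catalan (Suc i) = (4 * real i + 2) * catalan i"
proof -
  have c: "real ((2 * k) choose k) = fact (2 * k) / (fact k * fact k)" for k
    by (subst binomial_fact) (auto simp: mult_2)
  have "(fact (2 * Suc i) :: real) = (2 * real i + 2) * ((2 * real i + 1) * fact (2 * i))"
    by (simp add: algebra_simps)
  then show ?thesis unfolding catalan_def c
    by (simp add: divide_simps del: fact_Suc) (simp add: fact_Suc[of i] algebra_simps)
qed

lemma semicircle_moment_recursion:
  "semicircle_moment (k + 2) = (\<Sum>a\<le>k. semicircle_moment a * semicircle_moment (k - a))"
proof (cases "even k")
  case False
  have "semicircle_moment a * semicircle_moment (k - a) = 0" if "a \<le> k" for a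
    using False that by (auto simp: semicircle_moment_def)
  then show ?thesis using False by (simp add: semicircle_moment_def)
next
  case True
  then obtain m where m: "k = 2 * m" by (rule evenE)
  have "(\<Sum>a\<le>k. semicircle_moment a * semicircle_moment (k - a))
      = (\<Sum>a\<in>(\<lambda>i. 2 * i) ` {..m}. semicircle_moment a * semicircle_moment (k - a))"
    by (rule sum.mono_neutral_right) (auto simp: m semicircle_moment_def elim!: evenE)
  also have "\<dots> = (\<Sum>i\<le>m. semicircle_moment (2 * i) * semicircle_moment (k - 2 * i))"
    by (subst sum.reindex) (auto simp: inj_on_def)
  also have "\<dots> = (\<Sum>i\<le>m. catalan i * catalan (m - i))"
    by (intro sum.cong refl) (auto simp: m semicircle_moment_def simp flip: diff_mult_distrib2)
  also have "\<dots> = catalan (Suc m)"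
    by (rule catalan_Suc[OF _ catalan_step]) (simp add: catalan_def)
  finally show ?thesis by (simp add: m semicircle_moment_def)
qed

lemma (in wigner_array) tr_pow_eq: "tr_pow k = (\<lambda>\<omega>. trace_pow n (\<lambda>i j. Y i j \<omega>) k)"
  unfolding tr_pow_def[abs_def] trace_pow_def mon_def ..

lemma (in wigner_array) cst_eq: "cst k = 1 + real k * B k"
  by (rule cst_def)

lemma trace_pow_0: "trace_pow n A 0 = of_nat n"
proof -
  have "cwalks n 0 = (\<lambda>i. (i, [])) ` {..<n}" by (auto simp: cwalks_def walks_def)
  then show ?thesis
    unfolding trace_pow_def by (simp add: sum.reindex inj_on_def csteps_def)
qed

lemma powr_scale:
  assumes "0 < n" "2 * s \<le> m"
  shows "real n ^ s \<le> real n powr (real m / 2)"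
proof -
  have "real n ^ s = real n powr real s" using assms(1) by (simp add: powr_realpow)
  also have "\<dots> \<le> real n powr (real m / 2)" using assms by (intro powr_mono) auto
  finally show ?thesis .
qed

lemma tendsto_0_powr_bound:
  fixes f :: "nat \<Rightarrow> complex"
  assumes bound: "\<forall>\<^sub>F n in sequentially. cmod (f n) \<le> C n * real n powr - c" and "0 < c"
    and C: "\<And>n. C n \<le> K"
  shows "f \<longlonglongrightarrow> 0"
proof (rule tendsto_0_le[where K = 1])
  show "(\<lambda>n. K * real n powr - c) \<longlonglongrightarrow> 0"
    using \<open>0 < c\<close> by (intro tendsto_mult_right_zero tendsto_neg_powr filterlim_real_sequentially) auto
  show "\<forall>\<^sub>F n in sequentially. cmod (f n) \<le> norm (K * real n powr - c) * 1"
    using bound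
  proof eventually_elim
    case (elim n)
    have "C n * real n powr - c \<le> K * real n powr - c" by (intro mult_right_mono C) simp
    with elim show ?case by (simp add: abs_le_iff)
  qed
qed

text \<open>The constants must not depend on the size, hence \<open>B\<close> is shared by all arrays.\<close>

locale wigner_sequence =
  fixes M :: "nat \<Rightarrow> 'a measure" and Y :: "nat \<Rightarrow> nat \<Rightarrow> nat \<Rightarrow> 'a \<Rightarrow> complex"
    and v :: "nat \<Rightarrow> real" and B :: "nat \<Rightarrow> real"
  assumes arrays: "\<forall>\<^sub>F n in sequentially. wigner_array (M n) n (Y n) (v n) B"
    and v: "v \<longlonglongrightarrow> 1"
begin

definition trY :: "nat \<Rightarrow> nat \<Rightarrow> 'a \<Rightarrow> complex" where
  "trY n k \<omega> = trace_pow n (\<lambda>i j. Y n i j \<omega>) k"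

abbreviation scale :: "nat \<Rightarrow> nat \<Rightarrow> real" where
  "scale k n \<equiv> real n powr (1 + real k / 2)"

definition e :: "nat \<Rightarrow> nat \<Rightarrow> complex" where
  "e k n = (LINT \<omega>|M n. trY n k \<omega>)"

definition q :: "nat \<Rightarrow> nat \<Rightarrow> nat \<Rightarrow> complex" where
  "q a b n = (LINT \<omega>|M n. trY n a \<omega> * trY n b \<omega>)"

lemma covariance_tendsto:
  "(\<lambda>n. (q a b n - e a n * e b n) / (scale a n * scale b n)) \<longlonglongrightarrow> 0"
proof (rule tendsto_0_powr_bound[where c = 1])
  let ?s = "(a + b + 2) div 2"
  let ?C = "(1 + real (a + b) * B (a + b) + (1 + real a * B a) * (1 + real b * B b)) * real ?s ^ (a + b + 2)"
  show "\<forall>\<^sub>F n in sequentially. cmod ((q a b n - e a n * e b n) / (scale a n * scale b n)) \<le> ?C * real n powr - 1"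
    using arrays eventually_gt_at_top[of 0]
  proof eventually_elim
    case (elim n)
    interpret wigner_array "M n" n "Y n" "v n" B by (rule elim)
    have "cmod (q a b n - e a n * e b n) \<le> ?C * real n ^ ?s"
      using covariance_tr_pow_le[OF elim(2), of a b]
      unfolding tr_pow_eq q_def e_def trY_def cst_eq by (simp add: algebra_simps)
    also have "\<dots> \<le> ?C * real n powr (real (a + b + 2) / 2)"
      using cst_nonneg[OF elim(2), of "a + b"] cst_nonneg[OF elim(2), of a] cst_nonneg[OF elim(2), of b] elim(2)
      unfolding cst_eq by (intro mult_left_mono powr_scale) auto
    also have "real n powr (real (a + b + 2) / 2) = real n powr - 1 * (scale a n * scale b n)"
      unfolding powr_add[symmetric] by (simp add: add_divide_distrib)
    finally have "cmod (q a b n - e a n * e b n) \<le> ?C * real n powr - 1 * (scale a n * scale b n)"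
      by (simp only: mult.assoc)
    then show ?case using elim(2) by (simp add: norm_divide norm_mult field_simps)
  qed
qed auto

text \<open>Strong induction. By the recursion \<open>e (m + 2) n\<close> is, up to the factor
  \<open>v n\<close> tending to 1 and a negligible error, the sum of the second moments
  \<open>q a (m - a) n\<close>. These factor asymptotically by the covariance bound, and the limits
  obey the Catalan recursion.\<close>

lemma moment_tendsto: "(\<lambda>n. e k n / scale k n) \<longlonglongrightarrow> complex_of_real (semicircle_moment k)"
proof (induction k rule: less_induct)
  case (less k)
  consider "k = 0" | "k = 1" | m where "k = m + 2"
    by (metis One_nat_def Suc_1 add.commute add_Suc_right not0_implies_Suc plus_1_eq_Suc)
  then show ?case
  proof cases
    case 1
    have "\<forall>\<^sub>F n in sequentially. e k n / scale k n = 1"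
      using arrays eventually_gt_at_top[of 0]
    proof eventually_elim
      case (elim n)
      interpret wigner_array "M n" n "Y n" "v n" B by (rule elim)
      show ?case using elim(2) 1 prob_space by (simp add: e_def trY_def trace_pow_0)
    qed
    then show ?thesis using 1
      by (simp add: semicircle_moment_def catalan_def tendsto_eventually)
  next
    case 2
    \<comment> \<open>The trace itself is a sum of \<open>n\<close> diagonal entries with bounded
      means, against the scale \<open>n^(3/2)\<close>.\<close>
    have "(\<lambda>n. e k n / scale k n) \<longlonglongrightarrow> 0"
    proof (rule tendsto_0_powr_bound[where c = "1 / 2"])
      show "\<forall>\<^sub>F n in sequentially. cmod (e k n / scale k n) \<le> (1 + B 1) * real n powr - (1 / 2)"
        using arrays eventually_gt_at_top[of 0]
      proof eventually_elim
        case (elim n)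
        interpret wigner_array "M n" n "Y n" "v n" B by (rule elim)
        have "cmod (e k n) \<le> (1 + B 1) * real n"
          using tr_pow_moment_le[OF elim(2), of 1] 2
          unfolding tr_pow_eq e_def trY_def cst_eq by simp
        moreover have "real n = real n powr - (1 / 2) * scale k n"
          unfolding powr_add[symmetric] using 2 elim(2) by simp
        ultimately have "cmod (e k n) \<le> (1 + B 1) * real n powr - (1 / 2) * scale k n"
          by (metis mult.assoc)
        then show ?case using elim(2) by (simp add: norm_divide field_simps)
      qed
    qed auto
    with 2 show ?thesis by (simp add: semicircle_moment_def)
  next
    case (3 m)
    let ?s = "(m + 3) div 2"
    obtain V where V: "\<And>n. \<bar>v n\<bar> \<le> V"
      using convergent_imp_Bseq[OF convergentI[OF v]] unfolding Bseq_def by auto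
    have V0: "0 \<le> V" using V[of 0] by linarith
    have sc: "scale a n * scale (m - a) n = scale k n" if "a \<le> m" for a n
      unfolding powr_add[symmetric] using that 3 by (simp add: of_nat_diff add_divide_distrib diff_divide_distrib)
    have q: "(\<lambda>n. q a (m - a) n / scale k n) \<longlonglongrightarrow> complex_of_real (semicircle_moment a * semicircle_moment (m - a))"
      if a: "a \<le> m" for a
    proof -
      have "(\<lambda>n. (q a (m - a) n - e a n * e (m - a) n) / (scale a n * scale (m - a) n)
          + (e a n / scale a n) * (e (m - a) n / scale (m - a) n))
        \<longlonglongrightarrow> 0 + complex_of_real (semicircle_moment a) * complex_of_real (semicircle_moment (m - a))"
        using a 3 by (intro tendsto_add covariance_tendsto tendsto_mult less) auto
      moreover have "(q a (m - a) n - e a n * e (m - a) n) / (scale a n * scale (m - a) n)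
          + (e a n / scale a n) * (e (m - a) n / scale (m - a) n) = q a (m - a) n / scale k n" for n
        unfolding sc[OF a, symmetric] by (simp add: diff_divide_distrib)
      ultimately show ?thesis by simp
    qed
    let ?D = "\<lambda>n. (e k n - v n * (\<Sum>a\<le>m. q a (m - a) n)) / scale k n"
    let ?C1 = "(1 + real k * B k) * real ?s ^ (m + 3)" and ?C2 = "real (m + 1) * ((1 + real m * B m) * real ?s ^ (m + 2))"
    have "?D \<longlonglongrightarrow> 0"
    proof (rule tendsto_0_powr_bound[where c = "1 / 2"])
      show "\<forall>\<^sub>F n in sequentially. cmod (?D n) \<le> (?C1 + V * \<bar>?C2\<bar>) * real n powr - (1 / 2)"
        using arrays eventually_gt_at_top[of 0]
      proof eventually_elim
        case (elim n)
        interpret wigner_array "M n" n "Y n" "v n" B by (rule elim)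
        have c0: "0 \<le> 1 + real k * B k" "0 \<le> 1 + real m * B m"
          using cst_nonneg[OF elim(2)] unfolding cst_eq by auto
        have "cmod (e k n - v n * (\<Sum>a\<le>m. q a (m - a) n)) \<le> (?C1 + \<bar>v n\<bar> * ?C2) * real n ^ ?s"
          using tr_pow_recursion[OF elim(2), of m]
          unfolding tr_pow_eq q_def e_def trY_def cst_eq 3 by (simp add: algebra_simps)
        also have "\<dots> \<le> (?C1 + V * \<bar>?C2\<bar>) * real n ^ ?s"
        proof -
          have "0 \<le> ?C2" using c0(2) by simp
          then have "\<bar>v n\<bar> * ?C2 \<le> V * \<bar>?C2\<bar>"
            by (intro mult_mono V V0 abs_ge_self)
          then show ?thesis by (intro mult_right_mono add_left_mono) auto
        qed
        also have "\<dots> \<le> (?C1 + V * \<bar>?C2\<bar>) * real n powr (real (m + 3) / 2)"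
          using c0 V0 elim(2) by (intro mult_left_mono powr_scale) auto
        also have "real n powr (real (m + 3) / 2) = real n powr - (1 / 2) * scale k n"
          unfolding powr_add[symmetric] using 3 by (simp add: add_divide_distrib add.commute)
        finally have "cmod (e k n - v n * (\<Sum>a\<le>m. q a (m - a) n)) \<le> (?C1 + V * \<bar>?C2\<bar>) * real n powr - (1 / 2) * scale k n"
          by (simp only: mult.assoc)
        then show ?case using elim(2) by (simp add: norm_divide pos_divide_le_eq)
      qed
    qed auto
    then have "(\<lambda>n. ?D n + v n * (\<Sum>a\<le>m. q a (m - a) n / scale k n)) \<longlonglongrightarrow>
        0 + complex_of_real 1 * (\<Sum>a\<le>m. complex_of_real (semicircle_moment a * semicircle_moment (m - a)))"
      by (intro tendsto_add tendsto_mult tendsto_of_real v tendsto_sum q) auto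
    moreover have "?D n + v n * (\<Sum>a\<le>m. q a (m - a) n / scale k n) = e k n / scale k n" for n
      by (simp add: sum_divide_distrib[symmetric] diff_divide_distrib)
    ultimately show ?thesis
      unfolding 3 semicircle_moment_recursion by simp
  qed
qed

text \<open>For \<open>a = b\<close> this says that the normalized trace has vanishing variance,
  which is what Chebyshev's inequality needs under the tilted laws.\<close>

lemma second_moment_tendsto:
  "(\<lambda>n. q a b n / (scale a n * scale b n)) \<longlonglongrightarrow> complex_of_real (semicircle_moment a * semicircle_moment b)"
proof -
  have "(\<lambda>n. (q a b n - e a n * e b n) / (scale a n * scale b n) + (e a n / scale a n) * (e b n / scale b n))
    \<longlonglongrightarrow> 0 + complex_of_real (semicircle_moment a) * complex_of_real (semicircle_moment b)"
    by (intro tendsto_add covariance_tendsto tendsto_mult moment_tendsto)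
  then show ?thesis by (simp add: diff_divide_distrib)
qed

end

section \<open>Spectral decompositions and spectral functions\<close>

lemma mat_trace_comm:
  assumes "A \<in> carrier_mat n n" "B \<in> carrier_mat n n"
  shows "mat_trace (A * B) = mat_trace (B * A)"
proof -
  have "mat_trace (A * B) = (\<Sum>i<n. \<Sum>j<n. A $$ (i, j) * B $$ (j, i))"
    using assms by (simp add: mat_trace_def scalar_prod_def atLeast0LessThan)
  also have "\<dots> = (\<Sum>j<n. \<Sum>i<n. B $$ (j, i) * A $$ (i, j))"
    by (subst sum.swap) (simp add: mult.commute)
  also have "\<dots> = mat_trace (B * A)"
    using assms by (simp add: mat_trace_def scalar_prod_def atLeast0LessThan)
  finally show ?thesis .
qed

text \<open>By Schur triangularization the trace is the sum of the roots of the characteristic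
  polynomial, so they cannot all be 0.\<close>

lemma eigenvalue_of_trace_nonzero:
  fixes A :: "complex mat"
  assumes A: "A \<in> carrier_mat n n" and "mat_trace A \<noteq> 0"
  shows "\<exists>\<mu>. eigenvalue A \<mu> \<and> \<mu> \<noteq> 0"
proof -
  obtain as where as: "char_poly A = (\<Prod>a\<leftarrow>as. [:- a, 1:])" using char_poly_factorized[OF A] by blast
  obtain B P Q where d: "schur_decomposition A as = (B, P, Q)" by (cases "schur_decomposition A as")
  from schur_decomposition[OF A as d] have sim: "similar_mat_wit A B P Q" and B: "diag_mat B = as" by auto
  note w = similar_mat_witD2[OF A sim]
  have "mat_trace A = mat_trace (P * (B * Q))" using w by (simp add: assoc_mult_mat[of _ n n _ n _ n])
  also have "\<dots> = mat_trace ((B * Q) * P)" using w by (intro mat_trace_comm[of _ n]) auto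
  also have "\<dots> = mat_trace B" using w by (simp add: assoc_mult_mat[of _ n n _ n _ n])
  also have "\<dots> = sum_list as"
    unfolding B[symmetric] mat_trace_def diag_mat_def by (simp add: sum_list_sum_nth atLeast0LessThan)
  finally have "sum_list as \<noteq> 0" using assms(2) by simp
  then obtain \<mu> where mu: "\<mu> \<in> set as" "\<mu> \<noteq> 0" by (metis sum_list_neutral)
  have "poly (char_poly A) \<mu> = 0"
    unfolding as poly_prod_list using mu(1) by (auto simp: prod_list_zero_iff image_iff)
  then have "eigenvalue A \<mu>" by (simp add: eigenvalue_root_char_poly[OF A])
  with mu(2) show ?thesis by blast
qed

text \<open>Vectors are functions of which only the first \<open>n\<close> values count. The form is
  conjugate-linear in its first argument.\<close>

definition ip :: "nat \<Rightarrow> (nat \<Rightarrow> complex) \<Rightarrow> (nat \<Rightarrow> complex) \<Rightarrow> complex" where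
  "ip n x y = (\<Sum>k<n. cnj (x k) * y k)"

lemma ip_add_right: "ip n x (\<lambda>k. y k + z k) = ip n x y + ip n x z"
  by (simp add: ip_def sum.distrib algebra_simps)

lemma ip_diff_right: "ip n x (\<lambda>k. y k - z k) = ip n x y - ip n x z"
  by (simp add: ip_def sum_subtractf algebra_simps)

lemma ip_scale_right: "ip n x (\<lambda>k. c * y k) = c * ip n x y"
  by (simp add: ip_def sum_distrib_left algebra_simps)

lemma ip_sum_right: "ip n x (\<lambda>k. \<Sum>i\<in>I. y i k) = (\<Sum>i\<in>I. ip n x (y i))"
  unfolding ip_def by (subst sum.swap) (simp add: sum_distrib_left)

lemma ip_cnj: "cnj (ip n x y) = ip n y x"
  by (simp add: ip_def mult.commute)

lemma ip_self: "ip n x x = complex_of_real (\<Sum>k<n. (cmod (x k))\<^sup>2)"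
  unfolding ip_def of_real_sum by (intro sum.cong refl) (simp add: complex_norm_square mult.commute del: of_real_power)

lemma ip_self_nonneg: "0 \<le> Re (ip n x x)"
  unfolding ip_self by (simp add: sum_nonneg)

lemma ip_cong: "(\<And>k. k < n \<Longrightarrow> x k = x' k) \<Longrightarrow> (\<And>k. k < n \<Longrightarrow> y k = y' k) \<Longrightarrow> ip n x y = ip n x' y'"
  by (simp add: ip_def)

definition orthonormal :: "nat \<Rightarrow> nat \<Rightarrow> (nat \<Rightarrow> nat \<Rightarrow> complex) \<Rightarrow> bool" where
  "orthonormal n m u \<longleftrightarrow> (\<forall>i<m. \<forall>j<m. ip n (u i) (u j) = (if i = j then 1 else 0))"

text \<open>Nonnegativity of the squared norm of \<open>x - y\<close>, where \<open>y\<close> is the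
  projection of \<open>x\<close> onto the span of the family.\<close>

lemma bessel:
  assumes u: "orthonormal n m u"
  shows "(\<Sum>i<m. (cmod (ip n (u i) x))\<^sup>2) \<le> (\<Sum>k<n. (cmod (x k))\<^sup>2)"
proof -
  define c where "c i = ip n (u i) x" for i
  define y where "y k = (\<Sum>i<m. c i * u i k)" for k
  have uy: "ip n (u i) y = c i" if "i < m" for i
  proof -
    have "ip n (u i) y = (\<Sum>j<m. c j * ip n (u i) (u j))"
      unfolding y_def[abs_def] by (simp only: ip_sum_right ip_scale_right)
    also have "\<dots> = (\<Sum>j<m. if i = j then c j else 0)"
      using u that by (intro sum.cong refl) (simp add: orthonormal_def)
    also have "\<dots> = c i" using that by simp
    finally show ?thesis .
  qed
  have yx: "ip n z y = (\<Sum>i<m. c i * cnj (ip n (u i) z))" for z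
    unfolding y_def[abs_def] by (simp only: ip_sum_right ip_scale_right ip_cnj)
  have S: "ip n z y = complex_of_real (\<Sum>i<m. (cmod (c i))\<^sup>2)" if "\<And>i. i < m \<Longrightarrow> ip n (u i) z = c i" for z
    unfolding yx of_real_sum
    by (intro sum.cong refl) (simp add: that complex_norm_square del: of_real_power)
  have xy: "ip n x y = complex_of_real (\<Sum>i<m. (cmod (c i))\<^sup>2)" by (rule S) (simp add: c_def)
  have yy: "ip n y y = complex_of_real (\<Sum>i<m. (cmod (c i))\<^sup>2)" by (rule S) (rule uy)
  let ?z = "\<lambda>k. x k - y k"
  have "ip n ?z ?z = ip n ?z x - ip n ?z y" by (rule ip_diff_right)
  also have "ip n ?z x = cnj (ip n x x - ip n x y)" by (simp only: ip_cnj[of n x ?z, symmetric] ip_diff_right ip_cnj)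
  also have "ip n ?z y = cnj (ip n y x - ip n y y)" by (simp only: ip_cnj[of n y ?z, symmetric] ip_diff_right ip_cnj)
  also have "ip n y x = cnj (ip n x y)" by (simp only: ip_cnj)
  finally have "Re (ip n ?z ?z) = Re (ip n x x) - (\<Sum>i<m. (cmod (c i))\<^sup>2)" by (simp add: xy yy)
  with ip_self_nonneg[of n ?z] show ?thesis unfolding ip_self c_def by simp
qed

lemma orthonormal_norm_le:
  assumes "orthonormal n m u" "i < m" "k < n"
  shows "cmod (u i k) \<le> 1"
proof -
  have "(cmod (u i k))\<^sup>2 \<le> (\<Sum>k<n. (cmod (u i k))\<^sup>2)"
    using assms by (intro member_le_sum) auto
  also have "\<dots> = 1"
  proof -
    have "ip n (u i) (u i) = 1" using assms by (simp add: orthonormal_def)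
    then show ?thesis unfolding ip_self using of_real_eq_1_iff by blast
  qed
  finally show ?thesis using power2_le_imp_le[of "cmod (u i k)" 1] by simp
qed

text \<open>Double counting of all squared moduli: each vector contributes 1, and each coordinate at
  most 1, by Bessel's inequality for a standard basis vector.\<close>

lemma orthonormal_le:
  assumes u: "orthonormal n m u"
  shows "m \<le> n"
proof -
  have unit: "(\<Sum>k<n. (cmod (u i k))\<^sup>2) = 1" if "i < m" for i
  proof -
    have "ip n (u i) (u i) = 1" using assms that by (simp add: orthonormal_def)
    then show ?thesis unfolding ip_self using of_real_eq_1_iff by blast
  qed
  have le1: "(\<Sum>i<m. (cmod (u i k))\<^sup>2) \<le> 1" if "k < n" for k
  proof -
    have "ip n (u i) (\<lambda>l. if l = k then 1 else 0) = cnj (u i k)" for i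
      using that by (simp add: ip_def if_distrib sum.delta cong: if_cong)
    moreover have "(\<Sum>l<n. (cmod (if l = k then 1 else 0))\<^sup>2) = 1"
    proof -
      have "(\<Sum>l<n. (cmod (if l = k then 1 else 0))\<^sup>2) = (\<Sum>l<n. if l = k then 1 else 0)"
        by (intro sum.cong) auto
      then show ?thesis using that by simp
    qed
    ultimately show ?thesis using bessel[OF u, of "\<lambda>l. if l = k then 1 else 0"] by simp
  qed
  have "real m = (\<Sum>i<m. \<Sum>k<n. (cmod (u i k))\<^sup>2)" using unit by simp
  also have "\<dots> = (\<Sum>k<n. \<Sum>i<m. (cmod (u i k))\<^sup>2)" by (rule sum.swap)
  also have "\<dots> \<le> (\<Sum>k<n. 1)" by (intro sum_mono le1) simp
  finally show ?thesis by simp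
qed

definition mv :: "nat \<Rightarrow> (nat \<Rightarrow> nat \<Rightarrow> complex) \<Rightarrow> (nat \<Rightarrow> complex) \<Rightarrow> nat \<Rightarrow> complex" where
  "mv n a x = (\<lambda>k. \<Sum>l<n. a k l * x l)"

lemma mv_cong: "(\<And>l. l < n \<Longrightarrow> x l = y l) \<Longrightarrow> mv n a x k = mv n a y k"
  by (simp add: mv_def)

definition hermitian_fun :: "nat \<Rightarrow> (nat \<Rightarrow> nat \<Rightarrow> complex) \<Rightarrow> bool" where
  "hermitian_fun n a \<longleftrightarrow> (\<forall>k<n. \<forall>l<n. a k l = cnj (a l k))"

lemma hermitian_funD: "hermitian_fun n a \<Longrightarrow> k < n \<Longrightarrow> l < n \<Longrightarrow> cnj (a l k) = a k l"
  unfolding hermitian_fun_def by metis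

lemma ip_mv_left:
  assumes "hermitian_fun n a"
  shows "ip n (mv n a x) y = ip n x (mv n a y)"
proof -
  have "ip n (mv n a x) y = (\<Sum>k<n. \<Sum>l<n. cnj (a k l) * cnj (x l) * y k)"
    by (simp add: ip_def mv_def sum_distrib_right)
  also have "\<dots> = (\<Sum>l<n. \<Sum>k<n. cnj (x l) * (a l k * y k))"
    by (subst sum.swap) (intro sum.cong refl, simp add: hermitian_funD[OF assms])
  also have "\<dots> = ip n x (mv n a y)" by (simp add: ip_def mv_def sum_distrib_left)
  finally show ?thesis .
qed

text \<open>The trace of the square is the squared Hilbert-Schmidt norm, hence positive, and so the
  square has a nonzero eigenvalue. A root of it is, up to sign, an eigenvalue of the matrix.\<close>

lemma nonzero_hermitian_eigenvector:
  assumes a: "hermitian_fun n a" and ne: "k0 < n" "l0 < n" "a k0 l0 \<noteq> 0"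
  shows "\<exists>x \<mu>. \<mu> \<noteq> 0 \<and> ip n x x = 1 \<and> (\<forall>k<n. mv n a x k = complex_of_real \<mu> * x k)"
proof -
  let ?A = "mat n n (\<lambda>(i, j). a i j)"
  have A: "?A \<in> carrier_mat n n" by simp
  have "mat_trace (?A * ?A) = (\<Sum>i<n. \<Sum>j<n. a i j * a j i)"
    by (simp add: mat_trace_def scalar_prod_def atLeast0LessThan)
  also have "\<dots> = (\<Sum>i<n. \<Sum>j<n. complex_of_real ((cmod (a i j))\<^sup>2))"
  proof (intro sum.cong refl)
    fix i j assume "i \<in> {..<n}" "j \<in> {..<n}"
    then have "a j i = cnj (a i j)" by (simp add: hermitian_funD[OF a])
    then show "a i j * a j i = complex_of_real ((cmod (a i j))\<^sup>2)" by (simp only: complex_norm_square)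
  qed
  also have "\<dots> = complex_of_real (\<Sum>i<n. \<Sum>j<n. (cmod (a i j))\<^sup>2)" by simp
  finally have tr: "mat_trace (?A * ?A) = complex_of_real (\<Sum>i<n. \<Sum>j<n. (cmod (a i j))\<^sup>2)" .
  have "0 < (cmod (a k0 l0))\<^sup>2" using ne by simp
  also have "\<dots> \<le> (\<Sum>j<n. (cmod (a k0 j))\<^sup>2)" using ne by (intro member_le_sum) auto
  also have "\<dots> \<le> (\<Sum>i<n. \<Sum>j<n. (cmod (a i j))\<^sup>2)"
    using ne by (intro member_le_sum[of k0 _ "\<lambda>i. \<Sum>j<n. (cmod (a i j))\<^sup>2"]) (auto intro: sum_nonneg)
  finally have "mat_trace (?A * ?A) \<noteq> 0" unfolding tr by (metis of_real_eq_0_iff less_irrefl)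
  from eigenvalue_of_trace_nonzero[OF mult_carrier_mat[OF A A] this]
  obtain \<nu> where nu: "eigenvalue (?A * ?A) \<nu>" "\<nu> \<noteq> 0" by blast
  then obtain w where w: "w \<in> carrier_vec n" "w \<noteq> 0\<^sub>v n" "(?A * ?A) *\<^sub>v w = \<nu> \<cdot>\<^sub>v w"
    unfolding eigenvalue_def eigenvector_def by auto
  define x where "x k = w $ k" for k
  have mvA: "(?A *\<^sub>v y) $ k = mv n a (\<lambda>l. y $ l) k" if "k < n" "y \<in> carrier_vec n" for y k
    using that by (simp add: mv_def scalar_prod_def atLeast0LessThan)
  have aax: "mv n a (mv n a x) k = \<nu> * x k" if k: "k < n" for k
  proof -
    have "mv n a (mv n a x) k = mv n a (\<lambda>l. (?A *\<^sub>v w) $ l) k"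
      by (rule mv_cong) (simp only: mvA[OF _ w(1)] x_def[abs_def])
    also have "\<dots> = (?A *\<^sub>v (?A *\<^sub>v w)) $ k" by (rule mvA[OF k mult_mat_vec_carrier[OF A w(1)], symmetric])
    also have "?A *\<^sub>v (?A *\<^sub>v w) = \<nu> \<cdot>\<^sub>v w" using w(3) unfolding assoc_mult_mat_vec[OF A A w(1)] .
    finally show ?thesis using k w(1) by (simp add: x_def[abs_def])
  qed
  obtain k1 where k1: "k1 < n" "x k1 \<noteq> 0"
  proof -
    have "\<exists>k<n. w $ k \<noteq> 0"
    proof (rule ccontr)
      assume "\<not> (\<exists>k<n. w $ k \<noteq> 0)"
      then have "w = 0\<^sub>v n" using w(1) by (intro eq_vecI) auto
      with w(2) show False ..
    qed
    then show ?thesis using that unfolding x_def by blast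
  qed
  define s where "s = csqrt \<nu>"
  have s: "s * s = \<nu>" "s \<noteq> 0" using nu(2) power2_csqrt[of \<nu>] unfolding s_def power2_eq_square by auto
  \<comment> \<open>Since \<open>(a - s) (a + s) x = 0\<close>, either \<open>(a + s) x\<close> is
    an eigenvector for \<open>s\<close>, or it is zero and \<open>x\<close> is an eigenvector for
    \<open>- s\<close>.\<close>
  obtain y t where y: "t \<noteq> 0" "\<exists>k<n. y k \<noteq> 0" "\<forall>k<n. mv n a y k = t * y k"
  proof (cases "\<exists>k<n. mv n a x k + s * x k \<noteq> 0")
    case True
    define y where "y k = mv n a x k + s * x k" for k
    have "mv n a y k = s * y k" if k: "k < n" for k
    proof -
      have "mv n a y k = mv n a (mv n a x) k + s * mv n a x k"
        unfolding y_def[abs_def] by (simp add: mv_def algebra_simps sum.distrib sum_distrib_left)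
      then show ?thesis unfolding aax[OF k] y_def by (simp add: algebra_simps s(1)[symmetric])
    qed
    with that[of s y] s(2) True show ?thesis unfolding y_def by blast
  next
    case False
    then have "\<forall>k<n. mv n a x k = (- s) * x k" by (simp add: add_eq_0_iff)
    with that[of "- s" x] s(2) k1 show ?thesis by auto
  qed
  define N where "N = (\<Sum>k<n. (cmod (y k))\<^sup>2)"
  have N: "0 < N"
  proof -
    obtain k where "k < n" "y k \<noteq> 0" using y(2) by blast
    then show ?thesis unfolding N_def by (intro sum_pos2[of _ k]) auto
  qed
  have yy: "ip n y y = complex_of_real N" by (simp only: ip_self N_def)
  have "t * ip n y y = ip n y (mv n a y)"
    unfolding ip_scale_right[symmetric] using y(3) by (intro ip_cong) auto
  also have "\<dots> = cnj (ip n y (mv n a y))" using ip_mv_left[OF a, of y y] ip_cnj[of n y "mv n a y"] by simp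
  also have "ip n y (mv n a y) = t * ip n y y"
    unfolding ip_scale_right[symmetric] using y(3) by (intro ip_cong) auto
  finally have "t = cnj t" using N by (simp add: yy)
  then have t: "t = complex_of_real (Re t)" by (simp add: complex_eq_iff)
  have "Re t \<noteq> 0" using t y(1) by (metis of_real_0)
  moreover have "ip n (\<lambda>k. (1 / sqrt N) * y k) (\<lambda>k. (1 / sqrt N) * y k) = 1"
  proof -
    have "ip n (\<lambda>k. (1 / sqrt N) * y k) (\<lambda>k. (1 / sqrt N) * y k)
      = (1 / sqrt N) * cnj (ip n y (\<lambda>k. (1 / sqrt N) * y k))"
      by (subst ip_scale_right) (simp only: ip_cnj)
    also have "\<dots> = complex_of_real (1 / sqrt N * (1 / sqrt N * N))" 
      by (simp only: ip_scale_right yy of_real_mult complex_cnj_mult complex_cnj_complex_of_real)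
    also have "1 / sqrt N * (1 / sqrt N * N) = 1" using N by (simp add: field_simps)
    finally show ?thesis by simp
  qed
  moreover have "\<forall>k<n. mv n a (\<lambda>k. (1 / sqrt N) * y k) k = complex_of_real (Re t) * ((1 / sqrt N) * y k)"
  proof (intro allI impI)
    fix k assume k: "k < n"
    have "mv n a (\<lambda>k. (1 / sqrt N) * y k) k = (1 / sqrt N) * mv n a y k"
      by (simp add: mv_def sum_distrib_left algebra_simps)
    also have "mv n a y k = complex_of_real (Re t) * y k" using y(3) k t by metis
    finally show "mv n a (\<lambda>k. (1 / sqrt N) * y k) k = complex_of_real (Re t) * ((1 / sqrt N) * y k)"
      by (simp only: ac_simps)
  qed
  ultimately show ?thesis by blast
qed

text \<open>The family need not be a basis: part of the kernel may be missing, while zero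
  eigenvalues may also be listed. This is harmless for functions of the spectrum that vanish at
  0.\<close>

definition spectral :: "nat \<Rightarrow> (nat \<Rightarrow> nat \<Rightarrow> complex) \<Rightarrow> nat \<Rightarrow> (nat \<Rightarrow> nat \<Rightarrow> complex) \<Rightarrow> (nat \<Rightarrow> real) \<Rightarrow> bool" where
  "spectral n a m u lam \<longleftrightarrow> orthonormal n m u \<and>
     (\<forall>k<n. \<forall>l<n. a k l = (\<Sum>i<m. complex_of_real (lam i) * u i k * cnj (u i l)))"

text \<open>Take an orthonormal family of eigenvectors of maximal size, which is at most
  \<open>n\<close>. The remainder of the matrix annihilates this family. If it were nonzero, its
  eigenvector for a nonzero eigenvalue would be orthogonal to the family and would extend
  it.\<close>

theorem spectral_exists:
  assumes a: "hermitian_fun n a"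
  shows "\<exists>m u lam. spectral n a m u lam"
proof -
  define P where "P m \<longleftrightarrow> (\<exists>u lam. orthonormal n m u \<and>
    (\<forall>i<m. \<forall>k<n. mv n a (u i) k = complex_of_real (lam i) * u i k))" for m
  have "P 0" by (simp add: P_def orthonormal_def)
  moreover have "m \<le> n" if "P m" for m using that orthonormal_le unfolding P_def by blast
  ultimately obtain m where m: "P m" "\<And>m'. P m' \<Longrightarrow> m' \<le> m"
    by (metis GreatestI_nat Greatest_le_nat)
  then obtain u lam where u: "orthonormal n m u"
    and ev: "\<And>i k. i < m \<Longrightarrow> k < n \<Longrightarrow> mv n a (u i) k = complex_of_real (lam i) * u i k"
    unfolding P_def by blast
  define r where "r k l = a k l - (\<Sum>i<m. complex_of_real (lam i) * u i k * cnj (u i l))" for k l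
  have r: "hermitian_fun n r"
    unfolding hermitian_fun_def r_def by (simp add: hermitian_funD[OF a] ac_simps)
  have mvr: "mv n r x k = mv n a x k - (\<Sum>i<m. complex_of_real (lam i) * u i k * ip n (u i) x)" for x k
  proof -
    have "mv n r x k = mv n a x k - (\<Sum>l<n. \<Sum>i<m. complex_of_real (lam i) * u i k * (cnj (u i l) * x l))"
      by (simp add: mv_def r_def left_diff_distrib sum_subtractf sum_distrib_right mult.assoc)
    also have "(\<Sum>l<n. \<Sum>i<m. complex_of_real (lam i) * u i k * (cnj (u i l) * x l))
        = (\<Sum>i<m. complex_of_real (lam i) * u i k * ip n (u i) x)"
      by (subst sum.swap) (simp add: ip_def sum_distrib_left)
    finally show ?thesis .
  qed
  have ru: "mv n r (u j) k = 0" if "j < m" "k < n" for j k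
  proof -
    have "(\<Sum>i<m. complex_of_real (lam i) * u i k * ip n (u i) (u j))
      = (\<Sum>i<m. if j = i then complex_of_real (lam i) * u i k else 0)"
      using u that by (intro sum.cong refl) (auto simp: orthonormal_def)
    also have "\<dots> = complex_of_real (lam j) * u j k" using that by simp
    finally show ?thesis using ev[OF that] by (simp add: mvr)
  qed
  have "r k l = 0" if kl: "k < n" "l < n" for k l
  proof (rule ccontr)
    assume "r k l \<noteq> 0"
    from nonzero_hermitian_eigenvector[OF r kl this] obtain x \<mu> where
      x: "\<mu> \<noteq> 0" "ip n x x = 1" "\<forall>k<n. mv n r x k = complex_of_real \<mu> * x k" by blast
    have orth: "ip n (u i) x = 0" if i: "i < m" for i
    proof -
      have "complex_of_real \<mu> * ip n (u i) x = ip n (u i) (mv n r x)"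
        unfolding ip_scale_right[symmetric] using x(3) by (intro ip_cong) auto
      also have "\<dots> = ip n (mv n r (u i)) x" by (rule ip_mv_left[OF r, symmetric])
      also have "\<dots> = 0" by (simp add: ip_def ru[OF i])
      finally show ?thesis using x(1) by simp
    qed
    have ax: "mv n a x k = complex_of_real \<mu> * x k" if "k < n" for k
      using mvr[of x k] x(3) that orth by simp
    have "P (Suc m)"
      unfolding P_def
    proof (intro exI conjI)
      show "orthonormal n (Suc m) (u(m := x))"
        unfolding orthonormal_def
      proof (intro allI impI)
        fix i j assume ij: "i < Suc m" "j < Suc m"
        have orth': "ip n x (u i) = 0" if "i < m" for i
          using orth[OF that] ip_cnj[of n "u i" x] by simp
        show "ip n ((u(m := x)) i) ((u(m := x)) j) = (if i = j then 1 else 0)"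
          using ij u x(2) orth orth' by (auto simp: less_Suc_eq orthonormal_def)
      qed
      show "\<forall>i<Suc m. \<forall>k<n. mv n a ((u(m := x)) i) k = complex_of_real ((lam(m := \<mu>)) i) * (u(m := x)) i k"
        using ev ax by (auto simp: less_Suc_eq)
    qed
    from m(2)[OF this] show False by simp
  qed
  then have "spectral n a m u lam" using u by (auto simp: spectral_def r_def)
  then show ?thesis by blast
qed

section \<open>Rayleigh quotients and traces of convex functions\<close>

lemma orthonormal_unit: "orthonormal n m u \<Longrightarrow> i < m \<Longrightarrow> (\<Sum>k<n. (cmod (u i k))\<^sup>2) = 1"
proof -
  assume "orthonormal n m u" "i < m"
  then have "ip n (u i) (u i) = 1" by (simp add: orthonormal_def)
  then show ?thesis unfolding ip_self using of_real_eq_1_iff by blast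
qed

lemma cmod_ip_swap: "cmod (ip n x y) = cmod (ip n y x)"
  by (subst ip_cnj[symmetric]) (rule complex_mod_cnj)

lemma norm_orthonormal_sum:
  assumes u: "orthonormal n m u"
  shows "(\<Sum>k<n. (cmod (\<Sum>i<m. d i * u i k))\<^sup>2) = (\<Sum>i<m. (cmod (d i))\<^sup>2)"
proof -
  define y where "y k = (\<Sum>i<m. d i * u i k)" for k
  have uy: "ip n (u i) y = d i" if "i < m" for i
  proof -
    have "ip n (u i) y = (\<Sum>j<m. d j * ip n (u i) (u j))"
      unfolding y_def[abs_def] by (simp only: ip_sum_right ip_scale_right)
    also have "\<dots> = (\<Sum>j<m. if i = j then d j else 0)"
      using u that by (intro sum.cong refl) (simp add: orthonormal_def)
    also have "\<dots> = d i" using that by simp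
    finally show ?thesis .
  qed
  have "ip n y y = (\<Sum>i<m. d i * cnj (ip n (u i) y))"
    by (subst (2) y_def[abs_def]) (simp only: ip_sum_right ip_scale_right ip_cnj)
  also have "\<dots> = complex_of_real (\<Sum>i<m. (cmod (d i))\<^sup>2)"
    unfolding of_real_sum by (intro sum.cong refl) (simp add: uy complex_norm_square del: of_real_power)
  finally show ?thesis unfolding ip_self y_def of_real_eq_iff .
qed

lemma spectral_mv:
  assumes s: "spectral n a m u lam" and k: "k < n"
  shows "mv n a x k = (\<Sum>i<m. complex_of_real (lam i) * ip n (u i) x * u i k)"
proof -
  have "mv n a x k = (\<Sum>l<n. \<Sum>i<m. complex_of_real (lam i) * u i k * (cnj (u i l) * x l))"
    using s k by (simp add: mv_def spectral_def sum_distrib_right mult.assoc)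
  also have "\<dots> = (\<Sum>i<m. complex_of_real (lam i) * ip n (u i) x * u i k)"
    by (subst sum.swap) (simp add: ip_def sum_distrib_left sum_distrib_right ac_simps)
  finally show ?thesis .
qed

text \<open>The Rayleigh quotient, when \<open>x\<close> is a unit vector.\<close>

definition rq :: "nat \<Rightarrow> (nat \<Rightarrow> nat \<Rightarrow> complex) \<Rightarrow> (nat \<Rightarrow> complex) \<Rightarrow> real" where
  "rq n a x = Re (ip n x (mv n a x))"

lemma spectral_rq:
  assumes s: "spectral n a m u lam"
  shows "rq n a x = (\<Sum>i<m. (cmod (ip n (u i) x))\<^sup>2 * lam i)"
proof -
  have "ip n x (mv n a x) = ip n x (\<lambda>k. \<Sum>i<m. complex_of_real (lam i) * ip n (u i) x * u i k)"
    by (rule ip_cong) (simp_all add: spectral_mv[OF s])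
  also have "\<dots> = (\<Sum>i<m. complex_of_real (lam i) * ip n (u i) x * ip n x (u i))"
    by (simp only: ip_sum_right ip_scale_right)
  also have "\<dots> = complex_of_real (\<Sum>i<m. (cmod (ip n (u i) x))\<^sup>2 * lam i)"
    unfolding of_real_sum
  proof (intro sum.cong refl)
    fix i
    have "ip n (u i) x * ip n x (u i) = complex_of_real ((cmod (ip n (u i) x))\<^sup>2)"
      by (simp only: complex_norm_square ip_cnj)
    then have "complex_of_real (lam i) * (ip n (u i) x * ip n x (u i)) = complex_of_real (lam i) * complex_of_real ((cmod (ip n (u i) x))\<^sup>2)"
      by (rule arg_cong)
    then show "complex_of_real (lam i) * ip n (u i) x * ip n x (u i) = complex_of_real ((cmod (ip n (u i) x))\<^sup>2 * lam i)"
      unfolding of_real_mult mult.assoc[symmetric] by (simp only: mult.commute)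
  qed
  finally show ?thesis by (simp add: rq_def)
qed

lemma spectral_rq_eigenvector:
  assumes s: "spectral n a m u lam" and "i < m"
  shows "rq n a (u i) = lam i"
proof -
  have u: "orthonormal n m u" using s by (simp add: spectral_def)
  have "rq n a (u i) = (\<Sum>j<m. if j = i then lam j else 0)"
    unfolding spectral_rq[OF s] using u assms(2) by (intro sum.cong refl) (simp add: orthonormal_def)
  then show ?thesis using assms(2) by simp
qed

text \<open>Jensen's inequality with the missing mass placed at 0, where \<open>h\<close>
  vanishes.\<close>

lemma convex_sub_probability:
  fixes h :: "real \<Rightarrow> real"
  assumes h: "convex_on UNIV h" "h 0 = 0" and "finite I" and w: "\<And>i. i \<in> I \<Longrightarrow> 0 \<le> w i" "sum w I \<le> 1"
  shows "h (\<Sum>i\<in>I. w i * x i) \<le> (\<Sum>i\<in>I. w i * h (x i))"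
proof (cases "sum w I = 0")
  case True
  then have "w i = 0" if "i \<in> I" for i using that w(1) \<open>finite I\<close> sum_nonneg_eq_0_iff[of I w] by blast
  then show ?thesis using h(2) by simp
next
  case False
  define W where "W = sum w I"
  have W: "0 < W" "W \<le> 1" using False w sum_nonneg[of I w] unfolding W_def by force+
  have ne: "I \<noteq> {}" using False by auto
  define y where "y = (\<Sum>i\<in>I. (w i / W) * x i)"
  have "h y \<le> (\<Sum>i\<in>I. (w i / W) * h (x i))"
    unfolding y_def using convex_on_sum[OF \<open>finite I\<close> ne h(1), of "\<lambda>i. w i / W" x] w W
    by (simp add: W_def sum_divide_distrib[symmetric])
  then have "h y \<le> (\<Sum>i\<in>I. w i * h (x i)) / W" by (simp add: sum_divide_distrib)
  then have 1: "W * h y \<le> (\<Sum>i\<in>I. w i * h (x i))"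
    using W(1) by (simp add: pos_le_divide_eq mult.commute)
  have "(\<Sum>i\<in>I. w i * x i) = W * y" using W(1) by (simp add: y_def sum_distrib_left)
  moreover have "h (W * y) \<le> W * h y"
    using convex_onD[OF h(1), of W 0 y] W h(2) by simp
  ultimately show ?thesis using 1 by simp
qed

text \<open>The chosen decomposition depends on the matrix only and not on \<open>h\<close>, so that
  traces of different functions are sums over the same eigenvalues.\<close>

definition trfun :: "(real \<Rightarrow> real) \<Rightarrow> nat \<Rightarrow> (nat \<Rightarrow> nat \<Rightarrow> complex) \<Rightarrow> real" where
  "trfun h n a = (case (SOME t. case t of (m, u, lam) \<Rightarrow> spectral n a m u lam) of
     (m, u, lam) \<Rightarrow> \<Sum>i<m. h (lam i))"

lemma spectral_choice:
  assumes "hermitian_fun n a"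
  shows "\<exists>m u lam. spectral n a m u lam \<and> (\<forall>h. trfun h n a = (\<Sum>i<m. h (lam i)))"
proof -
  let ?P = "\<lambda>t. case t of (m, u, lam) \<Rightarrow> spectral n a m u lam"
  have "\<exists>t. ?P t" using spectral_exists[OF assms] by auto
  then have "?P (SOME t. ?P t)" by (rule someI_ex)
  moreover obtain m u lam where t: "(SOME t. ?P t) = (m, u, lam)" by (metis prod.exhaust)
  ultimately have "spectral n a m u lam" by simp
  moreover have "trfun h n a = (\<Sum>i<m. h (lam i))" for h unfolding trfun_def t by simp
  ultimately show ?thesis by blast
qed

text \<open>Peierls' inequality. The squared inner products between the two families have row and
  column sums at most 1 by Bessel's inequality. The rows enter through Jensen's inequality, the
  columns through \<open>h \<ge> 0\<close>.\<close>

lemma peierls: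
  assumes a: "hermitian_fun n a" and w: "orthonormal n m' w"
    and h: "convex_on UNIV h" "h 0 = 0" "\<And>x. 0 \<le> h x"
  shows "(\<Sum>i<m'. h (rq n a (w i))) \<le> trfun h n a"
proof -
  obtain m u lam where s: "spectral n a m u lam" and tr: "\<And>h. trfun h n a = (\<Sum>i<m. h (lam i))"
    using spectral_choice[OF a] by blast
  have u: "orthonormal n m u" using s by (simp add: spectral_def)
  have "(\<Sum>i<m'. h (rq n a (w i))) \<le> (\<Sum>i<m'. \<Sum>j<m. (cmod (ip n (u j) (w i)))\<^sup>2 * h (lam j))"
  proof (rule sum_mono)
    fix i assume "i \<in> {..<m'}"
    then have "(\<Sum>j<m. (cmod (ip n (u j) (w i)))\<^sup>2) \<le> 1"
      using bessel[OF u, of "w i"] orthonormal_unit[OF w, of i] by simp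
    then show "h (rq n a (w i)) \<le> (\<Sum>j<m. (cmod (ip n (u j) (w i)))\<^sup>2 * h (lam j))"
      unfolding spectral_rq[OF s] by (intro convex_sub_probability h) auto
  qed
  also have "\<dots> = (\<Sum>j<m. h (lam j) * (\<Sum>i<m'. (cmod (ip n (w i) (u j)))\<^sup>2))"
    by (subst sum.swap) (simp add: sum_distrib_left mult.commute cmod_ip_swap)
  also have "\<dots> \<le> (\<Sum>j<m. h (lam j) * 1)"
  proof (intro sum_mono mult_left_mono h(3))
    fix j assume "j \<in> {..<m}"
    then show "(\<Sum>i<m'. (cmod (ip n (w i) (u j)))\<^sup>2) \<le> 1"
      using bessel[OF w, of "u j"] orthonormal_unit[OF u, of j] by simp
  qed
  finally show ?thesis by (simp add: tr)
qed

lemma hermitian_fun_lincomb: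
  assumes "hermitian_fun n a" "hermitian_fun n b"
  shows "hermitian_fun n (\<lambda>k l. complex_of_real s * a k l + complex_of_real t * b k l)"
  unfolding hermitian_fun_def by (simp add: hermitian_funD[OF assms(1)] hermitian_funD[OF assms(2)])

lemma rq_lincomb:
  "rq n (\<lambda>k l. complex_of_real s * a k l + complex_of_real t * b k l) x = s * rq n a x + t * rq n b x"
proof -
  have "mv n (\<lambda>k l. complex_of_real s * a k l + complex_of_real t * b k l) x
     = (\<lambda>k. complex_of_real s * mv n a x k + complex_of_real t * mv n b x k)"
    by (simp add: mv_def fun_eq_iff algebra_simps sum.distrib sum_distrib_left)
  then show ?thesis by (simp add: rq_def ip_add_right ip_scale_right)
qed

text \<open>In eigenvectors of the convex combination the Rayleigh quotients are affine in the
  matrix. Convexity of \<open>h\<close> applies there, and Peierls' inequality then applies to each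
  of the two matrices.\<close>

lemma trfun_convex:
  assumes a: "hermitian_fun n a" and b: "hermitian_fun n b"
    and h: "convex_on UNIV h" "h 0 = 0" "\<And>x. 0 \<le> h x" and t: "0 \<le> t" "t \<le> 1"
  shows "trfun h n (\<lambda>k l. complex_of_real (1 - t) * a k l + complex_of_real t * b k l)
    \<le> (1 - t) * trfun h n a + t * trfun h n b"
proof -
  let ?c = "\<lambda>k l. complex_of_real (1 - t) * a k l + complex_of_real t * b k l"
  obtain m u lam where s: "spectral n ?c m u lam" and tr: "\<And>h. trfun h n ?c = (\<Sum>i<m. h (lam i))"
    using spectral_choice[OF hermitian_fun_lincomb[OF a b]] by blast
  have u: "orthonormal n m u" using s by (simp add: spectral_def)
  have "trfun h n ?c = (\<Sum>i<m. h ((1 - t) * rq n a (u i) + t * rq n b (u i)))"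
    unfolding tr by (intro sum.cong refl) (simp only: spectral_rq_eigenvector[OF s, symmetric] rq_lincomb lessThan_iff)
  also have "\<dots> \<le> (\<Sum>i<m. (1 - t) * h (rq n a (u i)) + t * h (rq n b (u i)))"
    using convex_onD[OF h(1), of t] t by (intro sum_mono) auto
  also have "\<dots> = (1 - t) * (\<Sum>i<m. h (rq n a (u i))) + t * (\<Sum>i<m. h (rq n b (u i)))"
    by (simp add: sum.distrib sum_distrib_left)
  also have "\<dots> \<le> (1 - t) * trfun h n a + t * trfun h n b"
    using t by (intro add_mono mult_left_mono peierls a b u h) auto
  finally show ?thesis .
qed

lemma cmod_ip_unit_le:
  assumes "(\<Sum>k<n. (cmod (w k))\<^sup>2) = 1"
  shows "(cmod (ip n w y))\<^sup>2 \<le> (\<Sum>k<n. (cmod (y k))\<^sup>2)"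
proof -
  have "orthonormal n 1 (\<lambda>_. w)" using assms by (simp add: orthonormal_def ip_self)
  from bessel[OF this, of y] show ?thesis by simp
qed

lemma sum_rq_square_le:
  assumes w: "orthonormal n m w"
  shows "(\<Sum>i<m. (rq n z (w i))\<^sup>2) \<le> (\<Sum>k<n. \<Sum>l<n. (cmod (z k l))\<^sup>2)"
proof -
  have "(\<Sum>i<m. (rq n z (w i))\<^sup>2) \<le> (\<Sum>i<m. \<Sum>k<n. (cmod (mv n z (w i) k))\<^sup>2)"
  proof (rule sum_mono)
    fix i assume "i \<in> {..<m}"
    have "(rq n z (w i))\<^sup>2 \<le> (cmod (ip n (w i) (mv n z (w i))))\<^sup>2"
      unfolding rq_def using abs_Re_le_cmod by (metis abs_le_square_iff abs_norm_cancel)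
    also have "\<dots> \<le> (\<Sum>k<n. (cmod (mv n z (w i) k))\<^sup>2)"
      using orthonormal_unit[OF w] \<open>i \<in> {..<m}\<close> by (intro cmod_ip_unit_le) auto
    finally show "(rq n z (w i))\<^sup>2 \<le> (\<Sum>k<n. (cmod (mv n z (w i) k))\<^sup>2)" .
  qed
  also have "\<dots> = (\<Sum>k<n. \<Sum>i<m. (cmod (ip n (w i) (\<lambda>l. cnj (z k l))))\<^sup>2)"
  proof (subst sum.swap, intro sum.cong refl)
    fix k i
    have "mv n z (w i) k = cnj (ip n (w i) (\<lambda>l. cnj (z k l)))" by (simp add: mv_def ip_def mult.commute)
    then show "(cmod (mv n z (w i) k))\<^sup>2 = (cmod (ip n (w i) (\<lambda>l. cnj (z k l))))\<^sup>2" by simp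
  qed
  also have "\<dots> \<le> (\<Sum>k<n. \<Sum>l<n. (cmod (cnj (z k l)))\<^sup>2)"
    by (intro sum_mono bessel w)
  finally show ?thesis by simp
qed

text \<open>Peierls' inequality in the eigenvectors of \<open>a\<close> reduces the difference to at
  most \<open>n\<close> Rayleigh quotients of \<open>a - b\<close>; \<open>sqrt n\<close> comes from
  the Cauchy-Schwarz inequality.\<close>

lemma trfun_lipschitz_le:
  assumes a: "hermitian_fun n a" and b: "hermitian_fun n b"
    and h: "convex_on UNIV h" "h 0 = 0" "\<And>x. 0 \<le> h x" and K: "\<And>x y. \<bar>h x - h y\<bar> \<le> K * \<bar>x - y\<bar>" "0 \<le> K"
  shows "trfun h n a - trfun h n b \<le> K * sqrt n * sqrt (\<Sum>k<n. \<Sum>l<n. (cmod (a k l - b k l))\<^sup>2)"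
proof -
  obtain m u lam where s: "spectral n a m u lam" and tr: "\<And>h. trfun h n a = (\<Sum>i<m. h (lam i))"
    using spectral_choice[OF a] by blast
  have u: "orthonormal n m u" using s by (simp add: spectral_def)
  have rqd: "rq n (\<lambda>k l. a k l - b k l) x = rq n a x - rq n b x" for x
    using rq_lincomb[of n 1 a "- 1" b x] by simp
  let ?S = "\<Sum>k<n. \<Sum>l<n. (cmod (a k l - b k l))\<^sup>2"
  have "trfun h n a - trfun h n b \<le> (\<Sum>i<m. h (rq n a (u i))) - (\<Sum>i<m. h (rq n b (u i)))"
    unfolding tr using spectral_rq_eigenvector[OF s] peierls[OF b u h] by simp
  also have "\<dots> = (\<Sum>i<m. h (rq n a (u i)) - h (rq n b (u i)))" by (simp add: sum_subtractf)
  also have "\<dots> \<le> (\<Sum>i<m. K * \<bar>rq n (\<lambda>k l. a k l - b k l) (u i)\<bar>)"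
    unfolding rqd by (intro sum_mono order_trans[OF abs_ge_self K(1)])
  also have "\<dots> = K * (\<Sum>i<m. 1 * \<bar>rq n (\<lambda>k l. a k l - b k l) (u i)\<bar>)" by (simp add: sum_distrib_left)
  also have "(\<Sum>i<m. 1 * \<bar>rq n (\<lambda>k l. a k l - b k l) (u i)\<bar>) \<le> sqrt (real n * ?S)"
  proof (rule real_le_rsqrt)
    have "(\<Sum>i<m. 1 * \<bar>rq n (\<lambda>k l. a k l - b k l) (u i)\<bar>)\<^sup>2
        \<le> (\<Sum>i<m. 1\<^sup>2) * (\<Sum>i<m. \<bar>rq n (\<lambda>k l. a k l - b k l) (u i)\<bar>\<^sup>2)"
      by (rule Cauchy_Schwarz_ineq_sum)
    also have "\<dots> \<le> real n * ?S"
      using orthonormal_le[OF u] sum_rq_square_le[OF u, of "\<lambda>k l. a k l - b k l"]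
      by (intro mult_mono) (auto intro: sum_nonneg)
    finally show "(\<Sum>i<m. 1 * \<bar>rq n (\<lambda>k l. a k l - b k l) (u i)\<bar>)\<^sup>2 \<le> real n * ?S" .
  qed
  finally show ?thesis using K(2) by (simp add: real_sqrt_mult mult_left_mono mult.assoc)
qed

text \<open>Positive exponents only: the zeroth power is the identity, which a family that is not a
  basis does not resolve.\<close>

lemma spectral_pow:
  assumes A: "A \<in> carrier_mat n n" and s: "spectral n (\<lambda>i j. A $$ (i, j)) m u lam"
    and "p < n" "q < n"
  shows "(A ^\<^sub>m Suc k) $$ (p, q) = (\<Sum>i<m. complex_of_real (lam i ^ Suc k) * u i p * cnj (u i q))"
  using \<open>q < n\<close>
proof (induction k arbitrary: q)
  case 0
  then show ?case using s A \<open>p < n\<close> by (simp add: spectral_def)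
next
  case (Suc k)
  have u: "orthonormal n m u" using s by (simp add: spectral_def)
  have "(A ^\<^sub>m Suc (Suc k)) $$ (p, q) = (\<Sum>r<n. (A ^\<^sub>m Suc k) $$ (p, r) * A $$ (r, q))"
    using A \<open>p < n\<close> Suc.prems unfolding pow_mat.simps(2)[of A "Suc k"]
    by (subst index_mult_mat) (auto simp: scalar_prod_def atLeast0LessThan simp del: pow_mat.simps)
  also have "\<dots> = (\<Sum>r<n. (\<Sum>i<m. complex_of_real (lam i ^ Suc k) * u i p * cnj (u i r)) *
      (\<Sum>j<m. complex_of_real (lam j) * u j r * cnj (u j q)))"
    using s Suc.prems by (intro sum.cong refl arg_cong2[where f = "(*)"] Suc.IH) (auto simp: spectral_def)
  also have "\<dots> = (\<Sum>i<m. \<Sum>j<m. complex_of_real (lam i ^ Suc k) * u i p * (complex_of_real (lam j) * cnj (u j q)) * ip n (u i) (u j))"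
  proof -
    have "(\<Sum>r<n. (\<Sum>i<m. complex_of_real (lam i ^ Suc k) * u i p * cnj (u i r)) * (\<Sum>j<m. complex_of_real (lam j) * u j r * cnj (u j q)))
      = (\<Sum>r<n. \<Sum>i<m. \<Sum>j<m. complex_of_real (lam i ^ Suc k) * u i p * cnj (u i r) * (complex_of_real (lam j) * u j r * cnj (u j q)))"
      by (simp only: sum_product)
    also have "\<dots> = (\<Sum>i<m. \<Sum>r<n. \<Sum>j<m. complex_of_real (lam i ^ Suc k) * u i p * cnj (u i r) * (complex_of_real (lam j) * u j r * cnj (u j q)))"
      by (rule sum.swap)
    also have "\<dots> = (\<Sum>i<m. \<Sum>j<m. \<Sum>r<n. complex_of_real (lam i ^ Suc k) * u i p * cnj (u i r) * (complex_of_real (lam j) * u j r * cnj (u j q)))"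
      by (rule sum.cong[OF refl]) (rule sum.swap)
    also have "\<dots> = (\<Sum>i<m. \<Sum>j<m. complex_of_real (lam i ^ Suc k) * u i p * (complex_of_real (lam j) * cnj (u j q)) * ip n (u i) (u j))"
      unfolding ip_def sum_distrib_left by (intro sum.cong refl) (simp only: ac_simps)
    finally show ?thesis .
  qed
  also have "\<dots> = (\<Sum>i<m. \<Sum>j<m. if i = j then complex_of_real (lam i ^ Suc k) * u i p * (complex_of_real (lam j) * cnj (u j q)) else 0)"
    using u by (intro sum.cong refl) (simp add: orthonormal_def)
  also have "\<dots> = (\<Sum>i<m. complex_of_real (lam i ^ Suc (Suc k)) * u i p * cnj (u i q))"
    by (intro sum.cong refl) (simp add: ac_simps)
  finally show ?case .
qed

lemma spectral_trace_pow:
  assumes A: "A \<in> carrier_mat n n" and s: "spectral n (\<lambda>i j. A $$ (i, j)) m u lam" and "0 < k"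
  shows "mat_trace (A ^\<^sub>m k) = complex_of_real (\<Sum>i<m. lam i ^ k)"
proof -
  obtain j where k: "k = Suc j" using \<open>0 < k\<close> gr0_conv_Suc by auto
  have u: "orthonormal n m u" using s by (simp add: spectral_def)
  have "mat_trace (A ^\<^sub>m k) = (\<Sum>p<n. (A ^\<^sub>m Suc j) $$ (p, p))"
    unfolding mat_trace_def k using A by (simp del: pow_mat.simps)
  also have "\<dots> = (\<Sum>p<n. \<Sum>i<m. complex_of_real (lam i ^ Suc j) * u i p * cnj (u i p))"
    by (intro sum.cong refl spectral_pow[OF A s]) auto
  also have "\<dots> = (\<Sum>i<m. complex_of_real (lam i ^ Suc j) * ip n (u i) (u i))"
    by (subst sum.swap) (simp add: ip_def sum_distrib_left ac_simps)
  also have "\<dots> = (\<Sum>i<m. complex_of_real (lam i ^ Suc j))"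
    using u by (intro sum.cong refl) (simp add: orthonormal_def)
  finally show ?thesis by (simp add: k)
qed

lemma spectral_norm_mv_le:
  assumes s: "spectral n a m u lam" and "\<And>i. i < m \<Longrightarrow> \<bar>lam i\<bar> \<le> \<kappa>"
  shows "(\<Sum>k<n. (cmod (mv n a x k))\<^sup>2) \<le> \<kappa>\<^sup>2 * (\<Sum>k<n. (cmod (x k))\<^sup>2)"
proof -
  have u: "orthonormal n m u" using s by (simp add: spectral_def)
  have "(\<Sum>k<n. (cmod (mv n a x k))\<^sup>2) = (\<Sum>i<m. (cmod (complex_of_real (lam i) * ip n (u i) x))\<^sup>2)"
    unfolding norm_orthonormal_sum[OF u, symmetric] by (intro sum.cong refl) (simp add: spectral_mv[OF s])
  also have "\<dots> = (\<Sum>i<m. (lam i)\<^sup>2 * (cmod (ip n (u i) x))\<^sup>2)"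
    by (simp add: norm_mult power_mult_distrib)
  also have "\<dots> \<le> (\<Sum>i<m. \<kappa>\<^sup>2 * (cmod (ip n (u i) x))\<^sup>2)"
  proof (intro sum_mono mult_right_mono)
    fix i assume "i \<in> {..<m}"
    then have "\<bar>lam i\<bar> \<le> \<bar>\<kappa>\<bar>" using assms(2)[of i] by simp
    then show "(lam i)\<^sup>2 \<le> \<kappa>\<^sup>2" by (simp add: abs_le_square_iff)
  qed simp
  also have "\<dots> \<le> \<kappa>\<^sup>2 * (\<Sum>k<n. (cmod (x k))\<^sup>2)"
    unfolding sum_distrib_left[symmetric] by (intro mult_left_mono bessel u) simp
  finally show ?thesis .
qed

section \<open>Upper bound\<close>

lemma measurable_Re: "Re \<in> borel_measurable borel"
  by (intro borel_measurable_continuous_onI continuous_intros)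

lemma mat_adjoint_index: "A \<in> carrier_mat n n \<Longrightarrow> i < n \<Longrightarrow> j < n \<Longrightarrow> mat_adjoint A $$ (i, j) = cnj (A $$ (j, i))"
  for A :: "complex mat"
  by (simp add: mat_adjoint_def mat_of_rows_index)

lemma herm_mats_iff:
  "A \<in> herm_mats \<beta> n \<longleftrightarrow> A \<in> carrier_mat n n \<and> hermitian_fun n (\<lambda>i j. A $$ (i, j)) \<and>
     (\<beta> = 1 \<longrightarrow> (\<forall>i<n. \<forall>j<n. A $$ (i, j) \<in> \<real>))"
proof (cases "A \<in> carrier_mat n n")
  case True
  have "mat_adjoint A \<in> carrier_mat n n" using True by (simp add: mat_adjoint_def mat_of_rows_def)
  then have "mat_adjoint A = A \<longleftrightarrow> (\<forall>i<n. \<forall>j<n. mat_adjoint A $$ (i, j) = A $$ (i, j))"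
    using True by (auto intro!: eq_matI)
  also have "\<dots> \<longleftrightarrow> hermitian_fun n (\<lambda>i j. A $$ (i, j))"
    unfolding hermitian_fun_def using mat_adjoint_index[OF True] by metis
  finally have 1: "mat_adjoint A = A \<longleftrightarrow> hermitian_fun n (\<lambda>i j. A $$ (i, j))" .
  have 2: "elements_mat A \<subseteq> \<real> \<longleftrightarrow> (\<forall>i<n. \<forall>j<n. A $$ (i, j) \<in> \<real>)"
    using True unfolding elements_mat_def by fastforce
  show ?thesis using True unfolding herm_mats_def by (simp add: 1 2)
qed (simp add: herm_mats_def)

section \<open>Laplace transforms of the entries and of linear statistics\<close>

locale wigner_ldp =
  fixes d \<beta> :: nat
    and M :: "nat \<Rightarrow> 'a measure"
    and X :: "nat \<Rightarrow> 'a \<Rightarrow> complex mat"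
    and \<mu> \<nu> :: "complex measure"
  assumes d: "3 \<le> d" and beta: "\<beta> \<in> {1, 2}"
    and wigner: "wigner_matrix \<beta> M X \<mu> \<nu>"
    and diag2: "integrable \<mu> (\<lambda>z. (Re z)\<^sup>2)" "(LINT z|\<mu>. (Re z)\<^sup>2) \<le> 2 / real \<beta>"
    and var2: "\<beta> = 2 \<longrightarrow> prob_space.variance \<nu> Re = 1 / 2 \<and> prob_space.variance \<nu> Im = 1 / 2"
    and cc: "convex_concentration \<beta> M X"
    and subg: "sharp_sub_gaussian \<mu>" "sharp_sub_gaussian \<nu>"
begin

lemma prob_M: "prob_space (M n)"
  using wigner by (simp add: wigner_matrix_def)

lemma X_herm: "\<omega> \<in> space (M n) \<Longrightarrow> X n \<omega> \<in> herm_mats \<beta> n"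
  using wigner by (simp add: wigner_matrix_def)

definition Xf :: "nat \<Rightarrow> nat \<Rightarrow> nat \<Rightarrow> 'a \<Rightarrow> complex" where
  "Xf n i j \<omega> = X n \<omega> $$ (i, j)"

lemma X_carrier: "\<omega> \<in> space (M n) \<Longrightarrow> X n \<omega> \<in> carrier_mat n n"
  and X_hermitian: "\<omega> \<in> space (M n) \<Longrightarrow> hermitian_fun n (\<lambda>i j. Xf n i j \<omega>)"
  using X_herm unfolding herm_mats_iff Xf_def by blast+

lemma X_real: "\<omega> \<in> space (M n) \<Longrightarrow> \<beta> = 1 \<Longrightarrow> i < n \<Longrightarrow> j < n \<Longrightarrow> Im (Xf n i j \<omega>) = 0"
  using X_herm unfolding herm_mats_iff Xf_def by (metis complex_is_Real_iff)

lemma X_indep: "prob_space.indep_vars (M n) (\<lambda>_. borel) (\<lambda>(i, j). Xf n i j) {(i, j). i \<le> j \<and> j < n}"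
proof -
  have "(\<lambda>(i, j). Xf n i j) = (\<lambda>(i, j) \<omega>. X n \<omega> $$ (i, j))" by (auto simp: Xf_def fun_eq_iff)
  then show ?thesis using wigner by (simp add: wigner_matrix_def)
qed

lemma X_meas_upper: "i \<le> j \<Longrightarrow> j < n \<Longrightarrow> Xf n i j \<in> borel_measurable (M n)"
  using X_indep[of n] unfolding prob_space.indep_vars_def[OF prob_M] by auto

lemma X_meas: "i < n \<Longrightarrow> j < n \<Longrightarrow> Xf n i j \<in> borel_measurable (M n)"
proof (cases "i \<le> j")
  case False
  assume ij: "i < n" "j < n"
  with False have "(\<lambda>\<omega>. cnj (Xf n j i \<omega>)) \<in> borel_measurable (M n)"
    using X_meas_upper[of j i] by (intro measurable_compose[OF _ measurable_cnj]) auto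
  then show ?thesis using hermitian_funD[OF X_hermitian ij(1) ij(2)] by (subst measurable_cong) auto
qed (use X_meas_upper in auto)

lemma X_diag_law: "i < n \<Longrightarrow> distr (M n) borel (Xf n i i) = \<mu>"
  and X_off_law: "i < j \<Longrightarrow> j < n \<Longrightarrow> distr (M n) borel (Xf n i j) = \<nu>"
  using wigner unfolding wigner_matrix_def Xf_def[abs_def] by auto

lemma X_diag_real: "\<omega> \<in> space (M n) \<Longrightarrow> i < n \<Longrightarrow> Im (Xf n i i \<omega>) = 0"
  using hermitian_funD[OF X_hermitian, of \<omega> n i i] by (simp add: complex_eq_iff)

text \<open>The laws are read off the smallest matrices that have such entries, of size 1 and
  2.\<close>

lemma prob_mu: "prob_space \<mu>" and prob_nu: "prob_space \<nu>"
  using prob_space.prob_space_distr[OF prob_M X_meas[of 0 1 0]] X_diag_law[of 0 1]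
    prob_space.prob_space_distr[OF prob_M X_meas[of 0 2 1]] X_off_law[of 0 1 2] by auto

lemma sets_mu [measurable_cong]: "sets \<mu> = sets borel" and sets_nu [measurable_cong]: "sets \<nu> = sets borel"
  using X_diag_law[of 0 1] X_off_law[of 0 1 2] by (auto simp flip: X_diag_law[of 0 1] X_off_law[of 0 1 2])

lemma mu_real: "AE z in \<mu>. Im z = 0"
proof -
  have "AE z in distr (M 1) borel (Xf 1 0 0). Im z = 0"
    using X_diag_real[of _ 1 0] X_meas[of 0 1 0] by (subst AE_distr_iff) auto
  moreover have "distr (M 1) borel (Xf 1 0 0) = \<mu>" by (rule X_diag_law) simp
  ultimately show ?thesis by (simp only:)
qed

lemma nu_real: "\<beta> = 1 \<Longrightarrow> AE z in \<nu>. Im z = 0"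
proof -
  assume "\<beta> = 1"
  then have "AE z in distr (M 2) borel (Xf 2 0 1). Im z = 0"
    using X_real[of _ 2 0 1] X_meas[of 0 2 1] by (subst AE_distr_iff) auto
  moreover have "distr (M 2) borel (Xf 2 0 1) = \<nu>" by (rule X_off_law) simp_all
  ultimately show ?thesis by (simp only:)
qed

lemma mean_mu: "integrable \<mu> Re" "(LINT z|\<mu>. Re z) = 0"
  and mean_nu: "integrable \<nu> Re" "integrable \<nu> Im" "(LINT z|\<nu>. Re z) = 0" "(LINT z|\<nu>. Im z) = 0"
  and norm2_nu: "integrable \<nu> (\<lambda>z. (cmod z)\<^sup>2)" "(LINT z|\<nu>. (cmod z)\<^sup>2) = 1"
proof -
  have *: "integrable \<mu> (\<lambda>z. z)" "(LINT z|\<mu>. z) = 0" "integrable \<nu> (\<lambda>z. z)" "(LINT z|\<nu>. z) = 0"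
    using wigner by (auto simp: wigner_matrix_def)
  show "integrable \<mu> Re" "integrable \<nu> Re" "integrable \<nu> Im" using * by auto
  show "(LINT z|\<mu>. Re z) = 0" "(LINT z|\<nu>. Re z) = 0" "(LINT z|\<nu>. Im z) = 0" using * by simp_all
  show "integrable \<nu> (\<lambda>z. (cmod z)\<^sup>2)" "(LINT z|\<nu>. (cmod z)\<^sup>2) = 1"
    using wigner by (auto simp: wigner_matrix_def)
qed

lemma nu_indep: "prob_space.indep_var \<nu> borel Re borel Im"
  using wigner by (auto simp: wigner_matrix_def)

lemma nu_squares: "integrable \<nu> (\<lambda>z. (Re z)\<^sup>2)" "integrable \<nu> (\<lambda>z. (Im z)\<^sup>2)" "integrable \<nu> (\<lambda>z. Re z * Im z)"
proof -
  note [measurable_cong] = sets_nu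
  show "integrable \<nu> (\<lambda>z. (Re z)\<^sup>2)" "integrable \<nu> (\<lambda>z. (Im z)\<^sup>2)"
    by (rule Bochner_Integration.integrable_bound[OF norm2_nu(1)]; simp add: cmod_power2)+
  show "integrable \<nu> (\<lambda>z. Re z * Im z)"
    using prob_space.indep_var_integrable[OF prob_nu nu_indep mean_nu(1) mean_nu(2)] .
qed

text \<open>For \<open>\<beta> = 1\<close> the imaginary part vanishes almost surely; for
  \<open>\<beta> = 2\<close> both variances are prescribed. The mixed moment is 0 by
  independence.\<close>

lemma nu_covariance:
  "(LINT z|\<nu>. (Re z)\<^sup>2) = 1 / real \<beta>" "(LINT z|\<nu>. (Im z)\<^sup>2) = (if \<beta> = 1 then 0 else 1 / 2)"
  "(LINT z|\<nu>. Re z * Im z) = 0"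
proof -
  show 0: "(LINT z|\<nu>. Re z * Im z) = 0"
    using prob_space.indep_var_lebesgue_integral[OF prob_nu nu_indep mean_nu(1) mean_nu(2)] mean_nu by simp
  have "(LINT z|\<nu>. (Re z)\<^sup>2) + (LINT z|\<nu>. (Im z)\<^sup>2) = 1"
    using norm2_nu(2) nu_squares by (simp add: cmod_power2)
  moreover have "(LINT z|\<nu>. (Im z)\<^sup>2) = (if \<beta> = 1 then 0 else 1 / 2)"
  proof (cases "\<beta> = 1")
    case True
    then have "(LINT z|\<nu>. (Im z)\<^sup>2) = (LINT z|\<nu>. 0)"
      using nu_real by (intro integral_cong_AE) auto
    then show ?thesis using True by simp
  next
    case False
    then show ?thesis using beta var2 mean_nu by simp
  qed
  ultimately show "(LINT z|\<nu>. (Re z)\<^sup>2) = 1 / real \<beta>" "(LINT z|\<nu>. (Im z)\<^sup>2) = (if \<beta> = 1 then 0 else 1 / 2)"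
    using beta by (auto split: if_splits)
qed

lemma le_exp_of_ln_le: "0 \<le> x \<Longrightarrow> ln x \<le> c \<Longrightarrow> x \<le> exp c" for x c :: real
  using exp_le_cancel_iff[of "ln x" c] by (cases "x = 0") auto

text \<open>Real and imaginary part are uncorrelated, so the covariance form is diagonal, with
  entries at most \<open>1 / \<beta>\<close>.\<close>

lemma laplace_nu: "integrable \<nu> (\<lambda>\<xi>. exp (Re (w * \<xi>)))" "(LINT \<xi>|\<nu>. exp (Re (w * \<xi>))) \<le> exp ((cmod w)\<^sup>2 / (2 * real \<beta>))"
proof -
  show "integrable \<nu> (\<lambda>\<xi>. exp (Re (w * \<xi>)))" using subg(2) by (simp add: sharp_sub_gaussian_def)
  have "ln (LINT \<xi>|\<nu>. exp (Re (w * \<xi>))) \<le> 1 / 2 * inner w (covariance_op \<nu> w)"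
    using subg(2) by (simp add: sharp_sub_gaussian_def)
  also have "\<dots> \<le> (cmod w)\<^sup>2 / (2 * real \<beta>)"
  proof -
    have "inner w (covariance_op \<nu> w) = (LINT z|\<nu>. (Re z)\<^sup>2) * (Re w)\<^sup>2 + (LINT z|\<nu>. (Im z)\<^sup>2) * (Im w)\<^sup>2
        + 2 * (LINT z|\<nu>. Re z * Im z) * (Re w * Im w)"
      by (simp add: covariance_op_def covariance_def inner_complex_def mean_nu power2_eq_square mult.commute algebra_simps)
    then show ?thesis unfolding nu_covariance cmod_power2 using beta by (auto simp: add_divide_distrib)
  qed
  finally show "(LINT \<xi>|\<nu>. exp (Re (w * \<xi>))) \<le> exp ((cmod w)\<^sup>2 / (2 * real \<beta>))"
    by (intro le_exp_of_ln_le integral_nonneg_AE) auto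
qed

lemma laplace_mu: "integrable \<mu> (\<lambda>\<xi>. exp (s * Re \<xi>))" "(LINT \<xi>|\<mu>. exp (s * Re \<xi>)) \<le> exp (s\<^sup>2 / real \<beta>)"
proof -
  have sg: "integrable \<mu> (\<lambda>\<xi>. exp (Re (z * \<xi>))) \<and>
     ln (LINT \<xi>|\<mu>. exp (Re (z * \<xi>))) \<le> 1 / 2 * inner z (covariance_op \<mu> z)" for z
    using subg(1) by (simp add: sharp_sub_gaussian_def)
  from sg[of "complex_of_real s"] show "integrable \<mu> (\<lambda>\<xi>. exp (s * Re \<xi>))" by simp
  have "ln (LINT \<xi>|\<mu>. exp (s * Re \<xi>)) \<le> 1 / 2 * (s\<^sup>2 * (LINT z|\<mu>. (Re z)\<^sup>2))"
    using sg[of "complex_of_real s"]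
    by (simp add: covariance_op_def covariance_def inner_complex_def mean_mu power2_eq_square mult.commute mult.left_commute)
  also have "\<dots> \<le> 1 / 2 * (s\<^sup>2 * (2 / real \<beta>))"
    using diag2(2) by (intro mult_left_mono) auto
  finally show "(LINT \<xi>|\<mu>. exp (s * Re \<xi>)) \<le> exp (s\<^sup>2 / real \<beta>)"
    by (intro le_exp_of_ln_le integral_nonneg_AE) auto
qed

text \<open>The real part of the trace of \<open>c X\<close>; the trace is real when
  \<open>c\<close> is Hermitian.\<close>

definition pairing :: "nat \<Rightarrow> (nat \<Rightarrow> nat \<Rightarrow> complex) \<Rightarrow> 'a \<Rightarrow> real" where
  "pairing n c \<omega> = Re (\<Sum>k<n. \<Sum>l<n. c l k * Xf n k l \<omega>)"

lemma pairing_meas [measurable]: "pairing n c \<in> borel_measurable (M n)"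
  unfolding pairing_def[abs_def]
proof (rule measurable_compose[OF _ measurable_Re])
  show "(\<lambda>\<omega>. \<Sum>k<n. \<Sum>l<n. c l k * Xf n k l \<omega>) \<in> borel_measurable (M n)"
    by (intro borel_measurable_sum borel_measurable_times borel_measurable_const X_meas) auto
qed

lemma sum_upper:
  fixes f :: "nat \<Rightarrow> nat \<Rightarrow> real"
  assumes "\<And>k l. k < n \<Longrightarrow> l < n \<Longrightarrow> f k l = f l k"
  shows "(\<Sum>k<n. \<Sum>l<n. f k l) = (\<Sum>(k, l)\<in>{(i, j). i \<le> j \<and> j < n}. if k = l then f k l else 2 * f k l)"
proof -
  let ?U = "{(i, j). i < j \<and> j < n}" and ?D = "(\<lambda>i. (i, i)) ` {..<n}" and ?L = "{(i, j). j < i \<and> i < n}"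
  have fin: "finite ?U" "finite ?L" "finite ?D"
    by (rule finite_subset[of _ "{..<n} \<times> {..<n}"]; auto)+
  have "(\<Sum>k<n. \<Sum>l<n. f k l) = (\<Sum>(k, l)\<in>{..<n} \<times> {..<n}. f k l)" by (simp add: sum.cartesian_product)
  also have "{..<n} \<times> {..<n} = ?D \<union> (?U \<union> ?L)" by auto
  also have "(\<Sum>(k, l)\<in>?D \<union> (?U \<union> ?L). f k l) = (\<Sum>(k, l)\<in>?D. f k l) + ((\<Sum>(k, l)\<in>?U. f k l) + (\<Sum>(k, l)\<in>?L. f k l))"
    using fin by (subst sum.union_disjoint, force, force, force, subst sum.union_disjoint) auto
  also have "(\<Sum>(k, l)\<in>?L. f k l) = (\<Sum>(k, l)\<in>?U. f k l)"
    by (rule sum.reindex_bij_witness[where i = prod.swap and j = prod.swap]) (use assms in auto)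
  also have "(\<Sum>(k, l)\<in>?D. f k l) + ((\<Sum>(k, l)\<in>?U. f k l) + (\<Sum>(k, l)\<in>?U. f k l))
     = (\<Sum>(k, l)\<in>?D. if k = l then f k l else 2 * f k l) + (\<Sum>(k, l)\<in>?U. if k = l then f k l else 2 * f k l)"
  proof -
    have "(\<Sum>(k, l)\<in>?D. if k = l then f k l else 2 * f k l) = (\<Sum>(k, l)\<in>?D. f k l)"
      by (rule sum.cong) auto
    moreover have "(\<Sum>(k, l)\<in>?U. if k = l then f k l else 2 * f k l) = (\<Sum>(k, l)\<in>?U. 2 * f k l)"
      by (rule sum.cong) auto
    moreover have "(\<Sum>(k, l)\<in>?U. 2 * f k l) = 2 * (\<Sum>(k, l)\<in>?U. f k l)"
      by (simp add: sum_distrib_left case_prod_beta)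
    ultimately show ?thesis by simp
  qed
  also have "\<dots> = (\<Sum>(k, l)\<in>?D \<union> ?U. if k = l then f k l else 2 * f k l)"
    using fin by (intro sum.union_disjoint[symmetric]) auto
  also have "?D \<union> ?U = {(i, j). i \<le> j \<and> j < n}" by auto
  finally show ?thesis .
qed

text \<open>An entry above the diagonal occurs together with its conjugate, hence with parameter
  \<open>2 * c j i\<close>, and contributes \<open>2 * (cmod (c i j))^2 / \<beta>\<close>, the share
  of two positions. A diagonal entry contributes \<open>(cmod (c i i))^2 / \<beta>\<close>. The sum
  is the squared Hilbert-Schmidt norm over \<open>\<beta>\<close>, as for Gaussian matrices.\<close>

lemma laplace_pairing:
  assumes c: "hermitian_fun n c"
  shows "integrable (M n) (\<lambda>\<omega>. exp (pairing n c \<omega>))"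
    "(LINT \<omega>|M n. exp (pairing n c \<omega>)) \<le> exp ((\<Sum>k<n. \<Sum>l<n. (cmod (c k l))\<^sup>2) / real \<beta>)"
proof -
  interpret prob_space "M n" by (rule prob_M)
  let ?I = "{(i, j). i \<le> j \<and> j < n}"
  have fin: "finite ?I" by (rule finite_subset[of _ "{..<n} \<times> {..<n}"]) auto
  define g where "g p x = (case p of (i, j) \<Rightarrow> exp (Re ((if i = j then c j i else 2 * c j i) * x)))" for p :: "nat \<times> nat" and x :: complex
  define V where "V p \<omega> = g p ((\<lambda>(i, j). Xf n i j) p \<omega>)" for p \<omega>
  have gm: "g p \<in> borel_measurable borel" for p
    unfolding g_def by (cases p) (auto simp del: Re_complex_div_eq_0)
  have indV: "indep_vars (\<lambda>_. borel) V ?I"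
    unfolding V_def by (rule indep_vars_compose2[OF X_indep gm])
  have eq: "exp (pairing n c \<omega>) = (\<Prod>p\<in>?I. V p \<omega>)" if w: "\<omega> \<in> space (M n)" for \<omega>
  proof -
    have "pairing n c \<omega> = (\<Sum>k<n. \<Sum>l<n. Re (c l k * Xf n k l \<omega>))"
      by (simp only: pairing_def Re_sum)
    also have "\<dots> = (\<Sum>(k, l)\<in>?I. if k = l then Re (c l k * Xf n k l \<omega>) else 2 * Re (c l k * Xf n k l \<omega>))"
    proof (rule sum_upper)
      fix k l assume kl: "k < n" "l < n"
      have "c k l * Xf n l k \<omega> = cnj (c l k * Xf n k l \<omega>)"
        using hermitian_funD[OF c kl] hermitian_funD[OF X_hermitian[OF w] kl(2) kl(1)] by simp
      then show "Re (c l k * Xf n k l \<omega>) = Re (c k l * Xf n l k \<omega>)" by simp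
    qed
    finally show ?thesis
      unfolding exp_sum[OF fin, symmetric] V_def g_def
      by (simp add: exp_sum[OF fin] case_prod_beta) (intro prod.cong refl, auto simp: algebra_simps)
  qed
  have intV: "integrable (M n) (V p) \<and> expectation (V p) \<le>
      exp ((case p of (k, l) \<Rightarrow> if k = l then (cmod (c k l))\<^sup>2 else 2 * (cmod (c k l))\<^sup>2) / real \<beta>)"
    if p: "p \<in> ?I" for p
  proof -
    obtain i j where ij: "p = (i, j)" "i \<le> j" "j < n" using p by auto
    have rv: "Xf n i j \<in> borel_measurable (M n)" using ij X_meas_upper by auto
    have g1: "(\<lambda>\<omega>. g p (Xf n i j \<omega>)) = V p" by (simp add: V_def ij fun_eq_iff)
    have int: "integrable (M n) (V p) \<longleftrightarrow> integrable (distr (M n) borel (Xf n i j)) (g p)"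
      and E: "expectation (V p) = (LINT x|distr (M n) borel (Xf n i j). g p x)"
      unfolding g1[symmetric] using rv gm[of p] by (auto simp: integrable_distr_eq integral_distr)
    show ?thesis
    proof (cases "i = j")
      case True
      have ci: "cnj (c i i) = c i i" using hermitian_funD[OF c, of i i] ij True by simp
      then have "Im (c i i) = 0" by (simp add: complex_eq_iff)
      then have gp: "g p x = exp (Re (c i i) * Re x)" for x by (simp add: g_def ij True)
      have "(cmod (c i i))\<^sup>2 = (Re (c i i))\<^sup>2" using \<open>Im (c i i) = 0\<close> by (simp add: cmod_power2)
      with laplace_mu[of "Re (c i i)"] X_diag_law[of i n] ij True show ?thesis
        unfolding int E gp by simp
    next
      case False
      then have lt: "i < j" using ij by simp
      have gp: "g p x = exp (Re ((2 * c j i) * x))" for x using False by (simp add: g_def ij)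
      have "cmod (c j i) = cmod (c i j)" using hermitian_funD[OF c, of i j] ij lt by (metis complex_mod_cnj less_trans)
      then have e: "(cmod (2 * c j i))\<^sup>2 / (2 * real \<beta>) = (if i = j then (cmod (c i j))\<^sup>2 else 2 * (cmod (c i j))\<^sup>2) / real \<beta>"
        using False by (simp add: norm_mult power_mult_distrib)
      show ?thesis
        unfolding int E gp X_off_law[OF lt ij(3)] unfolding ij(1) prod.case e[symmetric] by (intro conjI laplace_nu)
    qed
  qed
  have I: "integrable (M n) (\<lambda>\<omega>. \<Prod>p\<in>?I. V p \<omega>)"
    using intV by (intro indep_vars_integrable fin indV) auto
  show "integrable (M n) (\<lambda>\<omega>. exp (pairing n c \<omega>))"
    using I eq by (subst Bochner_Integration.integrable_cong[OF refl]) auto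
  have "expectation (\<lambda>\<omega>. exp (pairing n c \<omega>)) = expectation (\<lambda>\<omega>. \<Prod>p\<in>?I. V p \<omega>)"
    by (intro Bochner_Integration.integral_cong refl eq)
  also have "\<dots> = (\<Prod>p\<in>?I. expectation (V p))"
    using intV by (intro indep_vars_lebesgue_integral fin indV) auto
  also have "\<dots> \<le> (\<Prod>p\<in>?I. exp ((case p of (k, l) \<Rightarrow> if k = l then (cmod (c k l))\<^sup>2 else 2 * (cmod (c k l))\<^sup>2) / real \<beta>))"
    using intV by (intro prod_mono conjI integral_nonneg_AE AE_I2) (auto simp: V_def g_def case_prod_beta)
  also have "\<dots> = exp ((\<Sum>p\<in>?I. case p of (k, l) \<Rightarrow> if k = l then (cmod (c k l))\<^sup>2 else 2 * (cmod (c k l))\<^sup>2) / real \<beta>)"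
    by (simp add: exp_sum[OF fin] sum_divide_distrib)
  also have "(\<Sum>p\<in>?I. case p of (k, l) \<Rightarrow> if k = l then (cmod (c k l))\<^sup>2 else 2 * (cmod (c k l))\<^sup>2)
     = (\<Sum>k<n. \<Sum>l<n. (cmod (c k l))\<^sup>2)"
  proof (rule sum_upper[symmetric])
    fix k l assume "k < n" "l < n"
    then show "(cmod (c k l))\<^sup>2 = (cmod (c l k))\<^sup>2" using hermitian_funD[OF c, of k l] by (metis complex_mod_cnj)
  qed
  finally show "(LINT \<omega>|M n. exp (pairing n c \<omega>)) \<le> exp ((\<Sum>k<n. \<Sum>l<n. (cmod (c k l))\<^sup>2) / real \<beta>)" .
qed

end

section \<open>The Hilbert-Schmidt norm and a net of low-rank matrices\<close>

definition hsn :: "nat \<Rightarrow> (nat \<Rightarrow> nat \<Rightarrow> complex) \<Rightarrow> real" where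
  "hsn n a = L2_set (\<lambda>(k, l). cmod (a k l)) ({..<n} \<times> {..<n})"

lemma hsn_nonneg: "0 \<le> hsn n a"
  unfolding hsn_def by (rule L2_set_nonneg)

lemma hsn_sqrt: "hsn n a = sqrt (\<Sum>k<n. \<Sum>l<n. (cmod (a k l))\<^sup>2)"
  by (simp add: hsn_def L2_set_def sum.cartesian_product case_prod_beta)

lemma hsn_square: "(hsn n a)\<^sup>2 = (\<Sum>k<n. \<Sum>l<n. (cmod (a k l))\<^sup>2)"
proof -
  have "0 \<le> (\<Sum>k<n. \<Sum>l<n. (cmod (a k l))\<^sup>2)" by (intro sum_nonneg zero_le_power2)
  then show ?thesis unfolding hsn_sqrt by (rule real_sqrt_pow2)
qed

lemma hsn_triangle: "hsn n (\<lambda>k l. a k l + b k l) \<le> hsn n a + hsn n b"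
proof -
  have "hsn n (\<lambda>k l. a k l + b k l) \<le> L2_set (\<lambda>p. (case p of (k, l) \<Rightarrow> cmod (a k l)) + (case p of (k, l) \<Rightarrow> cmod (b k l))) ({..<n} \<times> {..<n})"
    unfolding hsn_def by (rule L2_set_mono) (auto intro: norm_triangle_ineq)
  also have "\<dots> \<le> hsn n a + hsn n b" unfolding hsn_def by (rule L2_set_triangle_ineq)
  finally show ?thesis .
qed

lemma hsn_scale: "hsn n (\<lambda>k l. c * a k l) = cmod c * hsn n a"
proof -
  have "hsn n (\<lambda>k l. c * a k l) = L2_set (\<lambda>p. cmod c * (case p of (k, l) \<Rightarrow> cmod (a k l))) ({..<n} \<times> {..<n})"
    unfolding hsn_def by (intro L2_set_cong) (auto simp: norm_mult)
  then show ?thesis by (simp add: L2_set_right_distrib hsn_def)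
qed

lemma hsn_cong: "(\<And>k l. k < n \<Longrightarrow> l < n \<Longrightarrow> a k l = b k l) \<Longrightarrow> hsn n a = hsn n b"
  unfolding hsn_sqrt by simp

lemma hs_norm_eq: "A \<in> carrier_mat n n \<Longrightarrow> hs_norm A = hsn n (\<lambda>k l. A $$ (k, l))"
  unfolding hs_norm_def hsn_sqrt by simp

lemma hsn_swap: "hsn n (\<lambda>k l. a l k) = hsn n a"
  unfolding hsn_sqrt by (subst sum.swap) simp

lemma hsn_entry_le:
  assumes "\<And>k l. k < n \<Longrightarrow> l < n \<Longrightarrow> cmod (a k l) \<le> \<epsilon>" "0 \<le> \<epsilon>"
  shows "hsn n a \<le> real n * \<epsilon>"
proof -
  have "(hsn n a)\<^sup>2 \<le> (\<Sum>k<n. \<Sum>l<n. \<epsilon>\<^sup>2)"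
    unfolding hsn_square using assms by (intro sum_mono power_mono) auto
  also have "\<dots> = (real n * \<epsilon>)\<^sup>2" by (simp add: power2_eq_square)
  finally show ?thesis by (rule power2_le_imp_le) (use assms(2) in auto)
qed

lemma pairing_le_hsn:
  "cmod (\<Sum>k<n. \<Sum>l<n. a l k * b k l) \<le> hsn n a * hsn n b"
proof -
  have "cmod (\<Sum>k<n. \<Sum>l<n. a l k * b k l) \<le> (\<Sum>k<n. \<Sum>l<n. cmod (a l k) * cmod (b k l))"
    by (intro sum_norm_le order_trans[OF norm_sum] sum_mono) (simp add: norm_mult)
  also have "\<dots> = (\<Sum>p\<in>{..<n} \<times> {..<n}. \<bar>case p of (k, l) \<Rightarrow> cmod (a l k)\<bar> * \<bar>case p of (k, l) \<Rightarrow> cmod (b k l)\<bar>)"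
    by (simp add: sum.cartesian_product case_prod_beta)
  also have "\<dots> \<le> hsn n (\<lambda>k l. a l k) * hsn n b"
    unfolding hsn_def by (rule L2_set_mult_ineq)
  finally show ?thesis unfolding hsn_swap[of n a] .
qed

definition grid :: "nat \<Rightarrow> complex set" where
  "grid D = (\<lambda>(x, y). Complex (of_int x / of_nat D) (of_int y / of_nat D)) ` ({- int D..int D} \<times> {- int D..int D})"

lemma finite_grid [simp]: "finite (grid D)"
  by (simp add: grid_def)

lemma card_grid_le: "card (grid D) \<le> (2 * D + 1)\<^sup>2"
proof -
  have "card (grid D) \<le> card ({- int D..int D} \<times> {- int D..int D})"
    unfolding grid_def by (intro card_image_le) simp
  also have "\<dots> = (2 * D + 1)\<^sup>2" by (simp add: card_cartesian_product power2_eq_square nat_add_distrib nat_mult_distrib)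
  finally show ?thesis .
qed

lemma round_coordinate:
  assumes "0 < D" "\<bar>x\<bar> \<le> 1"
  shows "\<lfloor>real D * x\<rfloor> \<in> {- int D..int D}" "\<bar>x - of_int \<lfloor>real D * x\<rfloor> / real D\<bar> \<le> 1 / real D"
    "\<bar>of_int \<lfloor>real D * x\<rfloor> / real D\<bar> \<le> (1::real)"
proof -
  have b: "- real D \<le> real D * x" "real D * x \<le> real D"
    using assms mult_left_mono[of x 1 "real D"] mult_left_mono[of "-1" x "real D"] by (auto simp: abs_le_iff)
  then have "real_of_int (- int D) \<le> real D * x" "real D * x \<le> real_of_int (int D)" by simp_all
  then show m: "\<lfloor>real D * x\<rfloor> \<in> {- int D..int D}"
    by (auto simp: le_floor_iff floor_le_iff)
  have "\<bar>real D * x - of_int \<lfloor>real D * x\<rfloor>\<bar> \<le> 1" by linarith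
  then have "\<bar>real D * x - of_int \<lfloor>real D * x\<rfloor>\<bar> / real D \<le> 1 / real D" by (intro divide_right_mono) auto
  also have "\<bar>real D * x - of_int \<lfloor>real D * x\<rfloor>\<bar> / real D = \<bar>x - of_int \<lfloor>real D * x\<rfloor> / real D\<bar>"
  proof -
    have "x - of_int \<lfloor>real D * x\<rfloor> / real D = (real D * x - of_int \<lfloor>real D * x\<rfloor>) / real D"
      using assms(1) by (simp add: field_simps)
    then show ?thesis by (simp add: abs_divide)
  qed
  finally show "\<bar>x - of_int \<lfloor>real D * x\<rfloor> / real D\<bar> \<le> 1 / real D" .
  have "\<bar>\<lfloor>real D * x\<rfloor>\<bar> \<le> int D" using m by auto
  then have "real_of_int \<bar>\<lfloor>real D * x\<rfloor>\<bar> \<le> real_of_int (int D)" by (simp only: of_int_le_iff)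
  then show "\<bar>of_int \<lfloor>real D * x\<rfloor> / real D\<bar> \<le> (1::real)" using assms(1) by (simp add: abs_divide)
qed

lemma grid_approx:
  assumes "0 < D" "cmod z \<le> 1"
  shows "\<exists>g\<in>grid D. \<bar>Re g\<bar> \<le> 1 \<and> cmod g \<le> 2 \<and> cmod (z - g) \<le> 2 / real D"
proof -
  have z: "\<bar>Re z\<bar> \<le> 1" "\<bar>Im z\<bar> \<le> 1" using assms(2) abs_Re_le_cmod[of z] abs_Im_le_cmod[of z] by linarith+
  define g where "g = Complex (of_int \<lfloor>real D * Re z\<rfloor> / real D) (of_int \<lfloor>real D * Im z\<rfloor> / real D)"
  note r = round_coordinate[OF assms(1) z(1)] and i = round_coordinate[OF assms(1) z(2)]
  have "g \<in> grid D" unfolding grid_def g_def using r(1) i(1)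
    by (intro image_eqI[of _ _ "(\<lfloor>real D * Re z\<rfloor>, \<lfloor>real D * Im z\<rfloor>)"]) auto
  moreover have "\<bar>Re g\<bar> \<le> 1" using r(3) by (simp add: g_def)
  moreover have "cmod g \<le> 2" using cmod_le[of g] r(3) i(3) by (simp add: g_def)
  moreover have "cmod (z - g) \<le> 2 / real D" using cmod_le[of "z - g"] r(2) i(2) by (simp add: g_def)
  ultimately show ?thesis by blast
qed

definition low_rank :: "nat \<Rightarrow> nat \<Rightarrow> (nat \<times> nat \<Rightarrow> complex) \<Rightarrow> nat \<Rightarrow> nat \<Rightarrow> complex" where
  "low_rank n r F k l = (\<Sum>q<r. complex_of_real (Re (F (q, n))) * F (q, k) * cnj (F (q, l)))"

text \<open>Column \<open>n\<close> of \<open>F\<close> stores the coefficients and columns below \<open>n\<close> the vectors.\<close>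

definition net :: "nat \<Rightarrow> nat \<Rightarrow> (nat \<times> nat \<Rightarrow> complex) set" where
  "net n r = {F \<in> PiE ({..<r} \<times> {..n}) (\<lambda>_. grid (n ^ 4)). hsn n (low_rank n r F) \<le> 1 + 8 / (real n)\<^sup>2}"

lemma finite_net [simp]: "finite (net n r)"
proof (rule finite_subset)
  show "net n r \<subseteq> PiE ({..<r} \<times> {..n}) (\<lambda>_. grid (n ^ 4))" by (auto simp: net_def)
qed (rule finite_PiE; simp)

text \<open>The logarithm of this bound is of order \<open>r n log n\<close>, which has to stay
  below the speed.\<close>

lemma card_net_le: "card (net n r) \<le> (2 * n ^ 4 + 1) ^ (2 * (r * (n + 1)))"
proof -
  have "card (net n r) \<le> card (PiE ({..<r} \<times> {..n}) (\<lambda>_. grid (n ^ 4)))"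
    by (rule card_mono) (auto simp: net_def intro: finite_PiE)
  also have "\<dots> = card (grid (n ^ 4)) ^ (r * (n + 1))" by (simp add: card_PiE card_cartesian_product)
  also have "\<dots> \<le> ((2 * n ^ 4 + 1)\<^sup>2) ^ (r * (n + 1))" by (intro power_mono card_grid_le) simp
  finally show ?thesis by (simp only: power_mult)
qed

lemma hermitian_low_rank: "hermitian_fun n (low_rank n r F)"
  unfolding hermitian_fun_def low_rank_def cnj_sum complex_cnj_mult complex_cnj_complex_of_real complex_cnj_cnj
  by (intro allI impI sum.cong refl) (simp only: ac_simps)

text \<open>The factors are exchanged one at a time. The last exchange carries the prefactor
  \<open>cmod (a' * b') \<le> 2\<close>, whence \<open>4 = 1 + 1 + 2\<close>.\<close>

lemma triple_product_diff:
  fixes a b c a' b' c' :: complex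
  assumes "cmod (a - a') \<le> e" "cmod (b - b') \<le> e" "cmod (c - c') \<le> e" "cmod b \<le> 1" "cmod c \<le> 1" "cmod a' \<le> 1" "cmod b' \<le> 2"
  shows "cmod (a * b * c - a' * b' * c') \<le> 4 * e"
proof -
  have e: "0 \<le> e" using assms(1) norm_ge_zero order_trans by blast
  have "a * b * c - a' * b' * c' = (a - a') * (b * c) + a' * (b - b') * c + a' * b' * (c - c')"
    by (simp add: algebra_simps)
  also have "cmod \<dots> \<le> cmod ((a - a') * (b * c)) + cmod (a' * (b - b') * c) + cmod (a' * b' * (c - c'))"
    by (intro order_trans[OF norm_triangle_ineq] add_right_mono norm_triangle_ineq)
  also have "\<dots> \<le> e * (1 * 1) + 1 * e * 1 + 1 * 2 * e"
    unfolding norm_mult using assms e by (intro add_mono mult_mono) auto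
  finally show ?thesis by simp
qed

text \<open>Let \<open>\<sigma>\<close> be the l2-norm of the selected eigenvalues. The matrix
  \<open>H\<close> with the same eigenvectors and the eigenvalues \<open>lam i / \<sigma>\<close>
  has Hilbert-Schmidt norm 1 and pairs with \<open>a\<close> to \<open>\<sigma>\<close>. Rounding it
  to the grid moves it by at most \<open>8 / n^2\<close>, and pairing with \<open>a\<close>, of norm
  at most \<open>3 * n\<close>, makes this \<open>24 / n\<close>.\<close>

lemma spectral_net:
  assumes s: "spectral n a m u lam" and I: "I \<subseteq> {..<m}" "card I \<le> r" and r: "r \<le> n"
    and hs: "hsn n a \<le> 3 * real n" and S: "0 < (\<Sum>i\<in>I. (lam i)\<^sup>2)"
  shows "\<exists>F\<in>net n r. sqrt (\<Sum>i\<in>I. (lam i)\<^sup>2) - 24 / real n \<le> Re (\<Sum>k<n. \<Sum>l<n. low_rank n r F l k * a k l)"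
proof -
  have u: "orthonormal n m u" using s by (simp add: spectral_def)
  have finI: "finite I" using I(1) finite_subset by blast
  obtain e where e: "bij_betw e {..<card I} I" using bij_betw_from_nat_into_finite[OF finI] by blast
  have em: "e q < m" if "q < card I" for q using e I(1) that by (auto simp: bij_betw_def)
  define \<sigma> where "\<sigma> = sqrt (\<Sum>i\<in>I. (lam i)\<^sup>2)"
  have \<sigma>: "0 < \<sigma>" "\<sigma>\<^sup>2 = (\<Sum>i\<in>I. (lam i)\<^sup>2)" using S by (auto simp: \<sigma>_def)
  have "I \<noteq> {}" using S by auto
  then have "0 < card I" using finI by (simp add: card_gt_0_iff)
  then have n: "0 < n" using I(2) r by simp
  \<comment> \<open>The rank \<open>card I\<close> is padded with zeros up to
    \<open>r\<close>.\<close>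
  define \<kappa> where "\<kappa> q = (if q < card I then lam (e q) / \<sigma> else 0)" for q
  define w where "w q k = (if q < card I then u (e q) k else 0)" for q k
  define H where "H k l = (\<Sum>q<r. complex_of_real (\<kappa> q) * w q k * cnj (w q l))" for k l
  have ow: "orthonormal n (card I) w"
    unfolding orthonormal_def
  proof (intro allI impI)
    fix i j assume ij: "i < card I" "j < card I"
    have "ip n (w i) (w j) = ip n (u (e i)) (u (e j))" using ij by (intro ip_cong) (auto simp: w_def)
    also have "\<dots> = (if e i = e j then 1 else 0)" using u em ij by (simp add: orthonormal_def)
    also have "e i = e j \<longleftrightarrow> i = j" using ij by (intro inj_on_eq_iff[OF bij_betw_imp_inj_on[OF e]]) auto
    finally show "ip n (w i) (w j) = (if i = j then 1 else 0)" .
  qed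
  have Hc: "H k l = (\<Sum>q<card I. complex_of_real (\<kappa> q) * w q k * cnj (w q l))" for k l
    unfolding H_def using I(2) by (intro sum.mono_neutral_right) (auto simp: w_def)
  have \<kappa>2: "(\<Sum>q<card I. (\<kappa> q)\<^sup>2) = 1"
  proof -
    have "(\<Sum>q<card I. (\<kappa> q)\<^sup>2) = (\<Sum>q<card I. (lam (e q))\<^sup>2) / \<sigma>\<^sup>2"
      by (simp add: \<kappa>_def power_divide sum_divide_distrib)
    also have "(\<Sum>q<card I. (lam (e q))\<^sup>2) = (\<Sum>i\<in>I. (lam i)\<^sup>2)"
      by (rule sum.reindex_bij_betw[OF e])
    finally show ?thesis using S \<sigma>(2) by simp
  qed
  have \<kappa>1: "\<bar>\<kappa> q\<bar> \<le> 1" for q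
  proof (cases "q < card I")
    case True
    then have "(\<kappa> q)\<^sup>2 \<le> (\<Sum>q<card I. (\<kappa> q)\<^sup>2)" by (intro member_le_sum) auto
    then have "(\<kappa> q)\<^sup>2 \<le> 1" by (simp only: \<kappa>2)
    then show ?thesis by (simp add: abs_square_le_1)
  qed (simp add: \<kappa>_def)
  have w1: "cmod (w q k) \<le> 1" if "k < n" for q k
    using orthonormal_norm_le[OF u em that] by (auto simp: w_def)
  have H1: "hsn n H = 1"
  proof -
    have "(hsn n H)\<^sup>2 = (\<Sum>l<n. \<Sum>k<n. (cmod (\<Sum>q<card I. (complex_of_real (\<kappa> q) * cnj (w q l)) * w q k))\<^sup>2)"
      unfolding hsn_square Hc by (subst sum.swap) (simp add: ac_simps)
    also have "\<dots> = (\<Sum>l<n. \<Sum>q<card I. (\<kappa> q)\<^sup>2 * (cmod (w q l))\<^sup>2)"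
      by (simp add: norm_orthonormal_sum[OF ow] norm_mult power_mult_distrib)
    also have "\<dots> = (\<Sum>q<card I. (\<kappa> q)\<^sup>2 * (\<Sum>l<n. (cmod (w q l))\<^sup>2))"
      by (subst sum.swap) (simp add: sum_distrib_left)
    also have "\<dots> = 1" using orthonormal_unit[OF ow] \<kappa>2 by simp
    finally show ?thesis using hsn_nonneg[of n H] by (simp add: power2_eq_1_iff)
  qed
  have Ha: "(\<Sum>k<n. \<Sum>l<n. H l k * a k l) = (\<Sum>q<card I. complex_of_real (\<kappa> q) * ip n (w q) (mv n a (w q)))"
  proof -
    have "(\<Sum>k<n. \<Sum>l<n. H l k * a k l) = (\<Sum>k<n. \<Sum>l<n. \<Sum>q<card I. complex_of_real (\<kappa> q) * (cnj (w q k) * (a k l * w q l)))"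
      unfolding Hc sum_distrib_right by (intro sum.cong refl) (simp only: ac_simps)
    also have "\<dots> = (\<Sum>k<n. \<Sum>q<card I. \<Sum>l<n. complex_of_real (\<kappa> q) * (cnj (w q k) * (a k l * w q l)))"
      by (rule sum.cong[OF refl]) (rule sum.swap)
    also have "\<dots> = (\<Sum>q<card I. \<Sum>k<n. \<Sum>l<n. complex_of_real (\<kappa> q) * (cnj (w q k) * (a k l * w q l)))"
      by (rule sum.swap)
    also have "\<dots> = (\<Sum>q<card I. complex_of_real (\<kappa> q) * ip n (w q) (mv n a (w q)))"
      by (simp only: ip_def mv_def sum_distrib_left)
    finally show ?thesis .
  qed
  have "Re (\<Sum>k<n. \<Sum>l<n. H l k * a k l) = (\<Sum>q<card I. \<kappa> q * rq n a (w q))"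
    unfolding Ha rq_def by simp
  also have "\<dots> = (\<Sum>q<card I. (lam (e q))\<^sup>2 / \<sigma>)"
  proof (intro sum.cong refl)
    fix q assume q: "q \<in> {..<card I}"
    then have "w q = u (e q)" by (simp add: w_def fun_eq_iff)
    then have "rq n a (w q) = lam (e q)" using spectral_rq_eigenvector[OF s em] q by simp
    then show "\<kappa> q * rq n a (w q) = (lam (e q))\<^sup>2 / \<sigma>" using q by (simp add: \<kappa>_def power2_eq_square)
  qed
  also have "\<dots> = (\<Sum>i\<in>I. (lam i)\<^sup>2) / \<sigma>"
    unfolding sum_divide_distrib[symmetric] by (subst sum.reindex_bij_betw[OF e]) simp
  also have "\<dots> = \<sigma>" unfolding \<sigma>(2)[symmetric] using \<sigma>(1) by (simp add: power2_eq_square)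
  finally have pH: "Re (\<Sum>k<n. \<Sum>l<n. H l k * a k l) = \<sigma>" .
  have D: "0 < n ^ 4" using n by simp
  define rd where "rd z = (SOME g. g \<in> grid (n ^ 4) \<and> \<bar>Re g\<bar> \<le> 1 \<and> cmod g \<le> 2 \<and> cmod (z - g) \<le> 2 / real (n ^ 4))" for z
  have rd: "rd z \<in> grid (n ^ 4) \<and> \<bar>Re (rd z)\<bar> \<le> 1 \<and> cmod (rd z) \<le> 2 \<and> cmod (z - rd z) \<le> 2 / real (n ^ 4)"
    if "cmod z \<le> 1" for z
  proof -
    have "\<exists>g. g \<in> grid (n ^ 4) \<and> \<bar>Re g\<bar> \<le> 1 \<and> cmod g \<le> 2 \<and> cmod (z - g) \<le> 2 / real (n ^ 4)"
      using grid_approx[OF D that] by blast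
    then show ?thesis unfolding rd_def by (rule someI_ex)
  qed
  define F where "F = (\<lambda>(q, k)\<in>{..<r} \<times> {..n}. rd (if k = n then complex_of_real (\<kappa> q) else w q k))"
  have in1: "cmod (if k = n then complex_of_real (\<kappa> q) else w q k) \<le> 1" if "k \<le> n" for q k
    using w1 \<kappa>1 that by simp
  have FP: "F \<in> PiE ({..<r} \<times> {..n}) (\<lambda>_. grid (n ^ 4))"
  proof (rule PiE_I)
    fix p assume "p \<in> {..<r} \<times> {..n}"
    then obtain q k where p: "p = (q, k)" "q < r" "k \<le> n" by auto
    then show "F p \<in> grid (n ^ 4)" using rd[OF in1[OF p(3), of q]] by (simp add: F_def)
  qed (auto simp: F_def)
  have Fn: "F (q, n) = rd (complex_of_real (\<kappa> q))" if "q < r" for q using that by (simp add: F_def)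
  have Fk: "F (q, k) = rd (w q k)" if "q < r" "k < n" for q k using that by (simp add: F_def)
  have ent: "cmod (H k l - low_rank n r F k l) \<le> real r * (8 / real (n ^ 4))" if kl: "k < n" "l < n" for k l
  proof -
    have "cmod (H k l - low_rank n r F k l) \<le> (\<Sum>q<r. 8 / real (n ^ 4))"
      unfolding H_def low_rank_def sum_subtractf[symmetric]
    proof (rule sum_norm_le)
      fix q assume "q \<in> {..<r}"
      then have q: "q < r" by simp
      have k1: "cmod (complex_of_real (\<kappa> q)) \<le> 1" using \<kappa>1 by simp
      have "cmod (complex_of_real (\<kappa> q) - complex_of_real (Re (rd (complex_of_real (\<kappa> q))))) \<le> cmod (complex_of_real (\<kappa> q) - rd (complex_of_real (\<kappa> q)))"
        using abs_Re_le_cmod[of "complex_of_real (\<kappa> q) - rd (complex_of_real (\<kappa> q))"] by (simp flip: of_real_diff)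
      then have t1: "cmod (complex_of_real (\<kappa> q) - complex_of_real (Re (rd (complex_of_real (\<kappa> q))))) \<le> 2 / real (n ^ 4)"
        using rd[OF k1] by linarith
      have t3: "cmod (cnj (w q l) - cnj (rd (w q l))) \<le> 2 / real (n ^ 4)"
        using rd[OF w1[OF kl(2)], of q] by (metis complex_cnj_diff complex_mod_cnj)
      have "cmod (complex_of_real (\<kappa> q) * w q k * cnj (w q l) - complex_of_real (Re (F (q, n))) * F (q, k) * cnj (F (q, l))) \<le> 4 * (2 / real (n ^ 4))"
        unfolding Fn[OF q] Fk[OF q kl(1)] Fk[OF q kl(2)]
        using rd[OF k1] rd[OF w1[OF kl(1)], of q] w1[OF kl(1), of q] w1[OF kl(2), of q]
        by (intro triple_product_diff t1 t3) auto
      then show "cmod (complex_of_real (\<kappa> q) * w q k * cnj (w q l) - complex_of_real (Re (F (q, n))) * F (q, k) * cnj (F (q, l))) \<le> 8 / real (n ^ 4)"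
        by simp
    qed
    then show ?thesis by simp
  qed
  \<comment> \<open>Each of the \<open>n^2\<close> entries is off by at most
    \<open>8 * r / n^4\<close>, and \<open>r \<le> n\<close>.\<close>
  have diff: "hsn n (\<lambda>k l. H k l - low_rank n r F k l) \<le> 8 / (real n)\<^sup>2"
  proof -
    have "hsn n (\<lambda>k l. H k l - low_rank n r F k l) \<le> real n * (real r * (8 / real (n ^ 4)))"
      by (rule hsn_entry_le[OF ent]) simp_all
    also have "\<dots> \<le> real n * (real n * (8 / real (n ^ 4)))"
      using r by (intro mult_left_mono mult_right_mono) auto
    also have "\<dots> = 8 / (real n)\<^sup>2" using n by (simp add: field_simps power2_eq_square power4_eq_xxxx)
    finally show ?thesis .
  qed
  have "hsn n (low_rank n r F) = hsn n (\<lambda>k l. H k l + (- 1) * (H k l - low_rank n r F k l))" by simp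
  also have "\<dots> \<le> hsn n H + hsn n (\<lambda>k l. (- 1) * (H k l - low_rank n r F k l))" by (rule hsn_triangle)
  also have "hsn n (\<lambda>k l. (- 1) * (H k l - low_rank n r F k l)) = hsn n (\<lambda>k l. H k l - low_rank n r F k l)"
    unfolding hsn_scale by simp
  finally have "hsn n (low_rank n r F) \<le> 1 + 8 / (real n)\<^sup>2" using diff H1 by simp
  with FP have "F \<in> net n r" by (simp add: net_def)
  moreover have "\<sigma> - 24 / real n \<le> Re (\<Sum>k<n. \<Sum>l<n. low_rank n r F l k * a k l)"
  proof -
    have "(\<Sum>k<n. \<Sum>l<n. H l k * a k l) - (\<Sum>k<n. \<Sum>l<n. low_rank n r F l k * a k l)
        = (\<Sum>k<n. \<Sum>l<n. (H l k - low_rank n r F l k) * a k l)"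
      by (simp add: sum_subtractf left_diff_distrib)
    also have "cmod \<dots> \<le> hsn n (\<lambda>k l. H k l - low_rank n r F k l) * hsn n a"
      by (rule pairing_le_hsn)
    also have "\<dots> \<le> 8 / (real n)\<^sup>2 * (3 * real n)"
      using diff hs hsn_nonneg by (intro mult_mono) auto
    also have "\<dots> = 24 / real n" using n by (simp add: power2_eq_square)
    finally have "\<bar>Re ((\<Sum>k<n. \<Sum>l<n. H l k * a k l) - (\<Sum>k<n. \<Sum>l<n. low_rank n r F l k * a k l))\<bar> \<le> 24 / real n"
      using abs_Re_le_cmod order_trans by blast
    then show ?thesis using pH by simp
  qed
  ultimately show ?thesis unfolding \<sigma>_def by (intro bexI)
qed

section \<open>A convex Lipschitz replacement of the power\<close>

definition clamp_slope :: "nat \<Rightarrow> real \<Rightarrow> real \<Rightarrow> real" where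
  "clamp_slope d L x = real d * max 0 (min x L) ^ (d - 1)"

text \<open>Continuing the positive part of \<open>x^d\<close> beyond \<open>L\<close> along its tangent makes it Lipschitz and keeps it
  convex.\<close>

definition tcut :: "nat \<Rightarrow> real \<Rightarrow> real \<Rightarrow> real" where
  "tcut d L x = max 0 (min x L) ^ d + clamp_slope d L x * (x - max 0 (min x L))"

text \<open>Bernoulli's inequality in homogeneous form. Adding the square term turns the new
  left-hand side into the previous one times \<open>q\<close>.\<close>

lemma power_above_tangent:
  fixes p q :: real
  assumes "0 \<le> p" "0 \<le> q"
  shows "p ^ Suc m + real (Suc m) * p ^ m * (q - p) \<le> q ^ Suc m"
proof (induction m)
  case (Suc m)
  have "p ^ Suc (Suc m) + real (Suc (Suc m)) * p ^ Suc m * (q - p)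
      \<le> p ^ Suc (Suc m) + real (Suc (Suc m)) * p ^ Suc m * (q - p) + real (Suc m) * p ^ m * (q - p)\<^sup>2"
    using assms by simp
  also have "\<dots> = (p ^ Suc m + real (Suc m) * p ^ m * (q - p)) * q"
    by (simp add: algebra_simps power2_eq_square)
  also have "\<dots> \<le> q ^ Suc m * q" by (intro mult_right_mono Suc assms)
  finally show ?case by (simp add: mult.commute)
qed simp

lemma tcut_subgradient:
  assumes "0 < d" "0 \<le> L"
  shows "tcut d L x + clamp_slope d L x * (y - x) \<le> tcut d L y"
proof -
  obtain m where d: "d = Suc m" using assms(1) gr0_conv_Suc by auto
  define p where "p = max 0 (min x L)"
  define q where "q = max 0 (min y L)"
  have pq: "0 \<le> p" "p \<le> L" "0 \<le> q" "q \<le> L" using assms(2) by (auto simp: p_def q_def)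
  \<comment> \<open>Outside the clamped range the graph continues with an extremal slope, the
    largest one when \<open>q = L\<close> and 0 when \<open>q = 0\<close>, so comparison with the
    slope at \<open>p\<close> has the right sign.\<close>
  have "0 \<le> (real d * q ^ m - real d * p ^ m) * (y - q)"
  proof -
    consider "y = q" | "q < y" "q = L" | "y < q" "q = 0" using assms(2) unfolding q_def by linarith
    then show ?thesis
    proof cases
      case 2
      then have "p ^ m \<le> q ^ m" using pq by (intro power_mono) auto
      then have "real d * p ^ m \<le> real d * q ^ m" by (intro mult_left_mono) auto
      then show ?thesis using 2(1) by (intro mult_nonneg_nonneg) auto
    next
      case 3
      then have "q ^ m \<le> p ^ m" using pq by (intro power_mono) auto
      then have "real d * q ^ m \<le> real d * p ^ m" by (intro mult_left_mono) auto
      then show ?thesis using 3(1) by (intro mult_nonpos_nonpos) auto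
    qed simp
  qed
  then have "real d * p ^ m * (y - q) \<le> real d * q ^ m * (y - q)" by (simp add: left_diff_distrib)
  moreover have "p ^ d + real d * p ^ m * (q - p) \<le> q ^ d"
    unfolding d using power_above_tangent[OF pq(1,3), of m] by simp
  moreover have "tcut d L x + clamp_slope d L x * (y - x)
     = p ^ d + real d * p ^ m * (q - p) + real d * p ^ m * (y - q)"
    unfolding tcut_def clamp_slope_def p_def[symmetric] by (simp add: d algebra_simps)
  moreover have "tcut d L y = q ^ d + real d * q ^ m * (y - q)"
    unfolding tcut_def clamp_slope_def q_def[symmetric] by (simp add: d)
  ultimately show ?thesis by linarith
qed

lemma clamp_slope_bounds:
  assumes "0 \<le> L"
  shows "0 \<le> clamp_slope d L x" "clamp_slope d L x \<le> real d * L ^ (d - 1)"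
  using assms unfolding clamp_slope_def by (auto intro!: mult_left_mono power_mono)

lemma convex_of_subgradient:
  fixes f g :: "real \<Rightarrow> real"
  assumes "\<And>x y. f x + g x * (y - x) \<le> f y"
  shows "convex_on UNIV f"
proof (rule convex_onI)
  fix t x y :: real assume t: "0 < t" "t < 1"
  define z where "z = (1 - t) *\<^sub>R x + t *\<^sub>R y"
  have "(1 - t) * (f z + g z * (x - z)) + t * (f z + g z * (y - z)) \<le> (1 - t) * f x + t * f y"
    using t by (intro add_mono mult_left_mono assms) auto
  moreover have "(1 - t) * (f z + g z * (x - z)) + t * (f z + g z * (y - z)) = f z"
  proof -
    have "(1 - t) * (x - z) + t * (y - z) = 0" by (simp add: z_def algebra_simps)
    then have "g z * ((1 - t) * (x - z) + t * (y - z)) = 0" by simp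
    then show ?thesis by (simp add: algebra_simps)
  qed
  ultimately show "f ((1 - t) *\<^sub>R x + t *\<^sub>R y) \<le> (1 - t) * f x + t * f y" by (simp add: z_def)
qed simp

lemma tcut_lipschitz:
  assumes "0 < d" "0 \<le> L"
  shows "\<bar>tcut d L x - tcut d L y\<bar> \<le> real d * L ^ (d - 1) * \<bar>x - y\<bar>"
proof -
  have *: "tcut d L x - tcut d L y \<le> real d * L ^ (d - 1) * \<bar>x - y\<bar>" for x y
  proof -
    have "tcut d L x - tcut d L y \<le> clamp_slope d L x * (x - y)"
      using tcut_subgradient[OF assms, of x y] by (simp add: algebra_simps)
    also have "\<dots> \<le> clamp_slope d L x * \<bar>x - y\<bar>"
      using clamp_slope_bounds[OF assms(2)] by (intro mult_left_mono) auto
    also have "\<dots> \<le> real d * L ^ (d - 1) * \<bar>x - y\<bar>"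
      using clamp_slope_bounds[OF assms(2)] by (intro mult_right_mono) auto
    finally show ?thesis .
  qed
  from *[of x y] *[of y x] show ?thesis by (simp add: abs_minus_commute abs_le_iff)
qed

lemma tcut_nonpos: "x \<le> 0 \<Longrightarrow> 2 \<le> d \<Longrightarrow> 0 \<le> L \<Longrightarrow> tcut d L x = 0"
  by (auto simp add: tcut_def clamp_slope_def min_def max_def zero_power)

lemma tcut_middle: "0 \<le> x \<Longrightarrow> x \<le> L \<Longrightarrow> tcut d L x = x ^ d"
  by (simp add: tcut_def min_def max_def)

lemma tcut_nonneg:
  assumes "2 \<le> d" "0 \<le> L"
  shows "0 \<le> tcut d L x"
  using tcut_subgradient[of d L 0 x] assms by (simp add: tcut_nonpos clamp_slope_def zero_power)

lemma tcut_le_power: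
  assumes "0 < d" "0 \<le> x" "0 \<le> L"
  shows "tcut d L x \<le> x ^ d"
proof -
  obtain m where d: "d = Suc m" using assms(1) gr0_conv_Suc by auto
  show ?thesis unfolding tcut_def clamp_slope_def d
    using power_above_tangent[of "max 0 (min x L)" x m] assms by simp
qed

text \<open>\<open>x^d\<close> is the power of the positive part plus, with the sign of
  \<open>(-1)^d\<close>, that of the negative part. Both are cut; for odd \<open>d\<close> the
  result is a difference of two convex functions.\<close>

definition tcut_pair :: "nat \<Rightarrow> real \<Rightarrow> real \<Rightarrow> real" where
  "tcut_pair d L x = tcut d L x + (- 1) ^ d * tcut d L (- x)"

text \<open>Values up to \<open>L\<close> in modulus are untouched, and beyond \<open>L\<close> the
  cut only lowers the modulus. For even \<open>d\<close> the cut function thus lies below the power,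
  which makes deviations of the trace to the left a matter of the bulk alone.\<close>

lemma tcut_pair_diff:
  assumes d: "2 \<le> d" and L: "0 \<le> L"
  shows "\<bar>x ^ d - tcut_pair d L x\<bar> \<le> (if L < \<bar>x\<bar> then \<bar>x\<bar> ^ d else 0)"
    and "even d \<Longrightarrow> tcut_pair d L x \<le> x ^ d"
proof -
  have *: "\<exists>r. x ^ d - tcut_pair d L x = r * (\<bar>x\<bar> ^ d - tcut d L \<bar>x\<bar>) \<and> (r = 1 \<or> r = (- 1) ^ d)"
  proof (cases "0 \<le> x")
    case True
    then show ?thesis using d L by (intro exI[of _ 1]) (simp add: tcut_pair_def tcut_nonpos)
  next
    case False
    have "x ^ d = (- 1) ^ d * (- x) ^ d" by (simp flip: power_mult_distrib)
    then show ?thesis using False d L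
      by (intro exI[of _ "(- 1) ^ d"]) (simp add: tcut_pair_def tcut_nonpos right_diff_distrib)
  qed
  have b: "0 \<le> \<bar>x\<bar> ^ d - tcut d L \<bar>x\<bar>" "\<bar>x\<bar> ^ d - tcut d L \<bar>x\<bar> \<le> \<bar>x\<bar> ^ d"
    using tcut_le_power[of d "\<bar>x\<bar>" L] tcut_nonneg[of d L "\<bar>x\<bar>"] d L by auto
  obtain r where r: "x ^ d - tcut_pair d L x = r * (\<bar>x\<bar> ^ d - tcut d L \<bar>x\<bar>)" "r = 1 \<or> r = (- 1) ^ d"
    using * by blast
  have "\<bar>r\<bar> = 1" using r(2) by (auto simp: power_abs)
  then have "\<bar>x ^ d - tcut_pair d L x\<bar> = \<bar>x\<bar> ^ d - tcut d L \<bar>x\<bar>"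
    unfolding r(1) abs_mult using b(1) by simp
  then show "\<bar>x ^ d - tcut_pair d L x\<bar> \<le> (if L < \<bar>x\<bar> then \<bar>x\<bar> ^ d else 0)"
    using b tcut_middle[of "\<bar>x\<bar>" L d] by (simp add: not_less)
  show "even d \<Longrightarrow> tcut_pair d L x \<le> x ^ d" using r b(1) by auto
qed

lemma trfun_cong:
  assumes "\<And>k l. k < n \<Longrightarrow> l < n \<Longrightarrow> a k l = b k l"
  shows "trfun h n a = trfun h n b"
proof -
  have "spectral n a = spectral n b" using assms by (simp add: spectral_def fun_eq_iff)
  then show ?thesis by (simp only: trfun_def)
qed

section \<open>Concentration of spectral statistics and the net event\<close>

context wigner_ldp
begin

text \<open>Fixed once, so that the same constant serves all sizes and all functions.\<close>

definition conc_const :: real where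
  "conc_const = (SOME c. 0 < c \<and> (\<forall>n g. mat_convex_on (herm_mats \<beta> n) g \<and> mat_lipschitz1_on (herm_mats \<beta> n) g \<longrightarrow>
        integrable (M n) (\<lambda>\<omega>. g (X n \<omega>)) \<and>
        (\<forall>t>0. measure (M n) {\<omega>\<in>space (M n). \<bar>g (X n \<omega>) - (LINT \<omega>'|M n. g (X n \<omega>'))\<bar> > t}
                 \<le> inverse c * exp (- c * t\<^sup>2))))"

lemma conc_const: "0 < conc_const"
  and concentration:
    "mat_convex_on (herm_mats \<beta> n) g \<Longrightarrow> mat_lipschitz1_on (herm_mats \<beta> n) g \<Longrightarrow>
        integrable (M n) (\<lambda>\<omega>. g (X n \<omega>))"
    "mat_convex_on (herm_mats \<beta> n) g \<Longrightarrow> mat_lipschitz1_on (herm_mats \<beta> n) g \<Longrightarrow> 0 < t \<Longrightarrow>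
        measure (M n) {\<omega>\<in>space (M n). \<bar>g (X n \<omega>) - (LINT \<omega>'|M n. g (X n \<omega>'))\<bar> > t}
                 \<le> inverse conc_const * exp (- conc_const * t\<^sup>2)"
proof -
  let ?P = "\<lambda>c. 0 < c \<and> (\<forall>n g. mat_convex_on (herm_mats \<beta> n) g \<and> mat_lipschitz1_on (herm_mats \<beta> n) g \<longrightarrow>
        integrable (M n) (\<lambda>\<omega>. g (X n \<omega>)) \<and>
        (\<forall>t>0. measure (M n) {\<omega>\<in>space (M n). \<bar>g (X n \<omega>) - (LINT \<omega>'|M n. g (X n \<omega>'))\<bar> > t}
                 \<le> inverse c * exp (- c * t\<^sup>2)))"
  have "\<exists>c. ?P c" using cc unfolding convex_concentration_def by blast
  then have P: "?P conc_const" unfolding conc_const_def by (rule someI_ex)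
  then show "0 < conc_const" by blast
  show "mat_convex_on (herm_mats \<beta> n) g \<Longrightarrow> mat_lipschitz1_on (herm_mats \<beta> n) g \<Longrightarrow>
        integrable (M n) (\<lambda>\<omega>. g (X n \<omega>))"
    "mat_convex_on (herm_mats \<beta> n) g \<Longrightarrow> mat_lipschitz1_on (herm_mats \<beta> n) g \<Longrightarrow> 0 < t \<Longrightarrow>
        measure (M n) {\<omega>\<in>space (M n). \<bar>g (X n \<omega>) - (LINT \<omega>'|M n. g (X n \<omega>'))\<bar> > t}
                 \<le> inverse conc_const * exp (- conc_const * t\<^sup>2)"
    using P by simp_all
qed

text \<open>The trace of a \<open>K / sqrt n\<close>-Lipschitz function is
  \<open>K\<close>-Lipschitz in the Hilbert-Schmidt norm, because summing over up to
  \<open>n\<close> eigenvalues costs a factor \<open>sqrt n\<close>. Division by \<open>K\<close>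
  makes the concentration property applicable.\<close>

lemma trfun_concentration:
  assumes n: "0 < n" and h: "convex_on UNIV h" "h 0 = 0" "\<And>x. 0 \<le> h x"
    and K: "\<And>x y. \<bar>h x - h y\<bar> \<le> K / sqrt n * \<bar>x - y\<bar>" "0 < K"
  shows "integrable (M n) (\<lambda>\<omega>. trfun h n (\<lambda>i j. Xf n i j \<omega>))"
    and "0 < t \<Longrightarrow> measure (M n) {\<omega>\<in>space (M n). \<bar>trfun h n (\<lambda>i j. Xf n i j \<omega>)
       - (LINT \<omega>|M n. trfun h n (\<lambda>i j. Xf n i j \<omega>))\<bar> > K * t} \<le> inverse conc_const * exp (- conc_const * t\<^sup>2)"
proof -
  define g where "g A = trfun h n (\<lambda>i j. A $$ (i, j)) / K" for A
  have conv: "mat_convex_on (herm_mats \<beta> n) g"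
    unfolding mat_convex_on_def
  proof (intro ballI)
    fix A B and t :: real assume A: "A \<in> herm_mats \<beta> n" and B: "B \<in> herm_mats \<beta> n" and t: "t \<in> {0..1}"
    have "trfun h n (\<lambda>i j. (complex_of_real (1 - t) \<cdot>\<^sub>m A + complex_of_real t \<cdot>\<^sub>m B) $$ (i, j))
      = trfun h n (\<lambda>i j. complex_of_real (1 - t) * A $$ (i, j) + complex_of_real t * B $$ (i, j))"
      using A B by (intro trfun_cong) (auto simp: herm_mats_iff)
    also have "\<dots> \<le> (1 - t) * trfun h n (\<lambda>i j. A $$ (i, j)) + t * trfun h n (\<lambda>i j. B $$ (i, j))"
      using A B t by (intro trfun_convex h) (auto simp: herm_mats_iff)
    finally show "g (complex_of_real (1 - t) \<cdot>\<^sub>m A + complex_of_real t \<cdot>\<^sub>m B) \<le> (1 - t) * g A + t * g B"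
      unfolding g_def using K(2) by (simp add: field_simps)
  qed
  have lip: "mat_lipschitz1_on (herm_mats \<beta> n) g"
    unfolding mat_lipschitz1_on_def
  proof (intro ballI)
    fix A B assume A: "A \<in> herm_mats \<beta> n" and B: "B \<in> herm_mats \<beta> n"
    have *: "trfun h n (\<lambda>i j. A $$ (i, j)) - trfun h n (\<lambda>i j. B $$ (i, j)) \<le> K * hsn n (\<lambda>i j. A $$ (i, j) - B $$ (i, j))"
      if "A \<in> herm_mats \<beta> n" "B \<in> herm_mats \<beta> n" for A B
    proof -
      have "trfun h n (\<lambda>i j. A $$ (i, j)) - trfun h n (\<lambda>i j. B $$ (i, j))
        \<le> K / sqrt n * sqrt n * sqrt (\<Sum>k<n. \<Sum>l<n. (cmod (A $$ (k, l) - B $$ (k, l)))\<^sup>2)"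
        using that K by (intro trfun_lipschitz_le h) (auto simp: herm_mats_iff)
      then show ?thesis using n by (simp add: hsn_sqrt)
    qed
    have sym: "hsn n (\<lambda>i j. B $$ (i, j) - A $$ (i, j)) = hsn n (\<lambda>i j. A $$ (i, j) - B $$ (i, j))"
      unfolding hsn_sqrt by (simp add: norm_minus_commute)
    have "hs_norm (A - B) = hsn n (\<lambda>i j. (A - B) $$ (i, j))"
      using A B by (intro hs_norm_eq) (auto simp: herm_mats_iff)
    also have "\<dots> = hsn n (\<lambda>i j. A $$ (i, j) - B $$ (i, j))"
      using A B by (intro hsn_cong) (auto simp: herm_mats_iff)
    finally have hs: "hs_norm (A - B) = hsn n (\<lambda>i j. A $$ (i, j) - B $$ (i, j))" .
    have "\<bar>trfun h n (\<lambda>i j. A $$ (i, j)) - trfun h n (\<lambda>i j. B $$ (i, j))\<bar> \<le> K * hs_norm (A - B)"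
      unfolding hs using *[OF A B] *[OF B A] unfolding sym by linarith
    moreover have "\<bar>g A - g B\<bar> = \<bar>trfun h n (\<lambda>i j. A $$ (i, j)) - trfun h n (\<lambda>i j. B $$ (i, j))\<bar> / K"
      unfolding g_def using K(2) by (simp add: abs_divide flip: diff_divide_distrib)
    ultimately show "\<bar>g A - g B\<bar> \<le> hs_norm (A - B)" using K(2) by (simp add: pos_divide_le_eq mult.commute)
  qed
  have gX: "trfun h n (\<lambda>i j. Xf n i j \<omega>) = K * g (X n \<omega>)" for \<omega>
    using K(2) by (simp add: g_def Xf_def)
  show "integrable (M n) (\<lambda>\<omega>. trfun h n (\<lambda>i j. Xf n i j \<omega>))"
    unfolding gX by (intro integrable_mult_right concentration(1) conv lip)
  assume t: "0 < t"
  have "\<bar>K * g (X n \<omega>) - (LINT \<omega>|M n. K * g (X n \<omega>))\<bar> > K * t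
     \<longleftrightarrow> \<bar>g (X n \<omega>) - (LINT \<omega>|M n. g (X n \<omega>))\<bar> > t" for \<omega>
    using K(2) by (simp add: abs_mult flip: right_diff_distrib)
  then show "measure (M n) {\<omega>\<in>space (M n). \<bar>trfun h n (\<lambda>i j. Xf n i j \<omega>)
       - (LINT \<omega>|M n. trfun h n (\<lambda>i j. Xf n i j \<omega>))\<bar> > K * t} \<le> inverse conc_const * exp (- conc_const * t\<^sup>2)"
    unfolding gX using concentration(2)[OF conv lip t] by simp
qed

lemma hsn_X_meas: "(\<lambda>\<omega>. hsn n (\<lambda>i j. Xf n i j \<omega>)) \<in> borel_measurable (M n)"
  unfolding hsn_sqrt
proof (rule measurable_compose[where g = sqrt])
  show "(\<lambda>\<omega>. \<Sum>k<n. \<Sum>l<n. (cmod (Xf n k l \<omega>))\<^sup>2) \<in> borel_measurable (M n)"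
    by (intro borel_measurable_sum borel_measurable_power measurable_compose[OF X_meas borel_measurable_norm]) auto
qed (rule borel_measurable_sqrt)

lemma second_moment_entry:
  assumes "i < n" "j < n"
  shows "integrable (M n) (\<lambda>\<omega>. (cmod (Xf n i j \<omega>))\<^sup>2)" "(LINT \<omega>|M n. (cmod (Xf n i j \<omega>))\<^sup>2) \<le> 2"
proof -
  have up: "integrable (M n) (\<lambda>\<omega>. (cmod (Xf n i j \<omega>))\<^sup>2) \<and> (LINT \<omega>|M n. (cmod (Xf n i j \<omega>))\<^sup>2) \<le> 2"
    if ij: "i \<le> j" "j < n" for i j
  proof -
    have rv: "Xf n i j \<in> borel_measurable (M n)" using ij by (rule X_meas_upper)
    have sq: "(\<lambda>z::complex. (cmod z)\<^sup>2) \<in> borel_measurable borel" by simp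
    have *: "integrable (M n) (\<lambda>\<omega>. (cmod (Xf n i j \<omega>))\<^sup>2) \<longleftrightarrow> integrable (distr (M n) borel (Xf n i j)) (\<lambda>z. (cmod z)\<^sup>2)"
      "(LINT \<omega>|M n. (cmod (Xf n i j \<omega>))\<^sup>2) = (LINT z|distr (M n) borel (Xf n i j). (cmod z)\<^sup>2)"
      by (simp_all add: integrable_distr_eq[OF rv sq] integral_distr[OF rv sq])
    show ?thesis
    proof (cases "i = j")
      case True
      note [measurable_cong] = sets_mu
      have ae: "AE z in \<mu>. (Re z)\<^sup>2 = (cmod z)\<^sup>2" using mu_real by eventually_elim (simp add: cmod_power2)
      have "integrable \<mu> (\<lambda>z. (cmod z)\<^sup>2)"
        by (rule integrable_cong_AE_imp[OF diag2(1) _ ae]) simp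
      moreover have "(LINT z|\<mu>. (cmod z)\<^sup>2) = (LINT z|\<mu>. (Re z)\<^sup>2)"
        using ae by (intro integral_cong_AE) auto
      moreover have "2 / real \<beta> \<le> 2" using beta by auto
      ultimately show ?thesis using diag2(2) X_diag_law[OF ij(2)] True unfolding * by simp
    next
      case False
      then show ?thesis using norm2_nu X_off_law[of i j n] ij unfolding * by simp
    qed
  qed
  have "integrable (M n) (\<lambda>\<omega>. (cmod (Xf n i j \<omega>))\<^sup>2) \<and> (LINT \<omega>|M n. (cmod (Xf n i j \<omega>))\<^sup>2) \<le> 2"
  proof (cases "i \<le> j")
    case False
    have "cmod (Xf n i j \<omega>) = cmod (Xf n j i \<omega>)" if "\<omega> \<in> space (M n)" for \<omega>
      using hermitian_funD[OF X_hermitian[OF that] assms] by (metis complex_mod_cnj)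
    then have "integrable (M n) (\<lambda>\<omega>. (cmod (Xf n i j \<omega>))\<^sup>2) = integrable (M n) (\<lambda>\<omega>. (cmod (Xf n j i \<omega>))\<^sup>2)"
      "(LINT \<omega>|M n. (cmod (Xf n i j \<omega>))\<^sup>2) = (LINT \<omega>|M n. (cmod (Xf n j i \<omega>))\<^sup>2)"
      by (auto intro!: Bochner_Integration.integrable_cong Bochner_Integration.integral_cong)
    then show ?thesis using up[of j i] False assms by simp
  qed (use up assms in simp)
  then show "integrable (M n) (\<lambda>\<omega>. (cmod (Xf n i j \<omega>))\<^sup>2)" "(LINT \<omega>|M n. (cmod (Xf n i j \<omega>))\<^sup>2) \<le> 2" by auto
qed

text \<open>The Hilbert-Schmidt norm is itself convex and 1-Lipschitz. Its mean is at most
  \<open>2 * n\<close>, since its mean square is at most \<open>2 * n^2\<close>, and a further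
  deviation by \<open>n\<close> costs \<open>exp (- c n^2)\<close>.\<close>

lemma hsn_tail:
  assumes n: "0 < n"
  shows "measure (M n) {\<omega>\<in>space (M n). hsn n (\<lambda>i j. Xf n i j \<omega>) > 3 * real n} \<le> inverse conc_const * exp (- conc_const * (real n)\<^sup>2)"
proof -
  interpret prob_space "M n" by (rule prob_M)
  let ?h = "\<lambda>\<omega>. hsn n (\<lambda>i j. Xf n i j \<omega>)"
  have conv: "mat_convex_on (herm_mats \<beta> n) hs_norm"
    unfolding mat_convex_on_def
  proof (intro ballI)
    fix A B and t :: real assume A: "A \<in> herm_mats \<beta> n" and B: "B \<in> herm_mats \<beta> n" and t: "t \<in> {0..1}"
    have "hs_norm (complex_of_real (1 - t) \<cdot>\<^sub>m A + complex_of_real t \<cdot>\<^sub>m B)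
       = hsn n (\<lambda>i j. complex_of_real (1 - t) * A $$ (i, j) + complex_of_real t * B $$ (i, j))"
      using A B by (subst hs_norm_eq[of _ n]) (auto simp: herm_mats_iff intro!: hsn_cong)
    also have "\<dots> \<le> hsn n (\<lambda>i j. complex_of_real (1 - t) * A $$ (i, j)) + hsn n (\<lambda>i j. complex_of_real t * B $$ (i, j))"
      by (rule hsn_triangle)
    also have "\<dots> = (1 - t) * hs_norm A + t * hs_norm B"
      using A B t by (simp add: hsn_scale hs_norm_eq[of A n] hs_norm_eq[of B n] herm_mats_iff del: of_real_diff)
    finally show "hs_norm (complex_of_real (1 - t) \<cdot>\<^sub>m A + complex_of_real t \<cdot>\<^sub>m B) \<le> (1 - t) * hs_norm A + t * hs_norm B" .
  qed
  have lip: "mat_lipschitz1_on (herm_mats \<beta> n) hs_norm"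
    unfolding mat_lipschitz1_on_def
  proof (intro ballI)
    fix A B assume A: "A \<in> herm_mats \<beta> n" and B: "B \<in> herm_mats \<beta> n"
    have hs: "hs_norm (A - B) = hsn n (\<lambda>i j. A $$ (i, j) - B $$ (i, j))" if "A \<in> herm_mats \<beta> n" "B \<in> herm_mats \<beta> n" for A B
      using that by (subst hs_norm_eq[of _ n]) (auto simp: herm_mats_iff intro!: hsn_cong)
    have *: "hs_norm A \<le> hs_norm (A - B) + hs_norm B" if "A \<in> herm_mats \<beta> n" "B \<in> herm_mats \<beta> n" for A B
      using hsn_triangle[of n "\<lambda>i j. A $$ (i, j) - B $$ (i, j)" "\<lambda>i j. B $$ (i, j)"] that
      unfolding hs[OF that] by (simp add: hs_norm_eq[of A n] hs_norm_eq[of B n] herm_mats_iff)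
    have "hs_norm (B - A) = hs_norm (A - B)"
      unfolding hs[OF A B] hs[OF B A] hsn_sqrt by (simp add: norm_minus_commute)
    with *[OF A B] *[OF B A] show "\<bar>hs_norm A - hs_norm B\<bar> \<le> hs_norm (A - B)" by linarith
  qed
  have hX: "hs_norm (X n \<omega>) = ?h \<omega>" if "\<omega> \<in> space (M n)" for \<omega>
    using hs_norm_eq[OF X_carrier[OF that]] by (simp add: Xf_def)
  have int: "integrable (M n) ?h"
    using concentration(1)[OF conv lip] hX by (subst Bochner_Integration.integrable_cong[OF refl, of _ _ "\<lambda>\<omega>. hs_norm (X n \<omega>)"]) auto
  have Eq: "expectation (\<lambda>\<omega>. hs_norm (X n \<omega>)) = expectation ?h"
    by (intro Bochner_Integration.integral_cong refl hX)
  have int2: "integrable (M n) (\<lambda>\<omega>. (?h \<omega>)\<^sup>2)"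
    unfolding hsn_square by (intro Bochner_Integration.integrable_sum second_moment_entry) auto
  have "expectation (\<lambda>\<omega>. (?h \<omega>)\<^sup>2) = (\<Sum>k<n. \<Sum>l<n. expectation (\<lambda>\<omega>. (cmod (Xf n k l \<omega>))\<^sup>2))"
    unfolding hsn_square
    by (subst Bochner_Integration.integral_sum; (intro Bochner_Integration.integrable_sum second_moment_entry sum.cong refl Bochner_Integration.integral_sum)?) auto
  also have "\<dots> \<le> (\<Sum>k<n. \<Sum>l<n. 2)" by (intro sum_mono second_moment_entry) auto
  also have "\<dots> = 2 * (real n)\<^sup>2" by (simp add: power2_eq_square)
  also have "\<dots> \<le> (2 * real n)\<^sup>2" by (simp add: power_mult_distrib)
  finally have "expectation (\<lambda>\<omega>. (?h \<omega>)\<^sup>2) \<le> (2 * real n)\<^sup>2" .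
  moreover have "(expectation ?h)\<^sup>2 \<le> expectation (\<lambda>\<omega>. (?h \<omega>)\<^sup>2)"
    using variance_eq[OF int int2] variance_positive[of ?h] by linarith
  ultimately have "(expectation ?h)\<^sup>2 \<le> (2 * real n)\<^sup>2" by linarith
  then have E: "expectation ?h \<le> 2 * real n" by (rule power2_le_imp_le) simp
  have "prob {\<omega>\<in>space (M n). ?h \<omega> > 3 * real n} \<le> prob {\<omega>\<in>space (M n). \<bar>hs_norm (X n \<omega>) - expectation (\<lambda>\<omega>. hs_norm (X n \<omega>))\<bar> > real n}"
  proof (rule finite_measure_mono)
    show "{\<omega>\<in>space (M n). ?h \<omega> > 3 * real n} \<subseteq> {\<omega>\<in>space (M n). \<bar>hs_norm (X n \<omega>) - expectation (\<lambda>\<omega>. hs_norm (X n \<omega>))\<bar> > real n}"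
      using E hX unfolding Eq by force
    have [measurable]: "(\<lambda>\<omega>. hs_norm (X n \<omega>)) \<in> borel_measurable (M n)"
      using concentration(1)[OF conv lip] by simp
    show "{\<omega>\<in>space (M n). \<bar>hs_norm (X n \<omega>) - expectation (\<lambda>\<omega>. hs_norm (X n \<omega>))\<bar> > real n} \<in> events"
      by measurable
  qed
  also have "\<dots> \<le> inverse conc_const * exp (- conc_const * (real n)\<^sup>2)"
    using n by (intro concentration(2) conv lip) simp
  finally show ?thesis .
qed

lemma chernoff_pairing:
  assumes c: "hermitian_fun n c" and N: "(hsn n c)\<^sup>2 \<le> N" "0 < N" and y: "0 < y"
  shows "measure (M n) {\<omega>\<in>space (M n). pairing n c \<omega> \<ge> y} \<le> exp (- real \<beta> * y\<^sup>2 / (4 * N))"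
proof -
  interpret prob_space "M n" by (rule prob_M)
  have b: "0 < real \<beta>" using beta by auto
  \<comment> \<open>The minimizer of \<open>s^2 * N / \<beta> - s * y\<close>.\<close>
  define s where "s = real \<beta> * y / (2 * N)"
  have s: "0 < s" using y N b by (simp add: s_def)
  let ?c = "\<lambda>k l. complex_of_real s * c k l"
  have hc: "hermitian_fun n ?c" using hermitian_fun_lincomb[OF c c, of s 0] by simp
  have ps: "pairing n ?c \<omega> = s * pairing n c \<omega>" for \<omega>
  proof -
    have "(\<Sum>k<n. \<Sum>l<n. complex_of_real s * c l k * Xf n k l \<omega>) = complex_of_real s * (\<Sum>k<n. \<Sum>l<n. c l k * Xf n k l \<omega>)"
      by (simp add: sum_distrib_left mult.assoc)
    then show ?thesis by (simp add: pairing_def)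
  qed
  have eq: "{\<omega>\<in>space (M n). pairing n c \<omega> \<ge> y} = {\<omega>\<in>space (M n). exp (pairing n ?c \<omega>) \<ge> exp (s * y)}"
    using s by (simp add: ps)
  have "prob {\<omega>\<in>space (M n). pairing n c \<omega> \<ge> y} \<le> expectation (\<lambda>\<omega>. exp (pairing n ?c \<omega>)) / exp (s * y)"
    unfolding eq by (rule integral_Markov_inequality_measure[OF laplace_pairing(1)[OF hc] sets.top]) auto
  also have "\<dots> \<le> exp ((hsn n ?c)\<^sup>2 / real \<beta>) / exp (s * y)"
    using laplace_pairing(2)[OF hc] unfolding hsn_square by (intro divide_right_mono) auto
  also have "\<dots> = exp (s\<^sup>2 * (hsn n c)\<^sup>2 / real \<beta> - s * y)"
    unfolding hsn_scale by (simp add: exp_diff power_mult_distrib)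
  also have "\<dots> \<le> exp (s\<^sup>2 * N / real \<beta> - s * y)"
    using N b by (simp add: divide_right_mono mult_left_mono)
  also have "s\<^sup>2 * N / real \<beta> - s * y = - real \<beta> * y\<^sup>2 / (4 * N)"
    using b N by (simp add: s_def power2_eq_square field_simps)
  finally show ?thesis .
qed

text \<open>The exceptional set: outside it every selection of at most \<open>r\<close> eigenvalues
  has l2-norm below \<open>t\<close>, provided that \<open>r \<le> n\<close>. The bound
  \<open>3 * n\<close> on the norm keeps the rounding error at \<open>24 / n\<close>.\<close>

definition net_event :: "nat \<Rightarrow> nat \<Rightarrow> real \<Rightarrow> 'a set" where
  "net_event n r t = {\<omega>\<in>space (M n). hsn n (\<lambda>i j. Xf n i j \<omega>) > 3 * real n} \<union>
     (\<Union>F\<in>net n r. {\<omega>\<in>space (M n). pairing n (low_rank n r F) \<omega> \<ge> t - 24 / real n})"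

lemma net_event_sets [measurable]: "net_event n r t \<in> sets (M n)"
proof -
  note [measurable] = hsn_X_meas[of n]
  show ?thesis unfolding net_event_def by (intro sets.Un sets.finite_UN finite_net) measurable
qed

lemma net_event_prob:
  assumes n: "0 < n" and t: "24 / real n < t"
  shows "measure (M n) (net_event n r t) \<le> inverse conc_const * exp (- conc_const * (real n)\<^sup>2) +
    real ((2 * n ^ 4 + 1) ^ (2 * (r * (n + 1)))) * exp (- real \<beta> * (t - 24 / real n)\<^sup>2 / (4 * (1 + 8 / (real n)\<^sup>2)\<^sup>2))"
proof -
  interpret prob_space "M n" by (rule prob_M)
  note [measurable] = hsn_X_meas[of n]
  let ?A = "\<lambda>F. {\<omega>\<in>space (M n). pairing n (low_rank n r F) \<omega> \<ge> t - 24 / real n}"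
  let ?q = "exp (- real \<beta> * (t - 24 / real n)\<^sup>2 / (4 * (1 + 8 / (real n)\<^sup>2)\<^sup>2))"
  have "prob (net_event n r t) \<le> prob {\<omega>\<in>space (M n). hsn n (\<lambda>i j. Xf n i j \<omega>) > 3 * real n} + prob (\<Union>F\<in>net n r. ?A F)"
    unfolding net_event_def by (intro measure_Un_le sets.finite_UN finite_net) measurable
  also have "prob (\<Union>F\<in>net n r. ?A F) \<le> (\<Sum>F\<in>net n r. prob (?A F))"
    by (intro finite_measure_subadditive_finite finite_net image_subsetI) measurable
  also have "\<dots> \<le> (\<Sum>F\<in>net n r. ?q)"
  proof (rule sum_mono)
    fix F assume "F \<in> net n r"
    then have "hsn n (low_rank n r F) \<le> 1 + 8 / (real n)\<^sup>2" by (simp add: net_def)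
    then have "(hsn n (low_rank n r F))\<^sup>2 \<le> (1 + 8 / (real n)\<^sup>2)\<^sup>2" by (intro power_mono hsn_nonneg)
    moreover have "0 < (1 + 8 / (real n)\<^sup>2)\<^sup>2" by (intro zero_less_power add_pos_nonneg) auto
    ultimately show "prob (?A F) \<le> ?q" using t by (intro chernoff_pairing hermitian_low_rank) auto
  qed
  also have "\<dots> = real (card (net n r)) * ?q" by simp
  also have "\<dots> \<le> real ((2 * n ^ 4 + 1) ^ (2 * (r * (n + 1)))) * ?q"
    by (intro mult_right_mono of_nat_mono card_net_le) simp
  also note hsn_tail[OF n]
  finally show ?thesis by simp
qed

lemma net_event_dominates:
  assumes w: "\<omega> \<in> space (M n)" "\<omega> \<notin> net_event n r t" and s: "spectral n (\<lambda>i j. Xf n i j \<omega>) m u lam"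
    and I: "I \<subseteq> {..<m}" "card I \<le> r" "r \<le> n" and t: "0 < t"
  shows "(\<Sum>i\<in>I. (lam i)\<^sup>2) < t\<^sup>2"
proof (rule ccontr)
  assume "\<not> ?thesis"
  then have ge: "t\<^sup>2 \<le> (\<Sum>i\<in>I. (lam i)\<^sup>2)" by simp
  then have pos: "0 < (\<Sum>i\<in>I. (lam i)\<^sup>2)" using t by (meson less_le_trans zero_less_power)
  have hs: "hsn n (\<lambda>i j. Xf n i j \<omega>) \<le> 3 * real n" using w by (auto simp: net_event_def)
  from spectral_net[OF s I hs pos] obtain F where F: "F \<in> net n r"
    "sqrt (\<Sum>i\<in>I. (lam i)\<^sup>2) - 24 / real n \<le> pairing n (low_rank n r F) \<omega>" unfolding pairing_def by blast
  have "t \<le> sqrt (\<Sum>i\<in>I. (lam i)\<^sup>2)" using ge t by (intro real_le_rsqrt)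
  with F w show False by (auto simp: net_event_def not_le)
qed

end

section \<open>Moments of the entries and the bulk of the spectrum\<close>

lemma power_le_exp:
  assumes "0 \<le> (x::real)"
  shows "x ^ k \<le> real k ^ k * exp x"
proof (cases "k = 0")
  case False
  have "x / real k \<le> exp (x / real k)" using exp_ge_add_one_self[of "x / real k"] by linarith
  then have "(x / real k) ^ k \<le> exp (x / real k) ^ k" using assms by (intro power_mono) auto
  also have "\<dots> = exp x" using False by (simp flip: exp_of_nat_mult)
  finally show ?thesis using False by (simp add: power_divide pos_divide_le_eq mult.commute)
qed (use assms in simp)

text \<open>A sum of exponentials of linear forms, so that sub-Gaussian laws integrate it.\<close>

definition expdom :: "complex \<Rightarrow> real" where
  "expdom z = exp (Re (Complex 2 1 * z)) + exp (Re (Complex 2 (-1) * z))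
     + exp (Re (Complex (-2) 1 * z)) + exp (Re (Complex (-2) (-1) * z))"

lemma expdom_ge: "exp (2 * \<bar>Re z\<bar> + \<bar>Im z\<bar>) \<le> expdom z"
proof -
  have p: "0 \<le> exp x" for x :: real by simp
  show ?thesis
    unfolding expdom_def
    by (cases "0 \<le> Re z"; cases "0 \<le> Im z") (simp_all add: add_increasing add_increasing2)
qed

text \<open>The weight \<open>exp \<bar>Re z\<bar>\<close> is carried along because it dominates
  every tilt with parameter in \<open>[-1, 1]\<close>.\<close>

lemma power_expdom: "cmod z ^ k * exp \<bar>Re z\<bar> \<le> real k ^ k * expdom z"
proof -
  have "cmod z ^ k \<le> real k ^ k * exp (cmod z)" by (rule power_le_exp) simp
  also have "\<dots> \<le> real k ^ k * exp (\<bar>Re z\<bar> + \<bar>Im z\<bar>)"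
    using cmod_le[of z] by (intro mult_left_mono) auto
  finally have "cmod z ^ k * exp \<bar>Re z\<bar> \<le> real k ^ k * exp (\<bar>Re z\<bar> + \<bar>Im z\<bar>) * exp \<bar>Re z\<bar>"
    by (intro mult_right_mono) auto
  also have "\<dots> = real k ^ k * exp (2 * \<bar>Re z\<bar> + \<bar>Im z\<bar>)"
    by (simp add: mult.assoc flip: exp_add)
  also have "\<dots> \<le> real k ^ k * expdom z" by (intro mult_left_mono expdom_ge) simp
  finally show ?thesis .
qed

lemma power_expdom': "cmod z ^ k \<le> real k ^ k * expdom z"
proof -
  have "cmod z ^ k * 1 \<le> cmod z ^ k * exp \<bar>Re z\<bar>" by (intro mult_left_mono) auto
  with power_expdom[of z k] show ?thesis by simp
qed

lemma expdom_nonneg: "0 \<le> expdom z"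
  by (simp add: expdom_def)

lemma spectral_smult:
  "spectral n a m u lam \<Longrightarrow> spectral n (\<lambda>k l. complex_of_real c * a k l) m u (\<lambda>i. c * lam i)"
  unfolding spectral_def by (simp add: sum_distrib_left mult.assoc)

context wigner_ldp
begin

lemma expdom_integrable: "integrable \<mu> expdom" "integrable \<nu> expdom"
  unfolding expdom_def[abs_def] using subg
  by (auto simp only: sharp_sub_gaussian_def intro!: Bochner_Integration.integrable_add)

lemma moment_mu: "integrable \<mu> (\<lambda>z. cmod z ^ k)" and moment_nu: "integrable \<nu> (\<lambda>z. cmod z ^ k)"
proof -
  note [measurable_cong] = sets_mu sets_nu
  show "integrable \<mu> (\<lambda>z. cmod z ^ k)"
    by (rule Bochner_Integration.integrable_bound[OF integrable_mult_right[OF expdom_integrable(1), of "real k ^ k"]])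
      (auto simp: expdom_nonneg power_expdom')
  show "integrable \<nu> (\<lambda>z. cmod z ^ k)"
    by (rule Bochner_Integration.integrable_bound[OF integrable_mult_right[OF expdom_integrable(2), of "real k ^ k"]])
      (auto simp: expdom_nonneg power_expdom')
qed

lemma moment_X:
  assumes ij: "i \<le> j" "j < n"
  shows "integrable (M n) (\<lambda>\<omega>. cmod (Xf n i j \<omega>) ^ k)"
    "(LINT \<omega>|M n. cmod (Xf n i j \<omega>) ^ k) \<le> max (LINT z|\<mu>. cmod z ^ k) (LINT z|\<nu>. cmod z ^ k)"
proof -
  have rv: "Xf n i j \<in> borel_measurable (M n)" using ij by (rule X_meas_upper)
  have sq: "(\<lambda>z::complex. cmod z ^ k) \<in> borel_measurable borel" by simp
  have law: "distr (M n) borel (Xf n i j) = (if i = j then \<mu> else \<nu>)"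
    using X_diag_law[of i n] X_off_law[of i j n] ij by auto
  have "integrable (distr (M n) borel (Xf n i j)) (\<lambda>z. cmod z ^ k)"
    unfolding law using moment_mu moment_nu by auto
  then show "integrable (M n) (\<lambda>\<omega>. cmod (Xf n i j \<omega>) ^ k)"
    by (simp add: integrable_distr_eq[OF rv sq])
  have "(LINT \<omega>|M n. cmod (Xf n i j \<omega>) ^ k) = (LINT z|distr (M n) borel (Xf n i j). cmod z ^ k)"
    by (simp add: integral_distr[OF rv sq])
  then show "(LINT \<omega>|M n. cmod (Xf n i j \<omega>) ^ k) \<le> max (LINT z|\<mu>. cmod z ^ k) (LINT z|\<nu>. cmod z ^ k)"
    unfolding law by simp
qed

lemma X_array: "wigner_array (M n) n (Xf n) 1 (\<lambda>k. max (LINT z|\<mu>. cmod z ^ k) (LINT z|\<nu>. cmod z ^ k))"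
proof -
  interpret prob_space "M n" by (rule prob_M)
  show ?thesis
  proof
    show "Xf n j i \<omega> = cnj (Xf n i j \<omega>)" if "i < n" "j < n" "\<omega> \<in> space (M n)" for i j \<omega>
      using hermitian_funD[OF X_hermitian[OF that(3)] that(2,1)] by simp
    show "indep_vars (\<lambda>_. borel) (\<lambda>(i, j). Xf n i j) {(i, j). i \<le> j \<and> j < n}" by (rule X_indep)
    fix i j assume ij: "i < j" "j < n"
    then have rv: "Xf n i j \<in> borel_measurable (M n)" by (intro X_meas_upper) auto
    have "expectation (Xf n i j) = (LINT z|distr (M n) borel (Xf n i j). z)"
      by (rule integral_distr[OF rv, symmetric]) simp
    then show "expectation (Xf n i j) = 0"
      using wigner X_off_law[OF ij] by (simp add: wigner_matrix_def)
    have "expectation (\<lambda>\<omega>. (cmod (Xf n i j \<omega>))\<^sup>2) = (LINT z|distr (M n) borel (Xf n i j). (cmod z)\<^sup>2)"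
      by (rule integral_distr[OF rv, symmetric]) simp
    then show "expectation (\<lambda>\<omega>. (cmod (Xf n i j \<omega>))\<^sup>2) = 1"
      using norm2_nu X_off_law[OF ij] by simp
  qed (rule moment_X; assumption)+
qed

sublocale Xseq: wigner_sequence M Xf "\<lambda>_. 1" "\<lambda>k. max (LINT z|\<mu>. cmod z ^ k) (LINT z|\<nu>. cmod z ^ k)"
  by unfold_locales (simp_all add: X_array)

definition Z :: "nat \<Rightarrow> 'a \<Rightarrow> real" where
  "Z n = normalized_trace_power d X n"

lemma trX: "\<omega> \<in> space (M n) \<Longrightarrow> Xseq.trY n k \<omega> = mat_trace (X n \<omega> ^\<^sub>m k)"
  using mat_trace_pow[OF X_carrier, of \<omega> n k] by (simp add: Xseq.trY_def Xf_def)

lemma trX_spectral: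
  assumes "\<omega> \<in> space (M n)" "spectral n (\<lambda>i j. Xf n i j \<omega>) m u lam" "0 < k"
  shows "Xseq.trY n k \<omega> = complex_of_real (\<Sum>i<m. lam i ^ k)"
  unfolding trX[OF assms(1)] using spectral_trace_pow[OF X_carrier[OF assms(1)] _ assms(3)] assms(2)
  by (simp add: Xf_def)

lemma Z_spectral:
  assumes w: "\<omega> \<in> space (M n)" and s: "spectral n (\<lambda>i j. Xf n i j \<omega>) m u lam"
  shows "Z n \<omega> = (\<Sum>i<m. (lam i / sqrt n) ^ d) / real n"
proof -
  let ?c = "1 / sqrt (real n)"
  let ?A = "complex_of_real ?c \<cdot>\<^sub>m X n \<omega>"
  have A: "?A \<in> carrier_mat n n" using X_carrier[OF w] by simp
  have "spectral n (\<lambda>i j. ?A $$ (i, j)) m u (\<lambda>i. ?c * lam i)"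
    using spectral_smult[OF s, of ?c] X_carrier[OF w] by (simp add: spectral_def Xf_def)
  from spectral_trace_pow[OF A this, of d] show ?thesis
    using d unfolding Z_def normalized_trace_power_def by simp
qed

lemma Z_trX: "\<omega> \<in> space (M n) \<Longrightarrow> 0 < n \<Longrightarrow> Z n \<omega> = Re (Xseq.trY n d \<omega>) / real n powr (1 + real d / 2)"
proof -
  assume w: "\<omega> \<in> space (M n)" and n: "0 < n"
  obtain m u lam where s: "spectral n (\<lambda>i j. Xf n i j \<omega>) m u lam"
    using spectral_choice[OF X_hermitian[OF w]] by blast
  have "real n powr (1 + real d / 2) = real n * sqrt n ^ d"
    using n by (simp add: powr_add powr_half_sqrt[symmetric] powr_powr powr_realpow[symmetric])
  moreover have "Re (Xseq.trY n d \<omega>) = (\<Sum>i<m. lam i ^ d)"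
    using trX_spectral[OF w s] d by simp
  ultimately show ?thesis
    unfolding Z_spectral[OF w s] by (simp add: power_divide sum_divide_distrib[symmetric] field_simps)
qed

lemma trX_meas: "Xseq.trY n k \<in> borel_measurable (M n)"
proof -
  interpret wigner_array "M n" n "Xf n" 1 "\<lambda>k. max (LINT z|\<mu>. cmod z ^ k) (LINT z|\<nu>. cmod z ^ k)"
    by (rule X_array)
  show ?thesis using integrable_tr_pow[of k] unfolding tr_pow_eq Xseq.trY_def[abs_def] by (rule borel_measurable_integrable)
qed

lemma trX_integrable: "integrable (M n) (Xseq.trY n k)"
proof -
  interpret wigner_array "M n" n "Xf n" 1 "\<lambda>k. max (LINT z|\<mu>. cmod z ^ k) (LINT z|\<nu>. cmod z ^ k)"
    by (rule X_array)
  show ?thesis using integrable_tr_pow[of k] unfolding tr_pow_eq Xseq.trY_def[abs_def] .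
qed

lemma Z_0: "Z 0 \<omega> = 0"
  by (simp add: Z_def normalized_trace_power_def)

lemma Z_meas: "Z n \<in> borel_measurable (M n)"
proof (cases "n = 0")
  case True
  then have "Z n = (\<lambda>_. 0)" by (simp add: Z_0 fun_eq_iff)
  then show ?thesis by simp
next
  case False
  have "(\<lambda>\<omega>. Re (Xseq.trY n d \<omega>) / real n powr (1 + real d / 2)) \<in> borel_measurable (M n)"
    by (intro borel_measurable_divide measurable_compose[OF trX_meas measurable_Re] borel_measurable_const)
  then show ?thesis using Z_trX False by (subst measurable_cong) auto
qed

lemma moment_X_tendsto:
  "(\<lambda>n. (LINT \<omega>|M n. Re (Xseq.trY n k \<omega>)) / real n powr (1 + real k / 2)) \<longlonglongrightarrow> semicircle_moment k"
proof -
  have "(\<lambda>n. Re (Xseq.e k n / complex_of_real (real n powr (1 + real k / 2)))) \<longlonglongrightarrow> Re (complex_of_real (semicircle_moment k))"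
    by (intro tendsto_Re Xseq.moment_tendsto)
  moreover have "Re (Xseq.e k n / complex_of_real (real n powr (1 + real k / 2)))
      = (LINT \<omega>|M n. Re (Xseq.trY n k \<omega>)) / real n powr (1 + real k / 2)" for n
    unfolding Xseq.e_def using integral_Re[OF trX_integrable[of n k]] by (simp add: Re_divide_of_real)
  ultimately show ?thesis by (simp only: Re_complex_of_real)
qed

text \<open>The trace of the cut power of \<open>X / sqrt n\<close>, kept as two traces of convex
  functions because concentration is assumed for convex functions only.\<close>

definition bulk :: "nat \<Rightarrow> real \<Rightarrow> 'a \<Rightarrow> real" where
  "bulk n L \<omega> = trfun (\<lambda>x. tcut d L (x / sqrt n)) n (\<lambda>i j. Xf n i j \<omega>)
     + (- 1) ^ d * trfun (\<lambda>x. tcut d L (- x / sqrt n)) n (\<lambda>i j. Xf n i j \<omega>)"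

lemma bulk_spectral:
  assumes w: "\<omega> \<in> space (M n)"
  shows "\<exists>m u lam. spectral n (\<lambda>i j. Xf n i j \<omega>) m u lam \<and> (\<forall>L. bulk n L \<omega> = (\<Sum>i<m. tcut_pair d L (lam i / sqrt n)))"
proof -
  obtain m u lam where s: "spectral n (\<lambda>i j. Xf n i j \<omega>) m u lam"
    and t: "\<And>h. trfun h n (\<lambda>i j. Xf n i j \<omega>) = (\<Sum>i<m. h (lam i))"
    using spectral_choice[OF X_hermitian[OF w]] by blast
  have "bulk n L \<omega> = (\<Sum>i<m. tcut_pair d L (lam i / sqrt n))" for L
    unfolding bulk_def t tcut_pair_def by (simp add: sum.distrib sum_distrib_left)
  with s show ?thesis by blast
qed

lemma tcut_scaled:
  assumes L: "0 \<le> L" and c: "\<bar>c\<bar> = 1 / sqrt (real n)"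
  shows "convex_on UNIV (\<lambda>x. tcut d L (c * x))" "tcut d L (c * 0) = 0" "0 \<le> tcut d L (c * x)"
    "\<bar>tcut d L (c * x) - tcut d L (c * y)\<bar> \<le> (real d * L ^ (d - 1)) / sqrt n * \<bar>x - y\<bar>"
proof -
  have d0: "0 < d" "2 \<le> d" using d by auto
  show "convex_on UNIV (\<lambda>x. tcut d L (c * x))"
  proof (rule convex_of_subgradient[where g = "\<lambda>x. clamp_slope d L (c * x) * c"])
    fix x y
    show "tcut d L (c * x) + clamp_slope d L (c * x) * c * (y - x) \<le> tcut d L (c * y)"
      using tcut_subgradient[OF d0(1) L, of "c * x" "c * y"] by (simp add: algebra_simps)
  qed
  show "tcut d L (c * 0) = 0" using tcut_nonpos[of 0 d L] d0 L by simp
  show "0 \<le> tcut d L (c * x)" by (rule tcut_nonneg[OF d0(2) L])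
  have "\<bar>c * x - c * y\<bar> = 1 / sqrt n * \<bar>x - y\<bar>"
    unfolding c[symmetric] abs_mult[symmetric] by (simp add: right_diff_distrib)
  with tcut_lipschitz[OF d0(1) L, of "c * x" "c * y"]
  show "\<bar>tcut d L (c * x) - tcut d L (c * y)\<bar> \<le> (real d * L ^ (d - 1)) / sqrt n * \<bar>x - y\<bar>" by simp
qed

lemma bulk_concentration:
  assumes n: "0 < n" and L: "0 < L" and t: "0 < t"
  defines "K \<equiv> real d * L ^ (d - 1)"
  shows "integrable (M n) (bulk n L)"
    and "measure (M n) {\<omega>\<in>space (M n). \<bar>bulk n L \<omega> - (LINT \<omega>|M n. bulk n L \<omega>)\<bar> > 2 * K * t}
       \<le> 2 * inverse conc_const * exp (- conc_const * t\<^sup>2)"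
proof -
  interpret prob_space "M n" by (rule prob_M)
  have K: "0 < K" using L d by (simp add: K_def)
  let ?f = "\<lambda>\<omega>. trfun (\<lambda>x. tcut d L (1 / sqrt n * x)) n (\<lambda>i j. Xf n i j \<omega>)"
  let ?g = "\<lambda>\<omega>. trfun (\<lambda>x. tcut d L (- 1 / sqrt n * x)) n (\<lambda>i j. Xf n i j \<omega>)"
  have c: "\<bar>1 / sqrt (real n)\<bar> = 1 / sqrt (real n)" "\<bar>- 1 / sqrt (real n)\<bar> = 1 / sqrt (real n)" by auto
  note f = trfun_concentration[OF n tcut_scaled(1)[OF less_imp_le[OF L] c(1)] tcut_scaled(2)[OF less_imp_le[OF L] c(1)]
      tcut_scaled(3)[OF less_imp_le[OF L] c(1)] tcut_scaled(4)[OF less_imp_le[OF L] c(1), folded K_def] K]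
  note g = trfun_concentration[OF n tcut_scaled(1)[OF less_imp_le[OF L] c(2)] tcut_scaled(2)[OF less_imp_le[OF L] c(2)]
      tcut_scaled(3)[OF less_imp_le[OF L] c(2)] tcut_scaled(4)[OF less_imp_le[OF L] c(2), folded K_def] K]
  have eq: "bulk n L \<omega> = ?f \<omega> + (- 1) ^ d * ?g \<omega>" for \<omega> by (simp add: bulk_def)
  show int: "integrable (M n) (bulk n L)"
    using f(1) g(1) unfolding eq[abs_def] by (intro Bochner_Integration.integrable_add integrable_mult_right)
  have E: "(LINT \<omega>|M n. bulk n L \<omega>) = expectation ?f + (- 1) ^ d * expectation ?g"
    unfolding eq using f(1) g(1) by simp
  have [measurable]: "?f \<in> borel_measurable (M n)" "?g \<in> borel_measurable (M n)"
    using f(1) g(1) by auto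
  have "prob {\<omega>\<in>space (M n). \<bar>bulk n L \<omega> - (LINT \<omega>|M n. bulk n L \<omega>)\<bar> > 2 * K * t}
     \<le> prob ({\<omega>\<in>space (M n). \<bar>?f \<omega> - expectation ?f\<bar> > K * t} \<union> {\<omega>\<in>space (M n). \<bar>?g \<omega> - expectation ?g\<bar> > K * t})"
  proof (rule finite_measure_mono)
    show "{\<omega>\<in>space (M n). \<bar>bulk n L \<omega> - (LINT \<omega>|M n. bulk n L \<omega>)\<bar> > 2 * K * t}
      \<subseteq> {\<omega>\<in>space (M n). \<bar>?f \<omega> - expectation ?f\<bar> > K * t} \<union> {\<omega>\<in>space (M n). \<bar>?g \<omega> - expectation ?g\<bar> > K * t}"
    proof (rule subsetI, rule ccontr)
      fix \<omega>
      assume 1: "\<omega> \<in> {\<omega>\<in>space (M n). \<bar>bulk n L \<omega> - (LINT \<omega>|M n. bulk n L \<omega>)\<bar> > 2 * K * t}"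
        and 2: "\<omega> \<notin> {\<omega>\<in>space (M n). \<bar>?f \<omega> - expectation ?f\<bar> > K * t} \<union> {\<omega>\<in>space (M n). \<bar>?g \<omega> - expectation ?g\<bar> > K * t}"
      have "\<bar>bulk n L \<omega> - (LINT \<omega>|M n. bulk n L \<omega>)\<bar> = \<bar>(?f \<omega> - expectation ?f) + (- 1) ^ d * (?g \<omega> - expectation ?g)\<bar>"
        unfolding E unfolding eq by (simp add: algebra_simps)
      also have "\<dots> \<le> \<bar>?f \<omega> - expectation ?f\<bar> + \<bar>(- 1) ^ d * (?g \<omega> - expectation ?g)\<bar>" by (rule abs_triangle_ineq)
      also have "\<bar>(- 1) ^ d * (?g \<omega> - expectation ?g)\<bar> = \<bar>?g \<omega> - expectation ?g\<bar>" by (simp add: abs_mult power_abs)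
      finally show False using 1 2 by auto
    qed
  qed measurable
  also have "\<dots> \<le> prob {\<omega>\<in>space (M n). \<bar>?f \<omega> - expectation ?f\<bar> > K * t} + prob {\<omega>\<in>space (M n). \<bar>?g \<omega> - expectation ?g\<bar> > K * t}"
    by (rule measure_Un_le) measurable
  also have "\<dots> \<le> inverse conc_const * exp (- conc_const * t\<^sup>2) + inverse conc_const * exp (- conc_const * t\<^sup>2)"
    by (intro add_mono f(2) g(2) t)
  finally show "measure (M n) {\<omega>\<in>space (M n). \<bar>bulk n L \<omega> - (LINT \<omega>|M n. bulk n L \<omega>)\<bar> > 2 * K * t}
       \<le> 2 * inverse conc_const * exp (- conc_const * t\<^sup>2)" by simp
qed

end

lemma exp_dominated:
  fixes f \<upsilon> :: "nat \<Rightarrow> real"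
  assumes "filterlim (\<lambda>n. f n / \<upsilon> n) at_top sequentially" "filterlim \<upsilon> at_top sequentially"
  shows "\<forall>\<^sub>F n in sequentially. C * exp (- f n) \<le> exp (- a * \<upsilon> n)"
proof -
  have "\<forall>\<^sub>F n in sequentially. a + 1 \<le> f n / \<upsilon> n"
    using assms(1) by (simp add: filterlim_at_top)
  moreover have "\<forall>\<^sub>F n in sequentially. max 1 (ln (max 1 C)) \<le> \<upsilon> n"
    using assms(2) unfolding filterlim_at_top by blast
  ultimately show ?thesis
  proof eventually_elim
    case (elim n)
    then have u: "0 < \<upsilon> n" "ln (max 1 C) \<le> \<upsilon> n" by auto
    have "(a + 1) * \<upsilon> n \<le> f n" using elim(1) u(1) by (simp add: pos_le_divide_eq)
    then have "exp (- f n) \<le> exp (- ((a + 1) * \<upsilon> n))" by simp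
    moreover have "C \<le> exp (\<upsilon> n)"
    proof -
      have "exp (ln (max 1 C)) \<le> exp (\<upsilon> n)" using u(2) by (simp only: exp_le_cancel_iff)
      moreover have "exp (ln (max 1 C)) = max 1 C" by (rule exp_ln) simp
      ultimately show ?thesis by linarith
    qed
    ultimately have "C * exp (- f n) \<le> exp (\<upsilon> n) * exp (- ((a + 1) * \<upsilon> n))"
      by (intro mult_mono) auto
    also have "\<dots> = exp (- a * \<upsilon> n)" by (simp add: algebra_simps flip: exp_add)
    finally show ?case .
  qed
qed

lemma filterlim_powr_at_top_nat: "0 < p \<Longrightarrow> filterlim (\<lambda>n. real n powr p) at_top sequentially"
  by real_asymp

lemma filterlim_scaled_powr:
  assumes "0 < c" "0 < p"
  shows "filterlim (\<lambda>n. c * real n powr p) at_top sequentially"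
  using assms by real_asymp

text \<open>The logarithm of the cardinality of the net on the scale of the speed: the factor
  \<open>n^(- \<kappa>)\<close> beats the logarithm.\<close>

lemma entropy_negligible:
  assumes "0 < \<kappa>" "\<kappa> < p"
  shows "(\<lambda>n. 2 * ((real n powr (p - \<kappa>) + 1) * (real n + 1)) * ln (2 * real n ^ 4 + 1) / real n powr (1 + p)) \<longlonglongrightarrow> 0"
  using assms by real_asymp

section \<open>Choice of scales and the two tail bounds\<close>

context wigner_ldp
begin

abbreviation speed :: "nat \<Rightarrow> real" where
  "speed n \<equiv> real n powr (1 + 2 / real d)"

definition \<kappa> :: real where "\<kappa> = 1 / (2 * (real d)\<^sup>2)"

definition level :: "nat \<Rightarrow> real" where "level n = real n powr \<kappa>"

text \<open>With this rank, \<open>rank * level^2 * n\<close> is at least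
  \<open>n^(1 + 2/d + \<kappa>)\<close>, more than any fixed multiple of the speed, whereas
  \<open>rank * n * log n\<close> stays below the speed.\<close>

definition rank_bound :: "nat \<Rightarrow> nat" where
  "rank_bound n = nat \<lceil>real n powr (2 / real d - \<kappa>)\<rceil>"

abbreviation \<gamma> :: real where "\<gamma> \<equiv> semicircle_moment d"

text \<open>The demands that \<open>1 / (2 * d^2)\<close> has to meet: a level tending to infinity,
  a rank bound that is a positive power of \<open>n\<close>, and a slope small enough for
  concentration to beat the speed. The last amounts to \<open>d^2 - 3 * d + 1 > 0\<close>, true from
  \<open>d = 3\<close> on.\<close>

lemma kappa: "0 < \<kappa>" "\<kappa> < 2 / real d" "0 < 1 - 2 / real d - 2 * \<kappa> * (real d - 1)"
proof -
  have d3: "3 \<le> real d" using d by simp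
  then show "0 < \<kappa>" by (simp add: \<kappa>_def)
  show "\<kappa> < 2 / real d" using d3 by (simp add: \<kappa>_def field_simps power2_eq_square)
  have "1 - 2 / real d - 2 * \<kappa> * (real d - 1) = ((real d)\<^sup>2 - 3 * real d + 1) / (real d)\<^sup>2"
    using d3 by (simp add: \<kappa>_def field_simps power2_eq_square)
  moreover have "0 < (real d)\<^sup>2 - 3 * real d + 1"
  proof -
    have "0 \<le> real d * (real d - 3)" using d3 by (intro mult_nonneg_nonneg) auto
    then show ?thesis by (simp add: power2_eq_square algebra_simps)
  qed
  ultimately show "0 < 1 - 2 / real d - 2 * \<kappa> * (real d - 1)" using d3 by simp
qed

lemma speed_at_top: "filterlim speed at_top sequentially"
  by (rule filterlim_powr_at_top_nat) (simp add: add_pos_nonneg)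

text \<open>If more than \<open>r\<close> eigenvalues exceeded the level, \<open>r\<close> of them
  would already have a sum of squares of at least \<open>t^2\<close>, which is excluded outside the
  net event. So the outliers together have l2-norm below \<open>t\<close>, and the sum of their
  \<open>d\<close>-th powers is at most the power \<open>d - 2\<close> of the largest times the sum
  of squares.\<close>

lemma outlier_sum_le:
  assumes w: "\<omega> \<in> space (M n)" "\<omega> \<notin> net_event n r t" and s: "spectral n (\<lambda>i j. Xf n i j \<omega>) m u lam"
    and n: "0 < n" and r: "r \<le> n" and L: "0 \<le> L" and t: "0 < t" "t\<^sup>2 \<le> real r * (L\<^sup>2 * real n)"
  shows "(\<Sum>i<m. if L < \<bar>lam i / sqrt n\<bar> then \<bar>lam i / sqrt n\<bar> ^ d else 0) \<le> t ^ d / sqrt n ^ d"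
proof -
  define Out where "Out = {i \<in> {..<m}. L < \<bar>lam i / sqrt n\<bar>}"
  have fin: "finite Out" by (simp add: Out_def)
  have big: "L\<^sup>2 * real n \<le> (lam i)\<^sup>2" if "i \<in> Out" for i
  proof -
    have "L * sqrt n \<le> \<bar>lam i\<bar>" using that n by (simp add: Out_def abs_divide pos_less_divide_eq)
    then have "(L * sqrt n)\<^sup>2 \<le> \<bar>lam i\<bar>\<^sup>2" using L by (intro power_mono) auto
    then show ?thesis by (simp add: power_mult_distrib)
  qed
  have "card Out \<le> r"
  proof (rule ccontr)
    assume "\<not> card Out \<le> r"
    then obtain I where I: "I \<subseteq> Out" "card I = r" using obtain_subset_with_card_n[of r Out] by auto
    have "t\<^sup>2 \<le> (\<Sum>i\<in>I. L\<^sup>2 * real n)" using t(2) I(2) by simp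
    also have "\<dots> \<le> (\<Sum>i\<in>I. (lam i)\<^sup>2)" using big I(1) by (intro sum_mono) auto
    also have "\<dots> < t\<^sup>2" using I r t(1) by (intro net_event_dominates[OF w s]) (auto simp: Out_def)
    finally show False by simp
  qed
  then have "(\<Sum>i\<in>Out. (lam i)\<^sup>2) < t\<^sup>2"
    using r t(1) by (intro net_event_dominates[OF w s]) (auto simp: Out_def)
  then have S: "(\<Sum>i\<in>Out. (lam i)\<^sup>2) \<le> t\<^sup>2" by simp
  have lt: "\<bar>lam i\<bar> \<le> t" if "i \<in> Out" for i
  proof -
    have "(lam i)\<^sup>2 \<le> (\<Sum>i\<in>Out. (lam i)\<^sup>2)" using that fin by (intro member_le_sum) auto
    then have "\<bar>lam i\<bar>\<^sup>2 \<le> t\<^sup>2" using S by simp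
    then show ?thesis using t(1) by (intro power2_le_imp_le[of "\<bar>lam i\<bar>" t]) auto
  qed
  obtain k where k: "d = k + 2" using d by (metis add.commute le_Suc_ex numeral_2_eq_2 Suc_leD numeral_3_eq_3)
  have "(\<Sum>i<m. if L < \<bar>lam i / sqrt n\<bar> then \<bar>lam i / sqrt n\<bar> ^ d else 0) = (\<Sum>i\<in>Out. \<bar>lam i / sqrt n\<bar> ^ d)"
    unfolding Out_def by (rule sum.inter_filter[symmetric]) simp
  also have "\<dots> = (\<Sum>i\<in>Out. \<bar>lam i\<bar> ^ d) / sqrt n ^ d"
    by (simp add: power_divide abs_divide sum_divide_distrib)
  also have "(\<Sum>i\<in>Out. \<bar>lam i\<bar> ^ d) \<le> (\<Sum>i\<in>Out. t ^ k * (lam i)\<^sup>2)"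
  proof (rule sum_mono)
    fix i assume "i \<in> Out"
    then have "\<bar>lam i\<bar> ^ k * \<bar>lam i\<bar>\<^sup>2 \<le> t ^ k * \<bar>lam i\<bar>\<^sup>2"
      using lt by (intro mult_right_mono power_mono) auto
    then show "\<bar>lam i\<bar> ^ d \<le> t ^ k * (lam i)\<^sup>2" by (simp only: k power_add power2_abs)
  qed
  also have "\<dots> = t ^ k * (\<Sum>i\<in>Out. (lam i)\<^sup>2)" by (simp add: sum_distrib_left)
  also have "\<dots> \<le> t ^ k * t\<^sup>2" using S t(1) by (intro mult_left_mono) auto
  also have "\<dots> = t ^ d" by (simp add: k power_add power2_eq_square)
  finally show ?thesis by (simp add: divide_right_mono)
qed

text \<open>Three comparisons of the trace with its bulk: one outside the net event for the upper
  tail, a one-sided one for the lower tail at even \<open>d\<close>, and one by the power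
  \<open>2 * d\<close> for the means.\<close>

lemma Z_bulk:
  assumes w: "\<omega> \<in> space (M n)" and n: "0 < n" and L: "0 \<le> L"
  shows "\<omega> \<notin> net_event n r t \<Longrightarrow> r \<le> n \<Longrightarrow> 0 < t \<Longrightarrow> t\<^sup>2 \<le> real r * (L\<^sup>2 * real n) \<Longrightarrow>
      \<bar>real n * Z n \<omega> - bulk n L \<omega>\<bar> \<le> t ^ d / sqrt n ^ d"
    and "even d \<Longrightarrow> bulk n L \<omega> \<le> real n * Z n \<omega>"
    and "0 < L \<Longrightarrow> \<bar>real n * Z n \<omega> - bulk n L \<omega>\<bar> \<le> Re (Xseq.trY n (2 * d) \<omega>) / (real n ^ d * L ^ d)"
proof -
  obtain m u lam where s: "spectral n (\<lambda>i j. Xf n i j \<omega>) m u lam"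
    and b: "\<And>L. bulk n L \<omega> = (\<Sum>i<m. tcut_pair d L (lam i / sqrt n))"
    using bulk_spectral[OF w] by blast
  have Zb: "real n * Z n \<omega> - bulk n L \<omega> = (\<Sum>i<m. (lam i / sqrt n) ^ d - tcut_pair d L (lam i / sqrt n))"
    unfolding Z_spectral[OF w s] b using n by (simp add: sum_subtractf)
  have d2: "2 \<le> d" using d by simp
  have le: "\<bar>real n * Z n \<omega> - bulk n L \<omega>\<bar> \<le> (\<Sum>i<m. if L < \<bar>lam i / sqrt n\<bar> then \<bar>lam i / sqrt n\<bar> ^ d else 0)"
    unfolding Zb by (intro order_trans[OF sum_abs] sum_mono tcut_pair_diff(1)[OF d2 L])
  show "\<omega> \<notin> net_event n r t \<Longrightarrow> r \<le> n \<Longrightarrow> 0 < t \<Longrightarrow> t\<^sup>2 \<le> real r * (L\<^sup>2 * real n) \<Longrightarrow>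
      \<bar>real n * Z n \<omega> - bulk n L \<omega>\<bar> \<le> t ^ d / sqrt n ^ d"
    using outlier_sum_le[OF w _ s n _ L] le by (meson order_trans)
  show "bulk n L \<omega> \<le> real n * Z n \<omega>" if "even d"
  proof -
    have "0 \<le> (\<Sum>i<m. (lam i / sqrt n) ^ d - tcut_pair d L (lam i / sqrt n))"
      using tcut_pair_diff(2)[OF d2 L that] by (intro sum_nonneg) simp
    then show ?thesis using Zb by linarith
  qed
  assume L0: "0 < L"
  note le
  also have "(\<Sum>i<m. if L < \<bar>lam i / sqrt n\<bar> then \<bar>lam i / sqrt n\<bar> ^ d else 0) \<le> (\<Sum>i<m. (lam i / sqrt n) ^ (2 * d) / L ^ d)"
  proof (rule sum_mono)
    fix i
    let ?x = "lam i / sqrt n"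
    have sq: "?x ^ (2 * d) = \<bar>?x\<bar> ^ d * \<bar>?x\<bar> ^ d"
      by (simp only: mult_2 power_add[symmetric] power_even_abs[of "d + d"] even_add simp_thms)
    show "(if L < \<bar>?x\<bar> then \<bar>?x\<bar> ^ d else 0) \<le> ?x ^ (2 * d) / L ^ d"
    proof (cases "L < \<bar>?x\<bar>")
      case True
      then have "L ^ d \<le> \<bar>?x\<bar> ^ d" using L by (intro power_mono) auto
      then have "\<bar>?x\<bar> ^ d * L ^ d \<le> \<bar>?x\<bar> ^ d * \<bar>?x\<bar> ^ d" by (intro mult_left_mono) auto
      then show ?thesis unfolding sq using True L0 by (simp add: pos_le_divide_eq)
    next
      case False
      then show ?thesis unfolding sq using L0 by simp
    qed
  qed
  also have "\<dots> = (\<Sum>i<m. lam i ^ (2 * d)) / (real n ^ d * L ^ d)"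
  proof -
    have "sqrt n ^ (2 * d) = real n ^ d" by (simp add: power_mult)
    then show ?thesis by (simp only: power_divide sum_divide_distrib divide_divide_eq_left)
  qed
  also have "(\<Sum>i<m. lam i ^ (2 * d)) = Re (Xseq.trY n (2 * d) \<omega>)"
    using trX_spectral[OF w s, of "2 * d"] d by simp
  finally show "\<bar>real n * Z n \<omega> - bulk n L \<omega>\<bar> \<le> Re (Xseq.trY n (2 * d) \<omega>) / (real n ^ d * L ^ d)" .
qed

lemma level_pos: "0 < n \<Longrightarrow> 0 < level n"
  by (simp add: level_def)

text \<open>The normalized means of trace and bulk differ by at most a convergent moment of order
  \<open>2 * d\<close> divided by \<open>level^d\<close>, and the level tends to infinity.\<close>

lemma bulk_mean_tendsto: "(\<lambda>n. (LINT \<omega>|M n. bulk n (level n) \<omega>) / real n) \<longlonglongrightarrow> \<gamma>"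
proof -
  let ?EZ = "\<lambda>n. (LINT \<omega>|M n. Re (Xseq.trY n d \<omega>)) / real n powr (1 + real d / 2)"
  let ?m = "\<lambda>n. (LINT \<omega>|M n. Re (Xseq.trY n (2 * d) \<omega>)) / real n powr (1 + real (2 * d) / 2)"
  have "(\<lambda>n. ?EZ n - (LINT \<omega>|M n. bulk n (level n) \<omega>) / real n) \<longlonglongrightarrow> 0"
  proof (rule tendsto_0_le[where K = 1])
    have "(\<lambda>n. ?m n * (1 / level n ^ d)) \<longlonglongrightarrow> semicircle_moment (2 * d) * 0"
    proof (intro tendsto_mult moment_X_tendsto)
      have "(\<lambda>n. (1 / level n) ^ d) \<longlonglongrightarrow> 0 ^ d"
        unfolding level_def using kappa(1)
        by (intro tendsto_power tendsto_divide_0[OF tendsto_const] filterlim_at_top_imp_at_infinity filterlim_powr_at_top_nat)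
      then show "(\<lambda>n. 1 / level n ^ d) \<longlonglongrightarrow> 0" using d by (simp add: power_divide zero_power)
    qed
    then show "(\<lambda>n. ?m n * (1 / level n ^ d)) \<longlonglongrightarrow> 0" by simp
    show "\<forall>\<^sub>F n in sequentially. norm (?EZ n - (LINT \<omega>|M n. bulk n (level n) \<omega>) / real n) \<le> norm (?m n * (1 / level n ^ d)) * 1"
      using eventually_gt_at_top[of 0]
    proof eventually_elim
      case (elim n)
      interpret prob_space "M n" by (rule prob_M)
      have L: "0 < level n" using elim by (rule level_pos)
      have intb: "integrable (M n) (bulk n (level n))" using bulk_concentration(1)[OF elim L, of 1] by simp
      have intZ: "integrable (M n) (Z n)"
      proof -
        have "integrable (M n) (\<lambda>\<omega>. Re (Xseq.trY n d \<omega>) / real n powr (1 + real d / 2))"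
          by (intro integrable_divide integrable_Re trX_integrable)
        then show ?thesis using Z_trX elim by (subst Bochner_Integration.integrable_cong[OF refl]) auto
      qed
      have EZ: "expectation (Z n) = ?EZ n"
        using Z_trX elim by (subst Bochner_Integration.integral_cong[OF refl, of _ _ "\<lambda>\<omega>. Re (Xseq.trY n d \<omega>) / real n powr (1 + real d / 2)"]) auto
      have int2: "integrable (M n) (\<lambda>\<omega>. Re (Xseq.trY n (2 * d) \<omega>) / (real n ^ d * level n ^ d))"
        by (intro integrable_divide integrable_Re trX_integrable)
      have "\<bar>real n * expectation (Z n) - expectation (bulk n (level n))\<bar> = \<bar>expectation (\<lambda>\<omega>. real n * Z n \<omega> - bulk n (level n) \<omega>)\<bar>"
        using intb intZ by simp
      also have "\<dots> \<le> expectation (\<lambda>\<omega>. \<bar>real n * Z n \<omega> - bulk n (level n) \<omega>\<bar>)" by (rule integral_abs_bound)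
      also have "\<dots> \<le> expectation (\<lambda>\<omega>. Re (Xseq.trY n (2 * d) \<omega>) / (real n ^ d * level n ^ d))"
        using intb intZ int2 L elim by (intro integral_mono Z_bulk(3)) auto
      also have "\<dots> = real n * (?m n * (1 / level n ^ d))"
        using elim by (simp add: powr_add powr_realpow)
      finally have 1: "\<bar>real n * ?EZ n - expectation (bulk n (level n))\<bar> \<le> real n * (?m n * (1 / level n ^ d))"
        unfolding EZ .
      have "\<bar>?EZ n - expectation (bulk n (level n)) / real n\<bar> = \<bar>real n * ?EZ n - expectation (bulk n (level n))\<bar> / real n"
      proof -
        have "?EZ n - expectation (bulk n (level n)) / real n = (real n * ?EZ n - expectation (bulk n (level n))) / real n"
          using elim by (simp add: diff_divide_distrib)
        then show ?thesis by (simp add: abs_divide)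
      qed
      also have "\<dots> \<le> ?m n * (1 / level n ^ d)"
        using 1 elim by (simp add: pos_divide_le_eq mult.commute)
      finally show ?case unfolding real_norm_def mult_1_right by (rule order_trans[OF _ abs_ge_self])
    qed
  qed
  then have "(\<lambda>n. ?EZ n - (?EZ n - (LINT \<omega>|M n. bulk n (level n) \<omega>) / real n)) \<longlonglongrightarrow> \<gamma> - 0"
    by (intro tendsto_diff moment_X_tendsto)
  then show ?thesis by simp
qed

text \<open>A deviation \<open>\<epsilon> * n\<close> against a Lipschitz constant of order
  \<open>n^(\<kappa> (d - 1))\<close> yields the exponent \<open>n^(2 - 2 \<kappa> (d - 1))\<close>.
  By \<open>kappa\<close> this exceeds the speed by a positive power of \<open>n\<close>, so the
  rate \<open>a\<close> is arbitrary.\<close>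

lemma bulk_tail:
  assumes "0 < \<epsilon>"
  shows "\<forall>\<^sub>F n in sequentially. measure (M n) {\<omega>\<in>space (M n). \<bar>bulk n (level n) \<omega> - (LINT \<omega>|M n. bulk n (level n) \<omega>)\<bar> > \<epsilon> * real n}
     \<le> exp (- a * speed n)"
proof -
  let ?p = "1 - 2 / real d - 2 * \<kappa> * (real d - 1)"
  let ?c = "conc_const * (\<epsilon> / (2 * real d))\<^sup>2"
  have c: "0 < ?c" using assms d conc_const by simp
  have "\<forall>\<^sub>F n in sequentially. 2 * inverse conc_const * exp (- (?c * real n powr ?p * speed n)) \<le> exp (- a * speed n)"
  proof (rule exp_dominated[OF _ speed_at_top])
    have "\<forall>\<^sub>F n in sequentially. ?c * real n powr ?p * speed n / speed n = ?c * real n powr ?p"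
      using eventually_gt_at_top[of 0] by eventually_elim simp
    then show "filterlim (\<lambda>n. ?c * real n powr ?p * speed n / speed n) at_top sequentially"
      by (subst filterlim_cong[OF refl refl]) (auto intro: filterlim_scaled_powr[OF c kappa(3)])
  qed
  then show ?thesis using eventually_gt_at_top[of 0]
  proof eventually_elim
    case (elim n)
    have L: "0 < level n" using elim(2) by (rule level_pos)
    define K where "K = real d * level n ^ (d - 1)"
    have K: "0 < K" using L d by (simp add: K_def)
    let ?t = "\<epsilon> * real n / (2 * K)"
    have t: "0 < ?t" using assms K elim(2) by simp
    have "2 * K * ?t = \<epsilon> * real n" using K by simp
    then have "measure (M n) {\<omega>\<in>space (M n). \<bar>bulk n (level n) \<omega> - (LINT \<omega>|M n. bulk n (level n) \<omega>)\<bar> > \<epsilon> * real n}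
       \<le> 2 * inverse conc_const * exp (- conc_const * ?t\<^sup>2)"
      using bulk_concentration(2)[OF elim(2) L t] unfolding K_def[symmetric] by simp
    also have "conc_const * ?t\<^sup>2 = ?c * (real n powr ?p * speed n)"
    proof -
      have Ld: "level n ^ (d - 1) = real n powr (\<kappa> * (real d - 1))"
        using d elim(2) unfolding level_def by (simp add: powr_power of_nat_diff mult.commute)
      have "real n powr ?p * speed n = real n powr (2 - 2 * (\<kappa> * (real d - 1)))"
        unfolding powr_add[symmetric] by (simp add: algebra_simps)
      also have "\<dots> = (real n)\<^sup>2 / (level n ^ (d - 1))\<^sup>2"
        unfolding Ld using elim(2) by (simp add: powr_diff powr_power mult.commute)
      finally show ?thesis by (simp add: K_def power_divide power_mult_distrib)
    qed
    then have "- conc_const * ?t\<^sup>2 = - (?c * real n powr ?p * speed n)" by simp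
    also note elim(1)
    finally show ?case by simp
  qed
qed

end

context wigner_ldp
begin

lemma real_beta: "0 < real \<beta>" "real \<beta> \<le> 2"
  using beta by auto

lemma rank_bound_le: "\<forall>\<^sub>F n in sequentially. rank_bound n \<le> n"
proof -
  have "2 / real d < 1" using d by (simp add: pos_divide_less_eq)
  then have "0 < 1 - (2 / real d - \<kappa>)" using kappa(1) by linarith
  then have "filterlim (\<lambda>n. real n powr (1 - (2 / real d - \<kappa>))) at_top sequentially"
    by (rule filterlim_powr_at_top_nat)
  then have "\<forall>\<^sub>F n in sequentially. 2 \<le> real n powr (1 - (2 / real d - \<kappa>))"
    by (simp add: filterlim_at_top)
  then show ?thesis using eventually_gt_at_top[of 1]
  proof eventually_elim
    case (elim n)
    let ?x = "real n powr (2 / real d - \<kappa>)"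
    have "1 \<le> ?x" using elim(2) kappa(2) by (intro ge_one_powr_ge_zero) auto
    have "2 * ?x \<le> real n powr (1 - (2 / real d - \<kappa>)) * ?x" using elim(1) by (intro mult_right_mono) auto
    also have "\<dots> = real n" using elim(2) by (simp flip: powr_add)
    finally have "?x + 1 \<le> real n" using \<open>1 \<le> ?x\<close> by linarith
    then have "real (rank_bound n) \<le> real n" unfolding rank_bound_def by linarith
    then show ?case by simp
  qed
qed

lemma rank_bound_bounds:
  "real n powr (2 / real d - \<kappa>) \<le> real (rank_bound n)" "real (rank_bound n) \<le> real n powr (2 / real d - \<kappa>) + 1"
proof -
  have "0 \<le> real n powr (2 / real d - \<kappa>)" by simp
  then show "real n powr (2 / real d - \<kappa>) \<le> real (rank_bound n)" "real (rank_bound n) \<le> real n powr (2 / real d - \<kappa>) + 1"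
    unfolding rank_bound_def by linarith+
qed

text \<open>The scale on which outliers matter: with l2-norm \<open>radius \<tau> n\<close> they can
  move the normalized trace by \<open>\<tau>^d\<close>.\<close>

abbreviation radius :: "real \<Rightarrow> nat \<Rightarrow> real" where
  "radius \<tau> n \<equiv> \<tau> * real n powr (1 / 2 + 1 / real d)"

lemma radius_square: "0 < n \<Longrightarrow> (radius \<tau> n)\<^sup>2 = \<tau>\<^sup>2 * speed n"
  by (simp add: power_mult_distrib powr_power distrib_left)

lemma radius_power: "0 < n \<Longrightarrow> (radius \<tau> n) ^ d / sqrt n ^ d = \<tau> ^ d * real n"
proof -
  assume n: "0 < n"
  have "real n powr (1 / 2 + 1 / real d) = sqrt n * real n powr (1 / real d)"
    by (simp add: powr_add powr_half_sqrt)
  then have "(radius \<tau> n) ^ d = \<tau> ^ d * (sqrt n ^ d * (real n powr (1 / real d)) ^ d)"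
    by (simp add: power_mult_distrib)
  also have "(real n powr (1 / real d)) ^ d = real n" using n d by (simp add: powr_power)
  finally show ?thesis using n by simp
qed

lemma radius_rank: "\<forall>\<^sub>F n in sequentially. (radius \<tau> n)\<^sup>2 \<le> real (rank_bound n) * ((level n)\<^sup>2 * real n)"
proof -
  have "\<forall>\<^sub>F n in sequentially. \<tau>\<^sup>2 \<le> real n powr \<kappa>"
    using filterlim_powr_at_top_nat[OF kappa(1)] by (simp add: filterlim_at_top)
  then show ?thesis using eventually_gt_at_top[of 0]
  proof eventually_elim
    case (elim n)
    have "(radius \<tau> n)\<^sup>2 = \<tau>\<^sup>2 * speed n" by (rule radius_square[OF elim(2)])
    also have "\<dots> \<le> real n powr \<kappa> * speed n" using elim(1) by (intro mult_right_mono) auto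
    also have "\<dots> = real n powr (2 / real d - \<kappa>) * ((level n)\<^sup>2 * real n)"
    proof -
      have "(level n)\<^sup>2 * real n = real n powr (2 * \<kappa>) * real n powr 1"
        using elim(2) by (simp add: level_def powr_power)
      also have "\<dots> = real n powr (2 * \<kappa> + 1)" by (rule powr_add[symmetric])
      finally have lv: "(level n)\<^sup>2 * real n = real n powr (2 * \<kappa> + 1)" .
      show ?thesis unfolding lv powr_add[symmetric] by (simp add: algebra_simps)
    qed
    also have "\<dots> \<le> real (rank_bound n) * ((level n)\<^sup>2 * real n)"
      using rank_bound_bounds(1) by (intro mult_right_mono) auto
    finally show ?case .
  qed
qed

text \<open>Union bound over the net. The Chernoff exponent is asymptotically
  \<open>\<beta> * \<tau>^2 / 4\<close> times the speed, the entropy of the net is negligible, and a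
  large Hilbert-Schmidt norm is less likely still. The loss \<open>\<eta>\<close> absorbs these
  errors.\<close>

lemma net_tail:
  assumes \<tau>: "0 < \<tau>" and \<eta>: "0 < \<eta>"
  shows "\<forall>\<^sub>F n in sequentially. measure (M n) (net_event n (rank_bound n) (radius \<tau> n))
     \<le> exp (- (real \<beta> / 4 * \<tau>\<^sup>2 - \<eta>) * speed n)"
proof -
  define N where "N n = real ((2 * n ^ 4 + 1) ^ (2 * (rank_bound n * (n + 1))))" for n
  define q where "q n = (radius \<tau> n - 24 / real n)\<^sup>2 / (4 * (1 + 8 / (real n)\<^sup>2)\<^sup>2)" for n
  have p0: "0 < 1 / 2 + 1 / real d" using d by (simp add: add_pos_nonneg)
  have one: "\<forall>\<^sub>F n in sequentially. inverse conc_const * exp (- (conc_const * (real n)\<^sup>2)) \<le> exp (- (real \<beta> / 4 * \<tau>\<^sup>2) * speed n)"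
  proof (rule exp_dominated[OF _ speed_at_top])
    have "0 < 1 - 2 / real d" using d by (simp add: field_simps)
    then have "filterlim (\<lambda>n. conc_const * real n powr (1 - 2 / real d)) at_top sequentially"
      by (rule filterlim_scaled_powr[OF conc_const])
    moreover have "\<forall>\<^sub>F n in sequentially. conc_const * (real n)\<^sup>2 / speed n = conc_const * real n powr (1 - 2 / real d)"
      using eventually_gt_at_top[of 0]
    proof eventually_elim
      case (elim n)
      have "(real n)\<^sup>2 = real n powr 2" using elim by simp
      then have "(real n)\<^sup>2 / speed n = real n powr (2 - (1 + 2 / real d))" by (simp only: powr_diff)
      then have e: "(real n)\<^sup>2 / speed n = real n powr (1 - 2 / real d)" by simp
      have "conc_const * (real n)\<^sup>2 / speed n = conc_const * ((real n)\<^sup>2 / speed n)" by simp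
      then show ?case unfolding e .
    qed
    ultimately show "filterlim (\<lambda>n. conc_const * (real n)\<^sup>2 / speed n) at_top sequentially"
      by (subst filterlim_cong[OF refl refl]) auto
  qed
  have "(\<lambda>n. ln (N n) / speed n) \<longlonglongrightarrow> 0"
  proof (rule tendsto_0_le[OF entropy_negligible[OF kappa(1,2)], where K = 1])
    show "\<forall>\<^sub>F n in sequentially. norm (ln (N n) / speed n) \<le>
       norm (2 * ((real n powr (2 / real d - \<kappa>) + 1) * (real n + 1)) * ln (2 * real n ^ 4 + 1) / real n powr (1 + 2 / real d)) * 1"
    proof (rule always_eventually, rule allI)
      fix n
      have l0: "0 \<le> ln (2 * real n ^ 4 + 1)" by simp
      have lnN: "ln (N n) = 2 * (real (rank_bound n) * (real n + 1)) * ln (2 * real n ^ 4 + 1)"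
      proof -
        have "N n = (2 * real n ^ 4 + 1) ^ (2 * (rank_bound n * (n + 1)))" by (simp add: N_def add.commute)
        moreover have "0 < 2 * real n ^ 4 + 1" by (simp add: add_nonneg_pos)
        ultimately show ?thesis by (simp add: ln_realpow distrib_left)
      qed
      have "ln (N n) \<le> 2 * ((real n powr (2 / real d - \<kappa>) + 1) * (real n + 1)) * ln (2 * real n ^ 4 + 1)"
        unfolding lnN using rank_bound_bounds(2)[of n] l0 by (intro mult_right_mono mult_left_mono) auto
      then have "ln (N n) / speed n \<le> 2 * ((real n powr (2 / real d - \<kappa>) + 1) * (real n + 1)) * ln (2 * real n ^ 4 + 1) / speed n"
        by (intro divide_right_mono) auto
      moreover have "0 \<le> ln (N n) / speed n" unfolding lnN using l0 by simp
      ultimately show "norm (ln (N n) / speed n) \<le>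
       norm (2 * ((real n powr (2 / real d - \<kappa>) + 1) * (real n + 1)) * ln (2 * real n ^ 4 + 1) / real n powr (1 + 2 / real d)) * 1"
        by simp
    qed
  qed
  moreover have "(\<lambda>n. q n / speed n) \<longlonglongrightarrow> \<tau>\<^sup>2 / 4"
  proof -
    have inv: "(\<lambda>n. 1 / real n) \<longlonglongrightarrow> 0" by (rule lim_1_over_n)
    have "(\<lambda>n. 24 * (1 / real n) / real n powr (1 / 2 + 1 / real d)) \<longlonglongrightarrow> 0"
      by (rule tendsto_divide_0[OF tendsto_mult[OF tendsto_const inv] filterlim_at_top_imp_at_infinity[OF filterlim_powr_at_top_nat[OF p0]]])
    then have "(\<lambda>n. (\<tau> - 24 * (1 / real n) / real n powr (1 / 2 + 1 / real d))\<^sup>2 / (4 * (1 + 8 * (1 / real n)\<^sup>2)\<^sup>2))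
       \<longlonglongrightarrow> (\<tau> - 0)\<^sup>2 / (4 * (1 + 8 * 0\<^sup>2)\<^sup>2)"
      by (intro tendsto_intros inv) auto
    moreover have "\<forall>\<^sub>F n in sequentially. (\<tau> - 24 * (1 / real n) / real n powr (1 / 2 + 1 / real d))\<^sup>2 / (4 * (1 + 8 * (1 / real n)\<^sup>2)\<^sup>2) = q n / speed n"
      using eventually_gt_at_top[of 0]
    proof eventually_elim
      case (elim n)
      let ?s = "real n powr (1 / 2 + 1 / real d)"
      have s: "0 < ?s" "?s\<^sup>2 = speed n" using elim radius_square[OF elim, of 1] by auto
      have "radius \<tau> n - 24 / real n = (\<tau> - 24 * (1 / real n) / ?s) * ?s" using s(1) by (simp add: left_diff_distrib)
      then have "(radius \<tau> n - 24 / real n)\<^sup>2 = (\<tau> - 24 * (1 / real n) / ?s)\<^sup>2 * speed n"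
        by (simp only: power_mult_distrib s(2))
      then show ?case unfolding q_def using elim by (simp add: power_divide)
    qed
    ultimately show ?thesis using Lim_transform_eventually by fastforce
  qed
  ultimately have "(\<lambda>n. ln (N n) / speed n - real \<beta> * (q n / speed n)) \<longlonglongrightarrow> 0 - real \<beta> * (\<tau>\<^sup>2 / 4)"
    by (intro tendsto_diff tendsto_mult tendsto_const)
  then have "\<forall>\<^sub>F n in sequentially. ln (N n) / speed n - real \<beta> * (q n / speed n) < - (real \<beta> / 4 * \<tau>\<^sup>2 - \<eta> / 2)"
    using \<eta> by (intro order_tendstoD(2)) auto
  moreover have "\<forall>\<^sub>F n in sequentially. 24 < radius \<tau> n"
    using filterlim_scaled_powr[OF \<tau> p0] unfolding filterlim_at_top_dense by blast
  moreover have "\<forall>\<^sub>F n in sequentially. 2 * exp (- (real \<beta> / 4 * \<tau>\<^sup>2 - \<eta> / 2) * speed n) \<le> exp (- (real \<beta> / 4 * \<tau>\<^sup>2 - \<eta>) * speed n)"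
  proof -
    have "\<forall>\<^sub>F n in sequentially. 2 / \<eta> \<le> speed n" using speed_at_top by (simp add: filterlim_at_top)
    then show ?thesis
    proof eventually_elim
      case (elim n)
      then have "1 \<le> \<eta> / 2 * speed n" using \<eta> by (simp add: field_simps)
      then have "2 \<le> exp (\<eta> / 2 * speed n)" using exp_ge_add_one_self[of "\<eta> / 2 * speed n"] by linarith
      then have "2 * exp (- (real \<beta> / 4 * \<tau>\<^sup>2 - \<eta> / 2) * speed n) \<le> exp (\<eta> / 2 * speed n) * exp (- (real \<beta> / 4 * \<tau>\<^sup>2 - \<eta> / 2) * speed n)"
        by (intro mult_right_mono) auto
      also have "\<dots> = exp (- (real \<beta> / 4 * \<tau>\<^sup>2 - \<eta>) * speed n)"
        unfolding exp_add[symmetric] by (simp add: algebra_simps)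
      finally show ?case .
    qed
  qed
  ultimately show ?thesis using one eventually_gt_at_top[of 0]
  proof eventually_elim
    case (elim n)
    have sp: "0 < speed n" using elim(5) by simp
    have "24 / real n \<le> 24" using elim(5) by (simp add: pos_divide_le_eq)
    then have t: "24 / real n < radius \<tau> n" using elim(2) by linarith
    have N0: "0 < N n" unfolding N_def of_nat_0_less_iff by (rule zero_less_power) simp
    have "measure (M n) (net_event n (rank_bound n) (radius \<tau> n)) \<le> inverse conc_const * exp (- conc_const * (real n)\<^sup>2) +
      N n * exp (- real \<beta> * (radius \<tau> n - 24 / real n)\<^sup>2 / (4 * (1 + 8 / (real n)\<^sup>2)\<^sup>2))"
      unfolding N_def by (rule net_event_prob[OF elim(5) t])
    also have "N n * exp (- real \<beta> * (radius \<tau> n - 24 / real n)\<^sup>2 / (4 * (1 + 8 / (real n)\<^sup>2)\<^sup>2)) = exp (ln (N n) - real \<beta> * q n)"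
    proof -
      have "- real \<beta> * (radius \<tau> n - 24 / real n)\<^sup>2 / (4 * (1 + 8 / (real n)\<^sup>2)\<^sup>2) = - (real \<beta> * q n)"
        unfolding q_def by simp
      then show ?thesis using N0 by (simp only: exp_diff exp_minus exp_ln divide_inverse)
    qed
    also have "\<dots> \<le> exp (- (real \<beta> / 4 * \<tau>\<^sup>2 - \<eta> / 2) * speed n)"
    proof -
      have "ln (N n) - real \<beta> * q n = (ln (N n) / speed n - real \<beta> * (q n / speed n)) * speed n"
        using sp by (simp add: left_diff_distrib)
      also have "\<dots> \<le> - (real \<beta> / 4 * \<tau>\<^sup>2 - \<eta> / 2) * speed n"
        using elim(1) sp by (intro mult_right_mono) auto
      finally show ?thesis by simp
    qed
    also have "inverse conc_const * exp (- conc_const * (real n)\<^sup>2) \<le> exp (- (real \<beta> / 4 * \<tau>\<^sup>2 - \<eta> / 2) * speed n)"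
    proof -
      have "- (real \<beta> / 4 * \<tau>\<^sup>2) * speed n \<le> - (real \<beta> / 4 * \<tau>\<^sup>2 - \<eta> / 2) * speed n"
        using \<eta> sp by (intro mult_right_mono) auto
      then have "exp (- (real \<beta> / 4 * \<tau>\<^sup>2) * speed n) \<le> exp (- (real \<beta> / 4 * \<tau>\<^sup>2 - \<eta> / 2) * speed n)"
        by (simp only: exp_le_cancel_iff)
      from order_trans[OF elim(4) this] show ?thesis by (simp only: mult_minus_left)
    qed
    finally have "measure (M n) (net_event n (rank_bound n) (radius \<tau> n)) \<le> 2 * exp (- (real \<beta> / 4 * \<tau>\<^sup>2 - \<eta> / 2) * speed n)" by simp
    also note elim(3)
    finally show ?case .
  qed
qed

lemma bulk_mean_close:
  assumes "0 < \<epsilon>"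
  shows "\<forall>\<^sub>F n in sequentially. \<bar>(LINT \<omega>|M n. bulk n (level n) \<omega>) - real n * \<gamma>\<bar> \<le> \<epsilon> * real n"
proof -
  have "\<forall>\<^sub>F n in sequentially. dist ((LINT \<omega>|M n. bulk n (level n) \<omega>) / real n) \<gamma> < \<epsilon>"
    using bulk_mean_tendsto assms by (rule tendstoD)
  then show ?thesis using eventually_gt_at_top[of 0]
  proof eventually_elim
    case (elim n)
    have "\<bar>(LINT \<omega>|M n. bulk n (level n) \<omega>) - real n * \<gamma>\<bar> = \<bar>(LINT \<omega>|M n. bulk n (level n) \<omega>) / real n - \<gamma>\<bar> * real n"
    proof -
      have "(LINT \<omega>|M n. bulk n (level n) \<omega>) - real n * \<gamma> = ((LINT \<omega>|M n. bulk n (level n) \<omega>) / real n - \<gamma>) * real n"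
        using elim(2) by (simp add: left_diff_distrib)
      then show ?thesis by (simp add: abs_mult)
    qed
    also have "\<dots> \<le> \<epsilon> * real n" using elim(1) by (intro mult_right_mono) (auto simp: dist_real_def)
    finally show ?case .
  qed
qed

lemma bulk_event_sets:
  "0 < n \<Longrightarrow> {\<omega>\<in>space (M n). \<bar>bulk n (level n) \<omega> - (LINT \<omega>|M n. bulk n (level n) \<omega>)\<bar> > c} \<in> sets (M n)"
proof -
  assume n: "0 < n"
  have [measurable]: "bulk n (level n) \<in> borel_measurable (M n)"
    using bulk_concentration(1)[OF n level_pos[OF n], of 1] by simp
  show ?thesis by measurable
qed

theorem upper_tail:
  assumes x: "0 < x" and \<eta>: "0 < \<eta>"
  shows "\<forall>\<^sub>F n in sequentially. measure (M n) {\<omega>\<in>space (M n). x \<le> \<bar>Z n \<omega> - \<gamma>\<bar>}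
     \<le> exp (- (real \<beta> / 4 * x powr (2 / real d) - \<eta>) * speed n)"
proof -
  have "isCont (\<lambda>y. real \<beta> / 4 * y powr (2 / real d)) x"
    using x by (intro continuous_intros) auto
  then obtain \<delta> where \<delta>: "0 < \<delta>" "\<And>y. \<bar>y - x\<bar> < \<delta> \<Longrightarrow> \<bar>real \<beta> / 4 * y powr (2 / real d) - real \<beta> / 4 * x powr (2 / real d)\<bar> < \<eta> / 3"
    using \<eta> unfolding continuous_at_eps_delta dist_real_def by (metis divide_pos_pos zero_less_numeral)
  \<comment> \<open>Slightly below \<open>x\<close>: the rate hardly changes, and the gap
    \<open>3 * \<epsilon>\<close> leaves room for the fluctuation of the bulk and the error of its
    mean.\<close>
  define y where "y = x - min (\<delta> / 2) (x / 2)"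
  have y: "0 < y" "y < x" "\<bar>y - x\<bar> < \<delta>" using x \<delta>(1) by (auto simp: y_def min_def)
  define \<epsilon> where "\<epsilon> = (x - y) / 3"
  have \<epsilon>: "0 < \<epsilon>" using y by (simp add: \<epsilon>_def)
  \<comment> \<open>Outliers of l2-norm at most \<open>radius \<tau> n\<close> move the normalized
    trace by at most \<open>\<tau>^d = y\<close>.\<close>
  define \<tau> where "\<tau> = y powr (1 / real d)"
  have \<tau>: "0 < \<tau>" "\<tau> ^ d = y" "\<tau>\<^sup>2 = y powr (2 / real d)"
    using y(1) d by (auto simp: \<tau>_def powr_power)
  have \<eta>3: "0 < \<eta> / 3" using \<eta> by simp
  let ?a = "real \<beta> / 4 * \<tau>\<^sup>2 - \<eta> / 3"
  have a: "real \<beta> / 4 * x powr (2 / real d) - \<eta> + \<eta> / 3 \<le> ?a" using \<delta>(2)[OF y(3)] unfolding \<tau>(3) by linarith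
  have "\<forall>\<^sub>F n in sequentially. 3 / \<eta> \<le> speed n" using speed_at_top by (simp add: filterlim_at_top)
  then show ?thesis
    using net_tail[OF \<tau>(1) \<eta>3] bulk_tail[OF \<epsilon>, of ?a] bulk_mean_close[OF \<epsilon>] rank_bound_le radius_rank[of \<tau>]
      eventually_gt_at_top[of 0]
  proof eventually_elim
    case (elim n)
    interpret prob_space "M n" by (rule prob_M)
    let ?N = "net_event n (rank_bound n) (radius \<tau> n)"
    let ?B = "{\<omega>\<in>space (M n). \<bar>bulk n (level n) \<omega> - (LINT \<omega>|M n. bulk n (level n) \<omega>)\<bar> > \<epsilon> * real n}"
    have "prob {\<omega>\<in>space (M n). x \<le> \<bar>Z n \<omega> - \<gamma>\<bar>} \<le> prob (?N \<union> ?B)"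
    proof (rule finite_measure_mono)
      show "?N \<union> ?B \<in> events" using bulk_event_sets[OF elim(7)] net_event_sets by blast
      show "{\<omega>\<in>space (M n). x \<le> \<bar>Z n \<omega> - \<gamma>\<bar>} \<subseteq> ?N \<union> ?B"
      proof (rule subsetI, rule ccontr)
        fix \<omega> assume w: "\<omega> \<in> {\<omega>\<in>space (M n). x \<le> \<bar>Z n \<omega> - \<gamma>\<bar>}" and not: "\<omega> \<notin> ?N \<union> ?B"
        have rad: "0 < radius \<tau> n" using \<tau>(1) elim(7) by simp
        have "\<bar>real n * Z n \<omega> - bulk n (level n) \<omega>\<bar> \<le> (radius \<tau> n) ^ d / sqrt n ^ d"
          using w not elim(5,6,7) level_pos[OF elim(7)] rad by (intro Z_bulk(1)) auto
        also have "\<dots> = y * real n" using radius_power[OF elim(7)] \<tau>(2) by simp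
        finally have 1: "\<bar>real n * Z n \<omega> - bulk n (level n) \<omega>\<bar> \<le> y * real n" .
        have 2: "\<bar>bulk n (level n) \<omega> - (LINT \<omega>|M n. bulk n (level n) \<omega>)\<bar> \<le> \<epsilon> * real n" using w not by auto
        have "x * real n \<le> \<bar>Z n \<omega> - \<gamma>\<bar> * real n" using w by (intro mult_right_mono) auto
        also have "\<dots> = \<bar>real n * Z n \<omega> - real n * \<gamma>\<bar>"
          by (simp add: abs_mult mult.commute flip: right_diff_distrib)
        also have "\<dots> \<le> y * real n + \<epsilon> * real n + \<epsilon> * real n" using 1 2 elim(4) by linarith
        also have "\<dots> = (x - \<epsilon>) * real n" by (simp add: \<epsilon>_def field_simps)
        also have "\<dots> < x * real n" using \<epsilon> elim(7) by (intro mult_strict_right_mono) auto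
        finally show False by simp
      qed
    qed
    also have "\<dots> \<le> prob ?N + prob ?B"
      by (rule measure_Un_le[OF net_event_sets bulk_event_sets[OF elim(7)]])
    also have "\<dots> \<le> exp (- ?a * speed n) + exp (- ?a * speed n)" using elim(2,3) by (intro add_mono)
    also have "\<dots> \<le> exp (\<eta> / 3 * speed n) * exp (- ?a * speed n)"
    proof -
      have "1 \<le> \<eta> / 3 * speed n" using elim(1) \<eta> by (simp add: field_simps)
      then have "2 \<le> exp (\<eta> / 3 * speed n)" using exp_ge_add_one_self[of "\<eta> / 3 * speed n"] by linarith
      then have "2 * exp (- ?a * speed n) \<le> exp (\<eta> / 3 * speed n) * exp (- ?a * speed n)" by (intro mult_right_mono) auto
      then show ?thesis by simp
    qed
    also have "\<dots> = exp (- (?a - \<eta> / 3) * speed n)" unfolding exp_add[symmetric] by (simp add: algebra_simps)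
    also have "\<dots> \<le> exp (- (real \<beta> / 4 * x powr (2 / real d) - \<eta>) * speed n)"
    proof -
      have "- (?a - \<eta> / 3) * speed n \<le> - (real \<beta> / 4 * x powr (2 / real d) - \<eta>) * speed n"
        using a by (intro mult_right_mono) auto
      then show ?thesis by simp
    qed
    finally show ?case .
  qed
qed

text \<open>For even \<open>d\<close> the bulk lies below the trace, so a small trace forces a small
  bulk, whose cost exceeds every multiple of the speed.\<close>

theorem lower_tail:
  assumes x: "0 < x" and ev: "even d"
  shows "\<forall>\<^sub>F n in sequentially. measure (M n) {\<omega>\<in>space (M n). Z n \<omega> \<le> \<gamma> - x} \<le> exp (- a * speed n)"
proof -
  have x3: "0 < x / 3" using x by simp
  show ?thesis
    using bulk_tail[OF x3, of a] bulk_mean_close[OF x3] eventually_gt_at_top[of 0]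
  proof eventually_elim
    case (elim n)
    interpret prob_space "M n" by (rule prob_M)
    let ?B = "{\<omega>\<in>space (M n). \<bar>bulk n (level n) \<omega> - (LINT \<omega>|M n. bulk n (level n) \<omega>)\<bar> > x / 3 * real n}"
    have "prob {\<omega>\<in>space (M n). Z n \<omega> \<le> \<gamma> - x} \<le> prob ?B"
    proof (rule finite_measure_mono[OF subsetI bulk_event_sets[OF elim(3)]], rule ccontr)
      fix \<omega> assume w: "\<omega> \<in> {\<omega>\<in>space (M n). Z n \<omega> \<le> \<gamma> - x}" and not: "\<omega> \<notin> ?B"
      have "bulk n (level n) \<omega> \<le> real n * Z n \<omega>"
        using w level_pos[OF elim(3)] elim(3) ev by (intro Z_bulk(2)) auto
      also have "\<dots> \<le> real n * (\<gamma> - x)" using w by (intro mult_left_mono) auto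
      finally have "bulk n (level n) \<omega> \<le> real n * \<gamma> - x * real n" by (simp add: algebra_simps)
      moreover have "\<bar>bulk n (level n) \<omega> - (LINT \<omega>|M n. bulk n (level n) \<omega>)\<bar> \<le> x / 3 * real n" using w not by auto
      moreover have "0 < x * real n" using x elim(3) by simp
      ultimately show False using elim(2) by linarith
    qed
    with elim(1) show ?case by linarith
  qed
qed

end

section \<open>Lower bound by exponential tilting\<close>

text \<open>A product density with normalized factors changes each marginal separately. Expectations
  of products, and with them independence, follow from the product formula under the original
  measure.\<close>

lemma (in prob_space) prob_space_tilt:
  fixes X :: "'i \<Rightarrow> 'a \<Rightarrow> 'b::real_normed_vector" and w :: "'i \<Rightarrow> 'b \<Rightarrow> real"
  assumes X: "indep_vars (\<lambda>_. borel) X I" and I: "finite I"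
    and wm: "\<And>i. i \<in> I \<Longrightarrow> w i \<in> borel_measurable borel" and w0: "\<And>i x. i \<in> I \<Longrightarrow> 0 \<le> w i x"
    and w1: "\<And>i. i \<in> I \<Longrightarrow> integrable M (\<lambda>\<omega>. w i (X i \<omega>))" "\<And>i. i \<in> I \<Longrightarrow> expectation (\<lambda>\<omega>. w i (X i \<omega>)) = 1"
  defines "M' \<equiv> density M (\<lambda>\<omega>. ennreal (\<Prod>i\<in>I. w i (X i \<omega>)))"
  shows tilt_expectation: "\<And>J (f :: 'i \<Rightarrow> 'b \<Rightarrow> 'c::{real_normed_field, banach, second_countable_topology}).
      J \<subseteq> I \<Longrightarrow> (\<And>j. j \<in> J \<Longrightarrow> f j \<in> borel_measurable borel) \<Longrightarrow>
      (\<And>j. j \<in> J \<Longrightarrow> integrable M (\<lambda>\<omega>. w j (X j \<omega>) *\<^sub>R f j (X j \<omega>))) \<Longrightarrow>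
      integrable M' (\<lambda>\<omega>. \<Prod>j\<in>J. f j (X j \<omega>)) \<and>
      (LINT \<omega>|M'. (\<Prod>j\<in>J. f j (X j \<omega>))) = (\<Prod>j\<in>J. expectation (\<lambda>\<omega>. w j (X j \<omega>) *\<^sub>R f j (X j \<omega>)))"
    and tilt_prob_space: "prob_space M'"
    and tilt_indep_vars: "prob_space.indep_vars M' (\<lambda>_. borel) X I"
proof -
  have Xm: "X i \<in> borel_measurable M" if "i \<in> I" for i using X that unfolding indep_vars_def by blast
  have Wm: "(\<lambda>\<omega>. \<Prod>i\<in>I. w i (X i \<omega>)) \<in> borel_measurable M"
    using Xm wm by (intro borel_measurable_prod measurable_compose[OF Xm wm]) auto
  have W0: "0 \<le> (\<Prod>i\<in>I. w i (X i \<omega>))" for \<omega> using w0 by (intro prod_nonneg) auto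
  \<comment> \<open>The value type stays general: the real case, applied to indicators, yields
    independence below.\<close>
  have main: "integrable M' (\<lambda>\<omega>. \<Prod>j\<in>J. f j (X j \<omega>)) \<and>
      (LINT \<omega>|M'. (\<Prod>j\<in>J. f j (X j \<omega>))) = (\<Prod>j\<in>J. expectation (\<lambda>\<omega>. w j (X j \<omega>) *\<^sub>R f j (X j \<omega>)))"
    if J: "J \<subseteq> I" and fm: "\<And>j. j \<in> J \<Longrightarrow> f j \<in> borel_measurable borel"
      and fi: "\<And>j. j \<in> J \<Longrightarrow> integrable M (\<lambda>\<omega>. w j (X j \<omega>) *\<^sub>R f j (X j \<omega>))"
    for J and f :: "'i \<Rightarrow> 'b \<Rightarrow> 'd::{real_normed_field, banach, second_countable_topology}"
  proof -
    \<comment> \<open>Indices outside \<open>J\<close> carry their weight alone, which integrates to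
      1.\<close>
    define g where "g i x = w i x *\<^sub>R (if i \<in> J then f i x else 1)" for i x
    have finJ: "finite J" using J I finite_subset by blast
    have gm: "g i \<in> borel_measurable borel" if "i \<in> I" for i
      unfolding g_def using wm[OF that] fm by (cases "i \<in> J") auto
    have prodg: "(\<Prod>i\<in>I. w i (X i \<omega>)) *\<^sub>R (\<Prod>j\<in>J. f j (X j \<omega>)) = (\<Prod>i\<in>I. g i (X i \<omega>))" for \<omega>
    proof -
      have "(\<Prod>j\<in>J. f j (X j \<omega>)) = (\<Prod>i\<in>I. if i \<in> J then f i (X i \<omega>) else 1)"
        using J I by (subst prod.inter_restrict[symmetric]) (auto simp: Int_absorb1 intro!: prod.cong)
      then show ?thesis by (simp add: g_def scaleR_conv_of_real prod.distrib of_real_prod)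
    qed
    have gind: "indep_vars (\<lambda>_. borel) (\<lambda>i \<omega>. g i (X i \<omega>)) I"
      using X gm by (rule indep_vars_compose2)
    have gi: "integrable M (\<lambda>\<omega>. g i (X i \<omega>))" if "i \<in> I" for i
      using fi[of i] w1(1)[OF that] by (cases "i \<in> J") (auto simp: g_def scaleR_conv_of_real)
    have int: "integrable M (\<lambda>\<omega>. \<Prod>i\<in>I. g i (X i \<omega>))" by (rule indep_vars_integrable[OF I gind gi])
    have E: "expectation (\<lambda>\<omega>. \<Prod>i\<in>I. g i (X i \<omega>)) = (\<Prod>i\<in>I. expectation (\<lambda>\<omega>. g i (X i \<omega>)))"
      by (rule indep_vars_lebesgue_integral[OF I gind gi])
    have fM: "(\<lambda>\<omega>. \<Prod>j\<in>J. f j (X j \<omega>)) \<in> borel_measurable M"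
      using J by (intro borel_measurable_prod measurable_compose[OF Xm fm]) auto
    have "integrable M' (\<lambda>\<omega>. \<Prod>j\<in>J. f j (X j \<omega>))"
      unfolding M'_def using int by (subst integrable_density[OF fM Wm]) (auto simp: W0 prodg)
    moreover have "(LINT \<omega>|M'. (\<Prod>j\<in>J. f j (X j \<omega>))) = expectation (\<lambda>\<omega>. \<Prod>i\<in>I. g i (X i \<omega>))"
      unfolding M'_def by (subst integral_density[OF fM Wm]) (auto simp: W0 prodg)
    moreover have "(\<Prod>i\<in>I. expectation (\<lambda>\<omega>. g i (X i \<omega>))) = (\<Prod>j\<in>J. expectation (\<lambda>\<omega>. w j (X j \<omega>) *\<^sub>R f j (X j \<omega>)))"
    proof -
      have one: "expectation (\<lambda>\<omega>. g i (X i \<omega>)) = 1" if "i \<in> I - J" for i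
      proof -
        have "expectation (\<lambda>\<omega>. g i (X i \<omega>)) = of_real (expectation (\<lambda>\<omega>. w i (X i \<omega>)))"
          using that integral_bounded_linear[OF bounded_linear_of_real w1(1), of i] by (simp add: g_def scaleR_conv_of_real)
        then show ?thesis using that w1(2)[of i] by simp
      qed
      have "(\<Prod>i\<in>I. expectation (\<lambda>\<omega>. g i (X i \<omega>))) = (\<Prod>i\<in>J. expectation (\<lambda>\<omega>. g i (X i \<omega>)))"
        using one J by (intro prod.mono_neutral_right I) auto
      then show ?thesis by (simp add: g_def cong: prod.cong)
    qed
    ultimately show ?thesis using E by simp
  qed
  then show "\<And>J (f :: 'i \<Rightarrow> 'b \<Rightarrow> 'c::{real_normed_field, banach, second_countable_topology}).
      J \<subseteq> I \<Longrightarrow> (\<And>j. j \<in> J \<Longrightarrow> f j \<in> borel_measurable borel) \<Longrightarrow>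
      (\<And>j. j \<in> J \<Longrightarrow> integrable M (\<lambda>\<omega>. w j (X j \<omega>) *\<^sub>R f j (X j \<omega>))) \<Longrightarrow>
      integrable M' (\<lambda>\<omega>. \<Prod>j\<in>J. f j (X j \<omega>)) \<and>
      (LINT \<omega>|M'. (\<Prod>j\<in>J. f j (X j \<omega>))) = (\<Prod>j\<in>J. expectation (\<lambda>\<omega>. w j (X j \<omega>) *\<^sub>R f j (X j \<omega>)))"
    by blast
  have wind: "indep_vars (\<lambda>_. borel) (\<lambda>i \<omega>. w i (X i \<omega>)) I"
    using X wm by (rule indep_vars_compose2)
  have "emeasure M' (space M') = (\<integral>\<^sup>+\<omega>. ennreal (\<Prod>i\<in>I. w i (X i \<omega>)) \<partial>M)"
    unfolding M'_def using Wm by (simp add: emeasure_density cong: nn_integral_cong)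
  also have "\<dots> = ennreal (expectation (\<lambda>\<omega>. \<Prod>i\<in>I. w i (X i \<omega>)))"
    using W0 by (intro nn_integral_eq_integral indep_vars_integrable[OF I wind] w1(1)) auto
  also have "expectation (\<lambda>\<omega>. \<Prod>i\<in>I. w i (X i \<omega>)) = 1"
    using w1 by (subst indep_vars_lebesgue_integral[OF I wind]) auto
  finally show P: "prob_space M'" by (intro prob_spaceI) simp
  interpret P: prob_space M' by (rule P)
  have sp: "space M' = space M" and se: "sets M' = sets M" by (simp_all add: M'_def)
  show "P.indep_vars (\<lambda>_. borel) X I"
    unfolding P.indep_vars_def2
  proof (intro conjI ballI)
    fix i assume "i \<in> I"
    then show "X i \<in> borel_measurable M'" using Xm by (simp add: M'_def)
  next
    let ?ind = "\<lambda>A x. indicator A x :: real"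
    have ev: "P.prob (\<Inter>j\<in>J. X j -` A j \<inter> space M) = (\<Prod>j\<in>J. expectation (\<lambda>\<omega>. w j (X j \<omega>) * ?ind (A j) (X j \<omega>)))"
      if J: "J \<subseteq> I" "J \<noteq> {}" and A: "\<And>j. j \<in> J \<Longrightarrow> A j \<in> sets borel" for J A
    proof -
      have finJ: "finite J" using J I finite_subset by blast
      have m: "integrable M' (\<lambda>\<omega>. \<Prod>j\<in>J. ?ind (A j) (X j \<omega>)) \<and> (LINT \<omega>|M'. (\<Prod>j\<in>J. ?ind (A j) (X j \<omega>))) = (\<Prod>j\<in>J. expectation (\<lambda>\<omega>. w j (X j \<omega>) *\<^sub>R ?ind (A j) (X j \<omega>)))"
      proof (rule main[OF J(1)])
        fix j assume j: "j \<in> J"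
        then have jI: "j \<in> I" using J by blast
        show "?ind (A j) \<in> borel_measurable borel" using A[OF j] by simp
        then have ms: "(\<lambda>\<omega>. ?ind (A j) (X j \<omega>)) \<in> borel_measurable M" by (rule measurable_compose[OF Xm[OF jI]])
        show "integrable M (\<lambda>\<omega>. w j (X j \<omega>) *\<^sub>R ?ind (A j) (X j \<omega>))"
        proof (rule Bochner_Integration.integrable_bound[OF w1(1)[OF jI]])
          show "(\<lambda>\<omega>. w j (X j \<omega>) *\<^sub>R ?ind (A j) (X j \<omega>)) \<in> borel_measurable M"
            using ms measurable_compose[OF Xm[OF jI] wm[OF jI]] by simp
          show "AE \<omega> in M. norm (w j (X j \<omega>) *\<^sub>R ?ind (A j) (X j \<omega>)) \<le> norm (w j (X j \<omega>))"
            by (rule AE_I2) (auto simp: indicator_def)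
        qed
      qed
      have set: "(\<Inter>j\<in>J. X j -` A j \<inter> space M) \<in> sets M'"
        unfolding se using J A Xm finJ by (intro sets.finite_INT) (auto intro: measurable_sets)
      have "(\<Prod>j\<in>J. ?ind (A j) (X j \<omega>)) = indicator (\<Inter>j\<in>J. X j -` A j \<inter> space M) \<omega>" if "\<omega> \<in> space M" for \<omega>
        using that finJ by (auto simp: indicator_def prod_zero_iff split: if_splits)
      then have "(LINT \<omega>|M'. (\<Prod>j\<in>J. ?ind (A j) (X j \<omega>))) = (LINT \<omega>|M'. indicator (\<Inter>j\<in>J. X j -` A j \<inter> space M) \<omega>)"
        by (intro Bochner_Integration.integral_cong) (auto simp: sp)
      also have "\<dots> = P.prob (\<Inter>j\<in>J. X j -` A j \<inter> space M)" using set by simp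
      finally show ?thesis using m by simp
    qed
    show "P.indep_sets (\<lambda>i. {X i -` A \<inter> space M' | A. A \<in> sets borel}) I"
    proof (rule P.indep_setsI)
      fix i assume "i \<in> I"
      then show "{X i -` A \<inter> space M' | A. A \<in> sets borel} \<subseteq> P.events"
        unfolding sp se using Xm by (auto intro: measurable_sets)
    next
      fix A J assume J: "J \<noteq> {}" "J \<subseteq> I" "finite J" and A: "\<forall>j\<in>J. A j \<in> {X j -` A \<inter> space M' | A. A \<in> sets borel}"
      then have "\<forall>j\<in>J. \<exists>B. A j = X j -` B \<inter> space M \<and> B \<in> sets borel" unfolding sp by blast
      then obtain B where B: "\<And>j. j \<in> J \<Longrightarrow> A j = X j -` B j \<inter> space M" "\<And>j. j \<in> J \<Longrightarrow> B j \<in> sets borel" by metis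
      have "P.prob (\<Inter>j\<in>J. A j) = P.prob (\<Inter>j\<in>J. X j -` B j \<inter> space M)" using B(1) by (intro arg_cong[where f = P.prob]) auto
      also have "\<dots> = (\<Prod>j\<in>J. expectation (\<lambda>\<omega>. w j (X j \<omega>) * ?ind (B j) (X j \<omega>)))" by (rule ev[OF J(2,1) B(2)])
      also have "\<dots> = (\<Prod>j\<in>J. P.prob (A j))"
      proof (rule prod.cong[OF refl])
        fix j assume j: "j \<in> J"
        show "expectation (\<lambda>\<omega>. w j (X j \<omega>) * ?ind (B j) (X j \<omega>)) = P.prob (A j)"
          using ev[of "{j}" B] j subsetD[OF J(2) j] B by simp
      qed
      finally show "P.prob (\<Inter>j\<in>J. A j) = (\<Prod>j\<in>J. P.prob (A j))" .
    qed
  qed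
qed

section \<open>Powers of a matrix shifted by a constant\<close>

definition vnorm :: "nat \<Rightarrow> (nat \<Rightarrow> complex) \<Rightarrow> real" where
  "vnorm n f = L2_set (\<lambda>k. cmod (f k)) {..<n}"

lemma vnorm_nonneg: "0 \<le> vnorm n f"
  unfolding vnorm_def by (rule L2_set_nonneg)

lemma vnorm_square: "(vnorm n f)\<^sup>2 = (\<Sum>k<n. (cmod (f k))\<^sup>2)"
  unfolding vnorm_def L2_set_def by (intro real_sqrt_pow2 sum_nonneg) simp

lemma vnorm_triangle: "vnorm n (\<lambda>k. f k + g k) \<le> vnorm n f + vnorm n g"
proof -
  have "vnorm n (\<lambda>k. f k + g k) \<le> L2_set (\<lambda>k. cmod (f k) + cmod (g k)) {..<n}"
    unfolding vnorm_def by (rule L2_set_mono) (auto intro: norm_triangle_ineq)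
  also have "\<dots> \<le> vnorm n f + vnorm n g" unfolding vnorm_def by (rule L2_set_triangle_ineq)
  finally show ?thesis .
qed

lemma vnorm_scale: "vnorm n (\<lambda>k. c * f k) = cmod c * vnorm n f"
  unfolding vnorm_def by (simp add: norm_mult L2_set_right_distrib)

lemma vnorm_const: "vnorm n (\<lambda>k. c) = sqrt n * cmod c"
proof (rule power2_eq_imp_eq)
  show "(vnorm n (\<lambda>k. c))\<^sup>2 = (sqrt n * cmod c)\<^sup>2" unfolding vnorm_square by (simp add: power_mult_distrib)
qed (auto simp: vnorm_nonneg)

lemma vnorm_product: "cmod (\<Sum>k<n. f k * g k) \<le> vnorm n f * vnorm n g"
proof -
  have "cmod (\<Sum>k<n. f k * g k) \<le> (\<Sum>k<n. \<bar>cmod (f k)\<bar> * \<bar>cmod (g k)\<bar>)"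
    by (rule sum_norm_le) (simp add: norm_mult)
  also have "\<dots> \<le> vnorm n f * vnorm n g" unfolding vnorm_def by (rule L2_set_mult_ineq)
  finally show ?thesis .
qed

lemma vnorm_cnj: "vnorm n (\<lambda>k. cnj (f k)) = vnorm n f"
  by (simp add: vnorm_def)

lemma vnorm_cong: "(\<And>k. k < n \<Longrightarrow> f k = g k) \<Longrightarrow> vnorm n f = vnorm n g"
  unfolding vnorm_def by (rule L2_set_cong) auto

lemma pow_mat_Suc_left:
  fixes A :: "complex mat"
  assumes A: "A \<in> carrier_mat n n"
  shows "A ^\<^sub>m Suc k = A * A ^\<^sub>m k"
proof (induction k)
  case (Suc k)
  have "A ^\<^sub>m Suc (Suc k) = (A * A ^\<^sub>m k) * A" using Suc by simp
  also have "\<dots> = A * (A ^\<^sub>m k * A)" using A by (intro assoc_mult_mat) auto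
  finally show ?case by simp
qed (use A in simp)

text \<open>\<open>A\<close> is \<open>B\<close> plus \<open>m\<close> times the all-ones matrix,
  whose operator norm gives \<open>\<bar>m\<bar> * n\<close>; \<open>\<kappa>\<close> bounds the
  operator norm of \<open>B\<close> and is at most that.\<close>

locale constant_shift =
  fixes n :: nat and A B :: "complex mat" and m :: real and \<kappa> :: real and r u lam
  assumes A: "A \<in> carrier_mat n n" and B: "B \<in> carrier_mat n n"
    and shift: "\<And>k l. k < n \<Longrightarrow> l < n \<Longrightarrow> A $$ (k, l) = complex_of_real m + B $$ (k, l)"
    and herm: "hermitian_fun n (\<lambda>k l. B $$ (k, l))"
    and spec: "spectral n (\<lambda>k l. B $$ (k, l)) r u lam" and lam: "\<And>i. i < r \<Longrightarrow> \<bar>lam i\<bar> \<le> \<kappa>"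
    and kappa: "0 \<le> \<kappa>" "\<kappa> \<le> \<bar>m\<bar> * real n"
begin

abbreviation a :: "nat \<Rightarrow> nat \<Rightarrow> complex" where "a \<equiv> \<lambda>k l. A $$ (k, l)"
abbreviation b :: "nat \<Rightarrow> nat \<Rightarrow> complex" where "b \<equiv> \<lambda>k l. B $$ (k, l)"
abbreviation h :: real where "h \<equiv> \<bar>m\<bar> * real n"

text \<open>With \<open>1\<close> for the all-ones vector, \<open>p i\<close> is the column
  \<open>A^i 1\<close> and \<open>q j\<close> is the row \<open>1^T B^j\<close>.\<close>

definition p :: "nat \<Rightarrow> nat \<Rightarrow> complex" where "p i k = (\<Sum>j<n. (A ^\<^sub>m i) $$ (k, j))"
definition q :: "nat \<Rightarrow> nat \<Rightarrow> complex" where "q j l = (\<Sum>k<n. (B ^\<^sub>m j) $$ (k, l))"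

lemma vnorm_b: "vnorm n (mv n b v) \<le> \<kappa> * vnorm n v"
proof (rule power2_le_imp_le)
  show "(vnorm n (mv n b v))\<^sup>2 \<le> (\<kappa> * vnorm n v)\<^sup>2"
    unfolding vnorm_square power_mult_distrib by (rule spectral_norm_mv_le[OF spec lam])
qed (use kappa vnorm_nonneg in auto)

lemma mv_a: "k < n \<Longrightarrow> mv n a v k = mv n b v k + complex_of_real m * (\<Sum>j<n. v j)"
  unfolding mv_def by (simp add: shift distrib_right sum.distrib sum_distrib_left)

lemma vnorm_a: "vnorm n (mv n a v) \<le> 2 * h * vnorm n v"
proof -
  have s: "cmod (\<Sum>j<n. v j) \<le> vnorm n v * sqrt n"
    using vnorm_product[where f = v and g = "\<lambda>_. 1" and n = n] by (simp add: vnorm_const)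
  have "vnorm n (mv n a v) = vnorm n (\<lambda>k. mv n b v k + complex_of_real m * (\<Sum>j<n. v j))"
    by (rule vnorm_cong) (rule mv_a)
  also have "\<dots> \<le> vnorm n (mv n b v) + vnorm n (\<lambda>k. complex_of_real m * (\<Sum>j<n. v j))" by (rule vnorm_triangle)
  also have "\<dots> \<le> h * vnorm n v + sqrt n * (\<bar>m\<bar> * (vnorm n v * sqrt n))"
    unfolding vnorm_const norm_mult norm_of_real
    using s vnorm_nonneg[of n v] kappa
    by (intro add_mono order_trans[OF vnorm_b] mult_left_mono mult_right_mono) auto
  also have "sqrt n * (\<bar>m\<bar> * (vnorm n v * sqrt n)) = \<bar>m\<bar> * (sqrt n * sqrt n) * vnorm n v" by (simp only: ac_simps)
  also have "sqrt n * sqrt n = real n" by simp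
  finally show ?thesis by (simp add: algebra_simps)
qed

lemma p_Suc: "k < n \<Longrightarrow> p (Suc i) k = mv n a (p i) k"
proof -
  assume k: "k < n"
  have "p (Suc i) k = (\<Sum>j<n. \<Sum>l<n. a k l * (A ^\<^sub>m i) $$ (l, j))"
    unfolding p_def pow_mat_Suc_left[OF A] using A k by (simp add: scalar_prod_def atLeast0LessThan)
  also have "\<dots> = mv n a (p i) k"
    unfolding mv_def p_def sum_distrib_left by (rule sum.swap)
  finally show ?thesis .
qed

lemma p_0: "k < n \<Longrightarrow> p 0 k = 1"
  using A by (simp add: p_def)

lemma vnorm_p: "vnorm n (p i) \<le> (2 * h) ^ i * sqrt n"
proof (induction i)
  case 0
  have "vnorm n (p 0) = vnorm n (\<lambda>_. 1)" by (rule vnorm_cong) (rule p_0)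
  then show ?case by (simp add: vnorm_const)
next
  case (Suc i)
  have "vnorm n (p (Suc i)) = vnorm n (mv n a (p i))" by (rule vnorm_cong) (rule p_Suc)
  also have "\<dots> \<le> 2 * h * vnorm n (p i)" by (rule vnorm_a)
  also have "\<dots> \<le> 2 * h * ((2 * h) ^ i * sqrt n)" using Suc by (intro mult_left_mono) auto
  finally show ?case by (simp add: ac_simps)
qed

text \<open>The error of treating the all-ones vector as an eigenvector of \<open>A\<close> with
  eigenvalue \<open>m * n\<close>.\<close>

definition e :: "nat \<Rightarrow> nat \<Rightarrow> complex" where "e i k = p i k - complex_of_real (m * real n) ^ i"

text \<open>Each multiplication by \<open>A\<close> at most doubles the error relative to
  \<open>h\<close> and adds a multiple of \<open>B 1\<close>. The factor \<open>h\<close> on the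
  left stands in for a division, so that \<open>h = 0\<close> is no special case.\<close>

lemma vnorm_e: "h * vnorm n (e i) \<le> real i * (2 * h) ^ i * (\<kappa> * sqrt n)"
proof (induction i)
  case 0
  have "vnorm n (e 0) = vnorm n (\<lambda>_. 0)" by (rule vnorm_cong) (simp add: e_def p_0)
  then show ?case by (simp add: vnorm_const)
next
  case (Suc i)
  let ?c = "complex_of_real (m * real n)"
  have step: "e (Suc i) k = mv n a (e i) k + ?c ^ i * mv n b (\<lambda>_. 1) k" if k: "k < n" for k
  proof -
    have "p (Suc i) k = mv n a (\<lambda>l. e i l + ?c ^ i * 1) k"
      unfolding p_Suc[OF k] by (simp add: e_def)
    also have "\<dots> = mv n a (e i) k + ?c ^ i * mv n a (\<lambda>_. 1) k"
      by (simp add: mv_def distrib_left sum.distrib sum_distrib_left ac_simps)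
    also have "mv n a (\<lambda>_. 1) k = mv n b (\<lambda>_. 1) k + ?c" by (subst mv_a[OF k]) simp
    finally have P: "p (Suc i) k = mv n a (e i) k + ?c ^ i * (mv n b (\<lambda>_. 1) k + ?c)" .
    show ?thesis unfolding e_def[of "Suc i"] P by (simp add: algebra_simps)
  qed
  have "vnorm n (e (Suc i)) = vnorm n (\<lambda>k. mv n a (e i) k + ?c ^ i * mv n b (\<lambda>_. 1) k)"
    by (rule vnorm_cong) (rule step)
  also have "\<dots> \<le> vnorm n (mv n a (e i)) + vnorm n (\<lambda>k. ?c ^ i * mv n b (\<lambda>_. 1) k)" by (rule vnorm_triangle)
  also have "\<dots> \<le> 2 * h * vnorm n (e i) + h ^ i * (\<kappa> * sqrt n)"
  proof (rule add_mono[OF vnorm_a])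
    have "cmod (?c ^ i) = h ^ i" unfolding norm_power norm_of_real by (simp add: abs_mult)
    moreover have "vnorm n (mv n b (\<lambda>_. 1)) \<le> \<kappa> * sqrt n" using vnorm_b[of "\<lambda>_. 1"] by (simp add: vnorm_const)
    ultimately show "vnorm n (\<lambda>k. ?c ^ i * mv n b (\<lambda>_. 1) k) \<le> h ^ i * (\<kappa> * sqrt n)"
      unfolding vnorm_scale by (simp add: mult_left_mono)
  qed
  finally have "h * vnorm n (e (Suc i)) \<le> h * (2 * h * vnorm n (e i) + h ^ i * (\<kappa> * sqrt n))"
    by (intro mult_left_mono) auto
  also have "\<dots> = 2 * h * (h * vnorm n (e i)) + h ^ Suc i * (\<kappa> * sqrt n)" by (simp add: algebra_simps)
  also have "\<dots> \<le> 2 * h * (real i * (2 * h) ^ i * (\<kappa> * sqrt n)) + (2 * h) ^ Suc i * (\<kappa> * sqrt n)"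
    using Suc kappa by (intro add_mono mult_left_mono mult_right_mono power_mono) auto
  finally show ?case by (simp add: algebra_simps)
qed

lemma q_Suc: "l < n \<Longrightarrow> q (Suc j) l = (\<Sum>k<n. q j k * b k l)"
proof -
  assume l: "l < n"
  have "q (Suc j) l = (\<Sum>k<n. \<Sum>i<n. (B ^\<^sub>m j) $$ (k, i) * b i l)"
    unfolding q_def using B l by (simp add: scalar_prod_def atLeast0LessThan)
  also have "\<dots> = (\<Sum>k<n. q j k * b k l)" unfolding q_def sum_distrib_right by (rule sum.swap)
  finally show ?thesis .
qed

lemma q_0: "k < n \<Longrightarrow> q 0 k = 1"
  using B by (simp add: q_def)

lemma vnorm_q: "vnorm n (q j) \<le> \<kappa> ^ j * sqrt n"
proof (induction j)
  case 0
  have "vnorm n (q 0) = vnorm n (\<lambda>_. 1)" by (rule vnorm_cong) (rule q_0)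
  then show ?case by (simp add: vnorm_const)
next
  case (Suc j)
  have "vnorm n (q (Suc j)) = vnorm n (\<lambda>l. cnj (mv n b (\<lambda>k. cnj (q j k)) l))"
  proof (rule vnorm_cong)
    fix l assume l: "l < n"
    show "q (Suc j) l = cnj (mv n b (\<lambda>k. cnj (q j k)) l)"
      unfolding q_Suc[OF l] mv_def cnj_sum complex_cnj_mult complex_cnj_cnj
      using hermitian_funD[OF herm _ l] by (intro sum.cong refl) (simp add: mult.commute)
  qed
  also have "\<dots> \<le> \<kappa> * vnorm n (q j)" unfolding vnorm_cnj using vnorm_b[of "\<lambda>k. cnj (q j k)"] unfolding vnorm_cnj .
  also have "\<dots> \<le> \<kappa> * (\<kappa> ^ j * sqrt n)" using Suc kappa by (intro mult_left_mono) auto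
  finally show ?case by (simp add: ac_simps)
qed

text \<open>Telescoping: \<open>A^d - B^d\<close> is the sum of
  \<open>A^i (A - B) B^(d - 1 - i)\<close>, and \<open>A - B\<close> is \<open>m\<close> times the
  outer product of the all-ones vector with itself.\<close>

lemma pow_shift:
  assumes "k < n" "l < n"
  shows "(A ^\<^sub>m d) $$ (k, l) = (B ^\<^sub>m d) $$ (k, l) + complex_of_real m * (\<Sum>i<d. p i k * q (d - Suc i) l)"
  using assms(2)
proof (induction d arbitrary: l)
  case 0
  then show ?case using A B by simp
next
  case (Suc d)
  have "(A ^\<^sub>m Suc d) $$ (k, l) = (\<Sum>j<n. (A ^\<^sub>m d) $$ (k, j) * a j l)"
    using A Suc.prems assms(1) by (simp add: scalar_prod_def atLeast0LessThan)
  also have "\<dots> = (\<Sum>j<n. (A ^\<^sub>m d) $$ (k, j) * b j l + complex_of_real m * (A ^\<^sub>m d) $$ (k, j))"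
    using Suc.prems by (intro sum.cong refl) (simp add: shift algebra_simps)
  also have "\<dots> = (\<Sum>j<n. (A ^\<^sub>m d) $$ (k, j) * b j l) + complex_of_real m * p d k"
    by (simp add: sum.distrib sum_distrib_left p_def)
  also have "(\<Sum>j<n. (A ^\<^sub>m d) $$ (k, j) * b j l) = (\<Sum>j<n. (B ^\<^sub>m d) $$ (k, j) * b j l + complex_of_real m * (\<Sum>i<d. p i k * (q (d - Suc i) j * b j l)))"
    by (intro sum.cong refl) (simp add: Suc.IH algebra_simps sum_distrib_left sum_distrib_right)
  also have "\<dots> = (B ^\<^sub>m Suc d) $$ (k, l) + complex_of_real m * (\<Sum>i<d. p i k * (\<Sum>j<n. q (d - Suc i) j * b j l))"
  proof -
    have "(\<Sum>j<n. (B ^\<^sub>m d) $$ (k, j) * b j l) = (B ^\<^sub>m Suc d) $$ (k, l)"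
      using B Suc.prems assms(1) by (simp add: scalar_prod_def atLeast0LessThan)
    moreover have "(\<Sum>j<n. \<Sum>i<d. p i k * (q (d - Suc i) j * b j l)) = (\<Sum>i<d. p i k * (\<Sum>j<n. q (d - Suc i) j * b j l))"
      by (subst sum.swap) (simp add: sum_distrib_left)
    ultimately show ?thesis by (simp add: sum.distrib flip: sum_distrib_left)
  qed
  also have "(\<Sum>i<d. p i k * (\<Sum>j<n. q (d - Suc i) j * b j l)) = (\<Sum>i<d. p i k * q (Suc d - Suc i) l)"
  proof (intro sum.cong refl)
    fix i assume "i \<in> {..<d}"
    then have "Suc d - Suc i = Suc (d - Suc i)" by auto
    then show "p i k * (\<Sum>j<n. q (d - Suc i) j * b j l) = p i k * q (Suc d - Suc i) l"
      by (simp only: q_Suc[OF Suc.prems])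
  qed
  finally show ?case using q_0[OF Suc.prems] by (simp add: algebra_simps)
qed

text \<open>All telescoping terms but the last contain a factor \<open>B\<close> and so a factor
  \<open>\<kappa>\<close>. The last one is \<open>m\<close> times \<open>1^T A^(d - 1) 1\<close>,
  which is close to \<open>(m * n)^d\<close>.\<close>

lemma trace_shift:
  assumes d: "0 < d"
  shows "cmod (mat_trace (A ^\<^sub>m d) - mat_trace (B ^\<^sub>m d) - complex_of_real (m * real n) ^ d)
     \<le> 2 * real d * (2 * h) ^ (d - 1) * \<kappa>"
proof -
  obtain c where c: "d = Suc c" using d gr0_conv_Suc by auto
  define t where "t i = complex_of_real m * (\<Sum>k<n. p i k * q (d - Suc i) k)" for i
  have "mat_trace (A ^\<^sub>m d) = (\<Sum>k<n. (B ^\<^sub>m d) $$ (k, k) + complex_of_real m * (\<Sum>i<d. p i k * q (d - Suc i) k))"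
    unfolding mat_trace_def using A by (intro sum.cong) (auto simp del: pow_mat.simps simp: pow_shift)
  also have "\<dots> = (\<Sum>k<n. (B ^\<^sub>m d) $$ (k, k)) + complex_of_real m * (\<Sum>k<n. \<Sum>i<d. p i k * q (d - Suc i) k)"
    by (simp only: sum.distrib sum_distrib_left)
  also have "(\<Sum>k<n. \<Sum>i<d. p i k * q (d - Suc i) k) = (\<Sum>i<d. \<Sum>k<n. p i k * q (d - Suc i) k)"
    by (rule sum.swap)
  also have "(\<Sum>k<n. (B ^\<^sub>m d) $$ (k, k)) = mat_trace (B ^\<^sub>m d)"
    unfolding mat_trace_def using B by (simp del: pow_mat.simps)
  finally have tr: "mat_trace (A ^\<^sub>m d) - mat_trace (B ^\<^sub>m d) = (\<Sum>i<c. t i) + t c"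
    unfolding t_def sum_distrib_left[symmetric] distrib_left[symmetric] by (simp add: c del: pow_mat.simps)
  have sq: "sqrt n * sqrt n = real n" by simp
  have ti: "cmod (t i) \<le> (2 * h) ^ c * \<kappa>" if i: "i < c" for i
  proof -
    have "cmod (t i) \<le> \<bar>m\<bar> * (vnorm n (p i) * vnorm n (q (d - Suc i)))"
      unfolding t_def norm_mult norm_of_real by (intro mult_left_mono vnorm_product) simp
    also have "\<dots> \<le> \<bar>m\<bar> * (((2 * h) ^ i * sqrt n) * (\<kappa> ^ (d - Suc i) * sqrt n))"
      by (intro mult_left_mono mult_mono vnorm_p vnorm_q vnorm_nonneg) auto
    also have "\<dots> = \<bar>m\<bar> * (sqrt n * sqrt n) * ((2 * h) ^ i * \<kappa> ^ (d - Suc i))"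
      by (simp only: ac_simps)
    also have "\<dots> = h * ((2 * h) ^ i * \<kappa> ^ (d - Suc i))" unfolding sq ..
    also have "\<dots> \<le> 2 * h * ((2 * h) ^ i * ((2 * h) ^ (d - Suc (Suc i)) * \<kappa>))"
    proof (rule mult_mono)
      have "d - Suc i = Suc (d - Suc (Suc i))" using i c by simp
      then have "\<kappa> ^ (d - Suc i) = \<kappa> ^ (d - Suc (Suc i)) * \<kappa>" by simp
      also have "\<dots> \<le> (2 * h) ^ (d - Suc (Suc i)) * \<kappa>" using kappa by (intro mult_right_mono power_mono) auto
      finally show "(2 * h) ^ i * \<kappa> ^ (d - Suc i) \<le> (2 * h) ^ i * ((2 * h) ^ (d - Suc (Suc i)) * \<kappa>)"
        by (rule mult_left_mono) simp
    qed (use kappa in auto)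
    also have "\<dots> = (2 * h) ^ (Suc i + (d - Suc (Suc i))) * \<kappa>" by (simp add: power_add ac_simps)
    also have "Suc i + (d - Suc (Suc i)) = c" using i c by simp
    finally show ?thesis .
  qed
  have "t c = complex_of_real m * (\<Sum>k<n. p c k)" by (simp add: t_def c q_0)
  also have "(\<Sum>k<n. p c k) = (\<Sum>k<n. e c k) + real n * complex_of_real (m * real n) ^ c"
    by (simp add: e_def sum_subtractf)
  finally have "t c - complex_of_real (m * real n) ^ d = complex_of_real m * (\<Sum>k<n. e c k)"
    by (simp add: c algebra_simps)
  also have "cmod \<dots> \<le> \<bar>m\<bar> * (vnorm n (e c) * sqrt n)"
    unfolding norm_mult norm_of_real using vnorm_product[where f = "e c" and g = "\<lambda>_. 1" and n = n] by (intro mult_left_mono) (auto simp: vnorm_const)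
  finally have tc: "cmod (t c - complex_of_real (m * real n) ^ d) \<le> \<bar>m\<bar> * (vnorm n (e c) * sqrt n)" .
  \<comment> \<open>A factor \<open>sqrt n\<close> common to both sides of the bound on
    \<open>e\<close> is cancelled, hence the separate case \<open>n = 0\<close>.\<close>
  have tc': "cmod (t c - complex_of_real (m * real n) ^ d) \<le> real c * (2 * h) ^ c * \<kappa>"
  proof (cases "n = 0")
    case True
    then show ?thesis using tc kappa by simp
  next
    case False
    have "(\<bar>m\<bar> * (vnorm n (e c) * sqrt n)) * sqrt n = h * vnorm n (e c)" using sq by (simp add: mult.assoc mult.left_commute)
    also have "\<dots> \<le> (real c * (2 * h) ^ c * \<kappa>) * sqrt n" using vnorm_e[of c] by (simp add: mult.assoc)
    finally have "\<bar>m\<bar> * (vnorm n (e c) * sqrt n) \<le> real c * (2 * h) ^ c * \<kappa>"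
      using False by (simp add: mult_le_cancel_right)
    with tc show ?thesis by linarith
  qed
  have "cmod (mat_trace (A ^\<^sub>m d) - mat_trace (B ^\<^sub>m d) - complex_of_real (m * real n) ^ d)
     = cmod ((\<Sum>i<c. t i) + (t c - complex_of_real (m * real n) ^ d))" unfolding tr by (simp add: algebra_simps)
  also have "\<dots> \<le> (\<Sum>i<c. (2 * h) ^ c * \<kappa>) + real c * (2 * h) ^ c * \<kappa>"
    using ti by (intro order_trans[OF norm_triangle_ineq] add_mono sum_norm_le tc') auto
  also have "\<dots> = 2 * real c * (2 * h) ^ c * \<kappa>" by simp
  also have "\<dots> \<le> 2 * real d * (2 * h) ^ c * \<kappa>" using kappa by (intro mult_right_mono mult_left_mono) (auto simp: c)
  finally show ?thesis by (simp add: c)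
qed

end

section \<open>Small exponential tilts of the off-diagonal law\<close>

lemma power_add_le:
  fixes x y :: real
  assumes "0 \<le> x" "0 \<le> y"
  shows "(x + y) ^ k \<le> 2 ^ k * (x ^ k + y ^ k)"
proof -
  have "(x + y) ^ k \<le> (2 * max x y) ^ k" using assms by (intro power_mono) auto
  also have "\<dots> = 2 ^ k * max x y ^ k" by (simp add: power_mult_distrib)
  also have "max x y ^ k \<le> x ^ k + y ^ k" using assms by (simp add: max_def)
  finally show ?thesis by simp
qed

lemma exp_taylor_real:
  fixes x :: real
  shows "\<bar>exp x - 1\<bar> \<le> exp \<bar>x\<bar> * \<bar>x\<bar>" "\<bar>exp x - 1 - x\<bar> \<le> exp \<bar>x\<bar> * \<bar>x\<bar> ^ 2" "\<bar>exp x - 1 - x - x\<^sup>2 / 2\<bar> \<le> exp \<bar>x\<bar> * \<bar>x\<bar> ^ 3"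
proof -
  show "\<bar>exp x - 1\<bar> \<le> exp \<bar>x\<bar> * \<bar>x\<bar>" using Taylor_exp_field[of x 0] by simp
  show "\<bar>exp x - 1 - x\<bar> \<le> exp \<bar>x\<bar> * \<bar>x\<bar> ^ 2" using Taylor_exp_field[of x 1] by (simp add: diff_diff_eq power2_eq_square)
  have "\<bar>exp x - 1 - x - x\<^sup>2 / 2\<bar> \<le> exp \<bar>x\<bar> * \<bar>x\<bar> ^ 3 / 2"
    using Taylor_exp_field[of x 2] by (simp add: numeral_2_eq_2 numeral_3_eq_3 diff_diff_eq fact_numeral)
  also have "\<dots> \<le> exp \<bar>x\<bar> * \<bar>x\<bar> ^ 3" by simp
  finally show "\<bar>exp x - 1 - x - x\<^sup>2 / 2\<bar> \<le> exp \<bar>x\<bar> * \<bar>x\<bar> ^ 3" .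
qed

context wigner_ldp
begin

definition D :: real where "D = (LINT z|\<mu>. expdom z) + (LINT z|\<nu>. expdom z)"

lemma D_ge: "(LINT z|\<mu>. expdom z) \<le> D" "(LINT z|\<nu>. expdom z) \<le> D" "0 \<le> D"
proof -
  have "0 \<le> (LINT z|\<mu>. expdom z)" "0 \<le> (LINT z|\<nu>. expdom z)" by (simp_all add: integral_nonneg_AE expdom_nonneg)
  then show "(LINT z|\<mu>. expdom z) \<le> D" "(LINT z|\<nu>. expdom z) \<le> D" "0 \<le> D" by (auto simp: D_def)
qed

lemma dominated_integral:
  fixes f :: "complex \<Rightarrow> 'c::{banach, second_countable_topology}"
  assumes f: "f \<in> borel_measurable borel" and c: "0 \<le> c" and le: "\<And>z. norm (f z) \<le> c * (cmod z ^ k * exp \<bar>Re z\<bar>)"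
  shows "integrable \<mu> f" "integrable \<nu> f" "norm (LINT z|\<mu>. f z) \<le> c * (real k ^ k * D)" "norm (LINT z|\<nu>. f z) \<le> c * (real k ^ k * D)"
proof -
  have le': "norm (f z) \<le> c * (real k ^ k * expdom z)" for z
    using le[of z] mult_left_mono[OF power_expdom[of z k] c] by linarith
  have fm: "f \<in> borel_measurable \<mu>" "f \<in> borel_measurable \<nu>" using f by (simp_all cong: measurable_cong_sets add: sets_mu sets_nu)
  have nn: "0 \<le> c * (real k ^ k * expdom z)" for z using c expdom_nonneg by simp
  have i: "integrable \<mu> (\<lambda>z. c * (real k ^ k * expdom z))" "integrable \<nu> (\<lambda>z. c * (real k ^ k * expdom z))"
    using expdom_integrable by auto
  show I: "integrable \<mu> f" "integrable \<nu> f"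
    using fm i le' nn by (auto intro!: Bochner_Integration.integrable_bound[OF i(1)] Bochner_Integration.integrable_bound[OF i(2)])
  have "norm (LINT z|\<mu>. f z) \<le> (LINT z|\<mu>. c * (real k ^ k * expdom z))"
    using I i le' by (intro order_trans[OF integral_norm_bound] integral_mono) auto
  also have "\<dots> = c * (real k ^ k * (LINT z|\<mu>. expdom z))" by simp
  also have "\<dots> \<le> c * (real k ^ k * D)" using c D_ge by (intro mult_left_mono) auto
  finally show "norm (LINT z|\<mu>. f z) \<le> c * (real k ^ k * D)" .
  have "norm (LINT z|\<nu>. f z) \<le> (LINT z|\<nu>. c * (real k ^ k * expdom z))"
    using I i le' by (intro order_trans[OF integral_norm_bound] integral_mono) auto
  also have "\<dots> = c * (real k ^ k * (LINT z|\<nu>. expdom z))" by simp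
  also have "\<dots> \<le> c * (real k ^ k * D)" using c D_ge by (intro mult_left_mono) auto
  finally show "norm (LINT z|\<nu>. f z) \<le> c * (real k ^ k * D)" .
qed

text \<open>Only the real part is tilted, so that for both values of \<open>\<beta>\<close> the mean
  created off the diagonal is a real constant.\<close>

definition laplace :: "real \<Rightarrow> real" where "laplace a = (LINT z|\<nu>. exp (a * Re z))"
definition tilt_density :: "real \<Rightarrow> complex \<Rightarrow> real" where "tilt_density a z = exp (a * Re z) / laplace a"
definition tilt_mean :: "real \<Rightarrow> real" where "tilt_mean a = (LINT z|\<nu>. exp (a * Re z) * Re z) / laplace a"
text \<open>The tilted mean is real, so this is the variance of the complex entry.\<close>

definition tilt_var :: "real \<Rightarrow> real" where "tilt_var a = (LINT z|\<nu>. exp (a * Re z) * (cmod z)\<^sup>2) / laplace a - (tilt_mean a)\<^sup>2"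

lemma measurable_exp_Re: "(\<lambda>z. exp (a * Re z)) \<in> borel_measurable borel"
  by (intro borel_measurable_continuous_onI continuous_intros)

lemma measurable_tilt_density: "tilt_density a \<in> borel_measurable borel"
  unfolding tilt_density_def[abs_def] by (intro borel_measurable_divide measurable_exp_Re borel_measurable_const)

lemma exp_Re_le:
  assumes "\<bar>a\<bar> \<le> 1"
  shows "exp (a * Re z) \<le> exp \<bar>Re z\<bar>" "exp \<bar>a * Re z\<bar> \<le> exp \<bar>Re z\<bar>"
proof -
  have "\<bar>a * Re z\<bar> \<le> 1 * \<bar>Re z\<bar>" unfolding abs_mult using assms by (intro mult_right_mono) auto
  then show "exp (a * Re z) \<le> exp \<bar>Re z\<bar>" "exp \<bar>a * Re z\<bar> \<le> exp \<bar>Re z\<bar>" by auto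
qed

lemma tilt_integrable:
  fixes f :: "complex \<Rightarrow> 'c::{banach, second_countable_topology}"
  assumes "\<bar>a\<bar> \<le> 1" "f \<in> borel_measurable borel" "\<And>z. norm (f z) \<le> c * cmod z ^ k" "0 \<le> c"
  shows "integrable \<nu> (\<lambda>z. exp (a * Re z) *\<^sub>R f z)"
proof (rule dominated_integral(2)[where c = c and k = k])
  show "(\<lambda>z. exp (a * Re z) *\<^sub>R f z) \<in> borel_measurable borel"
    by (intro borel_measurable_scaleR measurable_exp_Re assms)
  show "norm (exp (a * Re z) *\<^sub>R f z) \<le> c * (cmod z ^ k * exp \<bar>Re z\<bar>)" for z
  proof -
    have "norm (exp (a * Re z) *\<^sub>R f z) \<le> exp \<bar>Re z\<bar> * (c * cmod z ^ k)"
      unfolding norm_scaleR using exp_Re_le[OF assms(1), of z] assms(3)[of z] by (intro mult_mono) auto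
    then show ?thesis by (simp add: ac_simps)
  qed
qed (rule assms)

lemma laplace_ge_1: "\<bar>a\<bar> \<le> 1 \<Longrightarrow> 1 \<le> laplace a"
proof -
  interpret prob_space \<nu> by (rule prob_nu)
  assume a: "\<bar>a\<bar> \<le> 1"
  have i: "integrable \<nu> (\<lambda>z. exp (a * Re z))"
    using tilt_integrable[OF a, of "\<lambda>_. 1 :: real" 1 0] by simp
  have "(LINT z|\<nu>. 1 + a * Re z) \<le> laplace a"
    unfolding laplace_def using i mean_nu by (intro integral_mono) auto
  then show ?thesis using mean_nu prob_space by simp
qed

lemma tilt_density_nonneg: "0 \<le> tilt_density a z"
  unfolding tilt_density_def laplace_def by (intro divide_nonneg_nonneg integral_nonneg_AE) auto

text \<open>Taylor expansion under the integral. All three remainders are at most a power of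
  \<open>\<bar>a\<bar>\<close> times \<open>cmod z ^ 3 * exp \<bar>Re z\<bar>\<close>, so the
  constant is \<open>27 = 3 ^ 3\<close> from \<open>power_expdom\<close>.\<close>

lemma expansions:
  assumes a: "\<bar>a\<bar> \<le> 1"
  shows "\<bar>laplace a - 1 - a\<^sup>2 / (2 * real \<beta>)\<bar> \<le> \<bar>a\<bar> ^ 3 * (27 * D)"
    and "\<bar>(LINT z|\<nu>. exp (a * Re z) * Re z) - a / real \<beta>\<bar> \<le> a\<^sup>2 * (27 * D)"
    and "\<bar>(LINT z|\<nu>. exp (a * Re z) * (cmod z)\<^sup>2) - 1\<bar> \<le> \<bar>a\<bar> * (27 * D)"
proof -
  interpret prob_space \<nu> by (rule prob_nu)
  have i0: "integrable \<nu> (\<lambda>z. exp (a * Re z))" using tilt_integrable[OF a, of "\<lambda>_. 1 :: real" 1 0] by simp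
  have i1: "integrable \<nu> (\<lambda>z. exp (a * Re z) * Re z)"
    using tilt_integrable[OF a measurable_Re, of 1 1] by (simp add: abs_Re_le_cmod)
  have i2: "integrable \<nu> (\<lambda>z. exp (a * Re z) * (cmod z)\<^sup>2)"
    using tilt_integrable[OF a, of "\<lambda>z. (cmod z)\<^sup>2" 1 2] by simp
  have r3: "\<bar>Re z\<bar> ^ 3 \<le> cmod z ^ 3" for z using abs_Re_le_cmod[of z] by (intro power_mono) auto
  have "laplace a - 1 - a\<^sup>2 / (2 * real \<beta>) = (LINT z|\<nu>. exp (a * Re z) - 1 - a * Re z - (a * Re z)\<^sup>2 / 2)"
    unfolding laplace_def power_mult_distrib using i0 mean_nu nu_squares nu_covariance prob_space by simp
  also have "\<bar>\<dots>\<bar> \<le> \<bar>a\<bar> ^ 3 * (real 3 ^ 3 * D)"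
  proof (subst real_norm_def[symmetric], rule dominated_integral(4))
    show "(\<lambda>z. exp (a * Re z) - 1 - a * Re z - (a * Re z)\<^sup>2 / 2) \<in> borel_measurable borel"
      by (intro borel_measurable_continuous_onI continuous_intros) auto
    show "norm (exp (a * Re z) - 1 - a * Re z - (a * Re z)\<^sup>2 / 2) \<le> \<bar>a\<bar> ^ 3 * (cmod z ^ 3 * exp \<bar>Re z\<bar>)" for z
    proof -
      have "norm (exp (a * Re z) - 1 - a * Re z - (a * Re z)\<^sup>2 / 2) \<le> exp \<bar>a * Re z\<bar> * \<bar>a * Re z\<bar> ^ 3"
        unfolding real_norm_def by (rule exp_taylor_real)
      also have "\<dots> \<le> exp \<bar>Re z\<bar> * (\<bar>a\<bar> ^ 3 * cmod z ^ 3)"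
        unfolding abs_mult power_mult_distrib using exp_Re_le[OF a, of z] r3[of z]
        by (intro mult_mono mult_left_mono) (auto simp: abs_mult)
      finally show ?thesis by (simp only: ac_simps)
    qed
  qed simp
  finally show "\<bar>laplace a - 1 - a\<^sup>2 / (2 * real \<beta>)\<bar> \<le> \<bar>a\<bar> ^ 3 * (27 * D)" by simp
  have "(LINT z|\<nu>. exp (a * Re z) * Re z) - a / real \<beta> = (LINT z|\<nu>. exp (a * Re z) * Re z - Re z - a * (Re z)\<^sup>2)"
    using i1 mean_nu nu_squares nu_covariance by simp
  also have "\<bar>\<dots>\<bar> \<le> a\<^sup>2 * (real 3 ^ 3 * D)"
  proof (subst real_norm_def[symmetric], rule dominated_integral(4))
    show "(\<lambda>z. exp (a * Re z) * Re z - Re z - a * (Re z)\<^sup>2) \<in> borel_measurable borel"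
      by (intro borel_measurable_continuous_onI continuous_intros)
    show "norm (exp (a * Re z) * Re z - Re z - a * (Re z)\<^sup>2) \<le> a\<^sup>2 * (cmod z ^ 3 * exp \<bar>Re z\<bar>)" for z
    proof -
      have "exp (a * Re z) * Re z - Re z - a * (Re z)\<^sup>2 = (exp (a * Re z) - 1 - a * Re z) * Re z"
        by (simp add: algebra_simps power2_eq_square)
      also have "norm \<dots> \<le> (exp \<bar>a * Re z\<bar> * \<bar>a * Re z\<bar> ^ 2) * \<bar>Re z\<bar>"
        unfolding real_norm_def abs_mult[of "exp (a * Re z) - 1 - a * Re z" "Re z"] by (intro mult_right_mono exp_taylor_real) auto
      also have "\<dots> = exp \<bar>a * Re z\<bar> * (a\<^sup>2 * \<bar>Re z\<bar> ^ 3)"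
        by (simp add: abs_mult power_mult_distrib power2_eq_square power3_eq_cube)
      also have "\<dots> \<le> exp \<bar>Re z\<bar> * (a\<^sup>2 * cmod z ^ 3)"
        using exp_Re_le[OF a, of z] r3[of z] by (intro mult_mono mult_left_mono) auto
      finally show ?thesis by (simp only: ac_simps)
    qed
  qed simp
  finally show "\<bar>(LINT z|\<nu>. exp (a * Re z) * Re z) - a / real \<beta>\<bar> \<le> a\<^sup>2 * (27 * D)" by simp
  have "(LINT z|\<nu>. exp (a * Re z) * (cmod z)\<^sup>2) - 1 = (LINT z|\<nu>. exp (a * Re z) * (cmod z)\<^sup>2 - (cmod z)\<^sup>2)"
    using i2 norm2_nu by simp
  also have "\<bar>\<dots>\<bar> \<le> \<bar>a\<bar> * (real 3 ^ 3 * D)"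
  proof (subst real_norm_def[symmetric], rule dominated_integral(4))
    show "(\<lambda>z. exp (a * Re z) * (cmod z)\<^sup>2 - (cmod z)\<^sup>2) \<in> borel_measurable borel"
      by (intro borel_measurable_continuous_onI continuous_intros)
    show "norm (exp (a * Re z) * (cmod z)\<^sup>2 - (cmod z)\<^sup>2) \<le> \<bar>a\<bar> * (cmod z ^ 3 * exp \<bar>Re z\<bar>)" for z
    proof -
      have "exp (a * Re z) * (cmod z)\<^sup>2 - (cmod z)\<^sup>2 = (exp (a * Re z) - 1) * (cmod z)\<^sup>2"
        by (simp add: algebra_simps)
      also have "norm \<dots> \<le> (exp \<bar>a * Re z\<bar> * \<bar>a * Re z\<bar>) * (cmod z)\<^sup>2"
        unfolding real_norm_def abs_mult[of _ "(cmod z)\<^sup>2"] abs_power2 by (intro mult_right_mono exp_taylor_real) auto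
      also have "\<dots> \<le> (exp \<bar>Re z\<bar> * (\<bar>a\<bar> * cmod z)) * (cmod z)\<^sup>2"
        unfolding abs_mult[of a] using exp_Re_le[OF a, of z] abs_Re_le_cmod[of z]
        by (intro mult_mono mult_left_mono mult_right_mono) (auto simp: abs_mult)
      also have "\<dots> = \<bar>a\<bar> * (cmod z ^ 3 * exp \<bar>Re z\<bar>)" by (simp add: power2_eq_square power3_eq_cube)
      finally show ?thesis .
    qed
  qed simp
  finally show "\<bar>(LINT z|\<nu>. exp (a * Re z) * (cmod z)\<^sup>2) - 1\<bar> \<le> \<bar>a\<bar> * (27 * D)" by simp
qed

lemma tilt_limits:
  fixes a :: "nat \<Rightarrow> real"
  assumes a0: "a \<longlonglongrightarrow> 0" and ne: "\<forall>\<^sub>F n in sequentially. a n \<noteq> 0"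
  shows "(\<lambda>n. laplace (a n)) \<longlonglongrightarrow> 1" "(\<lambda>n. tilt_mean (a n) / a n) \<longlonglongrightarrow> 1 / real \<beta>" "(\<lambda>n. tilt_var (a n)) \<longlonglongrightarrow> 1"
    "(\<lambda>n. (laplace (a n) - 1) / (a n)\<^sup>2) \<longlonglongrightarrow> 1 / (2 * real \<beta>)"
proof -
  have ev: "\<forall>\<^sub>F n in sequentially. \<bar>a n\<bar> \<le> 1"
    using tendstoD[OF a0, of 1] by (rule eventually_mono) (auto simp: dist_real_def)
  have abs0: "(\<lambda>n. \<bar>a n\<bar>) \<longlonglongrightarrow> 0" using tendsto_rabs[OF a0] by simp
  have z1: "(\<lambda>n. (laplace (a n) - 1) / (a n)\<^sup>2 - 1 / (2 * real \<beta>)) \<longlonglongrightarrow> 0"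
  proof (rule tendsto_0_le[OF abs0, where K = "27 * D"])
    show "\<forall>\<^sub>F n in sequentially. norm ((laplace (a n) - 1) / (a n)\<^sup>2 - 1 / (2 * real \<beta>)) \<le> norm \<bar>a n\<bar> * (27 * D)"
      using ev ne
    proof eventually_elim
      case (elim n)
      have p: "0 < (a n)\<^sup>2" using elim(2) by simp
      have "(laplace (a n) - 1) / (a n)\<^sup>2 - 1 / (2 * real \<beta>) = (laplace (a n) - 1 - (a n)\<^sup>2 / (2 * real \<beta>)) / (a n)\<^sup>2"
        using elim(2) by (simp add: diff_divide_distrib)
      then have "norm ((laplace (a n) - 1) / (a n)\<^sup>2 - 1 / (2 * real \<beta>)) = \<bar>laplace (a n) - 1 - (a n)\<^sup>2 / (2 * real \<beta>)\<bar> / (a n)\<^sup>2"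
        by (simp add: abs_divide)
      also have "\<dots> \<le> (\<bar>a n\<bar> ^ 3 * (27 * D)) / (a n)\<^sup>2" using expansions(1)[OF elim(1)] p by (intro divide_right_mono) auto
      also have "\<dots> = \<bar>a n\<bar> * (27 * D)"
      proof -
        have "\<bar>a n\<bar> ^ 3 = \<bar>a n\<bar> * (a n)\<^sup>2" by (simp add: power3_eq_cube power2_eq_square abs_mult_self_eq mult.assoc)
        then show ?thesis using elim(2) by simp
      qed
      finally show ?case by simp
    qed
  qed
  then show L2: "(\<lambda>n. (laplace (a n) - 1) / (a n)\<^sup>2) \<longlonglongrightarrow> 1 / (2 * real \<beta>)" by (simp add: LIM_zero_iff)
  have "(\<lambda>n. (laplace (a n) - 1) / (a n)\<^sup>2 * (a n)\<^sup>2) \<longlonglongrightarrow> 1 / (2 * real \<beta>) * 0\<^sup>2"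
    by (intro tendsto_mult L2 tendsto_power a0)
  then have "(\<lambda>n. (laplace (a n) - 1) / (a n)\<^sup>2 * (a n)\<^sup>2) \<longlonglongrightarrow> 0" by simp
  moreover have "\<forall>\<^sub>F n in sequentially. (laplace (a n) - 1) / (a n)\<^sup>2 * (a n)\<^sup>2 = laplace (a n) - 1" using ne by eventually_elim simp
  ultimately have "(\<lambda>n. laplace (a n) - 1) \<longlonglongrightarrow> 0" by (rule Lim_transform_eventually)
  then show L1: "(\<lambda>n. laplace (a n)) \<longlonglongrightarrow> 1" by (simp add: LIM_zero_iff)
  have "(\<lambda>n. (LINT z|\<nu>. exp (a n * Re z) * Re z) / a n - 1 / real \<beta>) \<longlonglongrightarrow> 0"
  proof (rule tendsto_0_le[OF abs0, where K = "27 * D"])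
    show "\<forall>\<^sub>F n in sequentially. norm ((LINT z|\<nu>. exp (a n * Re z) * Re z) / a n - 1 / real \<beta>) \<le> norm \<bar>a n\<bar> * (27 * D)"
      using ev ne
    proof eventually_elim
      case (elim n)
      have "(LINT z|\<nu>. exp (a n * Re z) * Re z) / a n - 1 / real \<beta> = ((LINT z|\<nu>. exp (a n * Re z) * Re z) - a n / real \<beta>) / a n"
        using elim(2) by (simp add: diff_divide_distrib)
      then have "norm ((LINT z|\<nu>. exp (a n * Re z) * Re z) / a n - 1 / real \<beta>) = \<bar>(LINT z|\<nu>. exp (a n * Re z) * Re z) - a n / real \<beta>\<bar> / \<bar>a n\<bar>"
        by (simp only: real_norm_def abs_divide)
      also have "\<dots> \<le> ((a n)\<^sup>2 * (27 * D)) / \<bar>a n\<bar>" using expansions(2)[OF elim(1)] by (intro divide_right_mono) auto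
      also have "\<dots> = \<bar>a n\<bar> * (27 * D)"
      proof -
        have "(a n)\<^sup>2 = \<bar>a n\<bar> * \<bar>a n\<bar>" by (simp add: power2_eq_square)
        then show ?thesis using elim(2) by (simp only: mult.assoc) (simp add: field_simps)
      qed
      finally show ?case by simp
    qed
  qed
  then have "(\<lambda>n. (LINT z|\<nu>. exp (a n * Re z) * Re z) / a n) \<longlonglongrightarrow> 1 / real \<beta>" by (simp only: LIM_zero_iff)
  then have "(\<lambda>n. (LINT z|\<nu>. exp (a n * Re z) * Re z) / a n / laplace (a n)) \<longlonglongrightarrow> 1 / real \<beta> / 1"
    by (rule tendsto_divide[OF _ L1]) auto
  then show M: "(\<lambda>n. tilt_mean (a n) / a n) \<longlonglongrightarrow> 1 / real \<beta>" by (simp add: tilt_mean_def mult.commute)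
  have "(\<lambda>n. tilt_mean (a n) / a n * a n) \<longlonglongrightarrow> 1 / real \<beta> * 0" by (intro tendsto_mult M a0)
  then have "(\<lambda>n. tilt_mean (a n) / a n * a n) \<longlonglongrightarrow> 0" by simp
  moreover have "\<forall>\<^sub>F n in sequentially. tilt_mean (a n) / a n * a n = tilt_mean (a n)" using ne by eventually_elim simp
  ultimately have tm0: "(\<lambda>n. tilt_mean (a n)) \<longlonglongrightarrow> 0" by (rule Lim_transform_eventually)
  have "(\<lambda>n. (LINT z|\<nu>. exp (a n * Re z) * (cmod z)\<^sup>2) - 1) \<longlonglongrightarrow> 0"
  proof (rule tendsto_0_le[OF abs0, where K = "27 * D"])
    show "\<forall>\<^sub>F n in sequentially. norm ((LINT z|\<nu>. exp (a n * Re z) * (cmod z)\<^sup>2) - 1) \<le> norm \<bar>a n\<bar> * (27 * D)"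
      using ev by eventually_elim (use expansions(3) in simp)
  qed
  then have "(\<lambda>n. LINT z|\<nu>. exp (a n * Re z) * (cmod z)\<^sup>2) \<longlonglongrightarrow> 1" by (simp only: LIM_zero_iff)
  then have "(\<lambda>n. (LINT z|\<nu>. exp (a n * Re z) * (cmod z)\<^sup>2) / laplace (a n) - (tilt_mean (a n))\<^sup>2) \<longlonglongrightarrow> 1 / 1 - 0\<^sup>2"
    by (intro tendsto_diff tendsto_divide L1 tendsto_power tm0) auto
  then show "(\<lambda>n. tilt_var (a n)) \<longlonglongrightarrow> 1" by (simp add: tilt_var_def)
qed

end

section \<open>The tilted matrix as a Wigner array\<close>

context wigner_ldp
begin

definition upper :: "nat \<Rightarrow> (nat \<times> nat) set" where "upper n = {(i, j). i \<le> j \<and> j < n}"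
text \<open>The diagonal keeps its law; its \<open>n\<close> entries are few beside those that are
  shifted.\<close>

definition tilt :: "real \<Rightarrow> nat \<times> nat \<Rightarrow> complex \<Rightarrow> real" where "tilt a p z = (if fst p < snd p then tilt_density a z else 1)"
definition entry :: "nat \<Rightarrow> nat \<times> nat \<Rightarrow> 'a \<Rightarrow> complex" where "entry n = (\<lambda>(i, j). Xf n i j)"
definition tilted :: "nat \<Rightarrow> real \<Rightarrow> 'a measure" where
  "tilted n a = density (M n) (\<lambda>\<omega>. ennreal (\<Prod>p\<in>upper n. tilt a p (entry n p \<omega>)))"
definition tilted_mean :: "real \<Rightarrow> nat \<times> nat \<Rightarrow> (complex \<Rightarrow> 'c::{banach, second_countable_topology}) \<Rightarrow> 'c" where
  "tilted_mean a p f = (if fst p < snd p then LINT z|\<nu>. tilt_density a z *\<^sub>R f z else LINT z|\<mu>. f z)"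

lemma finite_upper: "finite (upper n)"
  by (rule finite_subset[of _ "{..<n} \<times> {..<n}"]) (auto simp: upper_def)

lemma entry_meas: "p \<in> upper n \<Longrightarrow> entry n p \<in> borel_measurable (M n)"
  by (auto simp: upper_def entry_def X_meas_upper)

lemma entry_law: "p \<in> upper n \<Longrightarrow> distr (M n) borel (entry n p) = (if fst p < snd p then \<nu> else \<mu>)"
  by (auto simp: upper_def entry_def X_off_law X_diag_law)

lemma tilt_density_integral:
  fixes f :: "complex \<Rightarrow> 'c::{banach, second_countable_topology}"
  shows "(LINT z|\<nu>. tilt_density a z *\<^sub>R f z) = (LINT z|\<nu>. exp (a * Re z) *\<^sub>R f z) /\<^sub>R laplace a"
proof -
  have "(LINT z|\<nu>. tilt_density a z *\<^sub>R f z) = (LINT z|\<nu>. inverse (laplace a) *\<^sub>R (exp (a * Re z) *\<^sub>R f z))"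
    by (simp add: tilt_density_def divide_inverse mult.commute)
  also have "\<dots> = (LINT z|\<nu>. exp (a * Re z) *\<^sub>R f z) /\<^sub>R laplace a" by (rule integral_scaleR_right)
  finally show ?thesis .
qed

lemma tilted_integrable:
  fixes f :: "complex \<Rightarrow> 'c::{banach, second_countable_topology}"
  assumes a: "\<bar>a\<bar> \<le> 1" and f: "f \<in> borel_measurable borel" and le: "\<And>z. norm (f z) \<le> c * (1 + cmod z ^ k)"
  shows "integrable \<nu> (\<lambda>z. tilt_density a z *\<^sub>R f z)" "integrable \<mu> f"
proof -
  have c: "0 \<le> c"
  proof -
    have "0 \<le> c * (1 + cmod 1 ^ k)" using le[of 1] norm_ge_zero order_trans by blast
    then show ?thesis by (simp add: zero_le_mult_iff)
  qed
  have g: "(\<lambda>z. c * (1 + cmod z ^ k)) \<in> borel_measurable borel" by measurable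
  have i1: "integrable \<nu> (\<lambda>z. exp (a * Re z) *\<^sub>R (1 :: real))" by (rule tilt_integrable[OF a, where c = 1 and k = 0]) auto
  have i2: "integrable \<nu> (\<lambda>z. exp (a * Re z) *\<^sub>R (cmod z ^ k))" by (rule tilt_integrable[OF a, where c = 1 and k = k]) auto
  have i: "integrable \<nu> (\<lambda>z. (c / laplace a) * (exp (a * Re z) *\<^sub>R 1 + exp (a * Re z) *\<^sub>R (cmod z ^ k)))"
    by (intro integrable_mult_right Bochner_Integration.integrable_add i1 i2)
  have e: "(c / laplace a) * (exp (a * Re z) *\<^sub>R 1 + exp (a * Re z) *\<^sub>R (cmod z ^ k)) = tilt_density a z * (c * (1 + cmod z ^ k))" for z
    by (simp add: tilt_density_def field_simps)
  note [measurable_cong] = sets_nu sets_mu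
  note [measurable] = f measurable_tilt_density
  show "integrable \<nu> (\<lambda>z. tilt_density a z *\<^sub>R f z)"
  proof (rule Bochner_Integration.integrable_bound[OF i])
    show "AE z in \<nu>. norm (tilt_density a z *\<^sub>R f z) \<le> norm ((c / laplace a) * (exp (a * Re z) *\<^sub>R 1 + exp (a * Re z) *\<^sub>R (cmod z ^ k)))"
    proof (rule AE_I2)
      fix z
      show "norm (tilt_density a z *\<^sub>R f z) \<le> norm ((c / laplace a) * (exp (a * Re z) *\<^sub>R 1 + exp (a * Re z) *\<^sub>R (cmod z ^ k)))"
        unfolding e using tilt_density_nonneg[of a z] c le[of z] by (simp add: abs_mult mult_left_mono)
    qed
  qed measurable
  interpret mu: prob_space \<mu> by (rule prob_mu)
  have "integrable \<mu> (\<lambda>z. c * (1 + cmod z ^ k))" by (intro integrable_mult_right Bochner_Integration.integrable_add moment_mu) auto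
  then show "integrable \<mu> f"
  proof (rule Bochner_Integration.integrable_bound)
    show "AE z in \<mu>. norm (f z) \<le> norm (c * (1 + cmod z ^ k))"
      by (rule AE_I2) (use le c in \<open>simp add: order_trans[OF le]\<close>)
  qed measurable
qed

lemma tilted_mean_moment_le:
  assumes a: "\<bar>a\<bar> \<le> 1"
  shows "tilted_mean a p (\<lambda>z. cmod z ^ k) \<le> real k ^ k * D"
proof (cases "fst p < snd p")
  case True
  have "(LINT z|\<nu>. exp (a * Re z) *\<^sub>R (cmod z ^ k)) \<le> norm (LINT z|\<nu>. exp (a * Re z) *\<^sub>R (cmod z ^ k))" by simp
  also have "\<dots> \<le> 1 * (real k ^ k * D)"
  proof (rule dominated_integral(4))
    show "(\<lambda>z. exp (a * Re z) *\<^sub>R (cmod z ^ k)) \<in> borel_measurable borel"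
      by (intro borel_measurable_scaleR measurable_exp_Re) measurable
    show "norm (exp (a * Re z) *\<^sub>R (cmod z ^ k)) \<le> 1 * (cmod z ^ k * exp \<bar>Re z\<bar>)" for z
      using mult_left_mono[OF exp_Re_le(1)[OF a, of z], of "cmod z ^ k"] by (simp add: mult.commute)
  qed simp
  finally have 1: "(LINT z|\<nu>. exp (a * Re z) *\<^sub>R (cmod z ^ k)) \<le> real k ^ k * D" by simp
  have "(LINT z|\<nu>. exp (a * Re z) *\<^sub>R (cmod z ^ k)) / laplace a \<le> (LINT z|\<nu>. exp (a * Re z) *\<^sub>R (cmod z ^ k)) / 1"
    using laplace_ge_1[OF a] by (intro divide_left_mono integral_nonneg_AE) auto
  moreover have "tilted_mean a p (\<lambda>z. cmod z ^ k) = (LINT z|\<nu>. exp (a * Re z) *\<^sub>R (cmod z ^ k)) / laplace a"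
    using True tilt_density_integral[of a "\<lambda>z. cmod z ^ k"] by (simp add: tilted_mean_def divide_inverse mult.commute)
  ultimately show ?thesis using 1 by simp
next
  case False
  have "(LINT z|\<mu>. cmod z ^ k) \<le> norm (LINT z|\<mu>. cmod z ^ k)" by simp
  also have "\<dots> \<le> 1 * (real k ^ k * D)"
  proof (rule dominated_integral(3))
    show "norm (cmod z ^ k) \<le> 1 * (cmod z ^ k * exp \<bar>Re z\<bar>)" for z
      using mult_left_mono[of 1 "exp \<bar>Re z\<bar>" "cmod z ^ k"] by simp
  qed auto
  finally show ?thesis using False by (simp add: tilted_mean_def)
qed

lemma abs_tilt_mean_le: "\<bar>a\<bar> \<le> 1 \<Longrightarrow> \<bar>tilt_mean a\<bar> \<le> D"
proof -
  assume a: "\<bar>a\<bar> \<le> 1"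
  have "norm (LINT z|\<nu>. exp (a * Re z) * Re z) \<le> 1 * (real 1 ^ 1 * D)"
  proof (rule dominated_integral(4))
    show "(\<lambda>z. exp (a * Re z) * Re z) \<in> borel_measurable borel" by (intro borel_measurable_times measurable_exp_Re measurable_Re)
    show "norm (exp (a * Re z) * Re z) \<le> 1 * (cmod z ^ 1 * exp \<bar>Re z\<bar>)" for z
    proof -
      have "norm (exp (a * Re z) * Re z) \<le> exp \<bar>Re z\<bar> * cmod z"
        unfolding real_norm_def abs_mult abs_exp_cancel using exp_Re_le(1)[OF a, of z] abs_Re_le_cmod[of z] by (intro mult_mono) auto
      then show ?thesis by (simp add: mult.commute)
    qed
  qed simp
  then have 1: "\<bar>LINT z|\<nu>. exp (a * Re z) * Re z\<bar> \<le> D" by simp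
  have "\<bar>tilt_mean a\<bar> = \<bar>LINT z|\<nu>. exp (a * Re z) * Re z\<bar> / laplace a"
    unfolding tilt_mean_def abs_divide using laplace_ge_1[OF a] by simp
  also have "\<dots> \<le> \<bar>LINT z|\<nu>. exp (a * Re z) * Re z\<bar> / 1" using laplace_ge_1[OF a] by (intro divide_left_mono) auto
  finally show ?thesis using 1 by simp
qed

lemma tilt_density_total: "\<bar>a\<bar> \<le> 1 \<Longrightarrow> (LINT z|\<nu>. tilt_density a z) = 1"
  using tilt_density_integral[of a "\<lambda>_. 1 :: real"] laplace_ge_1[of a] by (simp add: laplace_def[symmetric])

text \<open>The imaginary part is centred and independent of the real part, hence of the weight, so
  the tilted mean has no imaginary part.\<close>

lemma tilted_mean_identity: "\<bar>a\<bar> \<le> 1 \<Longrightarrow> i < j \<Longrightarrow> tilted_mean a (i, j) (\<lambda>z. z) = of_real (tilt_mean a)"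
proof -
  assume a: "\<bar>a\<bar> \<le> 1" and ij: "i < j"
  interpret prob_space \<nu> by (rule prob_nu)
  have i: "integrable \<nu> (\<lambda>z. tilt_density a z *\<^sub>R z)" by (rule tilted_integrable(1)[OF a, where c = 1 and k = 1]) auto
  have "Re (LINT z|\<nu>. tilt_density a z *\<^sub>R z) = (LINT z|\<nu>. tilt_density a z *\<^sub>R Re z)" using integral_Re[OF i] by simp
  also have "\<dots> = tilt_mean a" unfolding tilt_density_integral by (simp add: tilt_mean_def divide_inverse mult.commute)
  finally have re: "Re (LINT z|\<nu>. tilt_density a z *\<^sub>R z) = tilt_mean a" .
  have Im_i: "integrable \<nu> Im" "(LINT z|\<nu>. Im z) = 0" using mean_nu by auto
  have e_i: "integrable \<nu> (\<lambda>z. exp (a * Re z))" using tilt_integrable[OF a, of "\<lambda>_. 1 :: real" 1 0] by simp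
  have "indep_var borel ((\<lambda>x. exp (a * x)) \<circ> Re) borel (id \<circ> Im)"
    by (rule indep_var_compose[OF nu_indep]) auto
  then have ind: "indep_var borel (\<lambda>z. exp (a * Re z)) borel Im" by (simp add: comp_def)
  have "Im (LINT z|\<nu>. tilt_density a z *\<^sub>R z) = (LINT z|\<nu>. tilt_density a z *\<^sub>R Im z)" using integral_Im[OF i] by simp
  also have "\<dots> = (LINT z|\<nu>. exp (a * Re z) * Im z) / laplace a" unfolding tilt_density_integral by (simp add: divide_inverse mult.commute)
  also have "\<dots> = 0" using indep_var_lebesgue_integral[OF ind e_i Im_i(1)] Im_i(2) by simp
  finally show ?thesis using re ij by (simp add: tilted_mean_def complex_eq_iff)
qed

text \<open>Bounds the moments of \<open>z - tilt_mean a\<close> uniformly over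
  \<open>\<bar>a\<bar> \<le> 1\<close>; the tilt varies with \<open>n\<close>, while the moment
  theorem needs constants free of \<open>n\<close>.\<close>

definition tilt_bound :: "nat \<Rightarrow> real" where "tilt_bound k = 2 ^ k * (real k ^ k * D + D ^ k)"

definition off :: "nat \<Rightarrow> (nat \<times> nat) set" where "off m = {(i, j). i < j \<and> j < m}"

lemma off_upper: "off n \<subseteq> upper n" and finite_off: "finite (off n)"
proof -
  show s: "off n \<subseteq> upper n" by (auto simp: off_def upper_def)
  show "finite (off n)" by (rule finite_subset[OF s finite_upper])
qed

context
  fixes a :: real and n :: nat
  assumes a: "\<bar>a\<bar> \<le> 1"
begin

lemma tilt_facts:
  assumes p: "p \<in> upper n"
  shows "tilt a p \<in> borel_measurable borel" "0 \<le> tilt a p z"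
    "integrable (M n) (\<lambda>\<omega>. tilt a p (entry n p \<omega>))" "(LINT \<omega>|M n. tilt a p (entry n p \<omega>)) = 1"
proof -
  show m: "tilt a p \<in> borel_measurable borel" unfolding tilt_def[abs_def] using measurable_tilt_density by (cases "fst p < snd p") (auto simp: measurable_tilt_density)
  show "0 \<le> tilt a p z" by (simp add: tilt_def tilt_density_nonneg)
  have i: "integrable \<nu> (tilt_density a)" using tilted_integrable(1)[OF a, of "\<lambda>_. 1 :: real" 1 0] by simp
  interpret mu: prob_space \<mu> by (rule prob_mu)
  show "integrable (M n) (\<lambda>\<omega>. tilt a p (entry n p \<omega>))"
  proof -
    have "integrable (distr (M n) borel (entry n p)) (tilt a p)"
      using i entry_law[OF p] by (cases "fst p < snd p") (simp_all add: tilt_def[abs_def])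
    then show ?thesis by (subst (asm) integrable_distr_eq[OF entry_meas[OF p] m])
  qed
  show "(LINT \<omega>|M n. tilt a p (entry n p \<omega>)) = 1"
  proof -
    have "(LINT z|distr (M n) borel (entry n p). tilt a p z) = 1"
      using tilt_density_total[OF a] mu.prob_space entry_law[OF p] by (cases "fst p < snd p") (simp_all add: tilt_def[abs_def])
    then show ?thesis by (subst (asm) integral_distr[OF entry_meas[OF p] m])
  qed
qed

lemma entry_indep: "prob_space.indep_vars (M n) (\<lambda>_. borel) (entry n) (upper n)"
  using X_indep[of n] by (simp add: entry_def upper_def)

lemma prob_tilted: "prob_space (tilted n a)"
  unfolding tilted_def using prob_space.tilt_prob_space[OF prob_M entry_indep finite_upper tilt_facts] .

lemma entry_indep_tilted: "prob_space.indep_vars (tilted n a) (\<lambda>_. borel) (entry n) (upper n)"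
  unfolding tilted_def using prob_space.tilt_indep_vars[OF prob_M entry_indep finite_upper tilt_facts] .

lemma tilted_expectation_prod:
  fixes f :: "complex \<Rightarrow> 'c::{real_normed_field, banach, second_countable_topology}"
  assumes J: "J \<subseteq> upper n" and f: "f \<in> borel_measurable borel" and le: "\<And>z. norm (f z) \<le> c * (1 + cmod z ^ k)"
  shows "integrable (tilted n a) (\<lambda>\<omega>. \<Prod>p\<in>J. f (entry n p \<omega>))" "(LINT \<omega>|tilted n a. (\<Prod>p\<in>J. f (entry n p \<omega>))) = (\<Prod>p\<in>J. tilted_mean a p f)"
proof -
  have m: "(\<lambda>z. tilt a p z *\<^sub>R f z) \<in> borel_measurable borel" if "p \<in> upper n" for p
    using that by (intro borel_measurable_scaleR tilt_facts f)
  have i: "integrable (M n) (\<lambda>\<omega>. tilt a p (entry n p \<omega>) *\<^sub>R f (entry n p \<omega>))" if p: "p \<in> upper n" for p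
  proof -
    have "integrable (distr (M n) borel (entry n p)) (\<lambda>z. tilt a p z *\<^sub>R f z)"
      using tilted_integrable[OF a f le] entry_law[OF p] by (cases "fst p < snd p") (simp_all add: tilt_def)
    then show ?thesis by (subst (asm) integrable_distr_eq[OF entry_meas[OF p] m[OF p]])
  qed
  have E: "(LINT \<omega>|M n. tilt a p (entry n p \<omega>) *\<^sub>R f (entry n p \<omega>)) = tilted_mean a p f" if p: "p \<in> upper n" for p
  proof -
    have "(LINT z|distr (M n) borel (entry n p). tilt a p z *\<^sub>R f z) = tilted_mean a p f"
      using entry_law[OF p] by (cases "fst p < snd p") (simp_all add: tilt_def tilted_mean_def)
    then show ?thesis by (subst (asm) integral_distr[OF entry_meas[OF p] m[OF p]])
  qed
  have *: "integrable (tilted n a) (\<lambda>\<omega>. \<Prod>p\<in>J. f (entry n p \<omega>)) \<and>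
      (LINT \<omega>|tilted n a. (\<Prod>p\<in>J. f (entry n p \<omega>))) = (\<Prod>p\<in>J. LINT \<omega>|M n. tilt a p (entry n p \<omega>) *\<^sub>R f (entry n p \<omega>))"
    unfolding tilted_def
    by (rule prob_space.tilt_expectation[OF prob_M entry_indep finite_upper tilt_facts J]) (use J f i in auto)
  then show "integrable (tilted n a) (\<lambda>\<omega>. \<Prod>p\<in>J. f (entry n p \<omega>))" by blast
  show "(LINT \<omega>|tilted n a. (\<Prod>p\<in>J. f (entry n p \<omega>))) = (\<Prod>p\<in>J. tilted_mean a p f)"
    unfolding conjunct2[OF *] using J E by (intro prod.cong) auto
qed

lemma tilted_expectation:
  fixes f :: "complex \<Rightarrow> 'c::{real_normed_field, banach, second_countable_topology}"
  assumes p: "p \<in> upper n" and f: "f \<in> borel_measurable borel" and le: "\<And>z. norm (f z) \<le> c * (1 + cmod z ^ k)"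
  shows "integrable (tilted n a) (\<lambda>\<omega>. f (entry n p \<omega>))" "(LINT \<omega>|tilted n a. f (entry n p \<omega>)) = tilted_mean a p f"
  using tilted_expectation_prod[of "{p}" f c k] p f le by auto

lemma shift_moment_le: "norm (cmod (z - of_real (tilt_mean a)) ^ k) \<le> 2 ^ k * (cmod z ^ k + D ^ k)"
proof -
  have "cmod (z - of_real (tilt_mean a)) \<le> cmod z + D"
    using norm_triangle_ineq4[of z "of_real (tilt_mean a)"] abs_tilt_mean_le[OF a] by simp
  then have "cmod (z - of_real (tilt_mean a)) ^ k \<le> (cmod z + D) ^ k" by (intro power_mono) auto
  also have "\<dots> \<le> 2 ^ k * (cmod z ^ k + D ^ k)" by (intro power_add_le) (auto simp: D_ge)
  finally show ?thesis by simp
qed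

lemma shift_moment_le': "norm (cmod (z - of_real (tilt_mean a)) ^ k) \<le> (2 ^ k * (1 + D ^ k)) * (1 + cmod z ^ k)"
proof -
  have "cmod z ^ k + D ^ k \<le> (1 + D ^ k) * (1 + cmod z ^ k)" using D_ge(3) by (simp add: algebra_simps)
  then have "2 ^ k * (cmod z ^ k + D ^ k) \<le> 2 ^ k * ((1 + D ^ k) * (1 + cmod z ^ k))" by (intro mult_left_mono) auto
  with shift_moment_le[of z k] have "norm (cmod (z - of_real (tilt_mean a)) ^ k) \<le> 2 ^ k * ((1 + D ^ k) * (1 + cmod z ^ k))"
    by (rule order_trans)
  then show ?thesis by (simp only: mult.assoc)
qed

lemma tilted_mean_shift_moment: "tilted_mean a p (\<lambda>z. cmod (z - of_real (tilt_mean a)) ^ k) \<le> tilt_bound k"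
proof -
  interpret mu: prob_space \<mu> by (rule prob_mu)
  have m: "(\<lambda>z. cmod (z - of_real (tilt_mean a)) ^ k) \<in> borel_measurable borel" by measurable
  note I = tilted_integrable[OF a m shift_moment_le']
  have J: "integrable \<nu> (\<lambda>z. tilt_density a z *\<^sub>R (cmod z ^ k))" "integrable \<mu> (\<lambda>z. cmod z ^ k)"
    by (rule tilted_integrable[OF a, where c = 1 and k = k]; simp)+
  have T: "integrable \<nu> (tilt_density a)" using tilted_integrable(1)[OF a, of "\<lambda>_. 1 :: real" 1 0] by simp
  have "tilted_mean a p (\<lambda>z. cmod (z - of_real (tilt_mean a)) ^ k) \<le> 2 ^ k * (tilted_mean a p (\<lambda>z. cmod z ^ k) + D ^ k)"
  proof (cases "fst p < snd p")
    case True
    have "(LINT z|\<nu>. tilt_density a z *\<^sub>R (cmod (z - of_real (tilt_mean a)) ^ k)) \<le> (LINT z|\<nu>. 2 ^ k * (tilt_density a z *\<^sub>R (cmod z ^ k) + D ^ k * tilt_density a z))"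
    proof (rule integral_mono)
      show "tilt_density a z *\<^sub>R (cmod (z - of_real (tilt_mean a)) ^ k) \<le> 2 ^ k * (tilt_density a z *\<^sub>R (cmod z ^ k) + D ^ k * tilt_density a z)" for z
        using mult_left_mono[OF shift_moment_le[of z k] tilt_density_nonneg[of a z]] by (simp add: algebra_simps)
    qed (use I J T in auto)
    also have "\<dots> = 2 ^ k * ((LINT z|\<nu>. tilt_density a z *\<^sub>R (cmod z ^ k)) + D ^ k)" using J T tilt_density_total[OF a] by simp
    finally show ?thesis using True by (simp add: tilted_mean_def)
  next
    case False
    have "(LINT z|\<mu>. cmod (z - of_real (tilt_mean a)) ^ k) \<le> (LINT z|\<mu>. 2 ^ k * (cmod z ^ k + D ^ k))"
      using I J shift_moment_le by (intro integral_mono) auto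
    also have "\<dots> = 2 ^ k * ((LINT z|\<mu>. cmod z ^ k) + D ^ k)" using J mu.prob_space by simp
    finally show ?thesis using False by (simp add: tilted_mean_def)
  qed
  also have "\<dots> \<le> tilt_bound k" unfolding tilt_bound_def using tilted_mean_moment_le[OF a, of p k] by (intro mult_left_mono) auto
  finally show ?thesis .
qed

lemma tilted_mean_shift_variance: "i < j \<Longrightarrow> tilted_mean a (i, j) (\<lambda>z. (cmod (z - of_real (tilt_mean a)))\<^sup>2) = tilt_var a"
proof -
  assume ij: "i < j"
  have sq: "(cmod (z - of_real (tilt_mean a)))\<^sup>2 = (cmod z)\<^sup>2 - 2 * tilt_mean a * Re z + (tilt_mean a)\<^sup>2" for z
    by (simp add: cmod_power2 power2_diff algebra_simps)
  have J: "integrable \<nu> (\<lambda>z. tilt_density a z * (cmod z)\<^sup>2)"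
    using tilted_integrable(1)[OF a, of "\<lambda>z. (cmod z)\<^sup>2" 1 2] by simp
  have T: "integrable \<nu> (tilt_density a)" using tilted_integrable(1)[OF a, of "\<lambda>_. 1 :: real" 1 0] by simp
  have R: "integrable \<nu> (\<lambda>z. tilt_density a z * Re z)"
    using tilted_integrable(1)[OF a measurable_Re, of 1 1] abs_Re_le_cmod by (simp add: add_increasing)
  have R2: "(LINT z|\<nu>. tilt_density a z * Re z) = tilt_mean a"
    using tilt_density_integral[of a Re] by (simp add: tilt_mean_def divide_inverse mult.commute)
  have C2: "(LINT z|\<nu>. tilt_density a z * (cmod z)\<^sup>2) = tilt_var a + (tilt_mean a)\<^sup>2"
    using tilt_density_integral[of a "\<lambda>z. (cmod z)\<^sup>2"] by (simp add: tilt_var_def divide_inverse mult.commute)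
  have "(LINT z|\<nu>. tilt_density a z *\<^sub>R (cmod (z - of_real (tilt_mean a)))\<^sup>2)
      = (LINT z|\<nu>. tilt_density a z * (cmod z)\<^sup>2 - 2 * tilt_mean a * (tilt_density a z * Re z) + (tilt_mean a)\<^sup>2 * tilt_density a z)"
    unfolding sq by (simp add: algebra_simps)
  also have "\<dots> = tilt_var a" using J T R R2 C2 tilt_density_total[OF a] by (simp add: power2_eq_square)
  finally show ?thesis using ij by (simp add: tilted_mean_def)
qed

text \<open>The tilted mean is subtracted everywhere, the diagonal included, so that the shift is an
  exact multiple of the all-ones matrix. The diagonal is left with mean
  \<open>- tilt_mean a\<close>, which a Wigner array permits.\<close>

lemma tilted_array: "wigner_array (tilted n a) n (\<lambda>i j \<omega>. Xf n i j \<omega> - of_real (tilt_mean a)) (tilt_var a) tilt_bound"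
proof -
  interpret prob_space "tilted n a" by (rule prob_tilted)
  have sp: "space (tilted n a) = space (M n)" by (simp add: tilted_def)
  have e: "Xf n i j \<omega> = entry n (i, j) \<omega>" for i j \<omega> by (simp add: entry_def)
  show ?thesis
  proof
    show "Xf n j i \<omega> - of_real (tilt_mean a) = cnj (Xf n i j \<omega> - of_real (tilt_mean a))" if "i < n" "j < n" "\<omega> \<in> space (tilted n a)" for i j \<omega>
      using hermitian_funD[OF X_hermitian, of \<omega> n j i] that by (simp add: sp)
    have "indep_vars (\<lambda>_. borel) (\<lambda>p \<omega>. entry n p \<omega> - of_real (tilt_mean a)) (upper n)"
      by (rule indep_vars_compose2[OF entry_indep_tilted]) auto
    moreover have "(\<lambda>p \<omega>. entry n p \<omega> - of_real (tilt_mean a)) = (\<lambda>(i, j) \<omega>. Xf n i j \<omega> - of_real (tilt_mean a))"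
      by (auto simp: entry_def fun_eq_iff)
    ultimately show "indep_vars (\<lambda>_. borel) (\<lambda>(i, j) \<omega>. Xf n i j \<omega> - of_real (tilt_mean a)) {(i, j). i \<le> j \<and> j < n}"
      by (simp add: upper_def)
    show "expectation (\<lambda>\<omega>. Xf n i j \<omega> - of_real (tilt_mean a)) = 0" if "i < j" "j < n" for i j
    proof -
      have p: "(i, j) \<in> upper n" using that by (simp add: upper_def)
      show ?thesis
        using tilted_expectation[OF p, of "\<lambda>z. z" 1 1] tilted_mean_identity[OF a that(1)] prob_space unfolding e by simp
    qed
    show "expectation (\<lambda>\<omega>. (cmod (Xf n i j \<omega> - of_real (tilt_mean a)))\<^sup>2) = tilt_var a" if "i < j" "j < n" for i j
    proof -
      have p: "(i, j) \<in> upper n" using that by (simp add: upper_def)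
      have m: "(\<lambda>z. (cmod (z - of_real (tilt_mean a)))\<^sup>2) \<in> borel_measurable borel" by measurable
      show ?thesis unfolding e tilted_expectation(2)[OF p m shift_moment_le'] by (rule tilted_mean_shift_variance[OF that(1)])
    qed
    show "integrable (tilted n a) (\<lambda>\<omega>. cmod (Xf n i j \<omega> - of_real (tilt_mean a)) ^ k)"
      and "expectation (\<lambda>\<omega>. cmod (Xf n i j \<omega> - of_real (tilt_mean a)) ^ k) \<le> tilt_bound k" if "i \<le> j" "j < n" for i j k
    proof -
      have p: "(i, j) \<in> upper n" using that by (simp add: upper_def)
      have m: "(\<lambda>z. cmod (z - of_real (tilt_mean a)) ^ k) \<in> borel_measurable borel" by measurable
      show "integrable (tilted n a) (\<lambda>\<omega>. cmod (Xf n i j \<omega> - of_real (tilt_mean a)) ^ k)"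
        unfolding e by (rule tilted_expectation(1)[OF p m shift_moment_le'])
      show "expectation (\<lambda>\<omega>. cmod (Xf n i j \<omega> - of_real (tilt_mean a)) ^ k) \<le> tilt_bound k"
        unfolding e tilted_expectation(2)[OF p m shift_moment_le'] by (rule tilted_mean_shift_moment)
    qed
  qed
qed

text \<open>The centred summands are uncorrelated under the tilted law, so only the diagonal of the
  double sum contributes.\<close>

lemma centered_square_integral:
  "integrable (tilted n a) (\<lambda>\<omega>. (\<Sum>p\<in>off n. Re (entry n p \<omega>) - tilt_mean a)\<^sup>2)"
  "(LINT \<omega>|tilted n a. (\<Sum>p\<in>off n. Re (entry n p \<omega>) - tilt_mean a)\<^sup>2) \<le> real (card (off n)) * tilt_bound 2"
proof -
  let ?f = "\<lambda>z. Re z - tilt_mean a"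
  have fm: "?f \<in> borel_measurable borel" by (intro borel_measurable_diff measurable_Re borel_measurable_const)
  have f2m: "(\<lambda>z. (?f z)\<^sup>2) \<in> borel_measurable borel" by (intro borel_measurable_power fm)
  have le1: "norm (?f z) \<le> cmod (z - of_real (tilt_mean a)) ^ 1" for z using abs_Re_le_cmod[of "z - of_real (tilt_mean a)"] by simp
  have le2: "norm ((?f z)\<^sup>2) \<le> cmod (z - of_real (tilt_mean a)) ^ 2" for z using power_mono[OF le1[of z], of 2] by simp
  have B: "norm (?f z) \<le> (2 ^ 1 * (1 + D ^ 1)) * (1 + cmod z ^ 1)" for z
    using le1[of z] shift_moment_le'[of z 1] unfolding real_norm_def by linarith
  have B2: "norm ((?f z)\<^sup>2) \<le> (2 ^ 2 * (1 + D ^ 2)) * (1 + cmod z ^ 2)" for z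
    using le2[of z] shift_moment_le'[of z 2] unfolding real_norm_def by linarith
  have c2m: "(\<lambda>z. cmod (z - of_real (tilt_mean a)) ^ 2) \<in> borel_measurable borel" by measurable
  have E0: "tilted_mean a p ?f = 0" if p: "p \<in> off n" for p
  proof -
    have T: "integrable \<nu> (tilt_density a)" using tilted_integrable(1)[OF a, of "\<lambda>_. 1 :: real" 1 0] by simp
    have R: "integrable \<nu> (\<lambda>z. tilt_density a z * Re z)"
      using tilted_integrable(1)[OF a measurable_Re, of 1 1] abs_Re_le_cmod by (simp add: add_increasing)
    have R2: "(LINT z|\<nu>. tilt_density a z * Re z) = tilt_mean a"
      using tilt_density_integral[of a Re] by (simp add: tilt_mean_def divide_inverse mult.commute)
    have "(LINT z|\<nu>. tilt_density a z *\<^sub>R ?f z) = (LINT z|\<nu>. tilt_density a z * Re z - tilt_mean a * tilt_density a z)" by (simp add: algebra_simps)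
    also have "\<dots> = 0" using T R R2 tilt_density_total[OF a] by simp
    finally show ?thesis using p by (auto simp: tilted_mean_def off_def)
  qed
  have pq: "integrable (tilted n a) (\<lambda>\<omega>. (Re (entry n p \<omega>) - tilt_mean a) * (Re (entry n q \<omega>) - tilt_mean a)) \<and> (LINT \<omega>|tilted n a. (Re (entry n p \<omega>) - tilt_mean a) * (Re (entry n q \<omega>) - tilt_mean a)) \<le> (if p = q then tilt_bound 2 else 0)"
    if p: "p \<in> off n" and q: "q \<in> off n" for p q
  proof (cases "p = q")
    case True
    have u: "p \<in> upper n" using p off_upper by blast
    have e: "(Re (entry n p \<omega>) - tilt_mean a) * (Re (entry n q \<omega>) - tilt_mean a) = (?f (entry n p \<omega>))\<^sup>2" for \<omega> using True by (simp add: power2_eq_square)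
    have "(LINT \<omega>|tilted n a. (?f (entry n p \<omega>))\<^sup>2) \<le> (LINT \<omega>|tilted n a. cmod (entry n p \<omega> - of_real (tilt_mean a)) ^ 2)"
      using le2 by (intro integral_mono tilted_expectation[OF u f2m B2] tilted_expectation[OF u c2m shift_moment_le']) simp
    also have "\<dots> \<le> tilt_bound 2" unfolding tilted_expectation(2)[OF u c2m shift_moment_le'] by (rule tilted_mean_shift_moment)
    finally show ?thesis unfolding e using True tilted_expectation(1)[OF u f2m B2] by simp
  next
    case False
    have J: "{p, q} \<subseteq> upper n" using p q off_upper by blast
    show ?thesis using tilted_expectation_prod[OF J fm B] False E0[OF p] by simp
  qed
  have ex: "(\<Sum>p\<in>off n. Re (entry n p \<omega>) - tilt_mean a)\<^sup>2 = (\<Sum>p\<in>off n. \<Sum>q\<in>off n. (Re (entry n p \<omega>) - tilt_mean a) * (Re (entry n q \<omega>) - tilt_mean a))" for \<omega>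
    by (simp add: power2_eq_square sum_product)
  show "integrable (tilted n a) (\<lambda>\<omega>. (\<Sum>p\<in>off n. Re (entry n p \<omega>) - tilt_mean a)\<^sup>2)"
    unfolding ex using pq by (intro Bochner_Integration.integrable_sum) blast
  have "(LINT \<omega>|tilted n a. (\<Sum>p\<in>off n. Re (entry n p \<omega>) - tilt_mean a)\<^sup>2) = (\<Sum>p\<in>off n. \<Sum>q\<in>off n. LINT \<omega>|tilted n a. (Re (entry n p \<omega>) - tilt_mean a) * (Re (entry n q \<omega>) - tilt_mean a))"
    unfolding ex using pq by (subst Bochner_Integration.integral_sum; (intro Bochner_Integration.integrable_sum)?; (intro sum.cong refl)?;
      (subst Bochner_Integration.integral_sum)?) auto
  also have "\<dots> \<le> (\<Sum>p\<in>off n. \<Sum>q\<in>off n. if p = q then tilt_bound 2 else 0)" using pq by (intro sum_mono) blast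
  also have "\<dots> = real (card (off n)) * tilt_bound 2" using finite_off by (simp add: sum.delta)
  finally show "(LINT \<omega>|tilted n a. (\<Sum>p\<in>off n. Re (entry n p \<omega>) - tilt_mean a)\<^sup>2) \<le> real (card (off n)) * tilt_bound 2" .
qed

text \<open>The diagonal factors are 1, so the density is the exponential of an affine statistic of
  the off-diagonal entries, and on \<open>G\<close> it is at most \<open>exp Q\<close>.\<close>

lemma change_of_measure:
  assumes G: "G \<in> sets (M n)" and le: "\<And>\<omega>. \<omega> \<in> G \<Longrightarrow> a * (\<Sum>p\<in>off n. Re (entry n p \<omega>)) - real (card (off n)) * ln (laplace a) \<le> Q"
  shows "measure (tilted n a) G \<le> exp Q * measure (M n) G"
proof -
  interpret prob_space "M n" by (rule prob_M)
  interpret t: prob_space "tilted n a" by (rule prob_tilted)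
  have L: "0 < laplace a" using laplace_ge_1[OF a] by simp
  have prod: "(\<Prod>p\<in>upper n. tilt a p (entry n p \<omega>)) = exp (a * (\<Sum>p\<in>off n. Re (entry n p \<omega>)) - real (card (off n)) * ln (laplace a))" for \<omega>
  proof -
    have "(\<Prod>p\<in>upper n. tilt a p (entry n p \<omega>)) = (\<Prod>p\<in>off n. tilt a p (entry n p \<omega>))"
      using off_upper finite_upper by (intro prod.mono_neutral_right) (auto simp: tilt_def off_def upper_def)
    also have "\<dots> = (\<Prod>p\<in>off n. exp (a * Re (entry n p \<omega>) - ln (laplace a)))"
      using L by (intro prod.cong refl) (auto simp: tilt_def off_def tilt_density_def exp_diff)
    also have "\<dots> = exp (a * (\<Sum>p\<in>off n. Re (entry n p \<omega>)) - real (card (off n)) * ln (laplace a))"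
      unfolding exp_sum[OF finite_off, symmetric] by (simp add: sum_subtractf sum_distrib_left)
    finally show ?thesis .
  qed
  have Wm: "(\<lambda>\<omega>. ennreal (\<Prod>p\<in>upper n. tilt a p (entry n p \<omega>))) \<in> borel_measurable (M n)"
    by (intro measurable_compose[OF _ measurable_ennreal] borel_measurable_prod measurable_compose[OF entry_meas tilt_facts(1)]) auto
  have "emeasure (tilted n a) G = (\<integral>\<^sup>+\<omega>. ennreal (\<Prod>p\<in>upper n. tilt a p (entry n p \<omega>)) * indicator G \<omega> \<partial>M n)"
    unfolding tilted_def by (rule emeasure_density[OF Wm G])
  also have "\<dots> \<le> (\<integral>\<^sup>+\<omega>. ennreal (exp Q) * indicator G \<omega> \<partial>M n)"
    by (intro nn_integral_mono) (auto simp: prod le indicator_def)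
  also have "\<dots> = ennreal (exp Q) * emeasure (M n) G" using G by (rule nn_integral_cmult_indicator)
  finally show ?thesis
    unfolding emeasure_eq_measure t.emeasure_eq_measure by (simp add: ennreal_mult[symmetric])
qed

end

lemma card_off: "2 * real (card (off n)) = real n * (real n - 1)"
proof -
  have "card (off n) = card ((\<lambda>(j, i). (i, j)) ` (SIGMA j:{..<n}. {..<j}))"
    by (rule arg_cong[of _ _ card]) (auto simp: off_def)
  also have "\<dots> = card (SIGMA j:{..<n}. {..<j})" by (rule card_image) (auto simp: inj_on_def)
  also have "\<dots> = (\<Sum>j<n. j)" by simp
  finally have "real (card (off n)) = (\<Sum>j<n. real j)" by simp
  moreover have "2 * (\<Sum>j<n. real j) = real n * (real n - 1)" by (induction n) (auto simp: algebra_simps)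
  ultimately show ?thesis by simp
qed

end

section \<open>Probability of a neighbourhood of a point of finite rate\<close>

lemma markov_vanishing:
  fixes f :: "nat \<Rightarrow> 'a \<Rightarrow> real"
  assumes P: "\<forall>\<^sub>F n in sequentially. prob_space (P n) \<and> integrable (P n) (f n) \<and> (\<forall>\<omega>\<in>space (P n). 0 \<le> f n \<omega>) \<and> (LINT \<omega>|P n. f n \<omega>) \<le> g n"
    and lim: "g \<longlonglongrightarrow> 0" and \<delta>: "0 < \<delta>"
  shows "\<forall>\<^sub>F n in sequentially. measure (P n) {\<omega>\<in>space (P n). \<delta> \<le> f n \<omega>} \<le> 1 / 8"
proof -
  have "\<forall>\<^sub>F n in sequentially. g n < \<delta> / 8" using lim \<delta> by (intro order_tendstoD) auto
  with P show ?thesis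
  proof eventually_elim
    case (elim n)
    have "measure (P n) {\<omega>\<in>space (P n). \<delta> \<le> f n \<omega>} \<le> (LINT \<omega>|P n. f n \<omega>) / \<delta>"
      using elim \<delta> by (intro integral_Markov_inequality_measure[where A = "{}"]) auto
    \<comment> \<open>With 1/8, three such events together have probability below 1/2.\<close>
    also have "\<dots> \<le> (\<delta> / 8) / \<delta>" using elim \<delta> by (intro divide_right_mono) auto
    finally show ?case using \<delta> by simp
  qed
qed

lemma trace_pow_cong:
  assumes "\<And>i j. i < n \<Longrightarrow> j < n \<Longrightarrow> A i j = B i j"
  shows "trace_pow n A k = trace_pow n B k"
  unfolding trace_pow_def
proof (intro sum.cong refl)
  fix c assume "c \<in> cwalks n k"
  then have "fst c < n" "set (snd c) \<subseteq> {..<n}" by (cases c; simp add: cwalks_iff)+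
  then have "fst e < n \<and> snd e < n" if "e \<in> set (csteps c)" for e
    using steps_bounded[of "fst c" n "snd c" e] that unfolding csteps_def by simp
  then show "walk_prod A (csteps c) = walk_prod B (csteps c)"
    unfolding walk_prod_def by (intro arg_cong[of _ _ prod_list] map_cong refl) (auto simp: assms)
qed

context wigner_ldp
begin

definition shifted :: "nat \<Rightarrow> real \<Rightarrow> 'a \<Rightarrow> complex mat" where
  "shifted n m \<omega> = mat n n (\<lambda>(i, j). Xf n i j \<omega> - of_real m)"

text \<open>The tilted mean is about \<open>a / \<beta>\<close>, so the shift has the eigenvalue
  \<open>tilt_mean a * n\<close>, about \<open>\<theta> * n^(1/2 + 1/d)\<close>. The parameter tends
  to 0 because \<open>d \<ge> 3\<close>.\<close>

definition tilt_at :: "real \<Rightarrow> nat \<Rightarrow> real" where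
  "tilt_at \<theta> n = real \<beta> * \<theta> * real n powr (1 / real d - 1 / 2)"

lemma tilt_at_limits:
  assumes \<theta>: "\<theta> \<noteq> 0"
  shows "tilt_at \<theta> \<longlonglongrightarrow> 0" "\<forall>\<^sub>F n in sequentially. tilt_at \<theta> n \<noteq> 0" "\<forall>\<^sub>F n in sequentially. \<bar>tilt_at \<theta> n\<bar> \<le> 1"
    "(\<lambda>n. tilt_mean (tilt_at \<theta> n) * real n / real n powr (1 / 2 + 1 / real d)) \<longlonglongrightarrow> \<theta>"
    "0 < n \<Longrightarrow> (tilt_at \<theta> n)\<^sup>2 * (real n)\<^sup>2 = (real \<beta> * \<theta>)\<^sup>2 * speed n"
proof -
  have neg: "1 / real d - 1 / 2 < 0" using d by (simp add: field_simps)
  have "(\<lambda>n. real n powr (1 / real d - 1 / 2)) \<longlonglongrightarrow> 0"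
    using tendsto_neg_powr[OF neg filterlim_real_sequentially] .
  from tendsto_mult_left[OF this, of "real \<beta> * \<theta>"] show 0: "tilt_at \<theta> \<longlonglongrightarrow> 0"
    by (simp add: tilt_at_def[abs_def])
  show ne: "\<forall>\<^sub>F n in sequentially. tilt_at \<theta> n \<noteq> 0"
    using eventually_gt_at_top[of 0] by eventually_elim (use \<theta> real_beta in \<open>auto simp: tilt_at_def\<close>)
  show "\<forall>\<^sub>F n in sequentially. \<bar>tilt_at \<theta> n\<bar> \<le> 1"
    using tendstoD[OF 0, of 1] by (rule eventually_mono) (auto simp: dist_real_def)
  have b: "real \<beta> \<noteq> 0" using real_beta by auto
  have "(\<lambda>n. tilt_mean (tilt_at \<theta> n) / tilt_at \<theta> n * (real \<beta> * \<theta>)) \<longlonglongrightarrow> 1 / real \<beta> * (real \<beta> * \<theta>)"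
    by (intro tendsto_mult tilt_limits(2)[OF 0 ne] tendsto_const)
  then have "(\<lambda>n. tilt_mean (tilt_at \<theta> n) / tilt_at \<theta> n * (real \<beta> * \<theta>)) \<longlonglongrightarrow> \<theta>" using b by simp
  moreover have "\<forall>\<^sub>F n in sequentially. tilt_mean (tilt_at \<theta> n) / tilt_at \<theta> n * (real \<beta> * \<theta>)
      = tilt_mean (tilt_at \<theta> n) * real n / real n powr (1 / 2 + 1 / real d)"
    using eventually_gt_at_top[of 0]
  proof eventually_elim
    case (elim n)
    have "real n powr (1 / real d - 1 / 2) * real n powr 1 = real n powr (1 / 2 + 1 / real d)"
      unfolding powr_add[symmetric] by (rule arg_cong[of _ _ "(powr) _"]) simp
    then have p: "real n powr (1 / 2 + 1 / real d) = real n powr (1 / real d - 1 / 2) * real n" using elim by simp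
    show ?case unfolding p tilt_at_def using elim \<theta> b by (simp add: field_simps)
  qed
  ultimately show "(\<lambda>n. tilt_mean (tilt_at \<theta> n) * real n / real n powr (1 / 2 + 1 / real d)) \<longlonglongrightarrow> \<theta>"
    by (rule Lim_transform_eventually)
  show "(tilt_at \<theta> n)\<^sup>2 * (real n)\<^sup>2 = (real \<beta> * \<theta>)\<^sup>2 * speed n" if n: "0 < n"
  proof -
    have "speed n = (real n powr (1 / real d - 1 / 2) * real n powr (1 / real d - 1 / 2)) * (real n powr 1 * real n powr 1)"
      unfolding powr_add[symmetric] by (rule arg_cong[of _ _ "(powr) _"]) (simp add: field_simps)
    then show ?thesis using n by (simp add: tilt_at_def power2_eq_square)
  qed
qed

text \<open>An upper bound for the log-density where the sum of the centred real parts is at most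
  \<open>\<delta> * \<bar>a\<bar> * n^2\<close> in modulus.\<close>

definition exponent :: "real \<Rightarrow> real \<Rightarrow> nat \<Rightarrow> real" where
  "exponent \<theta> \<delta> n = (let a = tilt_at \<theta> n in \<delta> * (a\<^sup>2 * (real n)\<^sup>2) + real (card (off n)) * (a * tilt_mean a - ln (laplace a)))"

text \<open>There are about \<open>n^2 / 2\<close> entries above the diagonal, and each costs about
  \<open>a^2 / \<beta> - a^2 / (2 \<beta>) = a^2 / (2 \<beta>)\<close>. As \<open>a^2 * n^2\<close>
  is \<open>(\<beta> * \<theta>)^2\<close> times the speed, the total is
  \<open>\<beta> * \<theta>^2 / 4\<close> times the speed.\<close>

lemma exponent_le:
  assumes \<theta>: "\<theta> \<noteq> 0" and \<eta>: "(real \<beta> * \<theta>)\<^sup>2 * \<delta> < \<eta>"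
  shows "\<forall>\<^sub>F n in sequentially. ln 2 + exponent \<theta> \<delta> n \<le> (real \<beta> / 4 * \<theta>\<^sup>2 + \<eta>) * speed n"
proof -
  let ?a = "tilt_at \<theta>"
  note L = tilt_at_limits[OF \<theta>]
  note T = tilt_limits[OF L(1,2)]
  have b: "0 < real \<beta>" using real_beta by auto
  define c where "c n = tilt_mean (?a n) / ?a n - (laplace (?a n) - 1) / (?a n)\<^sup>2 / laplace (?a n)" for n
  have c: "c \<longlonglongrightarrow> 1 / real \<beta> - 1 / (2 * real \<beta>) / 1"
    unfolding c_def[abs_def] by (rule tendsto_diff[OF T(2) tendsto_divide[OF T(4) T(1)]]) simp
  have N: "(\<lambda>n. real (card (off n)) / (real n)\<^sup>2) \<longlonglongrightarrow> 1 / 2"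
  proof -
    have "(\<lambda>n. (real n * (real n - 1) / 2) / (real n)\<^sup>2) \<longlonglongrightarrow> 1 / 2" by real_asymp
    moreover have "real (card (off n)) = real n * (real n - 1) / 2" for n using card_off[of n] by simp
    ultimately show ?thesis by (simp only:)
  qed
  have ls: "(\<lambda>n. ln 2 / speed n) \<longlonglongrightarrow> 0"
    by (rule real_tendsto_divide_at_top[OF tendsto_const speed_at_top])
  have "(\<lambda>n. ln 2 / speed n + (real \<beta> * \<theta>)\<^sup>2 * (\<delta> + real (card (off n)) / (real n)\<^sup>2 * c n))
     \<longlonglongrightarrow> 0 + (real \<beta> * \<theta>)\<^sup>2 * (\<delta> + 1 / 2 * (1 / real \<beta> - 1 / (2 * real \<beta>) / 1))"
    by (intro tendsto_add tendsto_mult tendsto_const ls N c)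
  moreover have "0 + (real \<beta> * \<theta>)\<^sup>2 * (\<delta> + 1 / 2 * (1 / real \<beta> - 1 / (2 * real \<beta>) / 1)) < real \<beta> / 4 * \<theta>\<^sup>2 + \<eta>"
  proof -
    have "(real \<beta> * \<theta>)\<^sup>2 * (\<delta> + 1 / 2 * (1 / real \<beta> - 1 / (2 * real \<beta>) / 1)) = (real \<beta> * \<theta>)\<^sup>2 * \<delta> + real \<beta> / 4 * \<theta>\<^sup>2"
      using b by (simp add: field_simps power2_eq_square)
    then show ?thesis using \<eta> by simp
  qed
  ultimately have "\<forall>\<^sub>F n in sequentially. ln 2 / speed n + (real \<beta> * \<theta>)\<^sup>2 * (\<delta> + real (card (off n)) / (real n)\<^sup>2 * c n) < real \<beta> / 4 * \<theta>\<^sup>2 + \<eta>"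
    by (rule order_tendstoD)
  then show ?thesis using L(2) L(3) eventually_gt_at_top[of 0]
  proof eventually_elim
    case (elim n)
    let ?al = "tilt_at \<theta> n"
    have s: "0 < speed n" using elim(4) by simp
    have Lp: "1 \<le> laplace ?al" by (rule laplace_ge_1[OF elim(3)])
    \<comment> \<open>The bound \<open>ln L \<ge> 1 - 1 / L\<close> replaces the logarithm by a
      quotient covered by the expansion of \<open>L - 1\<close>.\<close>
    have "1 - 1 / laplace ?al \<le> ln (laplace ?al)" using Lp ln_le_minus_one[of "1 / laplace ?al"] by (simp add: ln_div)
    then have "?al * tilt_mean ?al - ln (laplace ?al) \<le> ?al * tilt_mean ?al - (laplace ?al - 1) / laplace ?al" using Lp by (simp add: diff_divide_distrib)
    also have "\<dots> = ?al\<^sup>2 * c n" unfolding c_def using elim(2) Lp by (simp add: field_simps power2_eq_square)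
    finally have "real (card (off n)) * (?al * tilt_mean ?al - ln (laplace ?al)) \<le> real (card (off n)) * (?al\<^sup>2 * c n)" by (intro mult_left_mono) auto
    also have "\<dots> = (?al\<^sup>2 * (real n)\<^sup>2) * (real (card (off n)) / (real n)\<^sup>2 * c n)" using elim(4) by simp
    finally have "exponent \<theta> \<delta> n \<le> (?al\<^sup>2 * (real n)\<^sup>2) * (\<delta> + real (card (off n)) / (real n)\<^sup>2 * c n)"
      unfolding exponent_def Let_def by (simp add: algebra_simps)
    also have "\<dots> = ((real \<beta> * \<theta>)\<^sup>2 * (\<delta> + real (card (off n)) / (real n)\<^sup>2 * c n)) * speed n"
      unfolding tilt_at_limits(5)[OF \<theta> elim(4)] by (simp only: ac_simps)
    finally have "ln 2 + exponent \<theta> \<delta> n \<le> (ln 2 / speed n + (real \<beta> * \<theta>)\<^sup>2 * (\<delta> + real (card (off n)) / (real n)\<^sup>2 * c n)) * speed n"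
      using s by (simp add: distrib_right)
    also have "\<dots> \<le> (real \<beta> / 4 * \<theta>\<^sup>2 + \<eta>) * speed n" using elim(1) s by (intro mult_right_mono) auto
    finally show ?case .
  qed
qed

text \<open>Strictly between the operator norm \<open>n^(1/2)\<close> of the centred matrix and the norm \<open>n^(1/2+1/d)\<close> of
  the shift.\<close>

definition noise_level :: "nat \<Rightarrow> real" where "noise_level n = real n powr (1 / 2 + 3 / (4 * real d))"

text \<open>The ratio of noise to shift is of order \<open>n^(- 1 / (4 d))\<close>. Hence the
  condition of \<open>constant_shift\<close> holds, the error in \<open>trace_shift\<close> is
  negligible on the scale of the trace, and the main term tends to
  \<open>\<theta>^d\<close>.\<close>

lemma shift_limits:
  assumes \<theta>: "\<theta> \<noteq> 0" and \<epsilon>: "0 < \<epsilon>"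
  shows "\<forall>\<^sub>F n in sequentially. noise_level n \<le> \<bar>tilt_mean (tilt_at \<theta> n)\<bar> * real n"
    "\<forall>\<^sub>F n in sequentially. 2 * real d * (2 * (\<bar>tilt_mean (tilt_at \<theta> n)\<bar> * real n)) ^ (d - 1) * noise_level n < \<epsilon> * real n powr (1 + real d / 2)"
    "\<forall>\<^sub>F n in sequentially. \<bar>(tilt_mean (tilt_at \<theta> n) * real n) ^ d / real n powr (1 + real d / 2) - \<theta> ^ d\<bar> < \<epsilon>"
proof -
  define p where "p n = real n powr (1 / 2 + 1 / real d)" for n
  define x where "x n = tilt_mean (tilt_at \<theta> n) * real n / p n" for n
  define y where "y n = noise_level n / p n" for n
  have x: "x \<longlonglongrightarrow> \<theta>" unfolding x_def[abs_def] p_def using tilt_at_limits(4)[OF \<theta>] .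
  have y_eq: "y n = real n powr (- (1 / (4 * real d)))" for n
    unfolding y_def noise_level_def p_def powr_diff[symmetric] by (rule arg_cong[of _ _ "(powr) _"]) (use d in \<open>simp add: field_simps\<close>)
  have "- (1 / (4 * real d)) < 0" using d by simp
  then have y: "y \<longlonglongrightarrow> 0" unfolding y_eq[abs_def] by (rule tendsto_neg_powr[OF _ filterlim_real_sequentially])
  have pd: "p n ^ d = real n powr (1 + real d / 2)" for n
  proof -
    have "real d * (1 / 2 + 1 / real d) = 1 + real d / 2" using d by (simp add: field_simps)
    then show ?thesis unfolding p_def using d by (cases "n = 0") (simp_all add: powr_power)
  qed
  have pos: "\<forall>\<^sub>F n in sequentially. 0 < p n" using eventually_gt_at_top[of 0] by eventually_elim (simp add: p_def)
  have "(\<lambda>n. \<bar>x n\<bar> - y n) \<longlonglongrightarrow> \<bar>\<theta>\<bar> - 0" by (intro tendsto_diff tendsto_rabs x y)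
  then have "\<forall>\<^sub>F n in sequentially. 0 < \<bar>x n\<bar> - y n" using \<theta> by (intro order_tendstoD) auto
  with pos show "\<forall>\<^sub>F n in sequentially. noise_level n \<le> \<bar>tilt_mean (tilt_at \<theta> n)\<bar> * real n"
  proof eventually_elim
    case (elim n)
    have "noise_level n / p n \<le> (\<bar>tilt_mean (tilt_at \<theta> n)\<bar> * real n) / p n" using elim by (simp add: x_def y_def abs_mult)
    then show ?case using elim(1) by (simp add: divide_le_cancel)
  qed
  have "(\<lambda>n. 2 * real d * (2 * \<bar>x n\<bar>) ^ (d - 1) * y n) \<longlonglongrightarrow> 2 * real d * (2 * \<bar>\<theta>\<bar>) ^ (d - 1) * 0"
    by (intro tendsto_mult tendsto_const tendsto_power tendsto_rabs x y)
  then have "\<forall>\<^sub>F n in sequentially. 2 * real d * (2 * \<bar>x n\<bar>) ^ (d - 1) * y n < \<epsilon>" using \<epsilon> by (intro order_tendstoD) auto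
  with pos show "\<forall>\<^sub>F n in sequentially. 2 * real d * (2 * (\<bar>tilt_mean (tilt_at \<theta> n)\<bar> * real n)) ^ (d - 1) * noise_level n < \<epsilon> * real n powr (1 + real d / 2)"
  proof eventually_elim
    case (elim n)
    have e: "2 * (\<bar>tilt_mean (tilt_at \<theta> n)\<bar> * real n) = p n * (2 * \<bar>x n\<bar>)" "noise_level n = p n * y n"
      using elim(1) by (simp_all add: x_def y_def abs_mult)
    have "2 * real d * (p n * (2 * \<bar>x n\<bar>)) ^ (d - 1) * (p n * y n) = p n ^ Suc (d - 1) * (2 * real d * (2 * \<bar>x n\<bar>) ^ (d - 1) * y n)"
      by (simp only: power_mult_distrib power_Suc ac_simps)
    also have "\<dots> < p n ^ Suc (d - 1) * \<epsilon>" using elim by (intro mult_strict_left_mono) auto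
    finally show ?case unfolding e pd[symmetric] using d by (simp add: mult.commute)
  qed
  have "(\<lambda>n. x n ^ d) \<longlonglongrightarrow> \<theta> ^ d" by (intro tendsto_power x)
  then have "\<forall>\<^sub>F n in sequentially. dist (x n ^ d) (\<theta> ^ d) < \<epsilon>" using \<epsilon> by (rule tendstoD)
  then show "\<forall>\<^sub>F n in sequentially. \<bar>(tilt_mean (tilt_at \<theta> n) * real n) ^ d / real n powr (1 + real d / 2) - \<theta> ^ d\<bar> < \<epsilon>"
    unfolding pd[symmetric] by (simp add: x_def dist_real_def power_divide)
qed

text \<open>Under the tilted law three events hold jointly with probability at least 1/2: the
  centred matrix has normalized trace near \<open>\<gamma>\<close>, its operator norm is at most
  \<open>noise_level n\<close>, and the log-density is at most
  \<open>exponent \<theta> \<delta> n\<close>. On them \<open>trace_shift\<close> places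
  \<open>Z n\<close> near \<open>\<gamma> + \<theta>^d\<close>, and \<open>change_of_measure\<close>
  returns to the original law.\<close>

lemma local_lower:
  assumes \<theta>: "\<theta> \<noteq> 0" and \<epsilon>: "0 < \<epsilon>" and \<eta>: "0 < \<eta>"
  shows "\<forall>\<^sub>F n in sequentially. exp (- (real \<beta> / 4 * \<theta>\<^sup>2 + \<eta>) * speed n)
    \<le> measure (M n) {\<omega>\<in>space (M n). \<bar>Z n \<omega> - (\<gamma> + \<theta> ^ d)\<bar> < 3 * \<epsilon>}"
proof -
  define a where "a = tilt_at \<theta>"
  \<comment> \<open>Chosen so that the fluctuation of the log-density costs only
    \<open>\<eta> / 2\<close> times the speed.\<close>
  define \<delta> where "\<delta> = \<eta> / (2 * (real \<beta> * \<theta>)\<^sup>2)"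
  have b: "0 < real \<beta>" using real_beta by auto
  have b\<theta>: "0 < (real \<beta> * \<theta>)\<^sup>2" using b \<theta> by simp
  have \<delta>: "0 < \<delta>" "(real \<beta> * \<theta>)\<^sup>2 * \<delta> < \<eta>" unfolding \<delta>_def using b\<theta> \<eta> by simp_all
  note lims = tilt_at_limits[OF \<theta>, folded a_def]
  interpret T: wigner_sequence "\<lambda>n. tilted n (a n)" "\<lambda>n i j \<omega>. Xf n i j \<omega> - of_real (tilt_mean (a n))" "\<lambda>n. tilt_var (a n)" tilt_bound
  proof
    show "\<forall>\<^sub>F n in sequentially. wigner_array (tilted n (a n)) n (\<lambda>i j \<omega>. Xf n i j \<omega> - of_real (tilt_mean (a n))) (tilt_var (a n)) tilt_bound"
      using lims(3) by eventually_elim (rule tilted_array)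
    show "(\<lambda>n. tilt_var (a n)) \<longlonglongrightarrow> 1" by (rule tilt_limits(3)[OF lims(1,2)])
  qed
  have sp: "space (tilted n c) = space (M n)" and se: "sets (tilted n c) = sets (M n)" for n c by (simp_all add: tilted_def)
  let ?B = "\<lambda>n \<omega>. shifted n (tilt_mean (a n)) \<omega>"
  have B: "?B n \<omega> \<in> carrier_mat n n" for n \<omega> by (simp add: shifted_def)
  have trB: "T.trY n k \<omega> = mat_trace (?B n \<omega> ^\<^sub>m k)" for n k \<omega>
    unfolding T.trY_def mat_trace_pow[OF B] by (rule trace_pow_cong) (simp add: shifted_def)
  have herm: "hermitian_fun n (\<lambda>k l. ?B n \<omega> $$ (k, l))" if w: "\<omega> \<in> space (M n)" for n \<omega>
    using hermitian_funD[OF X_hermitian[OF w]] by (auto simp: hermitian_fun_def shifted_def)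
  have real_tr: "\<exists>m u lam. spectral n (\<lambda>k l. ?B n \<omega> $$ (k, l)) m u lam \<and> (\<forall>k>0. T.trY n k \<omega> = complex_of_real (\<Sum>i<m. lam i ^ k))"
    if w: "\<omega> \<in> space (M n)" for n \<omega>
  proof -
    obtain m u lam where s: "spectral n (\<lambda>k l. ?B n \<omega> $$ (k, l)) m u lam" using spectral_exists[OF herm[OF w]] by blast
    then show ?thesis using spectral_trace_pow[OF B s] unfolding trB by blast
  qed
  have Im0: "Im (T.trY n k \<omega>) = 0" if "\<omega> \<in> space (M n)" "0 < k" for n k \<omega>
    using real_tr[OF that(1)] that(2) by auto
  have int: "integrable (tilted n (a n)) (T.trY n k)" "integrable (tilted n (a n)) (\<lambda>\<omega>. T.trY n k \<omega> * T.trY n l \<omega>)"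
    "prob_space (tilted n (a n))" if "\<bar>a n\<bar> \<le> 1" for n k l
  proof -
    interpret wigner_array "tilted n (a n)" n "\<lambda>i j \<omega>. Xf n i j \<omega> - of_real (tilt_mean (a n))" "tilt_var (a n)" tilt_bound
      by (rule tilted_array[OF that])
    show "integrable (tilted n (a n)) (T.trY n k)" "integrable (tilted n (a n)) (\<lambda>\<omega>. T.trY n k \<omega> * T.trY n l \<omega>)"
      using integrable_tr_pow[of k] integrable_tr_pow_mult[of k l] unfolding tr_pow_eq T.trY_def[abs_def] .
    show "prob_space (tilted n (a n))" by (rule prob_tilted[OF that])
  qed
  let ?s = "\<lambda>n. real n powr (1 + real d / 2)"
  \<comment> \<open>The mean of this squared distance is a polynomial in the first two moments of
    the normalized trace, and their limits make it vanish.\<close>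
  let ?f1 = "\<lambda>n \<omega>. (Re (T.trY n d \<omega>) / ?s n - \<gamma>)\<^sup>2"
  let ?g1 = "\<lambda>n. Re (T.q d d n / complex_of_real (?s n * ?s n)) - 2 * \<gamma> * Re (T.e d n / complex_of_real (?s n)) + \<gamma>\<^sup>2"
  have "?g1 \<longlonglongrightarrow> Re (complex_of_real (\<gamma> * \<gamma>)) - 2 * \<gamma> * Re (complex_of_real \<gamma>) + \<gamma>\<^sup>2"
    by (intro tendsto_add tendsto_diff tendsto_mult tendsto_const tendsto_Re T.second_moment_tendsto T.moment_tendsto)
  then have g1: "?g1 \<longlonglongrightarrow> 0" by (simp add: power2_eq_square)
  have "\<forall>\<^sub>F n in sequentially. measure (tilted n (a n)) {\<omega>\<in>space (tilted n (a n)). \<epsilon>\<^sup>2 \<le> ?f1 n \<omega>} \<le> 1 / 8"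
  proof (rule markov_vanishing[OF _ g1])
    show "\<forall>\<^sub>F n in sequentially. prob_space (tilted n (a n)) \<and> integrable (tilted n (a n)) (?f1 n) \<and> (\<forall>\<omega>\<in>space (tilted n (a n)). 0 \<le> ?f1 n \<omega>)
        \<and> (LINT \<omega>|tilted n (a n). ?f1 n \<omega>) \<le> ?g1 n"
      using lims(3)
    proof eventually_elim
      case (elim n)
      interpret prob_space "tilted n (a n)" by (rule int(3)[OF elim])
      let ?q = "\<lambda>\<omega>. Re (T.trY n d \<omega> * T.trY n d \<omega>)"
      have i: "integrable (tilted n (a n)) (\<lambda>\<omega>. Re (T.trY n d \<omega>))" "integrable (tilted n (a n)) ?q"
        by (intro integrable_Re int(1,2) elim)+
      have eq: "?f1 n \<omega> = ?q \<omega> / (?s n * ?s n) - 2 * \<gamma> * (Re (T.trY n d \<omega>) / ?s n) + \<gamma>\<^sup>2" if "\<omega> \<in> space (tilted n (a n))" for \<omega>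
      proof -
        have alg: "(r / s - g)\<^sup>2 = r * r / (s * s) - 2 * g * (r / s) + g\<^sup>2" for r s g :: real
          by (simp add: power2_eq_square algebra_simps)
        have "Im (T.trY n d \<omega>) = 0" using Im0[of \<omega> n d] that d by (simp add: sp)
        then have "?q \<omega> = Re (T.trY n d \<omega>) * Re (T.trY n d \<omega>)" by simp
        then show ?thesis by (simp only: alg)
      qed
      have I: "integrable (tilted n (a n)) (\<lambda>\<omega>. ?q \<omega> / (?s n * ?s n) - 2 * \<gamma> * (Re (T.trY n d \<omega>) / ?s n) + \<gamma>\<^sup>2)"
        using i by (intro Bochner_Integration.integrable_add Bochner_Integration.integrable_diff integrable_divide integrable_mult_right) auto
      have 1: "integrable (tilted n (a n)) (?f1 n)"
        by (rule Bochner_Integration.integrable_cong[THEN iffD2, OF refl _ I]) (rule eq)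
      have "(LINT \<omega>|tilted n (a n). ?f1 n \<omega>) = (LINT \<omega>|tilted n (a n). ?q \<omega> / (?s n * ?s n) - 2 * \<gamma> * (Re (T.trY n d \<omega>) / ?s n) + \<gamma>\<^sup>2)"
        by (rule Bochner_Integration.integral_cong[OF refl eq])
      also have "\<dots> = (LINT \<omega>|tilted n (a n). ?q \<omega>) / (?s n * ?s n) - 2 * \<gamma> * ((LINT \<omega>|tilted n (a n). Re (T.trY n d \<omega>)) / ?s n) + \<gamma>\<^sup>2"
        using i prob_space by simp
      also have "\<dots> = ?g1 n"
        unfolding T.q_def T.e_def integral_Re[OF int(1)[OF elim]] integral_Re[OF int(2)[OF elim]] Re_divide_of_real ..
      finally show ?case using 1 int(3)[OF elim] by simp
    qed
  qed (use \<epsilon> in simp)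
  note ev1 = this
  \<comment> \<open>The trace of the power \<open>2 * d\<close> dominates the power
    \<open>2 * d\<close> of each eigenvalue. Its mean is of order \<open>n^(1 + d)\<close>, and
    \<open>noise_level n ^ (2 * d)\<close> is larger by a factor \<open>n^(1/2)\<close>.\<close>
  let ?f2 = "\<lambda>n \<omega>. Re (T.trY n (2 * d) \<omega>) / noise_level n ^ (2 * d)"
  let ?g2 = "\<lambda>n. Re (T.e (2 * d) n / complex_of_real (real n powr (1 + real (2 * d) / 2))) * real n powr (- 1 / 2)"
  have "?g2 \<longlonglongrightarrow> Re (complex_of_real (semicircle_moment (2 * d))) * 0"
    by (intro tendsto_mult tendsto_Re T.moment_tendsto tendsto_neg_powr[OF _ filterlim_real_sequentially]) simp
  then have g2: "?g2 \<longlonglongrightarrow> 0" by simp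
  have noise_level_pow: "noise_level n ^ (2 * d) = real n powr (1 + real (2 * d) / 2) * real n powr (1 / 2)" for n
  proof -
    have "real (2 * d) * (1 / 2 + 3 / (4 * real d)) = 1 + real (2 * d) / 2 + 1 / 2" using d by (simp add: field_simps)
    then show ?thesis unfolding noise_level_def powr_add[symmetric] using d by (cases "n = 0") (simp_all only: powr_power, simp_all)
  qed
  have nonneg2: "0 \<le> ?f2 n \<omega>" if w: "\<omega> \<in> space (M n)" for n \<omega>
  proof -
    obtain m u lam where "spectral n (\<lambda>k l. ?B n \<omega> $$ (k, l)) m u lam"
      and tr: "\<And>k. 0 < k \<Longrightarrow> T.trY n k \<omega> = complex_of_real (\<Sum>i<m. lam i ^ k)" using real_tr[OF w] by blast
    have "0 < 2 * d" using d by simp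
    then have "T.trY n (2 * d) \<omega> = complex_of_real (\<Sum>i<m. lam i ^ (2 * d))" by (rule tr)
    then have "0 \<le> Re (T.trY n (2 * d) \<omega>)" by (simp add: sum_nonneg zero_le_even_power)
    then show ?thesis by (simp add: noise_level_def)
  qed
  have "\<forall>\<^sub>F n in sequentially. measure (tilted n (a n)) {\<omega>\<in>space (tilted n (a n)). 1 \<le> ?f2 n \<omega>} \<le> 1 / 8"
  proof (rule markov_vanishing[OF _ g2])
    show "\<forall>\<^sub>F n in sequentially. prob_space (tilted n (a n)) \<and> integrable (tilted n (a n)) (?f2 n) \<and> (\<forall>\<omega>\<in>space (tilted n (a n)). 0 \<le> ?f2 n \<omega>)
        \<and> (LINT \<omega>|tilted n (a n). ?f2 n \<omega>) \<le> ?g2 n"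
      using lims(3) eventually_gt_at_top[of 0]
    proof eventually_elim
      case (elim n)
      have i: "integrable (tilted n (a n)) (\<lambda>\<omega>. Re (T.trY n (2 * d) \<omega>))" using int(1)[OF elim(1)] by auto
      have "(LINT \<omega>|tilted n (a n). ?f2 n \<omega>) = Re (T.e (2 * d) n) / noise_level n ^ (2 * d)"
        using integral_Re[OF int(1)[OF elim(1)]] by (simp add: T.e_def)
      also have "\<dots> = ?g2 n"
      proof -
        have "real n powr (- 1 / 2) = 1 / real n powr (1 / 2)" using powr_minus_divide[of "real n" "1 / 2"] by simp
        then show ?thesis unfolding noise_level_pow Re_divide_of_real by (simp only: times_divide_times_eq mult_1_right)
      qed
      finally show ?case using i int(3)[OF elim(1)] nonneg2 by (simp add: sp)
    qed
  qed simp
  note ev2 = this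
  let ?S = "\<lambda>n \<omega>. \<Sum>p\<in>off n. Re (entry n p \<omega>) - tilt_mean (a n)"
  \<comment> \<open>The sum has variance of order \<open>n^2\<close>; after division by
    \<open>a^2 * n^4\<close> this is of order \<open>1 / speed\<close>.\<close>
  let ?f3 = "\<lambda>n \<omega>. (?S n \<omega>)\<^sup>2 / (\<bar>a n\<bar> * (real n)\<^sup>2)\<^sup>2"
  let ?g3 = "\<lambda>n. tilt_bound 2 / ((real \<beta> * \<theta>)\<^sup>2 * speed n)"
  have "filterlim (\<lambda>n. (real \<beta> * \<theta>)\<^sup>2 * speed n) at_top sequentially"
    using b\<theta> by (intro filterlim_tendsto_pos_mult_at_top[OF tendsto_const _ speed_at_top])
  then have g3: "?g3 \<longlonglongrightarrow> 0" by (rule real_tendsto_divide_at_top[OF tendsto_const])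
  have "\<forall>\<^sub>F n in sequentially. measure (tilted n (a n)) {\<omega>\<in>space (tilted n (a n)). \<delta>\<^sup>2 \<le> ?f3 n \<omega>} \<le> 1 / 8"
  proof (rule markov_vanishing[OF _ g3])
    show "\<forall>\<^sub>F n in sequentially. prob_space (tilted n (a n)) \<and> integrable (tilted n (a n)) (?f3 n) \<and> (\<forall>\<omega>\<in>space (tilted n (a n)). 0 \<le> ?f3 n \<omega>)
        \<and> (LINT \<omega>|tilted n (a n). ?f3 n \<omega>) \<le> ?g3 n"
      using lims(3) lims(2) eventually_gt_at_top[of 0]
    proof eventually_elim
      case (elim n)
      note c = centered_square_integral[OF elim(1), of n]
      have tB2: "0 \<le> tilt_bound 2" unfolding tilt_bound_def using D_ge(3) by simp
      have an: "0 < (a n)\<^sup>2" using elim(2) by simp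
      have nn: "0 < (real n)\<^sup>2" using elim(3) by simp
      have e1: "(\<bar>a n\<bar> * (real n)\<^sup>2)\<^sup>2 = ((a n)\<^sup>2 * (real n)\<^sup>2) * (real n)\<^sup>2" by (simp add: power2_eq_square)
      have "real (card (off n)) \<le> (real n)\<^sup>2" using card_off[of n] by (simp add: power2_eq_square algebra_simps)
      then have "real (card (off n)) * tilt_bound 2 \<le> (real n)\<^sup>2 * tilt_bound 2" using tB2 by (rule mult_right_mono)
      then have "(LINT \<omega>|tilted n (a n). (?S n \<omega>)\<^sup>2) \<le> (real n)\<^sup>2 * tilt_bound 2" using c(2) by linarith
      then have "(LINT \<omega>|tilted n (a n). (?S n \<omega>)\<^sup>2) / (((a n)\<^sup>2 * (real n)\<^sup>2) * (real n)\<^sup>2)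
          \<le> ((real n)\<^sup>2 * tilt_bound 2) / (((a n)\<^sup>2 * (real n)\<^sup>2) * (real n)\<^sup>2)"
        by (rule divide_right_mono) simp
      also have "\<dots> = tilt_bound 2 / ((a n)\<^sup>2 * (real n)\<^sup>2)" using nn an by (simp add: divide_simps)
      also have "\<dots> = ?g3 n" unfolding lims(5)[OF elim(3)] ..
      finally show ?case unfolding e1 using c(1) int(3)[OF elim(1)] by auto
    qed
  qed (use \<delta> in simp)
  note ev3 = this
  show ?thesis
    using ev1 ev2 ev3 lims(3) lims(2) eventually_gt_at_top[of 0] exponent_le[OF \<theta> \<delta>(2)]
      shift_limits[OF \<theta> \<epsilon>, folded a_def]
  proof eventually_elim
    case (elim n)
    interpret P: prob_space "M n" by (rule prob_M)
    interpret P': prob_space "tilted n (a n)" by (rule int(3)[OF elim(4)])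
    let ?m = "tilt_mean (a n)"
    let ?b1 = "{\<omega>\<in>space (tilted n (a n)). \<epsilon>\<^sup>2 \<le> ?f1 n \<omega>}"
    let ?b2 = "{\<omega>\<in>space (tilted n (a n)). 1 \<le> ?f2 n \<omega>}"
    let ?b3 = "{\<omega>\<in>space (tilted n (a n)). \<delta>\<^sup>2 \<le> ?f3 n \<omega>}"
    have trm: "T.trY n k \<in> borel_measurable (tilted n (a n))" for k
      by (rule borel_measurable_integrable[OF int(1)[OF elim(4)]])
    have Retr: "(\<lambda>\<omega>. Re (T.trY n k \<omega>)) \<in> borel_measurable (tilted n (a n))" for k
      by (rule measurable_compose[OF trm measurable_Re])
    have Sm: "(\<lambda>\<omega>. (?S n \<omega>)\<^sup>2) \<in> borel_measurable (tilted n (a n))"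
      by (rule borel_measurable_integrable[OF centered_square_integral(1)[OF elim(4)]])
    have sets: "?b1 \<in> sets (tilted n (a n))" "?b2 \<in> sets (tilted n (a n))" "?b3 \<in> sets (tilted n (a n))"
      using Retr[of d] Retr[of "2 * d"] Sm by measurable
    define G where "G = space (M n) - (?b1 \<union> ?b2 \<union> ?b3)"
    have bu: "?b1 \<union> ?b2 \<union> ?b3 \<in> sets (tilted n (a n))" by (intro sets.Un sets)
    have Gs: "G \<in> sets (M n)" unfolding G_def using sets.compl_sets[OF bu] by (simp only: sp se)
    have "P'.prob (?b1 \<union> ?b2 \<union> ?b3) \<le> P'.prob (?b1 \<union> ?b2) + P'.prob ?b3" by (intro measure_Un_le sets.Un sets)
    also have "\<dots> \<le> P'.prob ?b1 + P'.prob ?b2 + P'.prob ?b3" by (intro add_right_mono measure_Un_le sets)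
    also have "\<dots> \<le> 1 / 2" using elim(1-3) by simp
    finally have half: "1 / 2 \<le> P'.prob G" unfolding G_def using P'.prob_compl[OF bu] by (simp add: sp)
    have le_exp: "a n * (\<Sum>p\<in>off n. Re (entry n p \<omega>)) - real (card (off n)) * ln (laplace (a n)) \<le> exponent \<theta> \<delta> n" if w: "\<omega> \<in> G" for \<omega>
    proof -
      have w': "\<omega> \<in> space (M n)" "?f3 n \<omega> < \<delta>\<^sup>2" using w by (auto simp: G_def sp)
      have p: "0 < (\<bar>a n\<bar> * (real n)\<^sup>2)\<^sup>2" using elim(5,6) by simp
      have "(?S n \<omega>)\<^sup>2 < (\<delta> * (\<bar>a n\<bar> * (real n)\<^sup>2))\<^sup>2"
        using w'(2) p by (simp only: power_mult_distrib[of \<delta>] pos_divide_less_eq)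
      then have "\<bar>?S n \<omega>\<bar> < \<delta> * (\<bar>a n\<bar> * (real n)\<^sup>2)" using \<delta>(1) by (intro power2_less_imp_less[of "\<bar>_\<bar>"]) auto
      then have "\<bar>a n\<bar> * \<bar>?S n \<omega>\<bar> \<le> \<bar>a n\<bar> * (\<delta> * (\<bar>a n\<bar> * (real n)\<^sup>2))" by (intro mult_left_mono) auto
      also have "\<dots> = \<delta> * ((a n)\<^sup>2 * (real n)\<^sup>2)" by (simp add: power2_eq_square)
      finally have 1: "a n * ?S n \<omega> \<le> \<delta> * ((a n)\<^sup>2 * (real n)\<^sup>2)"
        using abs_ge_self[of "a n * ?S n \<omega>"] unfolding abs_mult by linarith
      have "(\<Sum>p\<in>off n. Re (entry n p \<omega>)) = ?S n \<omega> + real (card (off n)) * ?m" by (simp add: sum_subtractf)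
      then show ?thesis using 1 unfolding exponent_def Let_def a_def[symmetric] by (simp add: algebra_simps)
    qed
    have "1 / 2 \<le> exp (exponent \<theta> \<delta> n) * measure (M n) G"
      using change_of_measure[OF elim(4) Gs le_exp] half by linarith
    then have "exp (- exponent \<theta> \<delta> n) * (1 / 2) \<le> exp (- exponent \<theta> \<delta> n) * (exp (exponent \<theta> \<delta> n) * measure (M n) G)"
      by (intro mult_left_mono) auto
    then have "exp (- exponent \<theta> \<delta> n) * (1 / 2) \<le> measure (M n) G" by (simp add: mult.assoc[symmetric] exp_add[symmetric])
    moreover have "exp (- (real \<beta> / 4 * \<theta>\<^sup>2 + \<eta>) * speed n) \<le> exp (- (ln 2 + exponent \<theta> \<delta> n))"
      unfolding exp_le_cancel_iff mult_minus_left using elim(7) by (rule le_imp_neg_le)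
    moreover have "exp (- (ln 2 + exponent \<theta> \<delta> n)) = exp (- exponent \<theta> \<delta> n) * (1 / 2)"
    proof -
      have "exp (- ln 2) = (1 / 2 :: real)" by (simp add: exp_minus)
      then show ?thesis by (simp only: minus_add_distrib exp_add mult.commute)
    qed
    ultimately have "exp (- (real \<beta> / 4 * \<theta>\<^sup>2 + \<eta>) * speed n) \<le> measure (M n) G" by linarith
    also have "\<dots> \<le> measure (M n) {\<omega>\<in>space (M n). \<bar>Z n \<omega> - (\<gamma> + \<theta> ^ d)\<bar> < 3 * \<epsilon>}"
    proof (rule P.finite_measure_mono)
      show "{\<omega>\<in>space (M n). \<bar>Z n \<omega> - (\<gamma> + \<theta> ^ d)\<bar> < 3 * \<epsilon>} \<in> sets (M n)" using Z_meas[of n] by measurable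
      show "G \<subseteq> {\<omega>\<in>space (M n). \<bar>Z n \<omega> - (\<gamma> + \<theta> ^ d)\<bar> < 3 * \<epsilon>}"
      proof
        fix \<omega> assume w: "\<omega> \<in> G"
        then have w': "\<omega> \<in> space (M n)" "?f1 n \<omega> < \<epsilon>\<^sup>2" "?f2 n \<omega> < 1" by (auto simp: G_def sp)
        obtain m u lam where s: "spectral n (\<lambda>k l. ?B n \<omega> $$ (k, l)) m u lam"
          and tr: "\<And>k. 0 < k \<Longrightarrow> T.trY n k \<omega> = complex_of_real (\<Sum>i<m. lam i ^ k)" using real_tr[OF w'(1)] by blast
        have kp: "0 < noise_level n" using elim(6) by (simp add: noise_level_def)
        have lam: "\<bar>lam i\<bar> \<le> noise_level n" if i: "i < m" for i
        proof -
          have "lam i ^ (2 * d) \<le> (\<Sum>i<m. lam i ^ (2 * d))" using i by (intro member_le_sum) (auto simp: zero_le_even_power)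
          also have "\<dots> = Re (T.trY n (2 * d) \<omega>)" using tr[of "2 * d"] d by simp
          also have "\<dots> \<le> noise_level n ^ (2 * d)" using w'(3) kp by (simp add: divide_less_eq)
          finally have "\<bar>lam i\<bar> ^ (2 * d) \<le> noise_level n ^ (2 * d)" by (simp add: power_even_abs)
          then show ?thesis using kp d power_mono_iff[of "\<bar>lam i\<bar>" "noise_level n" "2 * d"] by simp
        qed
        interpret CS: constant_shift n "X n \<omega>" "?B n \<omega>" ?m "noise_level n" m u lam
        proof
          show "X n \<omega> \<in> carrier_mat n n" by (rule X_carrier[OF w'(1)])
          show "X n \<omega> $$ (k, l) = complex_of_real ?m + ?B n \<omega> $$ (k, l)" if "k < n" "l < n" for k l
            using that by (simp add: shifted_def Xf_def)
        qed (use B herm[OF w'(1)] s lam kp elim(8) in auto)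
        have d0: "0 < d" using d by simp
        have sn: "0 < ?s n" using elim(6) by simp
        have "cmod (Xseq.trY n d \<omega> - T.trY n d \<omega> - complex_of_real (?m * real n) ^ d) < \<epsilon> * ?s n"
          using CS.trace_shift[OF d0] elim(9) unfolding trX[OF w'(1)] trB by linarith
        then have "\<bar>Re (Xseq.trY n d \<omega>) - Re (T.trY n d \<omega>) - (?m * real n) ^ d\<bar> < \<epsilon> * ?s n"
          using abs_Re_le_cmod[of "Xseq.trY n d \<omega> - T.trY n d \<omega> - complex_of_real (?m * real n) ^ d"]
          by (simp add: of_real_power[symmetric] del: of_real_power of_real_mult)
        then have "\<bar>Re (Xseq.trY n d \<omega>) - Re (T.trY n d \<omega>) - (?m * real n) ^ d\<bar> / ?s n < \<epsilon>"
          using sn by (simp add: pos_divide_less_eq)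
        then have "\<bar>(Re (Xseq.trY n d \<omega>) - Re (T.trY n d \<omega>) - (?m * real n) ^ d) / ?s n\<bar> < \<epsilon>"
          using sn by (simp add: abs_divide)
        then have 1: "\<bar>Z n \<omega> - Re (T.trY n d \<omega>) / ?s n - (?m * real n) ^ d / ?s n\<bar> < \<epsilon>"
          unfolding Z_trX[OF w'(1) elim(6)] by (simp add: diff_divide_distrib)
        have 2: "\<bar>Re (T.trY n d \<omega>) / ?s n - \<gamma>\<bar> < \<epsilon>"
          using w'(2) \<epsilon> by (intro power2_less_imp_less[of "\<bar>_\<bar>"]) auto
        \<comment> \<open>One \<open>\<epsilon>\<close> each for the shift error, for the centred
          trace and for the main term.\<close>
        show "\<omega> \<in> {\<omega>\<in>space (M n). \<bar>Z n \<omega> - (\<gamma> + \<theta> ^ d)\<bar> < 3 * \<epsilon>}" using 1 2 elim(10) w'(1) by simp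
      qed
    qed
    finally show ?case .
  qed
qed

end

section \<open>The large deviations principle\<close>

lemma ext_ln_le: "0 \<le> p \<Longrightarrow> p \<le> exp c \<Longrightarrow> ext_ln p \<le> ereal c"
proof -
  assume "0 \<le> p" "p \<le> exp c"
  then show ?thesis using ln_mono[of p "exp c"] by (auto simp: ext_ln_def)
qed

lemma le_ext_ln: "exp c \<le> p \<Longrightarrow> ereal c \<le> ext_ln p"
proof -
  assume p: "exp c \<le> p"
  then have "0 < p" using exp_gt_zero[of c] by linarith
  then show ?thesis using p ln_ge_iff[of p c] by (auto simp: ext_ln_def)
qed

lemma limsup_rate_le:
  fixes p \<upsilon> :: "nat \<Rightarrow> real"
  assumes "filterlim \<upsilon> at_top sequentially" "\<And>n. 0 \<le> p n" "\<forall>\<^sub>F n in sequentially. p n \<le> exp (c * \<upsilon> n)"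
  shows "limsup (\<lambda>n. ereal (1 / \<upsilon> n) * ext_ln (p n)) \<le> ereal c"
proof (rule Limsup_bounded)
  have "\<forall>\<^sub>F n in sequentially. 0 < \<upsilon> n" using assms(1) by (simp add: filterlim_at_top_dense)
  with assms(3) show "\<forall>\<^sub>F n in sequentially. ereal (1 / \<upsilon> n) * ext_ln (p n) \<le> ereal c"
  proof eventually_elim
    case (elim n)
    have "ereal (1 / \<upsilon> n) * ext_ln (p n) \<le> ereal (1 / \<upsilon> n) * ereal (c * \<upsilon> n)"
      using elim ext_ln_le[OF assms(2) elim(1)] by (intro ereal_mult_left_mono) auto
    then show ?case using elim(2) by simp
  qed
qed

lemma liminf_rate_ge:
  fixes p \<upsilon> :: "nat \<Rightarrow> real"
  assumes "filterlim \<upsilon> at_top sequentially" "\<forall>\<^sub>F n in sequentially. exp (c * \<upsilon> n) \<le> p n"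
  shows "ereal c \<le> liminf (\<lambda>n. ereal (1 / \<upsilon> n) * ext_ln (p n))"
proof (rule Liminf_bounded)
  have "\<forall>\<^sub>F n in sequentially. 0 < \<upsilon> n" using assms(1) by (simp add: filterlim_at_top_dense)
  with assms(2) show "\<forall>\<^sub>F n in sequentially. ereal c \<le> ereal (1 / \<upsilon> n) * ext_ln (p n)"
  proof eventually_elim
    case (elim n)
    have "ereal (1 / \<upsilon> n) * ereal (c * \<upsilon> n) \<le> ereal (1 / \<upsilon> n) * ext_ln (p n)"
      using elim le_ext_ln[OF elim(1)] by (intro ereal_mult_left_mono) auto
    then show ?case using elim(2) by simp
  qed
qed

lemma powr_le_iff:
  fixes x t q :: real
  assumes "0 \<le> x" "0 \<le> t" "0 < q"
  shows "x powr q \<le> t \<longleftrightarrow> x \<le> t powr (1 / q)"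
proof
  assume "x powr q \<le> t"
  then have "(x powr q) powr (1 / q) \<le> t powr (1 / q)" using assms by (intro powr_mono2) auto
  then show "x \<le> t powr (1 / q)" using assms by (simp add: powr_powr)
next
  assume "x \<le> t powr (1 / q)"
  then have "x powr q \<le> (t powr (1 / q)) powr q" using assms by (intro powr_mono2) auto
  then show "x powr q \<le> t" using assms by (simp add: powr_powr)
qed

context wigner_ldp
begin

text \<open>The inverse of the rate: the distance from \<open>\<gamma>\<close> at which it reaches
  \<open>t\<close>.\<close>

definition rate_width :: "real \<Rightarrow> real" where
  "rate_width t = (4 / real \<beta> * t) powr (real d / 2)"

lemma trace_rate_le_iff:
  assumes t: "0 \<le> t"
  shows "trace_rate \<beta> d x \<le> ereal t \<longleftrightarrow> (even d \<longrightarrow> \<gamma> \<le> x) \<and> \<bar>x - \<gamma>\<bar> \<le> rate_width t"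
proof -
  have b: "0 < real \<beta>" using real_beta by auto
  have "real \<beta> / 4 * y powr (2 / real d) \<le> t \<longleftrightarrow> y \<le> rate_width t" if "0 \<le> y" for y
  proof -
    have "real \<beta> / 4 * y powr (2 / real d) \<le> t \<longleftrightarrow> y powr (2 / real d) \<le> 4 / real \<beta> * t"
      using b by (simp add: field_simps)
    also have "\<dots> \<longleftrightarrow> y \<le> (4 / real \<beta> * t) powr (1 / (2 / real d))"
      using b t d that by (intro powr_le_iff) auto
    finally show ?thesis by (simp add: rate_width_def)
  qed
  from this[of "\<bar>x - \<gamma>\<bar>"] show ?thesis by (auto simp: trace_rate_def semicircle_moment_def)
qed

lemma trace_rate_nonneg: "0 \<le> trace_rate \<beta> d x"
  by (simp add: trace_rate_def)

text \<open>For \<open>t \<ge> 0\<close> the level set is a closed interval around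
  \<open>\<gamma>\<close>, reduced to its right half for even \<open>d\<close>. Stated for all real
  \<open>t\<close>, this also supplies lower semicontinuity.\<close>

lemma compact_level: "compact {x. trace_rate \<beta> d x \<le> ereal t}"
proof (cases "0 \<le> t")
  case True
  have "{x. trace_rate \<beta> d x \<le> ereal t} = {if even d then \<gamma> else \<gamma> - rate_width t..\<gamma> + rate_width t}"
    unfolding trace_rate_le_iff[OF True] by auto
  then show ?thesis by simp
next
  case False
  have "\<not> trace_rate \<beta> d x \<le> ereal t" for x
  proof
    assume "trace_rate \<beta> d x \<le> ereal t"
    with trace_rate_nonneg[of x] have "0 \<le> ereal t" by (rule order_trans)
    with False show False by simp
  qed
  then show ?thesis by simp
qed

lemma rate_of_width: "0 \<le> t \<Longrightarrow> real \<beta> / 4 * rate_width t powr (2 / real d) = t"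
  using real_beta d by (auto simp: rate_width_def powr_powr)

lemma Z_event: "B \<in> sets borel \<Longrightarrow> {\<omega>\<in>space (M n). Z n \<omega> \<in> B} \<in> sets (M n)"
  using measurable_sets[OF Z_meas] by (simp add: vimage_def Int_def conj_commute)

text \<open>The closure of \<open>B\<close> misses the level set of \<open>\<alpha>\<close>. Hence
  each point of \<open>B\<close> is at least \<open>rate_width \<alpha>\<close> away from
  \<open>\<gamma>\<close> or, for even \<open>d\<close>, to the left of \<open>\<gamma>\<close>.
  Points of the second kind keep a distance \<open>\<delta>\<close>, since \<open>\<gamma>\<close>
  belongs to the level set and so not to the closure.\<close>

lemma upper_event:
  assumes B: "B \<in> sets borel" and \<alpha>: "0 < \<alpha>" and gt: "\<And>x. x \<in> closure B \<Longrightarrow> ereal \<alpha> < trace_rate \<beta> d x" and \<eta>: "0 < \<eta>"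
  shows "\<forall>\<^sub>F n in sequentially. measure (M n) {\<omega>\<in>space (M n). Z n \<omega> \<in> B} \<le> exp ((\<eta> - \<alpha>) * speed n)"
proof -
  have r: "0 < rate_width \<alpha>" using \<alpha> real_beta by (auto simp: rate_width_def)
  have notle: "\<not> ((even d \<longrightarrow> \<gamma> \<le> x) \<and> \<bar>x - \<gamma>\<bar> \<le> rate_width \<alpha>)" if "x \<in> closure B" for x
    using gt[OF that] trace_rate_le_iff[of \<alpha> x] \<alpha> by auto
  have "\<exists>\<delta>>0. \<forall>x\<in>B. (even d \<and> x \<le> \<gamma> - \<delta>) \<or> rate_width \<alpha> \<le> \<bar>x - \<gamma>\<bar>"
  proof -
    have "\<gamma> \<notin> closure B" using notle[of \<gamma>] r by auto
    then obtain \<delta> where \<delta>: "0 < \<delta>" "ball \<gamma> \<delta> \<subseteq> - closure B"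
      using open_contains_ball[of "- closure B"] by auto
    have "(even d \<and> x \<le> \<gamma> - \<delta>) \<or> rate_width \<alpha> \<le> \<bar>x - \<gamma>\<bar>" if x: "x \<in> B" for x
    proof -
      have xc: "x \<in> closure B" using x closure_subset by blast
      then have "x \<notin> ball \<gamma> \<delta>" using \<delta>(2) by blast
      then show ?thesis using notle[OF xc] by (auto simp: dist_real_def)
    qed
    then show ?thesis using \<delta>(1) by blast
  qed
  then obtain \<delta> where \<delta>: "0 < \<delta>" "\<And>x. x \<in> B \<Longrightarrow> (even d \<and> x \<le> \<gamma> - \<delta>) \<or> rate_width \<alpha> \<le> \<bar>x - \<gamma>\<bar>" by blast
  have e2: "0 < \<eta> / 2" using \<eta> by simp
  have up: "\<forall>\<^sub>F n in sequentially. measure (M n) {\<omega>\<in>space (M n). rate_width \<alpha> \<le> \<bar>Z n \<omega> - \<gamma>\<bar>} \<le> exp (- (\<alpha> - \<eta> / 2) * speed n)"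
    using upper_tail[OF r e2] \<alpha> by (simp only: rate_of_width less_imp_le)
  have low: "\<forall>\<^sub>F n in sequentially. measure (M n) {\<omega>\<in>space (M n). even d \<and> Z n \<omega> \<le> \<gamma> - \<delta>} \<le> exp (- (\<alpha> - \<eta> / 2) * speed n)"
  proof (cases "even d")
    case True
    then show ?thesis using lower_tail[OF \<delta>(1) True, of "\<alpha> - \<eta> / 2"] by simp
  qed simp
  have "\<forall>\<^sub>F n in sequentially. 2 * ln 2 / \<eta> \<le> speed n" using speed_at_top by (simp add: filterlim_at_top)
  with up low show ?thesis
  proof eventually_elim
    case (elim n)
    interpret prob_space "M n" by (rule prob_M)
    let ?U = "{\<omega>\<in>space (M n). rate_width \<alpha> \<le> \<bar>Z n \<omega> - \<gamma>\<bar>}" and ?L = "{\<omega>\<in>space (M n). even d \<and> Z n \<omega> \<le> \<gamma> - \<delta>}"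
    have m: "?U \<in> events" "?L \<in> events" using Z_meas[of n] by measurable
    have "prob {\<omega>\<in>space (M n). Z n \<omega> \<in> B} \<le> prob (?L \<union> ?U)"
      using m \<delta>(2) by (intro finite_measure_mono) auto
    also have "\<dots> \<le> prob ?L + prob ?U" using m by (intro measure_Un_le) auto
    also have "\<dots> \<le> 2 * exp (- (\<alpha> - \<eta> / 2) * speed n)" using elim(1,2) by simp
    also have "\<dots> = exp (ln 2 + - (\<alpha> - \<eta> / 2) * speed n)"
    proof -
      have "exp (ln 2) = (2 :: real)" by simp
      then show ?thesis by (simp only: exp_add)
    qed
    also have "\<dots> \<le> exp ((\<eta> - \<alpha>) * speed n)"
    proof -
      have "ln 2 \<le> \<eta> / 2 * speed n" using elim(3) \<eta> by (simp add: field_simps)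
      moreover have "(\<eta> - \<alpha>) * speed n = \<eta> / 2 * speed n + - (\<alpha> - \<eta> / 2) * speed n" by (simp add: field_simps)
      ultimately show ?thesis unfolding exp_le_cancel_iff by linarith
    qed
    finally show ?case .
  qed
qed

lemma upper_bound:
  assumes B: "B \<in> sets borel"
  shows "limsup (\<lambda>n. ereal (1 / speed n) * ext_ln (measure (M n) {\<omega>\<in>space (M n). Z n \<omega> \<in> B})) \<le> - (INF x\<in>closure B. trace_rate \<beta> d x)"
proof -
  let ?l = "limsup (\<lambda>n. ereal (1 / speed n) * ext_ln (measure (M n) {\<omega>\<in>space (M n). Z n \<omega> \<in> B}))"
  have "(INF x\<in>closure B. trace_rate \<beta> d x) \<le> - ?l"
  \<comment> \<open>Finite values below the infimum also cover an infinite infimum. Values that are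
    not positive are trivial, as probabilities are at most 1.\<close>
  proof (rule dense_le)
    fix z assume z: "z < (INF x\<in>closure B. trace_rate \<beta> d x)"
    show "z \<le> - ?l"
    proof (cases "0 < z")
      case False
      have "?l \<le> ereal 0"
        by (rule limsup_rate_le[OF speed_at_top]) (auto intro!: always_eventually prob_space.prob_le_1 prob_M)
      then have "0 \<le> - ?l" by (simp only: zero_ereal_def[symmetric] ereal_0_le_uminus_iff)
      with False show ?thesis by (meson not_less order_trans)
    next
      case True
      with z obtain \<alpha> where \<alpha>: "z = ereal \<alpha>" "0 < \<alpha>" by (cases z) auto
      have gt: "ereal \<alpha> < trace_rate \<beta> d x" if "x \<in> closure B" for x
        using less_INF_D[OF z that] \<alpha>(1) by simp
      have "?l \<le> ereal (- \<alpha>) + ereal \<eta>" if \<eta>: "0 < \<eta>" for \<eta>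
      proof -
        have "?l \<le> ereal (\<eta> - \<alpha>)" by (rule limsup_rate_le[OF speed_at_top _ upper_event[OF B \<alpha>(2) gt \<eta>]]) auto
        then show ?thesis by simp
      qed
      then have "?l \<le> ereal (- \<alpha>)" by (rule ereal_le_epsilon2)
      then have "- ereal (- \<alpha>) \<le> - ?l" by (simp only: ereal_minus_le_minus)
      then show ?thesis unfolding \<alpha>(1) by simp
    qed
  qed
  then have "- (- ?l) \<le> - (INF x\<in>closure B. trace_rate \<beta> d x)" by (simp only: ereal_minus_le_minus)
  then show ?thesis by simp
qed

text \<open>The signed \<open>d\<close>-th root of \<open>y - \<gamma>\<close> works; for even
  \<open>d\<close> a finite rate forces \<open>y \<ge> \<gamma>\<close>. At
  \<open>y = \<gamma>\<close> the root would be 0, which the tilt excludes, so a small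
  \<open>\<theta>\<close> of cost below \<open>\<eta>\<close> replaces it.\<close>

lemma shift_exists:
  assumes U: "open U" "y \<in> U" and fin: "trace_rate \<beta> d y \<noteq> \<infinity>" and \<eta>: "0 < \<eta>"
  shows "\<exists>\<theta>. \<theta> \<noteq> 0 \<and> \<gamma> + \<theta> ^ d \<in> U \<and> ereal (real \<beta> / 4 * \<theta>\<^sup>2) \<le> trace_rate \<beta> d y + ereal \<eta>"
proof (cases "y = \<gamma>")
  case True
  have "isCont (\<lambda>t. \<gamma> + t ^ d) 0" "isCont (\<lambda>t. real \<beta> / 4 * t\<^sup>2) 0" by (intro continuous_intros)+
  then have "((\<lambda>t. \<gamma> + t ^ d) \<longlongrightarrow> \<gamma> + 0 ^ d) (at 0)" "((\<lambda>t. real \<beta> / 4 * t\<^sup>2) \<longlongrightarrow> real \<beta> / 4 * 0\<^sup>2) (at 0)"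
    unfolding isCont_def .
  then have l: "((\<lambda>t. \<gamma> + t ^ d) \<longlongrightarrow> \<gamma>) (at 0)" "((\<lambda>t. real \<beta> / 4 * t\<^sup>2) \<longlongrightarrow> 0) (at 0)" using d by (auto simp: power_0_left)
  have "\<forall>\<^sub>F t in at 0. \<gamma> + t ^ d \<in> U" using topological_tendstoD[OF l(1) U(1)] U(2) True by simp
  moreover have "\<forall>\<^sub>F t in at 0. real \<beta> / 4 * t\<^sup>2 < \<eta>" using l(2) \<eta> by (rule order_tendstoD)
  moreover have "\<forall>\<^sub>F t in at (0 :: real). t \<noteq> 0" by (simp add: eventually_at_filter)
  ultimately have "\<forall>\<^sub>F t in at 0. t \<noteq> 0 \<and> \<gamma> + t ^ d \<in> U \<and> real \<beta> / 4 * t\<^sup>2 < \<eta>" by eventually_elim simp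
  then obtain t where t: "t \<noteq> 0" "\<gamma> + t ^ d \<in> U" "real \<beta> / 4 * t\<^sup>2 < \<eta>"
    using eventually_happens'[OF trivial_limit_at] by blast
  have "ereal (real \<beta> / 4 * t\<^sup>2) \<le> 0 + ereal \<eta>" using t(3) by simp
  also have "\<dots> \<le> trace_rate \<beta> d y + ereal \<eta>" by (intro add_right_mono trace_rate_nonneg)
  finally show ?thesis using t by blast
next
  case False
  define \<theta> where "\<theta> = sgn (y - \<gamma>) * \<bar>y - \<gamma>\<bar> powr (1 / real d)"
  have pos: "even d \<Longrightarrow> 0 < y - \<gamma>" using fin False by (auto simp: trace_rate_def semicircle_moment_def split: if_splits)
  have "(\<bar>y - \<gamma>\<bar> powr (1 / real d)) ^ d = \<bar>y - \<gamma>\<bar>" using d False by (simp add: powr_power)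
  moreover have "sgn (y - \<gamma>) ^ d = sgn (y - \<gamma>)" using pos False by (cases "even d") (auto simp: sgn_if)
  ultimately have pw: "\<theta> ^ d = y - \<gamma>" unfolding \<theta>_def power_mult_distrib using False by (simp add: sgn_if)
  have "(sgn (y - \<gamma>))\<^sup>2 = 1" using False by (simp add: sgn_if)
  moreover have "(\<bar>y - \<gamma>\<bar> powr (1 / real d))\<^sup>2 = \<bar>y - \<gamma>\<bar> powr (2 / real d)" using False by (simp add: powr_power)
  ultimately have sq: "\<theta>\<^sup>2 = \<bar>y - \<gamma>\<bar> powr (2 / real d)" unfolding \<theta>_def power_mult_distrib by simp
  have "ereal (real \<beta> / 4 * \<theta>\<^sup>2) = trace_rate \<beta> d y"
    using fin pos unfolding sq by (auto simp: trace_rate_def semicircle_moment_def split: if_splits)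
  then have "ereal (real \<beta> / 4 * \<theta>\<^sup>2) \<le> trace_rate \<beta> d y + ereal \<eta>" using \<eta> by (simp add: add_increasing2)
  moreover have "\<theta> \<noteq> 0" using False by (simp add: \<theta>_def sgn_if)
  ultimately show ?thesis using pw U(2) by (intro exI[of _ \<theta>]) simp
qed

lemma lower_bound:
  assumes B: "B \<in> sets borel"
  shows "- (INF x\<in>interior B. trace_rate \<beta> d x) \<le> liminf (\<lambda>n. ereal (1 / speed n) * ext_ln (measure (M n) {\<omega>\<in>space (M n). Z n \<omega> \<in> B}))"
proof -
  let ?l = "liminf (\<lambda>n. ereal (1 / speed n) * ext_ln (measure (M n) {\<omega>\<in>space (M n). Z n \<omega> \<in> B}))"
  have "- ?l \<le> trace_rate \<beta> d y" if y: "y \<in> interior B" for y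
  proof (cases "trace_rate \<beta> d y = \<infinity>")
    case False
    have "- ?l \<le> trace_rate \<beta> d y + ereal \<eta>" if \<eta>: "0 < \<eta>" for \<eta>
    proof -
      have e2: "0 < \<eta> / 2" using \<eta> by simp
      obtain \<theta> where \<theta>: "\<theta> \<noteq> 0" "\<gamma> + \<theta> ^ d \<in> interior B" "ereal (real \<beta> / 4 * \<theta>\<^sup>2) \<le> trace_rate \<beta> d y + ereal (\<eta> / 2)"
        using shift_exists[OF open_interior y False e2] by blast
      obtain \<epsilon> where \<epsilon>: "0 < \<epsilon>" "ball (\<gamma> + \<theta> ^ d) \<epsilon> \<subseteq> interior B"
        using open_contains_ball[of "interior B"] \<theta>(2) by auto
      have e3: "0 < \<epsilon> / 3" using \<epsilon> by simp
      have "\<forall>\<^sub>F n in sequentially. exp (- (real \<beta> / 4 * \<theta>\<^sup>2 + \<eta> / 2) * speed n) \<le> measure (M n) {\<omega>\<in>space (M n). Z n \<omega> \<in> B}"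
        using local_lower[OF \<theta>(1) e3 e2]
      proof eventually_elim
        case (elim n)
        interpret prob_space "M n" by (rule prob_M)
        have "prob {\<omega>\<in>space (M n). \<bar>Z n \<omega> - (\<gamma> + \<theta> ^ d)\<bar> < 3 * (\<epsilon> / 3)} \<le> prob {\<omega>\<in>space (M n). Z n \<omega> \<in> B}"
        proof (rule finite_measure_mono[OF _ Z_event[OF B]])
          show "{\<omega>\<in>space (M n). \<bar>Z n \<omega> - (\<gamma> + \<theta> ^ d)\<bar> < 3 * (\<epsilon> / 3)} \<subseteq> {\<omega>\<in>space (M n). Z n \<omega> \<in> B}"
            using \<epsilon>(2) interior_subset[of B] by (auto simp: dist_real_def abs_minus_commute subset_iff)
        qed
        with elim show ?case by linarith
      qed
      then have "ereal (- (real \<beta> / 4 * \<theta>\<^sup>2 + \<eta> / 2)) \<le> ?l" by (rule liminf_rate_ge[OF speed_at_top])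
      then have "- ?l \<le> ereal (real \<beta> / 4 * \<theta>\<^sup>2 + \<eta> / 2)" by (simp add: ereal_uminus_le_reorder)
      also have "\<dots> = ereal (real \<beta> / 4 * \<theta>\<^sup>2) + ereal (\<eta> / 2)" by simp
      also have "\<dots> \<le> trace_rate \<beta> d y + ereal (\<eta> / 2) + ereal (\<eta> / 2)" by (intro add_right_mono \<theta>(3))
      also have "\<dots> = trace_rate \<beta> d y + ereal \<eta>" by (simp add: add.assoc)
      finally show ?thesis .
    qed
    then show ?thesis by (rule ereal_le_epsilon2)
  qed simp
  then have "- ?l \<le> (INF x\<in>interior B. trace_rate \<beta> d x)" by (rule INF_greatest)
  then show ?thesis by (simp add: ereal_uminus_le_reorder)
qed

theorem large_deviations:
  "large_deviations_principle M (normalized_trace_power d X) speed (trace_rate \<beta> d)"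
  "good_rate_function (trace_rate \<beta> d)"
proof -
  have m: "normalized_trace_power d X n \<in> borel_measurable (M n)" for n using Z_meas[of n] by (simp add: Z_def)
  have "mono speed" by (intro monoI powr_mono2) auto
  then show "large_deviations_principle M (normalized_trace_power d X) speed (trace_rate \<beta> d)"
    unfolding large_deviations_principle_def
    using prob_M m speed_at_top trace_rate_nonneg compact_imp_closed[OF compact_level]
      upper_bound[unfolded Z_def] lower_bound[unfolded Z_def] by blast
  show "good_rate_function (trace_rate \<beta> d)"
    unfolding good_rate_function_def using compact_level by blast
qed

end

theorem corollary1p17:
  fixes d l \<beta> :: nat
    and M :: "nat \<Rightarrow> 'a measure"
    and X :: "nat \<Rightarrow> 'a \<Rightarrow> complex mat"
    and \<mu> \<nu> :: "complex measure"
  assumes "d \<ge> 3"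
    and "even l" and "l > d"
    and "\<beta> \<in> {1, 2}"
    and "wigner_matrix \<beta> M X \<mu> \<nu>"
    and "integrable \<mu> (\<lambda>z. (Re z)\<^sup>2)" and "(LINT z|\<mu>. (Re z)\<^sup>2) \<le> 2 / real \<beta>"
    and "\<beta> = 2 \<longrightarrow> prob_space.variance \<nu> Re = 1 / 2 \<and> prob_space.variance \<nu> Im = 1 / 2"
    and "convex_concentration \<beta> M X"
    and "log_laplace_bounded_derivatives 2 l (distr \<mu> borel Re)"
    and "\<beta> = 1 \<longrightarrow> log_laplace_bounded_derivatives 2 l (distr \<nu> borel Re)"
    and "\<beta> = 2 \<longrightarrow> log_laplace_bounded_derivatives 2 l \<nu>"
    and "sharp_sub_gaussian \<mu>" and "sharp_sub_gaussian \<nu>"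
  shows "large_deviations_principle M (normalized_trace_power d X)
           (\<lambda>n. real n powr (1 + 2 / real d)) (trace_rate \<beta> d)
       \<and> good_rate_function (trace_rate \<beta> d)"
proof -
  interpret wigner_ldp d \<beta> M X \<mu> \<nu>
    using assms by unfold_locales
  show ?thesis using large_deviations by blast
qed

end
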